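(* Let $b\in BMO^1_\alpha(\mathbb B_n,\mathcal L(\ell^2,\ell^1\cap\ell^2))$ be such that $\widetilde b\in L^\infty(\mathbb B_n,\mathcal L(\ell^2))$ and $b^\star\in BMO^1_\alpha(\mathbb B_n,\mathcal L(\ell^2,\ell^1))$, where $b^\star(w)=(b(w))^\star$ is the adjoint of $b(w)$ in $\mathcal L(\ell^2)$. Then the following assertions hold. (1) $T_b$ is a bounded operator on $A^2_\alpha(\mathbb B_n,\ell^2)$. (2) Assume further that $\lim_{d\to\infty}\big\|\widetilde{\|b_{(d)}(\cdot)\|_{\mathcal L(\ell^2)}}\big\|_{L^\infty(\mathbb B_n,\mathbb C)}=0$. If $$\sup_{e\in\mathbb C^d,\ \|e\|_{\mathbb C^d}=1}\ \lim_{z\to\partial\mathbb B_n}\|T_b(k^\alpha_ze)\|_{A^2_\alpha(\mathbb B_n,\ell^2)}=0$$ for every positive integer $d$, then $T_b$ is compact.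
   Context: Fix an integer $n\ge 1$ and a real $\alpha>-1$. $\mathbb B_n$ is the open unit ball of $\mathbb C^n$, $\langle z,w\rangle=\sum_k z_k\overline{w_k}$, and $d\nu_\alpha(z)=c_\alpha(1-|z|^2)^\alpha d\nu(z)$, where $\nu$ is Lebesgue measure and $c_\alpha$ is the constant making $\nu_\alpha$ a probability measure on $\mathbb B_n$. For a complex Banach space $E$ and $1\le p<\infty$, $L^p_\alpha(\mathbb B_n,E)$ is the Bochner–Lebesgue space of measurable $f:\mathbb B_n\to E$ with $\|f\|^p=\int_{\mathbb B_n}\|f(z)\|_E^p\,d\nu_\alpha(z)<\infty$; $L^\infty(\mathbb B_n,E)$ is the space of essentially bounded measurable functions; $A^p_\alpha(\mathbb B_n,E)$ is the subspace of holomorphic functions in $L^p_\alpha(\mathbb B_n,E)$; $H^\infty(\mathbb B_n,E)$ is the space of bounded holomorphic functions, which is dense in $A^2_\alpha(\mathbb B_n,E)$. $\mathcal L(E,F)$ denotes bounded linear operators and $\mathcal L(E)=\mathcal L(E,E)$. Kernels: $K^\alpha_z(w)=(1-\langle w,z\rangle)^{-(n+1+\alpha)}$, $k^\alpha_z(w)=(1-|z|^2)^{(n+1+\alpha)/2}(1-\langle w,z\rangle)^{-(n+1+\alpha)}$. For $a\in\mathbb B_n\setminus\{0\}$, $\varphi_a(z)=\dfrac{a-P_a(z)-\sqrt{1-|a|^2}\,Q_a(z)}{1-\langle z,a\rangle}$ with $P_a(z)=\frac{\langle z,a\rangle}{|a|^2}a$, $Q_a=I-P_a$; $\varphi_0(z)=-z$.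 For $b\in L^1_\alpha(\mathbb B_n,E)$ the Berezin transform is $\widetilde b(z)=\int_{\mathbb B_n}|k^\alpha_z(w)|^2b(w)\,d\nu_\alpha(w)$ (applied to a scalar function such as $w\mapsto\|b(w)\|$ with $E=\mathbb C$), and $b\in BMO^1_\alpha(\mathbb B_n,E)$ if $\|b\|_{BMO^1_\alpha(\mathbb B_n,E)}:=\sup_{z\in\mathbb B_n}\|b\circ\varphi_z-\widetilde b(z)\|_{L^1_\alpha(\mathbb B_n,E)}<\infty$. For $b\in L^1_\alpha(\mathbb B_n,\mathcal L(E,F))$ the Toeplitz operator $T_b$ is densely defined on $A^2_\alpha(\mathbb B_n,E)$ by $T_bf(z)=\int_{\mathbb B_n}b(w)(f(w))\overline{K^\alpha_z(w)}\,d\nu_\alpha(w)$, $f\in H^\infty(\mathbb B_n,E)$; it is called bounded (compact) if it extends to a bounded (compact) operator on $A^2_\alpha$. Fix an orthonormal basis $\{e_j\}_{j\ge1}$ of $\ell^2$; the $\ell^1$ norm is taken with respect to it, $\|x\|_{\ell^1}=\sum_i|\langle x,e_i\rangle_{\ell^2}|$. The space $\ell^1\cap\ell^2$ carries the norm $\max\{\|x\|_{\ell^1},\|x\|_{\ell^2}\}$. $\mathbb C^d$ is identified with the span of $e_1,\dots,e_d$ in $\ell^2$. For a positive integer $d$, $b_{(d)}:\mathbb B_n\to\mathcal L(\ell^2)$ is defined by $b_{(d)}(w)(e_i)=0$ if $1\le i\le d$ and $b_{(d)}(w)(e_i)=b(w)(e_i)$ if $i\ge d+1$. For a vector $e$,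 $k^\alpha_ze$ denotes $w\mapsto k^\alpha_z(w)e$. *)

theory Defs
  imports "HOL-Analysis.Analysis" "HOL-Probability.Essential_Supremum"
begin

section \<open>The complex Hilbert space of square-summable sequences\<close>

typedef ell2 = "{x :: nat \<Rightarrow> complex. summable (\<lambda>i. (cmod (x i))\<^sup>2)}"
  morphisms coord Abs_ell2
  by (rule exI[of _ "\<lambda>_. 0"]) simp

setup_lifting type_definition_ell2

lemma summable_coord: "summable (\<lambda>i. (cmod (coord x i))\<^sup>2)"
  using coord[of x] by simp

lemma norm_mult_le_squares: "cmod a * cmod b \<le> (cmod a)\<^sup>2 + (cmod b)\<^sup>2"
proof -
  have "2 * (cmod a * cmod b) \<le> (cmod a)\<^sup>2 + (cmod b)\<^sup>2"
    using sum_squares_bound[of "cmod a" "cmod b"] by (simp add: mult.assoc)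
  moreover have "0 \<le> cmod a * cmod b" by simp
  ultimately show ?thesis by linarith
qed

lemma ell2_add_closed:
  fixes x y :: "nat \<Rightarrow> complex"
  assumes "summable (\<lambda>i. (cmod (x i))\<^sup>2)" "summable (\<lambda>i. (cmod (y i))\<^sup>2)"
  shows "summable (\<lambda>i. (cmod (x i + y i))\<^sup>2)"
proof (rule summable_comparison_test'[of "\<lambda>i. 3 * ((cmod (x i))\<^sup>2 + (cmod (y i))\<^sup>2)" 0])
  show "summable (\<lambda>i. 3 * ((cmod (x i))\<^sup>2 + (cmod (y i))\<^sup>2))"
    by (intro summable_mult summable_add assms)
next
  fix i :: nat
  have "(cmod (x i + y i))\<^sup>2 \<le> (cmod (x i) + cmod (y i))\<^sup>2"
    by (intro power_mono norm_triangle_ineq) simp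
  also have "\<dots> \<le> 3 * ((cmod (x i))\<^sup>2 + (cmod (y i))\<^sup>2)"
    using norm_mult_le_squares[of "x i" "y i"] by (simp add: power2_sum)
  finally show "norm ((cmod (x i + y i))\<^sup>2) \<le> 3 * ((cmod (x i))\<^sup>2 + (cmod (y i))\<^sup>2)" by simp
qed

lemma ell2_scale_closed:
  fixes x :: "nat \<Rightarrow> complex"
  assumes "summable (\<lambda>i. (cmod (x i))\<^sup>2)"
  shows "summable (\<lambda>i. (cmod (c * x i))\<^sup>2)"
  using summable_mult[OF assms, of "(cmod c)\<^sup>2"] by (simp add: norm_mult power_mult_distrib)

lemma summable_coord_norm_mult: "summable (\<lambda>i. cmod (coord x i) * cmod (coord y i))"
  by (rule summable_comparison_test'[OF summable_add[OF summable_coord[of x] summable_coord[of y]], of 0])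
     (simp add: norm_mult_le_squares)

lemma summable_coord_inner: "summable (\<lambda>i. inner (coord x i) (coord y i))"
  by (rule summable_comparison_test'[OF summable_coord_norm_mult[of x y], of 0])
     (simp add: Cauchy_Schwarz_ineq2)

instantiation ell2 :: ab_group_add
begin
lift_definition zero_ell2 :: ell2 is "\<lambda>_. 0" by simp
lift_definition plus_ell2 :: "ell2 \<Rightarrow> ell2 \<Rightarrow> ell2" is "\<lambda>x y i. x i + y i"
  by (rule ell2_add_closed)
lift_definition uminus_ell2 :: "ell2 \<Rightarrow> ell2" is "\<lambda>x i. - x i" by simp
lift_definition minus_ell2 :: "ell2 \<Rightarrow> ell2 \<Rightarrow> ell2" is "\<lambda>x y i. x i - y i"
  using ell2_add_closed[where y = "\<lambda>i. - y i" for y] by simp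
instance by (standard; transfer; simp add: fun_eq_iff)
end

lift_definition scaleC :: "complex \<Rightarrow> ell2 \<Rightarrow> ell2" (infixr "*\<^sub>C" 75) is "\<lambda>c x i. c * x i"
  by (rule ell2_scale_closed)

instantiation ell2 :: real_vector
begin
definition scaleR_ell2 :: "real \<Rightarrow> ell2 \<Rightarrow> ell2" where
  "r *\<^sub>R x = complex_of_real r *\<^sub>C x"
instance
proof
  fix a b :: real and x y :: ell2
  show "a *\<^sub>R (x + y) = a *\<^sub>R x + a *\<^sub>R y"
    unfolding scaleR_ell2_def by transfer (simp add: fun_eq_iff distrib_left)
  show "(a + b) *\<^sub>R x = a *\<^sub>R x + b *\<^sub>R x"
    unfolding scaleR_ell2_def by transfer (simp add: fun_eq_iff distrib_right)
  show "a *\<^sub>R b *\<^sub>R x = (a * b) *\<^sub>R x"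
    unfolding scaleR_ell2_def by transfer (simp add: fun_eq_iff)
  show "1 *\<^sub>R x = x"
    unfolding scaleR_ell2_def by transfer simp
qed
end

instantiation ell2 :: real_inner
begin
definition inner_ell2 :: "ell2 \<Rightarrow> ell2 \<Rightarrow> real" where
  "inner x y = (\<Sum>i. inner (coord x i) (coord y i))"
definition norm_ell2 :: "ell2 \<Rightarrow> real" where
  "norm x = sqrt (\<Sum>i. (cmod (coord x i))\<^sup>2)"
definition sgn_ell2 :: "ell2 \<Rightarrow> ell2" where
  "sgn (x :: ell2) = x /\<^sub>R norm x"
definition dist_ell2 :: "ell2 \<Rightarrow> ell2 \<Rightarrow> real" where
  "dist (x :: ell2) y = norm (x - y)"
definition uniformity_ell2 :: "(ell2 \<times> ell2) filter" where
  "uniformity = (INF e\<in>{0<..}. principal {(x, y :: ell2). dist x y < e})"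
definition open_ell2 :: "ell2 set \<Rightarrow> bool" where
  "open (U :: ell2 set) = (\<forall>x\<in>U. eventually (\<lambda>(x', y). x' = x \<longrightarrow> y \<in> U) uniformity)"
instance
proof
  fix r :: real and x y z :: ell2 and U :: "ell2 set"
  show "sgn x = x /\<^sub>R norm x" by (rule sgn_ell2_def)
  show "dist x y = norm (x - y)" by (rule dist_ell2_def)
  show "uniformity = (INF e\<in>{0<..}. principal {(x, y :: ell2). dist x y < e})"
    by (rule uniformity_ell2_def)
  show "open (U :: ell2 set) = (\<forall>x\<in>U. eventually (\<lambda>(x', y). x' = x \<longrightarrow> y \<in> U) uniformity)"
    by (rule open_ell2_def)
  show "inner x y = inner y x"
    by (simp add: inner_ell2_def inner_commute)
  show "inner (x + y) z = inner x z + inner y z"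
    unfolding inner_ell2_def
    by (simp add: plus_ell2.rep_eq inner_add_left suminf_add summable_coord_inner)
  show "inner (r *\<^sub>R x) y = r * inner x y"
  proof -
    have "inner (coord (r *\<^sub>R x) i) (coord y i) = r * inner (coord x i) (coord y i)" for i
      by (simp add: scaleR_ell2_def scaleC.rep_eq flip: scaleR_conv_of_real)
    then show ?thesis
      unfolding inner_ell2_def by (simp add: suminf_mult summable_coord_inner)
  qed
  have sq: "inner x x = (\<Sum>i. (cmod (coord x i))\<^sup>2)"
    by (simp add: inner_ell2_def power2_norm_eq_inner)
  show "0 \<le> inner x x"
    unfolding sq by (rule suminf_nonneg[OF summable_coord]) simp
  show "inner x x = 0 \<longleftrightarrow> x = 0"
    unfolding sq by (subst suminf_eq_zero_iff[OF summable_coord])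
      (auto simp: zero_ell2.rep_eq fun_eq_iff simp flip: coord_inject)
  show "norm x = sqrt (inner x x)"
    unfolding sq by (rule norm_ell2_def)
qed
end

lemma norm_ell2_sq: "(norm (x :: ell2))\<^sup>2 = (\<Sum>i. (cmod (coord x i))\<^sup>2)"
  unfolding norm_ell2_def by (rule real_sqrt_pow2) (simp add: suminf_nonneg summable_coord)

lemma partial_sum_le_norm_ell2: "(\<Sum>i<k. (cmod (coord x i))\<^sup>2) \<le> (norm x)\<^sup>2"
  unfolding norm_ell2_sq by (rule sum_le_suminf[OF summable_coord]) auto

lemma coord_le_norm_ell2: "cmod (coord x i) \<le> norm x"
proof (rule power2_le_imp_le)
  have "(cmod (coord x i))\<^sup>2 \<le> (\<Sum>j<Suc i. (cmod (coord x j))\<^sup>2)"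
    by (rule member_le_sum) auto
  then show "(cmod (coord x i))\<^sup>2 \<le> (norm x)\<^sup>2"
    using partial_sum_le_norm_ell2[of x "Suc i"] by linarith
qed simp

instance ell2 :: banach
proof
  fix X :: "nat \<Rightarrow> ell2"
  assume X: "Cauchy X"
  have "Cauchy (\<lambda>m. coord (X m) i)" for i
  proof (rule metric_CauchyI)
    fix e :: real assume "0 < e"
    then obtain N where N: "\<forall>m\<ge>N. \<forall>n\<ge>N. dist (X m) (X n) < e"
      using X by (meson metric_CauchyD)
    have "dist (coord (X m) i) (coord (X n) i) \<le> dist (X m) (X n)" for m n
      using coord_le_norm_ell2[of "X m - X n" i] by (simp add: dist_norm minus_ell2.rep_eq)
    then show "\<exists>N. \<forall>m\<ge>N. \<forall>n\<ge>N. dist (coord (X m) i) (coord (X n) i) < e"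
      using N by (meson le_less_trans)
  qed
  then have "\<exists>l. (\<lambda>m. coord (X m) i) \<longlonglongrightarrow> l" for i
    by (simp add: Cauchy_convergent_iff convergent_def)
  then obtain l where l: "\<And>i. (\<lambda>m. coord (X m) i) \<longlonglongrightarrow> l i" by metis
  have key: "(\<Sum>i<k. (cmod (coord (X m) i - l i))\<^sup>2) \<le> e\<^sup>2"
    if N: "\<forall>m\<ge>N. \<forall>n\<ge>N. dist (X m) (X n) < e" and m: "m \<ge> N" for N m k e
  proof (rule Lim_bounded[of _ _ N])
    show "(\<lambda>n. \<Sum>i<k. (cmod (coord (X m) i - coord (X n) i))\<^sup>2)
            \<longlonglongrightarrow> (\<Sum>i<k. (cmod (coord (X m) i - l i))\<^sup>2)"
      by (intro tendsto_intros l)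
    show "\<forall>n\<ge>N. (\<Sum>i<k. (cmod (coord (X m) i - coord (X n) i))\<^sup>2) \<le> e\<^sup>2"
    proof (intro allI impI)
      fix n assume "n \<ge> N"
      have "(\<Sum>i<k. (cmod (coord (X m) i - coord (X n) i))\<^sup>2) \<le> (norm (X m - X n))\<^sup>2"
        using partial_sum_le_norm_ell2[of "X m - X n" k] by (simp add: minus_ell2.rep_eq)
      also have "\<dots> \<le> e\<^sup>2"
        using N m \<open>n \<ge> N\<close> by (intro power_mono) (auto simp: dist_norm less_imp_le)
      finally show "(\<Sum>i<k. (cmod (coord (X m) i - coord (X n) i))\<^sup>2) \<le> e\<^sup>2" .
    qed
  qed
  have summ: "summable (\<lambda>i. (cmod (coord (X m) i - l i))\<^sup>2)"
    and bound: "(\<Sum>i. (cmod (coord (X m) i - l i))\<^sup>2) \<le> e\<^sup>2"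
    if N: "\<forall>m\<ge>N. \<forall>n\<ge>N. dist (X m) (X n) < e" and m: "m \<ge> N" for N m e
  proof -
    show s: "summable (\<lambda>i. (cmod (coord (X m) i - l i))\<^sup>2)"
      by (rule bounded_imp_summable[of _ "e\<^sup>2"])
         (use key[OF N m, of "Suc k" for k] in \<open>auto simp: lessThan_Suc_atMost\<close>)
    show "(\<Sum>i. (cmod (coord (X m) i - l i))\<^sup>2) \<le> e\<^sup>2"
      by (rule suminf_le_const[OF s]) (use key[OF N m] in auto)
  qed
  obtain N0 where N0: "\<forall>m\<ge>N0. \<forall>n\<ge>N0. dist (X m) (X n) < 1"
    using X by (meson metric_CauchyD zero_less_one)
  have "summable (\<lambda>i. (cmod (- 1 * (coord (X N0) i - l i)))\<^sup>2)"
    by (rule ell2_scale_closed, rule summ[OF N0]) simp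
  from ell2_add_closed[OF summable_coord[of "X N0"] this]
  have "summable (\<lambda>i. (cmod (l i))\<^sup>2)" by simp
  then have L: "coord (Abs_ell2 l) = l" by (simp add: Abs_ell2_inverse)
  have "X \<longlonglongrightarrow> Abs_ell2 l"
  proof (rule metric_LIMSEQ_I)
    fix e :: real assume "0 < e"
    then obtain N where N: "\<forall>m\<ge>N. \<forall>n\<ge>N. dist (X m) (X n) < e / 2"
      using X by (meson half_gt_zero metric_CauchyD)
    have "dist (X m) (Abs_ell2 l) < e" if "m \<ge> N" for m
    proof -
      have "(norm (X m - Abs_ell2 l))\<^sup>2 \<le> (e / 2)\<^sup>2"
        using bound[OF N that] by (simp add: norm_ell2_sq minus_ell2.rep_eq L)
      then have "norm (X m - Abs_ell2 l) \<le> e / 2"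
        by (rule power2_le_imp_le) (use \<open>0 < e\<close> in simp)
      then show ?thesis using \<open>0 < e\<close> by (simp add: dist_norm)
    qed
    then show "\<exists>N. \<forall>m\<ge>N. dist (X m) (Abs_ell2 l) < e" by blast
  qed
  then show "convergent X" by (auto simp: convergent_def)
qed

definition cinner :: "ell2 \<Rightarrow> ell2 \<Rightarrow> complex" where
  "cinner x y = (\<Sum>i. coord x i * cnj (coord y i))"

text \<open>Sequences are indexed from 0, so \<open>e 0, e 1, \<dots>\<close> are the \<open>e\<^sub>1, e\<^sub>2, \<dots>\<close> of the paper
  and the span of \<open>e\<^sub>1, \<dots>, e\<^sub>d\<close> involves the indices \<open>i < d\<close>.\<close>

definition orthonormal_basis :: "(nat \<Rightarrow> ell2) \<Rightarrow> bool" where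
  "orthonormal_basis e \<longleftrightarrow>
     (\<forall>i j. cinner (e i) (e j) = (if i = j then 1 else 0)) \<and>
     (\<forall>x. (\<lambda>i. cinner x (e i) *\<^sub>C e i) sums x)"

definition first_span :: "(nat \<Rightarrow> ell2) \<Rightarrow> nat \<Rightarrow> ell2 set" where
  "first_span e d = {\<Sum>i<d. c i *\<^sub>C e i | c :: nat \<Rightarrow> complex. True}"

section \<open>Banach spaces of vectors and operators\<close>

text \<open>The spaces in play (\<open>\<ell>\<^sup>1\<close> and \<open>\<ell>\<^sup>1 \<inter> \<ell>\<^sup>2\<close> for a given orthonormal basis, and the operators
  from \<open>\<ell>\<^sup>2\<close> into them) are subspaces of \<open>\<ell>\<^sup>2\<close>, respectively of the operators on \<open>\<ell>\<^sup>2\<close>, with norms of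
  their own that depend on the basis. A Banach space is therefore given by its set of points in an
  ambient vector type together with its norm; the norm matters on the points only.\<close>

record 'v nspace =
  pts :: "'v set"
  nrm :: "'v \<Rightarrow> real"

definition type_space :: "'v::real_normed_vector nspace" where
  "type_space = \<lparr>pts = UNIV, nrm = norm\<rparr>"

abbreviation l2_space :: "ell2 nspace" where "l2_space \<equiv> type_space"
abbreviation C_space :: "complex nspace" where "C_space \<equiv> type_space"

text \<open>Every absolutely summable sequence is square summable, so \<open>\<ell>\<^sup>1\<close> lies inside \<open>\<ell>\<^sup>2\<close>.\<close>

definition l1_space :: "(nat \<Rightarrow> ell2) \<Rightarrow> ell2 nspace" where
  "l1_space e = \<lparr>pts = {x. summable (\<lambda>i. cmod (cinner x (e i)))},
                 nrm = (\<lambda>x. \<Sum>i. cmod (cinner x (e i)))\<rparr>"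

definition l1_cap_l2_space :: "(nat \<Rightarrow> ell2) \<Rightarrow> ell2 nspace" where
  "l1_cap_l2_space e = \<lparr>pts = pts (l1_space e) \<inter> pts l2_space,
                        nrm = (\<lambda>x. max (nrm (l1_space e) x) (nrm l2_space x))\<rparr>"

text \<open>\<open>ops_from_l2 F\<close> is \<open>\<L>(\<ell>\<^sup>2, F)\<close> with the operator norm. The type \<open>ell2 \<Rightarrow>\<^sub>L ell2\<close> consists of
  real-linear maps, so complex homogeneity is imposed here.\<close>

definition ops_from_l2 :: "ell2 nspace \<Rightarrow> (ell2 \<Rightarrow>\<^sub>L ell2) nspace" where
  "ops_from_l2 F =
     \<lparr>pts = {T. (\<forall>c x. blinfun_apply T (c *\<^sub>C x) = c *\<^sub>C blinfun_apply T x) \<and>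
                (\<forall>x. blinfun_apply T x \<in> pts F) \<and>
                (\<exists>C. \<forall>x. nrm F (blinfun_apply T x) \<le> C * norm x)},
      nrm = (\<lambda>T. SUP x\<in>{x. norm x \<le> 1}. nrm F (blinfun_apply T x))\<rparr>"

definition op_adjoint :: "(ell2 \<Rightarrow>\<^sub>L ell2) \<Rightarrow> (ell2 \<Rightarrow>\<^sub>L ell2)" where
  "op_adjoint T =
     (THE S. \<forall>x y. cinner (blinfun_apply T x) y = cinner x (blinfun_apply S y))"

text \<open>The operator \<open>b\<^sub>(\<^sub>d\<^sub>)(w)\<close> for \<open>T = b(w)\<close>.\<close>

definition tail_op :: "(nat \<Rightarrow> ell2) \<Rightarrow> nat \<Rightarrow> (ell2 \<Rightarrow>\<^sub>L ell2) \<Rightarrow> (ell2 \<Rightarrow>\<^sub>L ell2)" where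
  "tail_op e d T =
     (THE S. S \<in> pts (ops_from_l2 l2_space) \<and>
             (\<forall>i. blinfun_apply S (e i) = (if i < d then 0 else blinfun_apply T (e i))))"

section \<open>Bochner integration\<close>

text \<open>The Bochner integral of the library requires a second-countable target type, which excludes
  the operator spaces; this is the textbook definition for an arbitrary Banach space, built on
  the library's simple functions and their integrals.\<close>

definition strongly_measurable :: "'v::real_vector nspace \<Rightarrow> 'a measure \<Rightarrow> ('a \<Rightarrow> 'v) \<Rightarrow> bool" where
  "strongly_measurable E M f \<longleftrightarrow>
     f \<in> space M \<rightarrow> pts E \<and>
     (\<exists>s. (\<forall>i. simple_function M (s i) \<and> s i \<in> space M \<rightarrow> pts E) \<and>
          (AE x in M. (\<lambda>i::nat. nrm E (f x - s i x)) \<longlonglongrightarrow> 0))"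

definition has_Bochner_integral ::
    "'v::real_vector nspace \<Rightarrow> 'a measure \<Rightarrow> ('a \<Rightarrow> 'v) \<Rightarrow> 'v \<Rightarrow> bool" where
  "has_Bochner_integral E M f v \<longleftrightarrow>
     strongly_measurable E M f \<and> v \<in> pts E \<and>
     (\<exists>s. (\<forall>i. Bochner_Integration.simple_bochner_integrable M (s i) \<and> s i \<in> space M \<rightarrow> pts E) \<and>
          (\<lambda>i::nat. \<integral>\<^sup>+x. ennreal (nrm E (f x - s i x)) \<partial>M) \<longlonglongrightarrow> 0 \<and>
          (\<lambda>i. nrm E (Bochner_Integration.simple_bochner_integral M (s i) - v)) \<longlonglongrightarrow> 0)"

definition Bochner_integral :: "'v::real_vector nspace \<Rightarrow> 'a measure \<Rightarrow> ('a \<Rightarrow> 'v) \<Rightarrow> 'v" where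
  "Bochner_integral E M f = (THE v. has_Bochner_integral E M f v)"

definition Lp_norm :: "'v nspace \<Rightarrow> 'a measure \<Rightarrow> real \<Rightarrow> ('a \<Rightarrow> 'v) \<Rightarrow> ennreal" where
  "Lp_norm E M p f =
     (let I = \<integral>\<^sup>+x. ennreal (nrm E (f x) powr p) \<partial>M
      in if I = \<infinity> then \<infinity> else ennreal (enn2real I powr (1 / p)))"

definition Lp :: "'v::real_vector nspace \<Rightarrow> 'a measure \<Rightarrow> real \<Rightarrow> ('a \<Rightarrow> 'v) set" where
  "Lp E M p = {f. strongly_measurable E M f \<and> Lp_norm E M p f < \<infinity>}"

definition Linf_norm :: "'v nspace \<Rightarrow> 'a measure \<Rightarrow> ('a \<Rightarrow> 'v) \<Rightarrow> ennreal" where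
  "Linf_norm E M f = esssup M (\<lambda>x. ennreal (nrm E (f x)))"

definition Linf :: "'v::real_vector nspace \<Rightarrow> 'a measure \<Rightarrow> ('a \<Rightarrow> 'v) set" where
  "Linf E M = {f. strongly_measurable E M f \<and> Linf_norm E M f < \<infinity>}"

section \<open>The unit ball, kernels and automorphisms\<close>

definition herm :: "complex ^ 'n \<Rightarrow> complex ^ 'n \<Rightarrow> complex" where
  "herm z w = (\<Sum>k\<in>UNIV. z $ k * cnj (w $ k))"

abbreviation unit_ball :: "(complex ^ 'n) set" where
  "unit_ball \<equiv> ball 0 1"

definition ball_measure :: "(complex ^ 'n) measure" where
  "ball_measure = lebesgue_on unit_ball"

definition norm_const :: "'n::finite itself \<Rightarrow> real \<Rightarrow> real" where
  "norm_const _ \<alpha> = 1 / (LINT z|(ball_measure :: (complex ^ 'n) measure). (1 - (norm z)\<^sup>2) powr \<alpha>)"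

definition weighted_measure :: "real \<Rightarrow> (complex ^ 'n) measure" where
  "weighted_measure \<alpha> =
     density ball_measure (\<lambda>z. ennreal (norm_const TYPE('n) \<alpha> * (1 - (norm z)\<^sup>2) powr \<alpha>))"

text \<open>For \<open>z, w\<close> in the ball \<open>1 - \<langle>w, z\<rangle>\<close> has positive real part, and \<open>powr\<close> is the principal
  branch.\<close>

definition bergman_kernel :: "real \<Rightarrow> complex ^ 'n \<Rightarrow> complex ^ 'n \<Rightarrow> complex" where
  "bergman_kernel \<alpha> z w =
     (1 - herm w z) powr (- complex_of_real (real CARD('n) + 1 + \<alpha>))"

definition normalized_kernel :: "real \<Rightarrow> complex ^ 'n \<Rightarrow> complex ^ 'n \<Rightarrow> complex" where
  "normalized_kernel \<alpha> z w =
     complex_of_real ((1 - (norm z)\<^sup>2) powr ((real CARD('n) + 1 + \<alpha>) / 2)) * bergman_kernel \<alpha> z w"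

definition ball_aut :: "complex ^ 'n \<Rightarrow> complex ^ 'n \<Rightarrow> complex ^ 'n" where
  "ball_aut a z =
     (if a = 0 then - z
      else let P = (herm z a / complex_of_real ((norm a)\<^sup>2)) *s a; Q = z - P
           in (1 / (1 - herm z a)) *s
                (a - P - complex_of_real (sqrt (1 - (norm a)\<^sup>2)) *s Q))"

section \<open>Berezin transform, BMO and Toeplitz operators\<close>

definition berezin ::
    "real \<Rightarrow> 'v::real_vector nspace \<Rightarrow> (complex ^ 'n \<Rightarrow> 'v) \<Rightarrow> complex ^ 'n \<Rightarrow> 'v" where
  "berezin \<alpha> E b z =
     Bochner_integral E (weighted_measure \<alpha>) (\<lambda>w. (cmod (normalized_kernel \<alpha> z w))\<^sup>2 *\<^sub>R b w)"

definition BMO1_norm :: "real \<Rightarrow> 'v::real_vector nspace \<Rightarrow> (complex ^ 'n \<Rightarrow> 'v) \<Rightarrow> ennreal" where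
  "BMO1_norm \<alpha> E b =
     (SUP z\<in>unit_ball. Lp_norm E (weighted_measure \<alpha>) 1 (\<lambda>w. b (ball_aut z w) - berezin \<alpha> E b z))"

definition BMO1 :: "real \<Rightarrow> 'v::real_vector nspace \<Rightarrow> (complex ^ 'n \<Rightarrow> 'v) set" where
  "BMO1 \<alpha> E = {b. b \<in> Lp E (weighted_measure \<alpha>) 1 \<and> BMO1_norm \<alpha> E b < \<infinity>}"

definition holomorphic_on_ball :: "(complex ^ 'n \<Rightarrow> ell2) \<Rightarrow> bool" where
  "holomorphic_on_ball f \<longleftrightarrow>
     (\<forall>z\<in>unit_ball. \<exists>D. (f has_derivative D) (at z) \<and> (\<forall>c v. D (c *s v) = c *\<^sub>C D v))"

text \<open>Elements of the function spaces are functions on the whole of \<open>\<complex>\<^sup>n\<close> of which only the values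
  on the ball matter.\<close>

definition Hinf :: "(complex ^ 'n \<Rightarrow> ell2) set" where
  "Hinf = {f. holomorphic_on_ball f \<and> bounded (f ` unit_ball)}"

definition A2_norm :: "real \<Rightarrow> (complex ^ 'n \<Rightarrow> ell2) \<Rightarrow> ennreal" where
  "A2_norm \<alpha> f = Lp_norm l2_space (weighted_measure \<alpha>) 2 f"

definition A2 :: "real \<Rightarrow> (complex ^ 'n \<Rightarrow> ell2) set" where
  "A2 \<alpha> = {f. holomorphic_on_ball f \<and> f \<in> Lp l2_space (weighted_measure \<alpha>) 2}"

definition toeplitz ::
    "real \<Rightarrow> (complex ^ 'n \<Rightarrow> ell2 \<Rightarrow>\<^sub>L ell2) \<Rightarrow> (complex ^ 'n \<Rightarrow> ell2) \<Rightarrow> complex ^ 'n \<Rightarrow> ell2" where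
  "toeplitz \<alpha> b f z =
     Bochner_integral l2_space (weighted_measure \<alpha>)
       (\<lambda>w. cnj (bergman_kernel \<alpha> z w) *\<^sub>C blinfun_apply (b w) (f w))"

definition bounded_operator_A2 ::
    "real \<Rightarrow> ((complex ^ 'n \<Rightarrow> ell2) \<Rightarrow> (complex ^ 'n \<Rightarrow> ell2)) \<Rightarrow> bool" where
  "bounded_operator_A2 \<alpha> S \<longleftrightarrow>
     (\<forall>f\<in>A2 \<alpha>. S f \<in> A2 \<alpha>) \<and>
     (\<forall>f\<in>A2 \<alpha>. \<forall>g\<in>A2 \<alpha>. \<forall>z\<in>unit_ball. S (\<lambda>w. f w + g w) z = S f z + S g z) \<and>
     (\<forall>c. \<forall>f\<in>A2 \<alpha>. \<forall>z\<in>unit_ball. S (\<lambda>w. c *\<^sub>C f w) z = c *\<^sub>C S f z) \<and>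
     (\<exists>C::real. \<forall>f\<in>A2 \<alpha>. A2_norm \<alpha> (S f) \<le> ennreal C * A2_norm \<alpha> f)"

definition compact_operator_A2 ::
    "real \<Rightarrow> ((complex ^ 'n \<Rightarrow> ell2) \<Rightarrow> (complex ^ 'n \<Rightarrow> ell2)) \<Rightarrow> bool" where
  "compact_operator_A2 \<alpha> S \<longleftrightarrow>
     bounded_operator_A2 \<alpha> S \<and>
     (\<forall>F :: nat \<Rightarrow> complex ^ 'n \<Rightarrow> ell2. (\<forall>k. F k \<in> A2 \<alpha> \<and> A2_norm \<alpha> (F k) \<le> 1) \<longrightarrow>
        (\<exists>r g. strict_mono (r :: nat \<Rightarrow> nat) \<and> g \<in> A2 \<alpha> \<and>
               (\<lambda>k. A2_norm \<alpha> (\<lambda>z. S (F (r k)) z - g z)) \<longlonglongrightarrow> 0))"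

definition toeplitz_extension ::
    "real \<Rightarrow> (complex ^ 'n \<Rightarrow> ell2 \<Rightarrow>\<^sub>L ell2) \<Rightarrow> ((complex ^ 'n \<Rightarrow> ell2) \<Rightarrow> (complex ^ 'n \<Rightarrow> ell2)) \<Rightarrow> bool"
  where
  "toeplitz_extension \<alpha> b S \<longleftrightarrow> (\<forall>f\<in>Hinf. \<forall>z\<in>unit_ball. S f z = toeplitz \<alpha> b f z)"

definition toeplitz_bounded :: "real \<Rightarrow> (complex ^ 'n \<Rightarrow> ell2 \<Rightarrow>\<^sub>L ell2) \<Rightarrow> bool" where
  "toeplitz_bounded \<alpha> b \<longleftrightarrow> (\<exists>S. bounded_operator_A2 \<alpha> S \<and> toeplitz_extension \<alpha> b S)"

definition toeplitz_compact :: "real \<Rightarrow> (complex ^ 'n \<Rightarrow> ell2 \<Rightarrow>\<^sub>L ell2) \<Rightarrow> bool" where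
  "toeplitz_compact \<alpha> b \<longleftrightarrow> (\<exists>S. compact_operator_A2 \<alpha> S \<and> toeplitz_extension \<alpha> b S)"

text \<open>The filter \<open>z \<rightarrow> \<partial>\<bbbB>\<^sub>n\<close> from inside the ball.\<close>

definition to_boundary :: "(complex ^ 'n) filter" where
  "to_boundary = filtercomap norm (at_left 1)"

end

theory Submission
  imports Defs "HOL-Complex_Analysis.Complex_Analysis" "HOL-Real_Asymp.Real_Asymp"
begin

text \<open>The invariant measure \<open>(1 - |z|\<^sup>2)\<^sup>-\<^sup>n\<^sup>-\<^sup>1 dz\<close> of the ball gives the change of variables \<open>\<phi>\<^sub>a\<close> in \<open>\<nu>\<^sub>\<alpha>\<close>,
  hence the reproducing formula and the Forelli-Rudin estimates. A BMO symbol with bounded Berezin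
  transform satisfies \<open>\<integral> \<parallel>b\<parallel> |k\<^sub>z|\<^sup>2 d\<nu>\<^sub>\<alpha> \<le> B\<close> for almost every \<open>z\<close>; then \<open>\<integral> \<parallel>b\<parallel> |K\<^sub>z K\<^sub>u| d\<nu>\<^sub>\<alpha>\<close> is at most a
  multiple of \<open>B \<integral> |K\<^sub>z K\<^sub>u| d\<nu>\<^sub>\<alpha>\<close>, a kernel that passes the Schur test, so \<open>\<parallel>T\<^sub>b\<parallel> \<le> C B\<close>.
  For compactness the same bound makes the part of \<open>b\<close> beyond the first \<open>d\<close> basis vectors small in norm.
  On a single \<open>e\<^sub>i\<close> the operator is dominated by the kernel \<open>\<parallel>T\<^sub>b(K\<^sub>v e\<^sub>i)(u)\<parallel>\<close>: for \<open>v\<close> close to the sphere its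
  Schur constant is small, away from \<open>v\<close> by the Forelli-Rudin estimates and near \<open>v\<close> by
  Cauchy-Schwarz and \<open>\<parallel>T\<^sub>b(k\<^sub>v e\<^sub>i)\<parallel> \<rightarrow> 0\<close>; for \<open>v\<close> in a smaller ball, coordinatewise convergence of a
  subsequence suffices.\<close>

section \<open>Linear changes of variables\<close>

text \<open>The symbol is merely integrable and takes values in a non-separable operator space, and
  ||b|| is controlled only through its averages against |k_z|^2. So T_b f cannot be estimated by
  ||b|| ||f|| pointwise: ||f(w)|| is replaced by the integral of |K_w| ||f||, after which ||b||
  stands under |K_z K_u| alone, where averages suffice. As a by-product the integral defining T_b f
  converges for every f in A^2, so T_b itself is the bounded operator looked for. The change of
  variables comes from linear algebra: phi_a lifts to a linear involution of C^(n+1), which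
  preserves Lebesgue measure because its scaling constant has square 1. The Forelli-Rudin bounds
  avoid integration over the sphere: the moments of <u,z> are read off from the reproducing formula.
  For compactness the Schur test is used asymmetrically: near the sphere the row constant is small
  and the column constant only bounded, and the product of the two is what counts.\<close>

lemma nn_integral_lborel_translate:
  fixes f :: "'a::euclidean_space \<Rightarrow> ennreal"
  assumes [measurable]: "f \<in> borel_measurable borel"
  shows "(\<integral>\<^sup>+x. f (x + t) \<partial>lborel) = (\<integral>\<^sup>+x. f x \<partial>lborel)"
proof -
  have "(\<integral>\<^sup>+x. f x \<partial>lborel) = (\<integral>\<^sup>+x. f x \<partial>distr lborel borel ((+) t))"
    by (simp add: lborel_distr_plus)
  also have "\<dots> = (\<integral>\<^sup>+x. f (t + x) \<partial>lborel)"
    by (subst nn_integral_distr) auto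
  finally show ?thesis by (simp add: add.commute)
qed

text \<open>Uniqueness of Haar measure: \<open>\<lambda>(A) \<mu>(B) = \<mu>(A) \<lambda>(-B)\<close> for translation invariant \<open>\<lambda>\<close>, \<open>\<mu>\<close>,
  by Tonelli applied to \<open>1\<^sub>A(x + T y) 1\<^sub>B(T y)\<close>.\<close>

lemma emeasure_lborel_linear_vimage:
  fixes T :: "'a::euclidean_space \<Rightarrow> 'a"
  assumes T: "linear T" "surj T" and [measurable]: "A \<in> sets borel" "B \<in> sets borel"
  shows "emeasure lborel A * emeasure lborel (T -` B) = emeasure lborel (T -` A) * emeasure lborel (uminus -` B)"
proof -
  have [measurable]: "T \<in> borel_measurable borel"
    using T(1) by (intro borel_measurable_continuous_onI linear_continuous_on linear_conv_bounded_linear[THEN iffD1])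
  have add: "T (x + y) = T x + T y" for x y using T(1) by (rule linear_add)
  have [measurable]: "T -` X \<in> sets borel" if "X \<in> sets borel" for X
    using measurable_sets_borel[OF \<open>T \<in> borel_measurable borel\<close> that] by simp
  have [measurable]: "uminus -` B \<in> sets (borel :: 'a measure)"
    using measurable_sets_borel[of "uminus :: 'a \<Rightarrow> 'a" borel B] by simp
  have "emeasure lborel A * emeasure lborel (T -` B) = (\<integral>\<^sup>+y. indicator B (T y) * emeasure lborel A \<partial>lborel)"
    by (subst nn_integral_multc) (auto simp: mult.commute nn_integral_indicator[symmetric] simp del: nn_integral_indicator intro!: arg_cong2[where f="(*)"] nn_integral_cong split: split_indicator)
  also have "\<dots> = (\<integral>\<^sup>+y. \<integral>\<^sup>+x. indicator B (T y) * indicator A (x + T y) \<partial>lborel \<partial>lborel)"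
    by (intro nn_integral_cong) (simp add: nn_integral_cmult nn_integral_lborel_translate)
  also have "\<dots> = (\<integral>\<^sup>+x. \<integral>\<^sup>+y. indicator B (T y) * indicator A (x + T y) \<partial>lborel \<partial>lborel)"
    by (rule lborel_pair.Fubini') measurable
  also have "\<dots> = (\<integral>\<^sup>+x. \<integral>\<^sup>+y. indicator B (T y - x) * indicator A (T y) \<partial>lborel \<partial>lborel)"
  proof (rule nn_integral_cong)
    fix x :: 'a
    \<comment> \<open>Surjectivity writes the shift by x as T t, so translation invariance can be
      applied to the variable y inside T.\<close>
    obtain t where t: "x = T t" using T(2) by (metis surjD)
    show "(\<integral>\<^sup>+y. indicator B (T y) * indicator A (x + T y) \<partial>lborel) = (\<integral>\<^sup>+y. indicator B (T y - x) * indicator A (T y) \<partial>lborel)"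
      using nn_integral_lborel_translate[of "\<lambda>y. indicator B (T y - x) * indicator A (T y)" t]
      by (simp add: add t add.commute)
  qed
  also have "\<dots> = (\<integral>\<^sup>+y. \<integral>\<^sup>+x. indicator B (T y - x) * indicator A (T y) \<partial>lborel \<partial>lborel)"
    by (rule lborel_pair.Fubini') measurable
  also have "\<dots> = (\<integral>\<^sup>+y. emeasure lborel (uminus -` B) * indicator A (T y) \<partial>lborel)"
  proof (rule nn_integral_cong)
    fix y
    have "(\<integral>\<^sup>+x. indicator B (T y - x) \<partial>lborel) = (\<integral>\<^sup>+x. indicator (uminus -` B) (x + - T y) \<partial>lborel)"
      by (intro nn_integral_cong) (auto split: split_indicator)
    also have "\<dots> = emeasure lborel (uminus -` B)"
      by (subst nn_integral_lborel_translate) auto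
    finally show "(\<integral>\<^sup>+x. indicator B (T y - x) * indicator A (T y) \<partial>lborel) = emeasure lborel (uminus -` B) * indicator A (T y)"
      by (simp add: nn_integral_multc)
  qed
  also have "\<dots> = emeasure lborel (T -` A) * emeasure lborel (uminus -` B)"
    by (subst nn_integral_cmult) (auto simp: mult.commute nn_integral_indicator[symmetric] simp del: nn_integral_indicator intro!: arg_cong2[where f="(*)"] nn_integral_cong split: split_indicator)
  finally show ?thesis .
qed

text \<open>The unit ball, taken as the second set, is symmetric under negation and has finite
  nonzero measure. Haar uniqueness then says that preimages under T scale every Borel set by one
  constant, which takes the place of 1 / |det T|.\<close>

lemma emeasure_lborel_linear_vimage_ball:
  fixes T :: "'a::euclidean_space \<Rightarrow> 'a"
  assumes T: "linear T" "surj T" and A: "A \<in> sets borel"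
  shows "emeasure lborel (T -` A) = emeasure lborel (T -` ball 0 1) / emeasure lborel (ball (0::'a) 1) * emeasure lborel A"
proof -
  have b: "emeasure lborel (ball (0::'a) 1) \<noteq> 0" "emeasure lborel (ball (0::'a) 1) \<noteq> \<infinity>"
    using emeasure_lborel_ball_finite[of "0::'a" 1] content_ball_pos[of 1 "0::'a"]
    by (auto simp: measure_def infinity_ennreal_def)
  have u: "uminus -` ball (0::'a) 1 = ball 0 1" by auto
  have "emeasure lborel A * emeasure lborel (T -` ball 0 1) = emeasure lborel (T -` A) * emeasure lborel (ball (0::'a) 1)"
    using emeasure_lborel_linear_vimage[OF T A, of "ball 0 1"] by (simp add: u)
  then have "emeasure lborel (T -` A) = (emeasure lborel A * emeasure lborel (T -` ball 0 1)) / emeasure lborel (ball (0::'a) 1)"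
    using b by (simp add: ennreal_mult_divide_eq)
  then show ?thesis by (simp add: ennreal_times_divide mult.commute)
qed

text \<open>An isometry leaves the unit ball unchanged, so the scaling constant is 1. Surjectivity
  follows from injectivity in finite dimension.\<close>

lemma distr_lborel_isometry:
  fixes T :: "'a::euclidean_space \<Rightarrow> 'a"
  assumes T: "linear T" and n: "\<And>x. norm (T x) = norm x"
  shows "distr lborel borel T = lborel"
proof (rule measure_eqI)
  have T': "surj T"
    using T n by (metis eucl.linear_injective_imp_surjective linear_injective_0 norm_eq_zero)
  have [measurable]: "T \<in> borel_measurable borel"
    using T(1) by (intro borel_measurable_continuous_onI linear_continuous_on linear_conv_bounded_linear[THEN iffD1])
  fix A assume "A \<in> sets (distr lborel borel T)"
  then have A: "A \<in> sets borel" by simp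
  have u: "T -` ball (0::'a) 1 = ball 0 1" using n by auto
  have b: "emeasure lborel (ball (0::'a) 1) \<noteq> 0" "emeasure lborel (ball (0::'a) 1) \<noteq> \<infinity>"
    using emeasure_lborel_ball_finite[of "0::'a" 1] content_ball_pos[of 1 "0::'a"]
    by (auto simp: measure_def infinity_ennreal_def)
  show "emeasure (distr lborel borel T) A = emeasure lborel A"
    using emeasure_lborel_linear_vimage_ball[OF T T' A] A b
    by (simp add: emeasure_distr u ennreal_divide_self less_top)
qed simp

text \<open>Applying the scaling law twice gives c^2 = 1 for a nonnegative constant c. Meant for
  \<open>aut_lift a\<close>, whose determinant thus never has to be computed.\<close>

lemma distr_lborel_involution:
  fixes T :: "'a::euclidean_space \<Rightarrow> 'a"
  assumes T: "linear T" and n: "\<And>x. T (T x) = x"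
  shows "distr lborel borel T = lborel"
proof (rule measure_eqI)
  have T': "surj T" using n by (metis surjI)
  have [measurable]: "T \<in> borel_measurable borel"
    using T(1) by (intro borel_measurable_continuous_onI linear_continuous_on linear_conv_bounded_linear[THEN iffD1])
  fix A assume "A \<in> sets (distr lborel borel T)"
  then have A: "A \<in> sets borel" by simp
  define c where "c = emeasure lborel (T -` ball 0 1) / emeasure lborel (ball (0::'a) 1)"
  have b: "emeasure lborel (ball (0::'a) 1) \<noteq> 0" "emeasure lborel (ball (0::'a) 1) \<noteq> \<infinity>"
    using emeasure_lborel_ball_finite[of "0::'a" 1] content_ball_pos[of 1 "0::'a"]
    by (auto simp: measure_def infinity_ennreal_def)
  have *: "emeasure lborel (T -` X) = c * emeasure lborel X" if "X \<in> sets borel" for X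
    unfolding c_def by (rule emeasure_lborel_linear_vimage_ball[OF T T' that])
  have m: "T -` ball 0 1 \<in> sets borel"
    using measurable_sets_borel[OF \<open>T \<in> borel_measurable borel\<close>, of "ball 0 1"] by simp
  have vv: "T -` (T -` X) = X" for X by (simp only: vimage_def mem_Collect_eq n Collect_mem_eq)
  have "emeasure lborel (ball (0::'a) 1) = emeasure lborel (T -` (T -` ball 0 1))"
    by (simp add: vv)
  also have "\<dots> = c * c * emeasure lborel (ball (0::'a) 1)"
    using *[OF m] *[of "ball 0 1"] by (simp add: mult.assoc)
  finally have "c * c * emeasure lborel (ball (0::'a) 1) / emeasure lborel (ball (0::'a) 1) = 1"
    using b by (simp add: ennreal_divide_self less_top)
  then have cc: "c * c = 1" using b by (simp add: ennreal_mult_divide_eq)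
  then have "c = 1"
  proof (cases c)
    case (real r)
    then have "r * r = 1" using cc by (simp flip: ennreal_mult)
    then have "r\<^sup>2 = 1" by (simp add: power2_eq_square)
    then have "r = 1" using real by (simp add: power2_eq_1_iff)
    then show ?thesis using real by simp
  qed auto
  then show "emeasure (distr lborel borel T) A = emeasure lborel A"
    using *[OF A] A by (simp add: emeasure_distr)
qed simp

section \<open>The Hermitian form and the automorphisms of the ball\<close>

lemma herm_add_left: "herm (x + y) z = herm x z + herm y z"
  by (simp add: herm_def sum.distrib distrib_right)
lemma herm_add_right: "herm x (y + z) = herm x y + herm x z"
  by (simp add: herm_def sum.distrib distrib_left)
lemma herm_diff_left: "herm (x - y) z = herm x z - herm y z"
  by (simp add: herm_def sum_subtractf left_diff_distrib)
lemma herm_diff_right: "herm x (y - z) = herm x y - herm x z"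
  by (simp add: herm_def sum_subtractf right_diff_distrib)
lemma herm_scale_left: "herm (c *s x) y = c * herm x y"
  by (simp add: herm_def sum_distrib_left mult.assoc)
lemma herm_scale_right: "herm x (c *s y) = cnj c * herm x y"
  by (simp add: herm_def sum_distrib_left mult_ac)
lemma herm_scaleR_left: "herm (r *\<^sub>R x) y = r *\<^sub>R herm x y"
  by (simp add: herm_def scaleR_sum_right)
lemma herm_cnj: "cnj (herm x y) = herm y x"
  by (simp add: herm_def mult.commute)
lemma herm_0 [simp]: "herm 0 x = 0" "herm x 0 = 0"
  by (simp_all add: herm_def)

lemmas herm_lin = herm_add_left herm_add_right herm_diff_left herm_diff_right
  herm_scale_left herm_scale_right

lemma herm_self: "herm x x = complex_of_real ((norm x)\<^sup>2)"
  by (simp add: herm_def norm_vec_def L2_set_def sum_nonneg complex_norm_square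
      del: of_real_power)

lemma Re_herm: "Re (herm x y) = inner x y"
  by (simp add: herm_def inner_vec_def inner_complex_def)

lemma norm_scale_vec: "norm (c *s (x :: complex ^ 'n)) = cmod c * norm x"
proof -
  have "complex_of_real ((norm (c *s x))\<^sup>2) = complex_of_real ((cmod c * norm x)\<^sup>2)"
    using complex_norm_square[of c]
    by (simp flip: herm_self add: herm_lin power_mult_distrib del: of_real_power)
       (simp add: herm_self mult_ac)?
  then show ?thesis by (metis norm_ge_zero mult_nonneg_nonneg of_real_eq_iff power2_eq_imp_eq)
qed

text \<open>A unimodular factor u makes the pairing real, and the real part of the pairing is the
  Euclidean inner product, where Cauchy-Schwarz is available.\<close>

lemma norm_herm_le: "cmod (herm x y) \<le> norm x * norm y"
proof (cases "herm x y = 0")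
  case False
  define u where "u = cnj (sgn (herm x y))"
  have u: "cmod u = 1" using False by (simp add: u_def norm_sgn)
  have "complex_of_real (cmod (herm x y)) = herm (u *s x) y"
    using False by (simp add: herm_lin u_def sgn_eq complex_norm_square field_simps
        flip: complex_norm_square power2_eq_square)
  then have "cmod (herm x y) = inner (u *s x) y"
    by (metis Re_herm Re_complex_of_real)
  also have "\<dots> \<le> norm (u *s x) * norm y" by (rule norm_cauchy_schwarz)
  finally show ?thesis by (simp add: norm_scale_vec u)
qed simp

lemma herm_lt_1: "norm x < 1 \<Longrightarrow> norm y < 1 \<Longrightarrow> cmod (herm x y) < 1"
  by (metis norm_herm_le le_less_trans mult_strict_mono' norm_ge_zero mult_1)

lemma cmod_1_minus_herm_ge:
  assumes "norm y < 1" shows "1 - norm x \<le> cmod (1 - herm x y)"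
proof -
  have "cmod (herm x y) \<le> norm x"
    using norm_herm_le[of x y] assms by (smt (verit) mult_left_le norm_ge_zero)
  then show ?thesis using norm_triangle_ineq2[of 1 "herm x y"] by simp
qed

lemma cmod_1_minus_herm_commute: "cmod (1 - herm x y) = cmod (1 - herm y x)"
  by (metis complex_cnj_diff complex_cnj_one complex_mod_cnj herm_cnj)

lemma one_minus_herm_nz: "norm x < 1 \<Longrightarrow> norm y < 1 \<Longrightarrow> 1 - herm x y \<noteq> 0"
  using herm_lt_1[of x y] by auto

lemma cmod_1_minus_herm_le: "norm x < 1 \<Longrightarrow> norm y < 1 \<Longrightarrow> cmod (1 - herm x y) \<le> 2"
  using herm_lt_1[of x y] norm_triangle_ineq4[of 1 "herm x y"] by simp

lemma Re_1_minus_herm: "norm x < 1 \<Longrightarrow> norm y < 1 \<Longrightarrow> Re (1 - herm x y) > 0"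
  using herm_lt_1[of x y] complex_Re_le_cmod[of "herm x y"] by simp

text \<open>The pseudo-unitary lift of \<open>\<phi>\<^sub>a\<close> to \<open>\<complex> \<times> \<complex>\<^sup>n\<close>: it preserves \<open>|x\<^sub>0|\<^sup>2 - |x|\<^sup>2\<close>, and
  \<open>\<phi>\<^sub>a\<close> is the induced map on the quotients \<open>x / x\<^sub>0\<close>.\<close>

definition aut_lin :: "complex ^ 'n \<Rightarrow> complex ^ 'n \<Rightarrow> complex ^ 'n" where
  "aut_lin a x = complex_of_real (sqrt (1 - (norm a)\<^sup>2)) *s x
     + (complex_of_real ((1 - sqrt (1 - (norm a)\<^sup>2)) / (norm a)\<^sup>2) * herm x a) *s a"

definition aut_lift :: "complex ^ 'n \<Rightarrow> complex \<times> (complex ^ 'n) \<Rightarrow> complex \<times> (complex ^ 'n)" where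
  "aut_lift a y = (complex_of_real (1 / sqrt (1 - (norm a)\<^sup>2)) * (fst y - herm (snd y) a),
     complex_of_real (1 / sqrt (1 - (norm a)\<^sup>2)) *s (fst y *s a - aut_lin a (snd y)))"

text \<open>With s = sqrt(1 - |a|^2) the vector P + s Q equals s I + (1 - s) P, and
  \<open>aut_lin\<close> writes it with the coefficient (1 - s) / |a|^2. At a = 0 this coefficient
  is 0 by the convention for division, so the two cases of \<open>ball_aut\<close> merge into one
  formula.\<close>

lemma ball_aut_altdef: "ball_aut a z = (1 / (1 - herm z a)) *s (a - aut_lin a z)"
proof -
  let ?P = "(herm z a / complex_of_real ((norm a)\<^sup>2)) *s a" and ?s = "complex_of_real (sqrt (1 - (norm a)\<^sup>2))"
  have "aut_lin a z = ?P + ?s *s (z - ?P)"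
    by (simp add: aut_lin_def vec_eq_iff diff_divide_distrib algebra_simps)
  then show ?thesis
    by (cases "a = 0") (simp_all add: ball_aut_def Let_def diff_diff_eq)
qed

context
  fixes a :: "complex ^ 'n" and s k A :: complex
  assumes a: "norm a < 1"
  defines "s \<equiv> complex_of_real (sqrt (1 - (norm a)\<^sup>2))"
  defines "k \<equiv> complex_of_real ((1 - sqrt (1 - (norm a)\<^sup>2)) / (norm a)\<^sup>2)"
  defines "A \<equiv> complex_of_real ((norm a)\<^sup>2)"
begin

text \<open>Here k = 1 / (1 + s) unless a = 0. The last identity is kept multiplied by
  \<open>herm x a\<close>, because k = 0 when a = 0 and then k * (1 + s) = 1 fails.\<close>

lemma aut_consts: "s \<noteq> 0" "s * s = 1 - A" "k * A = 1 - s" "cnj s = s" "cnj k = k" "cnj A = A"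
  "herm a a = A" "k * (1 + s) * herm x a = herm x a"
proof -
  have n: "(norm a)\<^sup>2 < 1" using a by (simp add: abs_square_less_1)
  then show "s \<noteq> 0" by (simp add: s_def)
  show s2: "s * s = 1 - A" using n by (simp add: s_def A_def flip: of_real_mult del: of_real_power)
  show kA: "k * A = 1 - s" by (cases "a = 0") (auto simp: k_def A_def s_def)
  show "cnj s = s" "cnj k = k" "cnj A = A" by (simp_all add: s_def k_def A_def)
  show "herm a a = A" by (simp add: A_def herm_self)
  show "k * (1 + s) * herm x a = herm x a"
  proof (cases "a = 0")
    case False
    then have "A \<noteq> 0" by (simp add: A_def)
    have "A * (k * (1 + s)) = (k * A) * (1 + s)" by simp
    also have "\<dots> = A" unfolding kA using s2 by (simp add: algebra_simps)
    finally have "k * (1 + s) = 1" using \<open>A \<noteq> 0\<close> by (metis mult_cancel_left2)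
    then show ?thesis by simp
  qed simp
qed

lemma aut_lin_eq: "aut_lin a x = s *s x + (k * herm x a) *s a"
  by (simp add: aut_lin_def s_def k_def)

lemma aut_lift_eq: "aut_lift a y = ((1/s) * (fst y - herm (snd y) a), (1/s) *s (fst y *s a - aut_lin a (snd y)))"
  by (simp add: aut_lift_def s_def)

lemma herm_aut_lin: "herm (aut_lin a x) a = herm x a"
proof -
  have "s * herm x a + k * herm x a * A = (s + k * A) * herm x a" by (simp add: algebra_simps)
  also have "\<dots> = herm x a" using aut_consts(3) by simp
  finally show ?thesis by (simp add: aut_lin_eq herm_lin aut_consts(7))
qed

lemma aut_lin_a: "aut_lin a a = a"
  using aut_consts(3) by (simp add: aut_lin_eq aut_consts(7) flip: vector_sadd_rdistrib)

lemma aut_lin_lin: "aut_lin a (x - y) = aut_lin a x - aut_lin a y" "aut_lin a (c *s x) = c *s aut_lin a x"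
  by (simp_all add: aut_lin_eq herm_lin vec_eq_iff algebra_simps)

text \<open>\<open>aut_lin a\<close> is P + s Q, with P the orthogonal projection onto the line of a
  and Q = I - P. Its square is P + s^2 Q = s^2 I + (1 - s^2) P, and (1 - s^2) P x = <x,a> a.\<close>

lemma aut_lin_aut_lin: "aut_lin a (aut_lin a x) = (s * s) *s x + herm x a *s a"
proof -
  have "s * (k * herm x a) + k * herm x a = herm x a"
    using aut_consts(8)[of x] by (simp add: algebra_simps)
  then have "(s * (k * herm x a) + k * herm x a) * a $ i = herm x a * a $ i" for i by simp
  then show ?thesis
    by (subst aut_lin_eq, subst herm_aut_lin) (simp add: aut_lin_eq vec_eq_iff algebra_simps)
qed

text \<open>The cross terms cancel because \<open>aut_lin a\<close> fixes a, preserves the pairing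
  with a, and squares to s^2 I + <.,a> a.\<close>

lemma aut_lift_involution: "aut_lift a (aut_lift a y) = y"
proof -
  obtain x0 x where y: "y = (x0, x)" by (cases y)
  let ?yz = "(1/s) * (x0 - herm x a)" and ?yv = "(1/s) *s (x0 *s a - aut_lin a x)"
  have h: "herm ?yv a = (1/s) * (x0 * A - herm x a)"
    by (simp add: herm_lin herm_aut_lin aut_consts diff_divide_distrib)
  have "?yz - herm ?yv a = (1/s) * (x0 * (s * s))"
    unfolding h aut_consts(2) by (simp add: algebra_simps)
  then have 1: "(1/s) * (?yz - herm ?yv a) = x0" using aut_consts(1) by simp
  have "?yz *s a - aut_lin a ?yv = (1/s) *s ((x0 - herm x a) *s a - (x0 *s a - ((s * s) *s x + herm x a *s a)))"
    by (simp add: aut_lin_lin aut_lin_a aut_lin_aut_lin vec_eq_iff algebra_simps)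
  also have "\<dots> = s *s x" using aut_consts(1) by (simp add: vec_eq_iff algebra_simps)
  finally have e: "?yz *s a - aut_lin a ?yv = s *s x" .
  have 2: "(1/s) *s (?yz *s a - aut_lin a ?yv) = x" unfolding e using aut_consts(1) by (simp add: vec_eq_iff)
  show ?thesis using 1 2 by (simp add: aut_lift_eq y)
qed

text \<open>The polarised identity is proved because 1 - <phi_a(z), phi_a(w)> is needed for two
  different points. The two factors 1/s of the lift are compensated by 1 - |a|^2 = s^2.\<close>

lemma aut_lift_form:
  "fst (aut_lift a x) * cnj (fst (aut_lift a y)) - herm (snd (aut_lift a x)) (snd (aut_lift a y))
     = fst x * cnj (fst y) - herm (snd x) (snd y)"
proof -
  obtain x0 x1 y0 y1 where xy: "x = (x0, x1)" "y = (y0, y1)" by (cases x, cases y)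
  let ?p = "herm x1 a" and ?q = "cnj (herm y1 a)"
  have q: "herm a y1 = ?q" by (simp add: herm_cnj)
  have c1: "cnj s = s" "cnj k = k" using aut_consts by auto
  have LL: "herm (aut_lin a x1) (aut_lin a y1) = s * s * herm x1 y1 + ?p * ?q"
  proof -
    have "herm (aut_lin a x1) (aut_lin a y1) = s * s * herm x1 y1 + (2 * s + k * A) * (k * ?p) * ?q"
      by (simp add: aut_lin_eq herm_lin c1 q aut_consts(7) algebra_simps)
    also have "(2 * s + k * A) * (k * ?p) = ?p"
      using aut_consts(8)[of x1] unfolding aut_consts(3) by (simp add: algebra_simps)
    finally show ?thesis .
  qed
  have La: "herm a (aut_lin a y1) = ?q" by (metis herm_cnj herm_aut_lin)
  have "herm (x0 *s a - aut_lin a x1) (y0 *s a - aut_lin a y1) =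
      x0 * cnj y0 * A - x0 * ?q - cnj y0 * ?p + (s * s * herm x1 y1 + ?p * ?q)"
    by (simp add: herm_lin La LL herm_aut_lin aut_consts(7) algebra_simps)
  then have "(x0 - ?p) * cnj (y0 - herm y1 a) - herm (x0 *s a - aut_lin a x1) (y0 *s a - aut_lin a y1)
     = (1 - A) * x0 * cnj y0 - s * s * herm x1 y1"
    by (simp add: algebra_simps)
  also have "\<dots> = s * s * (x0 * cnj y0 - herm x1 y1)"
    by (simp add: aut_consts(2) algebra_simps)
  finally have *: "(x0 - ?p) * cnj (y0 - herm y1 a) - herm (x0 *s a - aut_lin a x1) (y0 *s a - aut_lin a y1)
     = s * s * (x0 * cnj y0 - herm x1 y1)" .
  have "fst (aut_lift a x) * cnj (fst (aut_lift a y)) - herm (snd (aut_lift a x)) (snd (aut_lift a y))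
    = (1/s) * (1/s) * ((x0 - ?p) * cnj (y0 - herm y1 a) - herm (x0 *s a - aut_lin a x1) (y0 *s a - aut_lin a y1))"
    using aut_consts(1) by (simp add: aut_lift_eq xy herm_lin c1 field_simps)
  then show ?thesis unfolding * using aut_consts(1) by (simp add: xy)
qed

end

section \<open>Identities for phi_a on the ball\<close>

lemma aut_lift_1:
  assumes "norm a < 1" "norm z < 1"
  shows "fst (aut_lift a (1, z)) = (1 - herm z a) / complex_of_real (sqrt (1 - (norm a)\<^sup>2))"
    "snd (aut_lift a (1, z)) = fst (aut_lift a (1, z)) *s ball_aut a z"
  using one_minus_herm_nz[OF assms(2,1)]
  by (simp_all add: aut_lift_eq assms ball_aut_altdef)

lemma one_minus_norm2_pos: "norm a < 1 \<Longrightarrow> 0 < 1 - (norm a)\<^sup>2"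
  by (simp add: abs_square_less_1)

text \<open>Evaluate the invariant form on the lifts of (1,z) and (1,w): these are scalar multiples
  of (1, phi_a(z)) and (1, phi_a(w)), and the two scalars factor out.\<close>

lemma one_minus_herm_ball_aut:
  assumes a: "norm a < 1" and "norm z < 1" "norm w < 1"
  shows "1 - herm (ball_aut a z) (ball_aut a w) =
    complex_of_real (1 - (norm a)\<^sup>2) * (1 - herm z w) / ((1 - herm z a) * (1 - herm a w))"
proof -
  define s where "s = complex_of_real (sqrt (1 - (norm a)\<^sup>2))"
  have s: "s * s = complex_of_real (1 - (norm a)\<^sup>2)" "s \<noteq> 0" "cnj s = s"
    using one_minus_norm2_pos[OF a] by (simp_all add: s_def flip: of_real_mult)
  define p q where "p = (1 - herm z a) / s" and "q = (1 - herm a w) / s"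
  have pq: "p \<noteq> 0" "q \<noteq> 0" using one_minus_herm_nz assms s by (auto simp: p_def q_def)
  have q: "cnj ((1 - herm w a) / s) = q" by (simp add: q_def s herm_cnj)
  have "1 - herm z w = p * q - herm (p *s ball_aut a z) ((1 - herm w a) / s *s ball_aut a w)"
    using aut_lift_form[OF a, of "(1,z)" "(1,w)"]
    unfolding aut_lift_1[OF a assms(2)] aut_lift_1[OF a assms(3)] s_def[symmetric] q p_def[symmetric] by simp
  also have "\<dots> = p * q * (1 - herm (ball_aut a z) (ball_aut a w))"
    unfolding herm_lin q by (simp add: algebra_simps)
  finally have "1 - herm (ball_aut a z) (ball_aut a w) = (1 - herm z w) / (p * q)" using pq by simp
  also have "\<dots> = s * s * (1 - herm z w) / ((1 - herm z a) * (1 - herm a w))" by (simp add: p_def q_def)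
  finally show ?thesis unfolding s .
qed

lemma one_minus_norm2_ball_aut:
  assumes a: "norm a < 1" and z: "norm z < 1"
  shows "1 - (norm (ball_aut a z))\<^sup>2 = (1 - (norm a)\<^sup>2) * (1 - (norm z)\<^sup>2) / (cmod (1 - herm z a))\<^sup>2"
proof -
  have "(1 - herm z a) * (1 - herm a z) = complex_of_real ((cmod (1 - herm z a))\<^sup>2)"
    by (simp add: complex_norm_square herm_cnj del: of_real_power)
  then have "complex_of_real (1 - (norm (ball_aut a z))\<^sup>2) = complex_of_real ((1 - (norm a)\<^sup>2) * (1 - (norm z)\<^sup>2) / (cmod (1 - herm z a))\<^sup>2)"
    using one_minus_herm_ball_aut[OF a z z] by (simp add: herm_self del: of_real_power)
  then show ?thesis by (simp only: of_real_eq_iff)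
qed

lemma norm_ball_aut: "norm a < 1 \<Longrightarrow> norm z < 1 \<Longrightarrow> norm (ball_aut a z) < 1"
proof -
  assume a: "norm a < 1" and z: "norm z < 1"
  have "0 < (1 - (norm a)\<^sup>2) * (1 - (norm z)\<^sup>2) / (cmod (1 - herm z a))\<^sup>2"
    using one_minus_norm2_pos[OF a] one_minus_norm2_pos[OF z] one_minus_herm_nz[OF z a] by simp
  then show ?thesis unfolding one_minus_norm2_ball_aut[OF a z, symmetric] by (simp add: abs_square_less_1)
qed

lemma one_minus_herm_ball_aut_center:
  assumes a: "norm a < 1" and z: "norm z < 1"
  shows "1 - herm (ball_aut a z) a = complex_of_real (1 - (norm a)\<^sup>2) / (1 - herm z a)"
proof -
  have "ball_aut a 0 = a" by (simp add: ball_aut_altdef aut_lin_def)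
  then show ?thesis using one_minus_herm_ball_aut[OF a z, of 0] one_minus_herm_nz[OF z a] by simp
qed

lemma ball_aut_0: "ball_aut a 0 = a"
  by (simp add: ball_aut_altdef aut_lin_def)

text \<open>The lift is homogeneous, so the scalar in front of (1, phi_a(z)) can be pulled out, and
  the involution on C^(n+1) descends to the quotients.\<close>

lemma ball_aut_involution:
  assumes a: "norm a < 1" and z: "norm z < 1"
  shows "ball_aut a (ball_aut a z) = z"
proof -
  let ?p = "fst (aut_lift a (1, z))" and ?w = "ball_aut a z"
  have s: "complex_of_real (sqrt (1 - (norm a)\<^sup>2)) \<noteq> 0" using one_minus_norm2_pos[OF a] by simp
  have p: "?p \<noteq> 0" using aut_lift_1(1)[OF a z] one_minus_herm_nz[OF z a] s by simp
  have "aut_lift a (c * 1, c *s w) = (c * fst (aut_lift a (1,w)), c *s snd (aut_lift a (1,w)))" for c w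
    by (simp add: aut_lift_eq[OF a] aut_lin_lin[OF a] herm_lin vec_eq_iff algebra_simps)
  from this[of ?p ?w] have "aut_lift a (aut_lift a (1,z)) = (?p * fst (aut_lift a (1,?w)), ?p *s snd (aut_lift a (1,?w)))"
    using aut_lift_1(2)[OF a z] by (metis mult.right_neutral prod.collapse)
  then have 1: "?p * fst (aut_lift a (1,?w)) = 1" "?p *s snd (aut_lift a (1,?w)) = z"
    using aut_lift_involution[OF a] by simp_all
  have "z = ?p *s (fst (aut_lift a (1,?w)) *s ball_aut a ?w)"
    using 1(2) aut_lift_1(2)[OF a norm_ball_aut[OF a z]] by simp
  also have "\<dots> = (?p * fst (aut_lift a (1,?w))) *s ball_aut a ?w" by simp
  finally show ?thesis using 1 by simp
qed

text \<open>Moving w to the origin by phi_w turns the claim into |1 - <z',u'>| \<le> 2. It acts as a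
  triangle inequality through the intermediate point w and is the only geometric input to the
  Carleson and Schur estimates below.\<close>

lemma kernel_submult:
  assumes z: "norm z < 1" and u: "norm u < 1" and w: "norm w < 1"
  shows "cmod (1 - herm z u) * (1 - (norm w)\<^sup>2) \<le> 2 * (cmod (1 - herm z w) * cmod (1 - herm w u))"
proof -
  let ?P = "cmod (1 - herm z w) * cmod (1 - herm w u)"
  have P: "?P > 0" using one_minus_herm_nz[OF z w] one_minus_herm_nz[OF w u] by simp
  have "(1 - (norm w)\<^sup>2) * cmod (1 - herm z u) / ?P = cmod (1 - herm (ball_aut w z) (ball_aut w u))"
    unfolding one_minus_herm_ball_aut[OF w z u] norm_mult norm_divide norm_of_real
    using one_minus_norm2_pos[OF w] by simp
  also have "\<dots> \<le> 2" by (intro cmod_1_minus_herm_le norm_ball_aut assms)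
  finally show ?thesis using P by (simp add: divide_simps mult_ac)
qed

section \<open>The invariant measure of the ball\<close>

lemma borel_measurable_scale_vec [measurable]:
  assumes [measurable]: "f \<in> borel_measurable M" "g \<in> borel_measurable M"
  shows "(\<lambda>x. f x *s (g x :: complex ^ 'n)) \<in> borel_measurable M"
proof -
  have "continuous_on UNIV (\<lambda>p :: complex \<times> (complex ^ 'n). fst p *s snd p)"
    unfolding vector_scalar_mult_def by (intro continuous_intros)
  from borel_measurable_continuous_Pair[OF assms this] show ?thesis by simp
qed

lemma borel_measurable_herm [measurable]:
  assumes [measurable]: "f \<in> borel_measurable M" "g \<in> borel_measurable M"
  shows "(\<lambda>x. herm (f x) (g x :: complex ^ 'n)) \<in> borel_measurable M"
proof -
  have "continuous_on UNIV (\<lambda>p :: (complex ^ 'n) \<times> (complex ^ 'n). herm (fst p) (snd p))"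
    unfolding herm_def by (intro continuous_intros)
  from borel_measurable_continuous_Pair[OF assms this] show ?thesis by simp
qed

lemma borel_measurable_ball_aut [measurable]: "ball_aut a \<in> borel_measurable borel"
  unfolding ball_aut_altdef[abs_def] aut_lin_def by measurable

lemma scaleR_vec_eq: "r *\<^sub>R (x :: complex ^ 'n) = complex_of_real r *s x"
  by (simp add: vec_eq_iff) (simp add: scaleR_conv_of_real)

lemma linear_aut_lift: "linear (aut_lift a)"
proof (rule linearI)
  fix x y :: "complex \<times> (complex ^ 'a)" and r :: real
  show "aut_lift a (x + y) = aut_lift a x + aut_lift a y"
    by (simp add: aut_lift_def aut_lin_def herm_lin vec_eq_iff algebra_simps del: of_real_divide)
  show "aut_lift a (r *\<^sub>R x) = r *\<^sub>R aut_lift a x"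
    by (simp add: aut_lift_def aut_lin_def herm_lin vec_eq_iff scaleR_vec_eq
        scaleR_conv_of_real[where 'a=complex] algebra_simps del: of_real_divide)
qed

lemma nn_integral_lborel_scaleR:
  fixes F :: "'a::euclidean_space \<Rightarrow> ennreal"
  assumes [measurable]: "F \<in> borel_measurable borel" and r: "r > 0"
  shows "(\<integral>\<^sup>+x. F x \<partial>lborel) = ennreal (r ^ DIM('a)) * (\<integral>\<^sup>+x. F (r *\<^sub>R x) \<partial>lborel)"
proof -
  have "(\<integral>\<^sup>+x. F x \<partial>lborel) = (\<integral>\<^sup>+x. F x \<partial>density (distr lborel borel (\<lambda>x. 0 + r *\<^sub>R x)) (\<lambda>_. ennreal (\<bar>r\<bar> ^ DIM('a))))"
    using lborel_affine[of r "0::'a"] r by simp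
  also have "\<dots> = ennreal (r ^ DIM('a)) * (\<integral>\<^sup>+x. F (r *\<^sub>R x) \<partial>lborel)"
    using r by (simp add: nn_integral_density nn_integral_distr nn_integral_cmult)
  finally show ?thesis .
qed

lemma distr_lborel_phase:
  assumes "cmod u = 1"
  shows "distr lborel borel (\<lambda>z :: complex ^ 'n. u *s z) = lborel"
  by (rule distr_lborel_isometry) (auto intro!: linearI simp: norm_scale_vec assms vec_eq_iff algebra_simps)

text \<open>The scalar c is split into the dilation by |c|, whose Jacobian has the real dimension 2n
  in the exponent, and the phase \<open>sgn c\<close>, which is an isometry.\<close>

lemma nn_integral_lborel_scale_vec:
  fixes F :: "complex ^ 'n \<Rightarrow> ennreal"
  assumes [measurable]: "F \<in> borel_measurable borel" and c: "c \<noteq> 0"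
  shows "(\<integral>\<^sup>+z. F z \<partial>lborel) = ennreal (cmod c ^ (2 * CARD('n))) * (\<integral>\<^sup>+z. F (c *s z) \<partial>lborel)"
proof -
  have "(\<integral>\<^sup>+z. F z \<partial>lborel) = ennreal (cmod c ^ (2 * CARD('n))) * (\<integral>\<^sup>+z. F (cmod c *\<^sub>R z) \<partial>lborel)"
    using nn_integral_lborel_scaleR[of F "cmod c"] c by (simp add: mult.commute)
  also have "(\<integral>\<^sup>+z. F (cmod c *\<^sub>R z) \<partial>lborel) = (\<integral>\<^sup>+z. F (cmod c *\<^sub>R z) \<partial>distr lborel borel (\<lambda>z. sgn c *s z))"
    by (subst distr_lborel_phase) (auto simp: norm_sgn c)
  also have "\<dots> = (\<integral>\<^sup>+z. F (c *s z) \<partial>lborel)"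
  proof -
    have "cmod c *\<^sub>R (sgn c *s z) = c *s z" for z :: "complex ^ 'n"
      using c by (auto simp: vec_eq_iff sgn_eq scaleR_vec_eq)
    then show ?thesis by (subst nn_integral_distr) auto
  qed
  finally show ?thesis .
qed

section \<open>Integration over the cone |x_0| > |x| in C^(n+1)\<close>

definition cone_const :: "nat \<Rightarrow> ennreal" where
  "cone_const n = (\<integral>\<^sup>+x. ennreal (cmod x ^ (2 * n)) * indicator {0<..<1} ((cmod x)\<^sup>2) \<partial>lborel)"

text \<open>\<open>cone_const\<close> multiplies both sides of the invariance identity; being
  neither 0 nor infinite is what allows it to be cancelled.\<close>

lemma cone_const_pos_finite: "cone_const n \<noteq> 0" "cone_const n \<noteq> \<infinity>"
proof -
  have "cone_const n \<le> (\<integral>\<^sup>+x. indicator (ball (0::complex) 1) x \<partial>lborel)"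
    unfolding cone_const_def
    by (intro nn_integral_mono) (auto split: split_indicator simp: abs_square_less_1 power_le_one ennreal_le_1)
  also have "\<dots> < \<infinity>" using emeasure_lborel_ball_finite[of "0::complex" 1] by simp
  finally show "cone_const n \<noteq> \<infinity>" by simp
  show "cone_const n \<noteq> 0"
  proof
    assume "cone_const n = 0"
    then have "AE x in lborel. ennreal (cmod x ^ (2 * n)) * indicator {0<..<1} ((cmod x)\<^sup>2) = 0"
      unfolding cone_const_def by (subst (asm) nn_integral_0_iff_AE) auto
    then have "AE x in lborel. x \<notin> ball 0 1 - {0 :: complex}"
      by eventually_elim (auto split: split_indicator_asm simp: abs_square_less_1 indicator_def split: if_splits)
    then have "ball 0 1 - {0 :: complex} \<in> null_sets lborel" by (subst (asm) AE_iff_null_sets[symmetric]) auto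
    then have "emeasure lborel (ball 0 1 - {0 :: complex}) = 0" by auto
    moreover have "emeasure lborel (ball 0 1 - {0 :: complex}) = emeasure lborel (ball (0::complex) 1)"
      by (rule emeasure_Diff_null_set) auto
    ultimately show False
      using emeasure_lborel_ball_finite[of "0::complex" 1] content_ball_pos[of 1 "0::complex"]
      by (auto simp: measure_def)
  qed
qed

text \<open>Integrating a function of \<open>x / x\<^sub>0\<close> over the part \<open>0 < |x\<^sub>0|\<^sup>2 - |x|\<^sup>2 < 1\<close> of the cone
  produces the invariant measure of the ball.\<close>

definition cone_fun :: "(complex ^ 'n \<Rightarrow> ennreal) \<Rightarrow> complex \<times> (complex ^ 'n) \<Rightarrow> ennreal" where
  "cone_fun F y = indicator {0<..<1} ((cmod (fst y))\<^sup>2 - (norm (snd y))\<^sup>2) * F ((1 / fst y) *s snd y)"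

lemma borel_measurable_cone_fun [measurable]:
  assumes [measurable]: "F \<in> borel_measurable borel"
  shows "cone_fun F \<in> borel_measurable borel"
proof -
  have [measurable]: "(\<lambda>y :: complex \<times> (complex ^ 'n). fst y) \<in> borel_measurable borel" "(\<lambda>y :: complex \<times> (complex ^ 'n). snd y) \<in> borel_measurable borel"
    by (auto intro!: borel_measurable_continuous_onI continuous_intros)
  show ?thesis unfolding cone_fun_def[abs_def] by measurable
qed

text \<open>For fixed x_0 the substitution x = x_0 z produces |x_0|^(2n) and separates the
  variables. For fixed z in the ball, rescaling x_0 by 1/t with t^2 = 1 - |z|^2 produces t^(-2n-2),
  which is the exponent n + 1 of the invariant measure. For z outside the ball the cone condition
  cannot hold.\<close>

lemma nn_integral_cone_fun:
  fixes F :: "complex ^ 'n \<Rightarrow> ennreal"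
  assumes [measurable]: "F \<in> borel_measurable borel"
  shows "(\<integral>\<^sup>+y. cone_fun F y \<partial>lborel) =
    cone_const CARD('n) * (\<integral>\<^sup>+z. indicator (ball 0 1) z * F z * ennreal ((1 - (norm z)\<^sup>2) powr - (real CARD('n) + 1)) \<partial>lborel)"
proof -
  have [measurable]: "ball 0 1 \<in> sets (borel :: (complex ^ 'n) measure)" by simp
  let ?N = "CARD('n)"
  let ?I = "\<lambda>x0 (z :: complex ^ 'n). indicator {0<..<1} ((cmod x0)\<^sup>2 * (1 - (norm z)\<^sup>2)) :: ennreal"
  have "(\<integral>\<^sup>+y. cone_fun F y \<partial>lborel) = (\<integral>\<^sup>+y. cone_fun F y \<partial>(lborel \<Otimes>\<^sub>M lborel))"
    by (simp add: lborel_prod)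
  also have "\<dots> = (\<integral>\<^sup>+x0. \<integral>\<^sup>+x. cone_fun F (x0, x) \<partial>lborel \<partial>lborel)"
    by (rule lborel.nn_integral_fst[symmetric]) (simp add: lborel_prod)
  also have "\<dots> = (\<integral>\<^sup>+x0. \<integral>\<^sup>+z. ennreal (cmod x0 ^ (2 * ?N)) * (?I x0 z * F z) \<partial>lborel \<partial>lborel)"
  proof (rule nn_integral_cong_AE)
    have "AE x0 in lborel. x0 \<noteq> (0::complex)" by (rule AE_lborel_singleton)
    then show "AE x0 in lborel. (\<integral>\<^sup>+x. cone_fun F (x0, x) \<partial>lborel) = (\<integral>\<^sup>+z. ennreal (cmod x0 ^ (2 * ?N)) * (?I x0 z * F z) \<partial>lborel)"
    proof eventually_elim
      case (elim x0)
      have [measurable]: "(\<lambda>x. cone_fun F (x0, x)) \<in> borel_measurable borel"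
        unfolding cone_fun_def fst_conv snd_conv by measurable
      have *: "cone_fun F (x0, x0 *s z) = ?I x0 z * F z" for z
        using elim by (simp add: cone_fun_def norm_scale_vec power_mult_distrib algebra_simps)
      show ?case
        by (subst nn_integral_lborel_scale_vec[OF _ elim]) (simp_all add: * nn_integral_cmult)
    qed
  qed
  also have "\<dots> = (\<integral>\<^sup>+z. \<integral>\<^sup>+x0. ennreal (cmod x0 ^ (2 * ?N)) * (?I x0 z * F z) \<partial>lborel \<partial>lborel)"
    by (rule lborel_pair.Fubini') measurable
  also have "\<dots> = (\<integral>\<^sup>+z. cone_const ?N * (indicator (ball 0 1) z * F z * ennreal ((1 - (norm z)\<^sup>2) powr - (real ?N + 1))) \<partial>lborel)"
  proof (rule nn_integral_cong)
    fix z :: "complex ^ 'n"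
    show "(\<integral>\<^sup>+x0. ennreal (cmod x0 ^ (2 * ?N)) * (?I x0 z * F z) \<partial>lborel) =
      cone_const ?N * (indicator (ball 0 1) z * F z * ennreal ((1 - (norm z)\<^sup>2) powr - (real ?N + 1)))"
    proof (cases "norm z < 1")
      case False
      then have "1 \<le> (norm z)\<^sup>2" by (smt (verit) one_le_power)
      then have "(cmod x0)\<^sup>2 * (1 - (norm z)\<^sup>2) \<le> 0" for x0
        by (intro mult_nonneg_nonpos) auto
      then have "?I x0 z = 0" for x0 by (simp add: indicator_def not_less)
      then show ?thesis using False by simp
    next
      case True
      define t where "t = sqrt (1 - (norm z)\<^sup>2)"
      have t: "t > 0" "t\<^sup>2 = 1 - (norm z)\<^sup>2" using one_minus_norm2_pos[OF True] by (auto simp: t_def)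
      have "(\<integral>\<^sup>+x0. ennreal (cmod x0 ^ (2 * ?N)) * (?I x0 z * F z) \<partial>lborel)
        = F z * (\<integral>\<^sup>+x0. ennreal (cmod x0 ^ (2 * ?N)) * ?I x0 z \<partial>lborel)"
        by (subst nn_integral_cmult[symmetric]) (auto simp: mult_ac)
      also have "(\<integral>\<^sup>+x0. ennreal (cmod x0 ^ (2 * ?N)) * ?I x0 z \<partial>lborel) =
         ennreal ((1/t)\<^sup>2) * (\<integral>\<^sup>+x. ennreal (cmod ((1/t) *\<^sub>R x) ^ (2 * ?N)) * ?I ((1/t) *\<^sub>R x) z \<partial>lborel)"
        using t by (subst nn_integral_lborel_scaleR[where r = "1/t"]) (simp_all)
      also have "\<dots> = ennreal ((1/t)\<^sup>2) * (\<integral>\<^sup>+x. ennreal ((1/t) ^ (2 * ?N)) * (ennreal (cmod x ^ (2 * ?N)) * indicator {0<..<1} ((cmod x)\<^sup>2)) \<partial>lborel)"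
      proof -
        have "(cmod ((1/t) *\<^sub>R x))\<^sup>2 * (1 - (norm z)\<^sup>2) = (cmod x)\<^sup>2" for x
          using t(1) unfolding t(2)[symmetric] by (simp add: power_mult_distrib power_divide)
        moreover have "ennreal (cmod ((1/t) *\<^sub>R x) ^ (2 * ?N)) = ennreal ((1/t) ^ (2 * ?N)) * ennreal (cmod x ^ (2 * ?N))" for x
          using t(1) by (simp add: power_mult_distrib power_divide flip: ennreal_mult)
        ultimately show ?thesis by (simp add: mult.assoc)
      qed
      also have "\<dots> = ennreal ((1/t)\<^sup>2 * (1/t) ^ (2 * ?N)) * cone_const ?N"
        by (simp add: nn_integral_cmult cone_const_def ennreal_mult mult.assoc)
      also have "(1/t)\<^sup>2 * (1/t) ^ (2 * ?N) = (1 - (norm z)\<^sup>2) powr - (real ?N + 1)"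
      proof -
        have "(1/t)\<^sup>2 * (1/t) ^ (2 * ?N) = inverse ((t\<^sup>2) ^ (?N + 1))"
          by (simp add: power_one_over inverse_eq_divide flip: power_mult power_add)
        also have "\<dots> = inverse ((1 - (norm z)\<^sup>2) powr (real (?N + 1)))"
          unfolding t(2) by (subst powr_realpow) (auto simp: one_minus_norm2_pos[OF True, simplified])
        finally show ?thesis by (simp add: add.commute flip: powr_minus)
      qed
      finally show ?thesis using True by (simp add: mult_ac)
    qed
  qed
  also have "\<dots> = cone_const ?N * (\<integral>\<^sup>+z. (indicator (ball 0 1) z * F z * ennreal ((1 - (norm z)\<^sup>2) powr - (real ?N + 1))) \<partial>lborel)"
    by (rule nn_integral_cmult) (simp, measurable)
  finally show ?thesis .
qed

text \<open>The lift preserves |x_0|^2 - |x|^2, hence the indicator, and induces phi_a on the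
  quotients x / x_0. Where the form is positive, x_0 is nonzero and x / x_0 lies in the ball;
  elsewhere both sides vanish.\<close>

lemma cone_fun_aut_lift:
  assumes a: "norm a < 1"
  shows "cone_fun F (aut_lift a y) = cone_fun (\<lambda>z. F (ball_aut a z)) y"
proof -
  have q: "(cmod (fst y))\<^sup>2 - (norm (snd y))\<^sup>2 = Re (fst y * cnj (fst y) - herm (snd y) (snd y))" for y :: "complex \<times> (complex ^ 'n)"
    by (simp add: herm_self complex_mult_cnj cmod_power2 flip: power2_eq_square)
  show ?thesis
  proof (cases "(cmod (fst y))\<^sup>2 - (norm (snd y))\<^sup>2 > 0")
    case True
    let ?z = "(1 / fst y) *s snd y"
    have y0: "fst y \<noteq> 0" using True by auto
    have lt: "norm (snd y) < cmod (fst y)" using True by (simp add: power_less_imp_less_base)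
    have z: "norm ?z < 1"
      using lt y0 by (simp only: norm_scale_vec) (simp add: norm_divide)
    have y: "y = (fst y * 1, fst y *s ?z)" using y0 by (simp add: prod_eq_iff vec_eq_iff)
    have h: "aut_lift a (c * 1, c *s w) = (c * fst (aut_lift a (1,w)), c *s snd (aut_lift a (1,w)))" for c w
      by (simp add: aut_lift_eq[OF a] aut_lin_lin[OF a] herm_lin vec_eq_iff algebra_simps)
    let ?p = "fst (aut_lift a (1, ?z))"
    have "?p \<noteq> 0" using aut_lift_1(1)[OF a z] one_minus_herm_nz[OF z a] one_minus_norm2_pos[OF a] by simp
    moreover have e: "aut_lift a y = (fst y * ?p, (fst y * ?p) *s ball_aut a ?z)"
      using h[of "fst y" ?z] aut_lift_1(2)[OF a z] y by simp
    ultimately have "(1 / fst (aut_lift a y)) *s snd (aut_lift a y) = ball_aut a ?z"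
      using y0 by simp
    then show ?thesis unfolding cone_fun_def q aut_lift_form[OF a] by simp
  next
    case False
    then show ?thesis unfolding cone_fun_def q aut_lift_form[OF a] by (simp add: indicator_def)
  qed
qed

text \<open>\<open>aut_lift a\<close> is a linear involution and so preserves Lebesgue measure on
  C^(n+1); integrating cone functions on both sides brings this invariance down to the ball.\<close>

lemma nn_integral_ball_aut_invariant:
  fixes F :: "complex ^ 'n \<Rightarrow> ennreal"
  assumes [measurable]: "F \<in> borel_measurable borel" and a: "norm a < 1"
  shows "(\<integral>\<^sup>+z. indicator (ball 0 1) z * F (ball_aut a z) * ennreal ((1 - (norm z)\<^sup>2) powr - (real CARD('n) + 1)) \<partial>lborel)
    = (\<integral>\<^sup>+z. indicator (ball 0 1) z * F z * ennreal ((1 - (norm z)\<^sup>2) powr - (real CARD('n) + 1)) \<partial>lborel)"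
    (is "?L = ?R")
proof -
  have m: "aut_lift a \<in> borel_measurable borel"
    by (intro borel_measurable_continuous_onI linear_continuous_on linear_aut_lift linear_conv_bounded_linear[THEN iffD1])
  have "cone_const CARD('n) * ?R = (\<integral>\<^sup>+y. cone_fun F y \<partial>distr lborel borel (aut_lift a))"
    unfolding distr_lborel_involution[OF linear_aut_lift aut_lift_involution[OF a]]
    by (rule nn_integral_cone_fun[symmetric]) measurable
  also have "\<dots> = (\<integral>\<^sup>+y. cone_fun (\<lambda>z. F (ball_aut a z)) y \<partial>lborel)"
    using m by (subst nn_integral_distr) (auto simp: cone_fun_aut_lift[OF a])
  also have "\<dots> = cone_const CARD('n) * ?L"
    by (rule nn_integral_cone_fun) measurable
  finally have "cone_const CARD('n) * ?R / cone_const CARD('n) = cone_const CARD('n) * ?L / cone_const CARD('n)" by simp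
  then show ?thesis using cone_const_pos_finite[of "CARD('n)"] by (simp add: ennreal_mult_divide_eq mult.commute[of "cone_const _"])
qed

section \<open>The weighted measures\<close>

lemma measurable_unit_ball [measurable]: "ball (0 :: complex ^ 'n) 1 \<in> sets borel"
  by simp

lemma space_weighted [simp]: "space (weighted_measure \<alpha> :: (complex ^ 'n) measure) = ball 0 1"
  by (simp add: weighted_measure_def ball_measure_def)

lemma sets_ball_measure: "A \<in> sets (ball_measure :: (complex ^ 'n) measure) \<longleftrightarrow> A \<subseteq> ball 0 1 \<and> A \<in> sets lebesgue"
  unfolding ball_measure_def by (subst sets_restrict_space_iff) auto

lemma sets_weighted: "sets (weighted_measure \<alpha> :: (complex ^ 'n) measure) = sets ball_measure"
  by (simp add: weighted_measure_def)

lemma measurable_borel_ball_measure: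
  "f \<in> measurable borel N \<Longrightarrow> f \<in> measurable (ball_measure :: (complex ^ 'n) measure) N"
  unfolding ball_measure_def by (intro measurable_restrict_space1 measurable_completion) simp

lemma measurable_weighted_eq: "measurable (weighted_measure \<alpha> :: (complex ^ 'n) measure) N = measurable ball_measure N"
  by (rule measurable_cong_sets) (auto simp: sets_weighted)

lemma measurable_borel_weighted:
  "f \<in> measurable borel N \<Longrightarrow> f \<in> measurable (weighted_measure \<alpha> :: (complex ^ 'n) measure) N"
  by (simp add: measurable_weighted_eq measurable_borel_ball_measure)

lemma measurable_ident_weighted [measurable]: "(\<lambda>x. x) \<in> measurable (weighted_measure \<alpha> :: (complex ^ 'n) measure) borel"
  by (rule measurable_borel_weighted) simp

lemma continuous_on_imp_measurable_weighted:
  assumes "continuous_on (ball 0 1) f"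
  shows "f \<in> borel_measurable (weighted_measure \<alpha> :: (complex ^ 'n) measure)"
proof -
  have "f \<in> borel_measurable (restrict_space borel (ball 0 1))"
    by (rule borel_measurable_continuous_on_restrict[OF assms])
  moreover have "(\<lambda>x. x) \<in> measurable (weighted_measure \<alpha> :: (complex ^ 'n) measure) (restrict_space borel (ball 0 1))"
    by (rule measurable_restrict_space2) auto
  ultimately show ?thesis using measurable_compose by fastforce
qed

text \<open>The shell lies between the spheres of radius sqrt(1 - \<delta>) and 1. Its volume is
  proportional to 1 - (1 - \<delta>)^n, which Bernoulli's inequality bounds by n \<delta>.\<close>

lemma emeasure_thin_shell_le:
  assumes d: "0 \<le> \<delta>" "\<delta> \<le> 1"
  shows "emeasure lborel {z :: complex ^ 'n. norm z < 1 \<and> 1 - (norm z)\<^sup>2 \<le> \<delta>}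
    \<le> ennreal (unit_ball_vol (real (2 * CARD('n))) * (real CARD('n) * \<delta>))"
proof -
  let ?V = "unit_ball_vol (real (2 * CARD('n)))" and ?N = "CARD('n)"
  have dim: "DIM(complex ^ 'n) = 2 * ?N" by simp
  have eb: "emeasure lborel (ball (0 :: complex ^ 'n) r) = ennreal (?V * r ^ (2 * ?N))" if "r \<ge> 0" for r
    using emeasure_ball[OF that, of "0 :: complex ^ 'n"] by (simp add: mult.commute)
  let ?r = "sqrt (1 - \<delta>)"
  have r: "0 \<le> ?r" "?r \<le> 1" using d by auto
  have rp: "?r ^ (2 * ?N) = (1 - \<delta>) ^ ?N" using d by (simp add: power_mult)
  have "{z :: complex ^ 'n. norm z < 1 \<and> 1 - (norm z)\<^sup>2 \<le> \<delta>} \<subseteq> ball 0 1 - ball 0 ?r"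
  proof safe
    fix z :: "complex ^ 'n" assume z: "1 - (norm z)\<^sup>2 \<le> \<delta>" "z \<in> ball 0 ?r"
    then have "(norm z)\<^sup>2 < ?r\<^sup>2" by (intro power_strict_mono) auto
    then show False using z d by simp
  qed simp
  then have "emeasure lborel {z :: complex ^ 'n. norm z < 1 \<and> 1 - (norm z)\<^sup>2 \<le> \<delta>} \<le> emeasure lborel (ball (0 :: complex ^ 'n) 1 - ball 0 ?r)"
    by (intro emeasure_mono) auto
  also have "\<dots> = emeasure lborel (ball (0 :: complex ^ 'n) 1) - emeasure lborel (ball (0 :: complex ^ 'n) ?r)"
    using r by (intro emeasure_Diff subset_ball) (auto simp: emeasure_lborel_ball_finite less_top[symmetric] eb)
  also have "\<dots> = ennreal (?V - ?V * (1 - \<delta>) ^ ?N)"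
    using r d by (simp add: eb rp ennreal_minus)
  also have "\<dots> \<le> ennreal (?V * (real ?N * \<delta>))"
  proof (rule ennreal_leI)
    have "1 + real ?N * (- \<delta>) \<le> (1 + - \<delta>) ^ ?N" using d by (intro Bernoulli_inequality) auto
    then have "1 - (1 - \<delta>) ^ ?N \<le> real ?N * \<delta>" by simp
    then have "?V * (1 - (1 - \<delta>) ^ ?N) \<le> ?V * (real ?N * \<delta>)" by (intro mult_left_mono) auto
    then show "?V - ?V * (1 - \<delta>) ^ ?N \<le> ?V * (real ?N * \<delta>)" by (simp add: right_diff_distrib)
  qed
  finally show ?thesis .
qed

text \<open>Cut the ball into shells 2^(-k-1) < 1 - |z|^2 \<le> 2^(-k). The weight there is of order
  2^(-ks) and the volume of order 2^(-k), so the sum is a geometric series of ratio 2^(-1-s),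
  convergent for s > -1.\<close>

lemma nn_integral_weight_finite:
  assumes s: "s > -1"
  shows "(\<integral>\<^sup>+z. indicator (ball 0 1) (z :: complex ^ 'n) * ennreal ((1 - (norm z)\<^sup>2) powr s) \<partial>lborel) < \<infinity>"
proof -
  let ?A = "\<lambda>k. {z :: complex ^ 'n. norm z < 1 \<and> 1 - (norm z)\<^sup>2 \<le> (1/2) ^ k}"
  let ?V = "unit_ball_vol (real (2 * CARD('n)))" and ?N = "real CARD('n)"
  \<comment> \<open>Covers both signs of s: for negative s the weight is bounded by its value at the
    inner dyadic level k + 1, which costs a factor 2^(-s).\<close>
  let ?B = "2 powr \<bar>s\<bar>"
  have ex: "\<exists>k. (1/2) ^ (Suc k) < t \<and> t \<le> (1/2) ^ k" if t: "0 < t" "t \<le> 1" for t :: real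
  proof -
    obtain n where n: "(1/2) ^ n < t" using real_arch_pow_inv[OF t(1), of "1/2"] by auto
    define m where "m = (LEAST n. (1/2) ^ n < t)"
    have m: "(1/2) ^ m < t" unfolding m_def by (rule LeastI[of "\<lambda>n. (1/2) ^ n < t", OF n])
    then have "m \<noteq> 0" using t by (cases m) auto
    then obtain k where k: "m = Suc k" by (cases m) auto
    have "\<not> (1/2) ^ k < t" using not_less_Least[of k "\<lambda>n. (1/2) ^ n < t"] k m_def by simp
    then show ?thesis using m k by (intro exI[of _ k]) auto
  qed
  have le: "indicator (ball 0 1) z * ennreal ((1 - (norm z)\<^sup>2) powr s) \<le> (\<Sum>k. ennreal (?B * ((1/2) powr s) ^ k) * indicator (?A k) z)" for z :: "complex ^ 'n"
  proof (cases "norm z < 1")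
    case True
    let ?t = "1 - (norm z)\<^sup>2"
    have t: "0 < ?t" "?t \<le> 1" using one_minus_norm2_pos[OF True] by auto
    obtain k where k: "(1/2) ^ (Suc k) < ?t" "?t \<le> (1/2) ^ k" using ex[OF t] by blast
    have "?t powr s \<le> ?B * ((1/2) powr s) ^ k"
    proof -
      have e: "((1/2) powr s) ^ k = ((1/2) ^ k) powr s" for k :: nat
        by (simp add: powr_powr flip: powr_realpow powr_realpow') (simp add: mult.commute)
      show ?thesis
      proof (cases "s \<ge> 0")
        case True
        then have "?t powr s \<le> ((1/2) ^ k) powr s" using k t by (intro powr_mono2) auto
        also have "\<dots> \<le> ?B * ((1/2) ^ k) powr s" using True by (simp add: mult_le_cancel_right1 ge_one_powr_ge_zero)
        finally show ?thesis by (simp add: e)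
      next
        case False
        then have "?t powr s \<le> ((1/2) ^ (Suc k)) powr s" using k by (intro powr_mono2') auto
        also have "\<dots> = (1/2) powr s * ((1/2) powr s) ^ k" unfolding e[symmetric, of "Suc k"] by simp
        also have b: "(1/2) powr s = ?B" using False by (simp add: powr_divide powr_minus inverse_eq_divide)
        finally show ?thesis unfolding b .
      qed
    qed
    moreover have fk: "f k \<le> suminf f" for f :: "nat \<Rightarrow> ennreal"
      using sum_le_suminf[of f "{k}"] by simp
    ultimately have "indicator (ball 0 1) z * ennreal (?t powr s) \<le> ennreal (?B * ((1/2) powr s) ^ k) * indicator (?A k) z"
      using True k by (simp add: ennreal_leI)
    also have "\<dots> \<le> (\<Sum>k. ennreal (?B * ((1/2) powr s) ^ k) * indicator (?A k) z)"
      by (rule fk[of "\<lambda>k. ennreal (?B * ((1/2) powr s) ^ k) * indicator (?A k) z"])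
    finally show ?thesis .
  qed simp
  have "(\<integral>\<^sup>+z. indicator (ball 0 1) (z :: complex ^ 'n) * ennreal ((1 - (norm z)\<^sup>2) powr s) \<partial>lborel)
     \<le> (\<integral>\<^sup>+z. (\<Sum>k. ennreal (?B * ((1/2) powr s) ^ k) * indicator (?A k) z) \<partial>lborel)"
    by (intro nn_integral_mono le)
  also have "\<dots> = (\<Sum>k. \<integral>\<^sup>+z. ennreal (?B * ((1/2) powr s) ^ k) * indicator (?A k) z \<partial>lborel)"
    by (rule nn_integral_suminf) measurable
  also have "\<dots> = (\<Sum>k. ennreal (?B * ((1/2) powr s) ^ k) * emeasure lborel (?A k))"
    by (intro arg_cong[of _ _ suminf] ext) (subst nn_integral_cmult, auto)
  also have "\<dots> \<le> (\<Sum>k. ennreal (?B * ?V * ?N * (1/2 * (1/2) powr s) ^ k))"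
  proof (intro suminf_le allI)
    fix k :: nat
    have "ennreal (?B * ((1/2) powr s) ^ k) * emeasure lborel (?A k) \<le> ennreal (?B * ((1/2) powr s) ^ k) * ennreal (?V * (?N * (1/2) ^ k))"
      using power_le_one[of "1/2 :: real" k] by (intro mult_left_mono emeasure_thin_shell_le) (auto simp: power_le_one)
    also have "\<dots> = ennreal (?B * ?V * ?N * (1/2 * (1/2) powr s) ^ k)"
      by (simp add: ennreal_mult[symmetric] power_mult_distrib power_divide mult_ac)
    finally show "ennreal (?B * ((1/2) powr s) ^ k) * emeasure lborel (?A k) \<le> ennreal (?B * ?V * ?N * (1/2 * (1/2) powr s) ^ k)" .
  qed auto
  also have "\<dots> < \<infinity>"
  proof -
    have "1/2 * (1/2) powr s = (1/2) powr (1 + s)" by (simp add: powr_add)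
    also have "\<dots> < 1" using s powr_less_mono2_neg[of "- (1 + s)" 1 2] by (simp add: powr_divide powr_minus_divide)
    finally have "summable (\<lambda>k. ?B * ?V * ?N * (1/2 * (1/2) powr s) ^ k)"
      by (intro summable_mult summable_geometric) auto
    then show ?thesis using suminf_ennreal2 by (simp add: suminf_ennreal_eq[OF _ summable_sums])
  qed
  finally show ?thesis .
qed

lemma borel_measurable_weight [measurable]: "(\<lambda>z :: complex ^ 'n. (1 - (norm z)\<^sup>2) powr s) \<in> borel_measurable borel"
  by measurable

lemma nn_integral_ball_measure:
  fixes F :: "complex ^ 'n \<Rightarrow> ennreal"
  shows "(\<integral>\<^sup>+z. F z \<partial>ball_measure) = (\<integral>\<^sup>+z. indicator (ball 0 1) z * F z \<partial>lborel)"
  unfolding ball_measure_def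
  by (subst nn_integral_restrict_space) (auto simp: nn_integral_completion mult.commute)

lemma weight_integral:
  fixes \<alpha> :: real
  assumes \<alpha>: "\<alpha> > -1"
  shows "norm_const TYPE('n::finite) \<alpha> > 0"
    "ennreal (norm_const TYPE('n) \<alpha>) * (\<integral>\<^sup>+z. ennreal ((1 - (norm z)\<^sup>2) powr \<alpha>) \<partial>(ball_measure :: (complex ^ 'n) measure)) = 1"
proof -
  let ?M = "ball_measure :: (complex ^ 'n) measure" and ?f = "\<lambda>z :: complex ^ 'n. (1 - (norm z)\<^sup>2) powr \<alpha>"
  let ?I = "\<integral>\<^sup>+z. ennreal (?f z) \<partial>?M"
  have [measurable]: "?f \<in> borel_measurable ?M" by (rule measurable_borel_ball_measure) measurable
  have fin: "?I < \<infinity>" using nn_integral_weight_finite[OF \<alpha>, where 'n='n] by (simp add: nn_integral_ball_measure)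
  have "?I \<noteq> 0"
  proof
    assume "?I = 0"
    then have "AE z in lborel. indicator (ball 0 1) (z :: complex ^ 'n) * ennreal (?f z) = 0"
      unfolding nn_integral_ball_measure by (subst (asm) nn_integral_0_iff_AE) auto
    then have "AE z in lborel. (z :: complex ^ 'n) \<notin> ball 0 1"
      by eventually_elim (auto simp: indicator_def abs_square_eq_1)
    then have "emeasure lborel (ball (0 :: complex ^ 'n) 1) = 0"
      by (subst (asm) AE_iff_null_sets[symmetric]) auto
    then show False using content_ball_pos[of 1 "0 :: complex ^ 'n"] by (simp add: measure_def)
  qed
  then obtain r where r: "?I = ennreal r" "r > 0" using fin by (cases ?I) (auto simp: less_le)
  have "(LINT z|?M. ?f z) = enn2real ?I" by (rule integral_eq_nn_integral) auto
  then have c: "norm_const TYPE('n) \<alpha> = 1 / r" using r by (simp add: norm_const_def)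
  show "norm_const TYPE('n::finite) \<alpha> > 0" using c r by simp
  show "ennreal (norm_const TYPE('n) \<alpha>) * ?I = 1" using r by (simp add: c ennreal_mult[symmetric])
qed

lemma weight_measurable_ball: "(\<lambda>z :: complex ^ 'n. ennreal (norm_const TYPE('n) \<alpha> * (1 - (norm z)\<^sup>2) powr \<alpha>)) \<in> borel_measurable ball_measure"
  by (rule measurable_borel_ball_measure) measurable

lemma nn_integral_weighted:
  fixes F :: "complex ^ 'n \<Rightarrow> ennreal"
  assumes "F \<in> borel_measurable borel"
  shows "(\<integral>\<^sup>+z. F z \<partial>weighted_measure \<alpha>) =
    (\<integral>\<^sup>+z. indicator (ball 0 1) z * (F z * ennreal (norm_const TYPE('n) \<alpha> * (1 - (norm z)\<^sup>2) powr \<alpha>)) \<partial>lborel)"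
  unfolding weighted_measure_def
  by (subst nn_integral_density[OF weight_measurable_ball])
     (auto simp: nn_integral_ball_measure measurable_borel_ball_measure assms mult.commute mult.left_commute)

lemma emeasure_weighted_space:
  assumes \<alpha>: "\<alpha> > -1"
  shows "emeasure (weighted_measure \<alpha>) (space (weighted_measure \<alpha> :: (complex ^ 'n) measure)) = 1"
proof -
  have "emeasure (weighted_measure \<alpha>) (space (weighted_measure \<alpha> :: (complex ^ 'n) measure)) = (\<integral>\<^sup>+z. 1 \<partial>(weighted_measure \<alpha> :: (complex ^ 'n) measure))"
    by simp
  also have "\<dots> = (\<integral>\<^sup>+z. ennreal (norm_const TYPE('n) \<alpha>) * ennreal ((1 - (norm z)\<^sup>2) powr \<alpha>) \<partial>(ball_measure :: (complex ^ 'n) measure))"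
    unfolding nn_integral_ball_measure using weight_integral(1)[OF \<alpha>, where 'n='n]
    by (subst nn_integral_weighted) (auto simp: ennreal_mult)
  also have "\<dots> = 1" using weight_integral(2)[OF \<alpha>, where 'n='n]
    by (subst nn_integral_cmult) (auto intro!: measurable_borel_ball_measure)
  finally show "emeasure (weighted_measure \<alpha>) (space (weighted_measure \<alpha> :: (complex ^ 'n) measure)) = 1" .
qed

lemma finite_measure_weighted: "\<alpha> > -1 \<Longrightarrow> finite_measure (weighted_measure \<alpha> :: (complex ^ 'n) measure)"
  by (rule finite_measureI) (simp only: emeasure_weighted_space, simp)

section \<open>Null sets, completeness and transport of the weighted measure\<close>

lemma AE_ball_measure: "(AE z in (ball_measure :: (complex ^ 'n) measure). P z) \<longleftrightarrow> (AE z in lborel. z \<in> ball 0 1 \<longrightarrow> P z)"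
  unfolding ball_measure_def by (subst AE_restrict_space_iff) (auto simp: AE_completion_iff)

lemma AE_weighted:
  assumes \<alpha>: "\<alpha> > -1"
  shows "(AE z in (weighted_measure \<alpha> :: (complex ^ 'n) measure). P z) \<longleftrightarrow> (AE z in ball_measure. P z)"
proof -
  have "(AE z in (weighted_measure \<alpha> :: (complex ^ 'n) measure). P z) \<longleftrightarrow>
     (AE z in ball_measure. 0 < ennreal (norm_const TYPE('n) \<alpha> * (1 - (norm z)\<^sup>2) powr \<alpha>) \<longrightarrow> P (z :: complex ^ 'n))"
    unfolding weighted_measure_def by (rule AE_density[OF weight_measurable_ball])
  also have "\<dots> \<longleftrightarrow> (AE z in ball_measure. P (z :: complex ^ 'n))"
    unfolding AE_ball_measure
    by (rule AE_cong) (use weight_integral(1)[OF \<alpha>, where 'n='n] in \<open>auto simp: zero_less_mult_iff abs_square_eq_1\<close>)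
  finally show ?thesis .
qed

text \<open>\<open>ball_measure\<close> carries the Lebesgue sets, not only the Borel sets, and the
  density is positive on the ball, so every subset of a null set is measurable. This is what makes
  almost everywhere limits measurable.\<close>

lemma weighted_complete:
  assumes \<alpha>: "\<alpha> > -1" and N: "AE z in (weighted_measure \<alpha> :: (complex ^ 'n) measure). z \<notin> N" "N \<subseteq> ball 0 1"
  shows "N \<in> sets (weighted_measure \<alpha> :: (complex ^ 'n) measure)"
proof -
  have "AE z in lborel. z \<notin> N"
    using N(1) unfolding AE_weighted[OF \<alpha>] AE_ball_measure by eventually_elim (use N(2) in auto)
  then obtain N' where "N \<subseteq> N'" "N' \<in> null_sets lborel"
    by (auto elim!: AE_E simp: null_sets_def)
  then have "N \<in> null_sets lebesgue"
    by (metis null_sets_completionI null_sets_completion_subset)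
  then show ?thesis using N(2) by (auto simp: sets_weighted sets_ball_measure)
qed

lemma measurable_weighted_AE_cong:
  assumes \<alpha>: "\<alpha> > -1" and f: "f \<in> measurable (weighted_measure \<alpha> :: (complex ^ 'n) measure) N"
    and eq: "AE z in (weighted_measure \<alpha> :: (complex ^ 'n) measure). f z = g z"
    and g: "g \<in> ball 0 1 \<rightarrow> space N"
  shows "g \<in> measurable (weighted_measure \<alpha>) N"
proof (rule measurableI)
  let ?M = "weighted_measure \<alpha> :: (complex ^ 'n) measure"
  show "g x \<in> space N" if "x \<in> space ?M" for x using g that by auto
  fix A assume A: "A \<in> sets N"
  let ?D = "{z \<in> ball 0 1. f z \<noteq> g z}"
  have D: "B \<in> sets ?M" if "B \<subseteq> ?D" for B
    by (rule weighted_complete[OF \<alpha>]) (use that eq in \<open>auto elim!: eventually_mono\<close>)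
  have "g -` A \<inter> space ?M = ((f -` A \<inter> space ?M) - ?D) \<union> (g -` A \<inter> ?D)" by auto
  also have "\<dots> \<in> sets ?M" using D[of ?D] D[of "g -` A \<inter> ?D"] measurable_sets[OF f A] by auto
  finally show "g -` A \<inter> space ?M \<in> sets ?M" .
qed

lemma borel_measurable_weighted_AE_limit:
  fixes f :: "complex ^ 'n \<Rightarrow> 'b::metric_space"
  assumes \<alpha>: "\<alpha> > -1" and s: "\<And>i. s i \<in> borel_measurable (weighted_measure \<alpha>)"
    and lim: "AE z in weighted_measure \<alpha>. (\<lambda>i::nat. s i z) \<longlonglongrightarrow> f z"
  shows "f \<in> borel_measurable (weighted_measure \<alpha>)"
proof -
  let ?M = "weighted_measure \<alpha> :: (complex ^ 'n) measure"
  let ?D = "{z \<in> ball 0 1. \<not> (\<lambda>i::nat. s i z) \<longlonglongrightarrow> f z}"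
  \<comment> \<open>An arbitrary value, used to overwrite both f and the approximants on the
    exceptional set.\<close>
  obtain c :: 'b where True by simp
  have D: "?D \<in> sets ?M" by (rule weighted_complete[OF \<alpha>]) (use lim in \<open>auto elim!: eventually_mono\<close>)
  have "(\<lambda>z. if z \<in> ?D then c else f z) \<in> borel_measurable ?M"
  proof (rule borel_measurable_LIMSEQ_metric[where f = "\<lambda>i z. if z \<in> ?D then c else s i z"])
    show "(\<lambda>z. if z \<in> ?D then c else s i z) \<in> borel_measurable ?M" for i
      using s by (intro measurable_If_set) (simp_all only: sets.Int_space_eq2[OF D] D, auto)
  qed auto
  then show ?thesis
    by (rule measurable_weighted_AE_cong[OF \<alpha>]) (use lim in \<open>auto elim!: eventually_mono\<close>)
qed

text \<open>The integral identity is known for Borel functions only, while the measure lives on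
  Lebesgue sets. A Lebesgue set is a Borel set up to a null part, so what must be shown is that T
  pulls null sets back to null sets; the identity itself yields this when applied to indicators of
  Borel null sets.\<close>

lemma distr_weighted:
  fixes T :: "complex ^ 'n \<Rightarrow> complex ^ 'n"
  assumes \<alpha>: "\<alpha> > -1" and T [measurable]: "T \<in> borel_measurable borel" and k [measurable]: "k \<in> borel_measurable borel"
    and ball: "\<And>z. norm z < 1 \<Longrightarrow> norm (T z) < 1"
    and eq: "\<And>F. F \<in> borel_measurable borel \<Longrightarrow> (\<integral>\<^sup>+z. F (T z) \<partial>weighted_measure \<alpha>) = (\<integral>\<^sup>+z. k z * F z \<partial>weighted_measure \<alpha>)"
  shows "T \<in> measurable (weighted_measure \<alpha>) (weighted_measure \<alpha>)"
    and "distr (weighted_measure \<alpha>) (weighted_measure \<alpha>) T = density (weighted_measure \<alpha>) k"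
proof -
  let ?M = "weighted_measure \<alpha> :: (complex ^ 'n) measure"
  have Tm: "T \<in> borel_measurable ?M" by (rule measurable_borel_weighted[OF T])
  have km: "k \<in> borel_measurable ?M" by (rule measurable_borel_weighted[OF k])
  have null: "AE z in ?M. T z \<notin> N" "AE z in ?M. z \<notin> N" if N: "N \<in> null_sets lborel" for N
  proof -
    have Nb [measurable]: "N \<in> sets borel" using N by auto
    show nN: "AE z in ?M. z \<notin> N"
      unfolding AE_weighted[OF \<alpha>] AE_ball_measure using AE_not_in[OF N] by eventually_elim simp
    have "(\<integral>\<^sup>+z. indicator N (T z) \<partial>?M) = (\<integral>\<^sup>+z. k z * indicator N z \<partial>?M)"
      by (rule eq) measurable
    also have "\<dots> = (\<integral>\<^sup>+z. 0 \<partial>?M)"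
      by (rule nn_integral_cong_AE) (use nN in eventually_elim, auto)
    finally have "(\<integral>\<^sup>+z. indicator N (T z) \<partial>?M) = 0" by simp
    then have "AE z in ?M. indicator N (T z) = (0::ennreal)"
      by (subst (asm) nn_integral_0_iff_AE) (auto intro!: measurable_compose[OF Tm])
    then show "AE z in ?M. T z \<notin> N" by eventually_elim (auto simp: indicator_def split: if_splits)
  qed
  have dec: "\<exists>S N. A = S \<union> N \<and> S \<in> sets borel \<and> (AE z in ?M. T z \<notin> N) \<and> (AE z in ?M. z \<notin> N)" if "A \<in> sets ?M" for A
  proof -
    have "A \<in> sets (completion lborel)" using that by (simp add: sets_weighted sets_ball_measure)
    then obtain S N N' where "A = S \<union> N" "N \<subseteq> N'" "N' \<in> null_sets lborel" "S \<in> sets lborel"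
      by (rule sets_completionE)
    moreover have "AE z in ?M. T z \<notin> N" using null(1)[OF \<open>N' \<in> _\<close>] by eventually_elim (use \<open>N \<subseteq> N'\<close> in auto)
    moreover have "AE z in ?M. z \<notin> N" using null(2)[OF \<open>N' \<in> _\<close>] by eventually_elim (use \<open>N \<subseteq> N'\<close> in auto)
    ultimately show ?thesis by (metis sets_lborel)
  qed
  show TM: "T \<in> measurable ?M ?M"
  proof (rule measurableI)
    fix A assume "A \<in> sets ?M"
    then obtain S N where SN: "A = S \<union> N" "S \<in> sets borel" "AE z in ?M. T z \<notin> N" using dec by blast
    have "T -` A \<inter> space ?M = (T -` S \<inter> space ?M) \<union> (T -` N \<inter> ball 0 1)" using SN by auto
    also have "\<dots> \<in> sets ?M"
      by (intro sets.Un measurable_sets[OF Tm] SN weighted_complete[OF \<alpha>]) (use SN(3) in \<open>auto elim!: eventually_mono\<close>)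
    finally show "T -` A \<inter> space ?M \<in> sets ?M" .
  qed (use ball in auto)
  show "distr ?M ?M T = density ?M k"
  proof (rule measure_eqI)
    fix A assume "A \<in> sets (distr ?M ?M T)"
    then have A: "A \<in> sets ?M" by simp
    then obtain S N where SN: "A = S \<union> N" "S \<in> sets borel" "AE z in ?M. T z \<notin> N" "AE z in ?M. z \<notin> N" using dec by blast
    have "emeasure (distr ?M ?M T) A = emeasure ?M (T -` A \<inter> space ?M)"
      by (rule emeasure_distr[OF TM A])
    also have "\<dots> = (\<integral>\<^sup>+z. indicator (T -` A \<inter> space ?M) z \<partial>?M)"
      by (rule nn_integral_indicator[symmetric]) (rule measurable_sets[OF TM A])
    also have "\<dots> = (\<integral>\<^sup>+z. indicator A (T z) \<partial>?M)"
      by (rule nn_integral_cong) (auto simp: indicator_def)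
    also have "\<dots> = (\<integral>\<^sup>+z. indicator S (T z) \<partial>?M)"
      by (rule nn_integral_cong_AE) (use SN(3) in eventually_elim, auto simp: SN(1) indicator_def)
    also have "\<dots> = (\<integral>\<^sup>+z. k z * indicator S z \<partial>?M)"
      using SN(2) by (intro eq) auto
    also have "\<dots> = (\<integral>\<^sup>+z. k z * indicator A z \<partial>?M)"
      by (rule nn_integral_cong_AE) (use SN(4) in eventually_elim, auto simp: SN(1) indicator_def)
    also have "\<dots> = emeasure (density ?M k) A" using A km by (simp add: emeasure_density)
    finally show "emeasure (distr ?M ?M T) A = emeasure (density ?M k) A" .
  qed simp
qed

section \<open>Kernels, and phi_a as a change of variables in nu_alpha\<close>

lemma cmod_bergman_kernel:
  "cmod (bergman_kernel \<alpha> z (w :: complex ^ 'n)) = cmod (1 - herm w z) powr - (real CARD('n) + 1 + \<alpha>)"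
  by (simp add: bergman_kernel_def norm_powr_real_powr')

lemma cmod_bergman_kernel_commute: "cmod (bergman_kernel \<alpha> z w) = cmod (bergman_kernel \<alpha> w z)"
  by (simp add: cmod_bergman_kernel cmod_1_minus_herm_commute)

lemma cnj_powr_real: "Re x > 0 \<Longrightarrow> cnj (x powr complex_of_real r) = cnj x powr complex_of_real r"
  by (subst cnj_powr) (auto simp: complex_nonpos_Reals_iff)

lemma cnj_bergman_kernel:
  assumes "norm z < 1" "norm w < 1"
  shows "cnj (bergman_kernel \<alpha> z w) = bergman_kernel \<alpha> w z"
proof -
  have "cnj (bergman_kernel \<alpha> z w) = cnj (1 - herm w z) powr (complex_of_real (- (real CARD('a) + 1 + \<alpha>)))"
    unfolding bergman_kernel_def using cnj_powr_real[OF Re_1_minus_herm[OF assms(2,1)], of "- (real CARD('a) + 1 + \<alpha>)"] by simp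
  then show ?thesis by (simp add: bergman_kernel_def herm_cnj)
qed

lemma normalized_kernel_sq:
  assumes "norm z < 1"
  shows "(cmod (normalized_kernel \<alpha> z (w :: complex ^ 'n)))\<^sup>2 =
    (1 - (norm z)\<^sup>2) powr (real CARD('n) + 1 + \<alpha>) * cmod (1 - herm w z) powr - (2 * (real CARD('n) + 1 + \<alpha>))"
proof -
  let ?c = "real CARD('n) + 1 + \<alpha>"
  have sq: "(x powr (?c / 2))\<^sup>2 = x powr ?c" "(x powr - ?c)\<^sup>2 = x powr - (2 * ?c)" for x :: real
    by (simp_all add: power2_eq_square algebra_simps flip: powr_add)
  show ?thesis
    unfolding normalized_kernel_def norm_mult cmod_bergman_kernel power_mult_distrib norm_of_real power2_abs sq ..
qed

lemma borel_measurable_normalized_kernel_sq: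
  "norm z < 1 \<Longrightarrow> (\<lambda>w. (cmod (normalized_kernel \<alpha> z w))\<^sup>2) \<in> borel_measurable borel"
  by (subst normalized_kernel_sq) measurable

text \<open>nu_alpha is the invariant measure times (1 - |z|^2)^(n+1+\<alpha>), and the identity for
  1 - |phi_a(z)|^2 turns the transformed weight into |k_a(z)|^2 times the original one.\<close>

lemma nn_integral_ball_aut:
  fixes F :: "complex ^ 'n \<Rightarrow> ennreal"
  assumes \<alpha>: "\<alpha> > -1" and a: "norm a < 1" and [measurable]: "F \<in> borel_measurable borel"
  shows "(\<integral>\<^sup>+z. F (ball_aut a z) \<partial>weighted_measure \<alpha>) =
    (\<integral>\<^sup>+z. ennreal ((cmod (normalized_kernel \<alpha> a z))\<^sup>2) * F z \<partial>weighted_measure \<alpha>)"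
proof -
  let ?c = "real CARD('n) + 1 + \<alpha>" and ?C = "norm_const TYPE('n) \<alpha>"
  \<comment> \<open>The weight is taken at phi_a(v), so that G(phi_a(z)) carries the weight at z
    itself.\<close>
  define G where "G v = indicator (ball 0 1) v * (F v * ennreal (?C * (1 - (norm (ball_aut a v))\<^sup>2) powr ?c))" for v
  have C: "?C > 0" by (rule weight_integral(1)[OF \<alpha>])
  have [measurable]: "G \<in> borel_measurable borel" unfolding G_def[abs_def] by measurable
  have [measurable]: "(\<lambda>z. ennreal ((cmod (normalized_kernel \<alpha> a z))\<^sup>2)) \<in> borel_measurable borel"
    using borel_measurable_normalized_kernel_sq[OF a] by measurable
  have split: "(1 - (norm z)\<^sup>2) powr ?c * (1 - (norm z)\<^sup>2) powr - (real CARD('n) + 1) = (1 - (norm z)\<^sup>2) powr \<alpha>" for z :: "complex ^ 'n"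
    by (subst powr_add[symmetric]) simp
  have "(\<integral>\<^sup>+z. F (ball_aut a z) \<partial>weighted_measure \<alpha>) =
     (\<integral>\<^sup>+z. indicator (ball 0 1) z * (F (ball_aut a z) * ennreal (?C * (1 - (norm z)\<^sup>2) powr \<alpha>)) \<partial>lborel)"
    by (rule nn_integral_weighted) measurable
  also have "\<dots> = (\<integral>\<^sup>+z. indicator (ball 0 1) z * G (ball_aut a z) * ennreal ((1 - (norm z)\<^sup>2) powr - (real CARD('n) + 1)) \<partial>lborel)"
  proof (rule nn_integral_cong)
    fix z :: "complex ^ 'n"
    show "indicator (ball 0 1) z * (F (ball_aut a z) * ennreal (?C * (1 - (norm z)\<^sup>2) powr \<alpha>)) =
       indicator (ball 0 1) z * G (ball_aut a z) * ennreal ((1 - (norm z)\<^sup>2) powr - (real CARD('n) + 1))"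
    proof (cases "norm z < 1")
      case True
      then show ?thesis
        using norm_ball_aut[OF a True] C unfolding split[symmetric, of z]
        by (simp add: G_def ball_aut_involution[OF a True] ennreal_mult mult.assoc)
    qed simp
  qed
  also have "\<dots> = (\<integral>\<^sup>+z. indicator (ball 0 1) z * G z * ennreal ((1 - (norm z)\<^sup>2) powr - (real CARD('n) + 1)) \<partial>lborel)"
    by (rule nn_integral_ball_aut_invariant[OF _ a]) measurable
  also have "\<dots> = (\<integral>\<^sup>+z. indicator (ball 0 1) z * (ennreal ((cmod (normalized_kernel \<alpha> a z))\<^sup>2) * F z * ennreal (?C * (1 - (norm z)\<^sup>2) powr \<alpha>)) \<partial>lborel)"
  proof (rule nn_integral_cong)
    fix z :: "complex ^ 'n"
    show "indicator (ball 0 1) z * G z * ennreal ((1 - (norm z)\<^sup>2) powr - (real CARD('n) + 1)) =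
       indicator (ball 0 1) z * (ennreal ((cmod (normalized_kernel \<alpha> a z))\<^sup>2) * F z * ennreal (?C * (1 - (norm z)\<^sup>2) powr \<alpha>))"
    proof (cases "norm z < 1")
      case z: True
      let ?x = "cmod (1 - herm z a)"
      have x: "?x > 0" using one_minus_herm_nz[OF z a] by simp
      have "(1 - (norm (ball_aut a z))\<^sup>2) powr ?c = (1 - (norm a)\<^sup>2) powr ?c * (1 - (norm z)\<^sup>2) powr ?c / (?x\<^sup>2) powr ?c"
        unfolding one_minus_norm2_ball_aut[OF a z]
        using one_minus_norm2_pos[OF a] one_minus_norm2_pos[OF z] x by (simp add: powr_divide powr_mult)
      also have "(?x\<^sup>2) powr ?c = ?x powr (2 * ?c)" using x by (simp add: powr_powr flip: powr_numeral)
      finally have "(1 - (norm (ball_aut a z))\<^sup>2) powr ?c = (cmod (normalized_kernel \<alpha> a z))\<^sup>2 * (1 - (norm z)\<^sup>2) powr ?c"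
        unfolding normalized_kernel_sq[OF a] powr_minus by (simp add: field_simps)
      then show ?thesis
        using z C unfolding split[symmetric, of z]
        by (simp add: G_def ennreal_mult mult_ac)
    qed simp
  qed
  also have "\<dots> = (\<integral>\<^sup>+z. ennreal ((cmod (normalized_kernel \<alpha> a z))\<^sup>2) * F z \<partial>weighted_measure \<alpha>)"
    by (rule nn_integral_weighted[symmetric]) measurable
  finally show ?thesis .
qed

lemma ball_aut_weighted:
  fixes a :: "complex ^ 'n"
  assumes \<alpha>: "\<alpha> > -1" and a: "norm a < 1"
  shows "ball_aut a \<in> measurable (weighted_measure \<alpha>) (weighted_measure \<alpha>)"
    "distr (weighted_measure \<alpha>) (weighted_measure \<alpha>) (ball_aut a) =
      density (weighted_measure \<alpha>) (\<lambda>w. ennreal ((cmod (normalized_kernel \<alpha> a w))\<^sup>2))"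
proof -
  note k = measurable_compose[OF borel_measurable_normalized_kernel_sq[OF a] measurable_ennreal]
  show "ball_aut a \<in> measurable (weighted_measure \<alpha>) (weighted_measure \<alpha>)"
    by (rule distr_weighted(1)[OF \<alpha> _ k _ nn_integral_ball_aut[OF \<alpha> a]]) (auto intro: norm_ball_aut[OF a])
  show "distr (weighted_measure \<alpha>) (weighted_measure \<alpha>) (ball_aut a) =
      density (weighted_measure \<alpha>) (\<lambda>w. ennreal ((cmod (normalized_kernel \<alpha> a w))\<^sup>2))"
    by (rule distr_weighted(2)[OF \<alpha> _ k _ nn_integral_ball_aut[OF \<alpha> a]]) (auto intro: norm_ball_aut[OF a])
qed

lemma phase_weighted:
  assumes \<alpha>: "\<alpha> > -1" and u: "cmod u = 1"
  shows "(\<lambda>z :: complex ^ 'n. u *s z) \<in> measurable (weighted_measure \<alpha>) (weighted_measure \<alpha>)"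
    "distr (weighted_measure \<alpha>) (weighted_measure \<alpha>) (\<lambda>z :: complex ^ 'n. u *s z) = weighted_measure \<alpha>"
proof -
  have eq: "(\<integral>\<^sup>+z. F (u *s z) \<partial>weighted_measure \<alpha>) = (\<integral>\<^sup>+z. 1 * F z \<partial>weighted_measure \<alpha>)"
    if [measurable]: "F \<in> borel_measurable borel" for F :: "complex ^ 'n \<Rightarrow> ennreal"
  proof -
    let ?G = "\<lambda>z :: complex ^ 'n. indicator (ball 0 1) z * (F z * ennreal (norm_const TYPE('n) \<alpha> * (1 - (norm z)\<^sup>2) powr \<alpha>))"
    have Gm: "?G \<in> borel_measurable borel" by measurable
    have "(\<integral>\<^sup>+z. F z \<partial>weighted_measure \<alpha>) = (\<integral>\<^sup>+z. ?G z \<partial>distr lborel borel ((*s) u))"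
      by (simp add: nn_integral_weighted distr_lborel_phase[OF u])
    also have "\<dots> = (\<integral>\<^sup>+z. ?G (u *s z) \<partial>lborel)" using Gm by (intro nn_integral_distr) (simp_all, measurable)
    also have "\<dots> = (\<integral>\<^sup>+z. indicator (ball 0 1) z * (F (u *s z) * ennreal (norm_const TYPE('n) \<alpha> * (1 - (norm z)\<^sup>2) powr \<alpha>)) \<partial>lborel)"
      by (rule nn_integral_cong) (simp add: norm_scale_vec u indicator_def)
    also have "\<dots> = (\<integral>\<^sup>+z. F (u *s z) \<partial>weighted_measure \<alpha>)"
      by (rule nn_integral_weighted[symmetric]) measurable
    finally show ?thesis by simp
  qed
  show "(\<lambda>z :: complex ^ 'n. u *s z) \<in> measurable (weighted_measure \<alpha>) (weighted_measure \<alpha>)"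
    by (rule distr_weighted(1)[OF \<alpha> _ _ _ eq]) (auto simp: norm_scale_vec u)
  have "distr (weighted_measure \<alpha>) (weighted_measure \<alpha>) (\<lambda>z :: complex ^ 'n. u *s z) = density (weighted_measure \<alpha>) (\<lambda>_. 1)"
    by (rule distr_weighted(2)[OF \<alpha> _ _ _ eq]) (auto simp: norm_scale_vec u)
  then show "distr (weighted_measure \<alpha>) (weighted_measure \<alpha>) (\<lambda>z :: complex ^ 'n. u *s z) = weighted_measure \<alpha>"
    by (simp add: density_1)
qed

section \<open>Mean value property\<close>

lemma circle_mean_value:
  assumes f: "f holomorphic_on cball 0 1"
  shows "(LINT x|lborel. indicator {0..1} x *\<^sub>R f (exp (2 * of_real pi * \<i> * of_real x))) = f 0"
proof -
  let ?g = "\<lambda>x::real. f (exp (2 * of_real pi * \<i> * of_real x))"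
  have "((\<lambda>u. f u / (u - 0)) has_contour_integral (2 * of_real pi * \<i> * f 0)) (circlepath 0 1)"
    by (rule Cauchy_integral_circlepath_simple[OF f]) simp
  then have "((\<lambda>x. ?g x * (2 * of_real pi * \<i>)) has_integral (2 * of_real pi * \<i> * f 0)) {0..1}"
    unfolding has_contour_integral_def
    by (rule has_integral_spike_finite[of "{}", rotated 2])
       (auto simp: vector_derivative_circlepath01, simp add: circlepath)
  then have "((\<lambda>x. ?g x * (2 * of_real pi * \<i>) * (1 / (2 * of_real pi * \<i>))) has_integral (2 * of_real pi * \<i> * f 0) * (1 / (2 * of_real pi * \<i>))) {0..1}"
    by (rule has_integral_mult_left)
  then have *: "(?g has_integral f 0) {0..1}" by simp
  have "continuous_on {0..1} ?g"
    by (rule continuous_on_compose2[OF holomorphic_on_imp_continuous_on[OF f]]) (auto intro!: continuous_intros simp: norm_exp_eq_Re)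
  then have "set_integrable lborel {0..1} ?g" by (rule borel_integrable_atLeastAtMost')
  from set_borel_integral_eq_integral(2)[OF this] * show ?thesis
    by (simp add: set_lebesgue_integral_def integral_unique)
qed

text \<open>The measure is invariant under z -> e^(2 pi i x) z, so the integral may be averaged over
  x. By Fubini the average is taken first, and on each circle it equals f(0) by Cauchy's
  formula.\<close>

lemma integral_weighted_mean_value:
  fixes f :: "complex ^ 'n \<Rightarrow> complex"
  assumes \<alpha>: "\<alpha> > -1" and int: "integrable (weighted_measure \<alpha>) f"
    and cont: "continuous_on (ball 0 1) f"
    and hol: "\<And>w. norm w < 1 \<Longrightarrow> (\<lambda>l. f (l *s w)) holomorphic_on cball 0 1"
  shows "(LINT w|weighted_measure \<alpha>. f w) = f 0"
proof -
  let ?M = "weighted_measure \<alpha> :: (complex ^ 'n) measure"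
  interpret M: finite_measure ?M by (rule finite_measure_weighted[OF \<alpha>])
  interpret P: pair_sigma_finite ?M "lborel :: real measure" by unfold_locales
  \<comment> \<open>Extension by 0 makes the function Borel on all of C^n, which gives joint
    measurability of (w,x) -> g(e^(2 pi i x) w).\<close>
  define g where "g w = (if w \<in> ball 0 1 then f w else 0)" for w
  let ?e = "\<lambda>x::real. exp (2 * of_real pi * \<i> * of_real x)"
  have e: "cmod (?e x) = 1" for x by (simp add: norm_exp_eq_Re)
  have g [measurable]: "g \<in> borel_measurable borel"
    unfolding g_def[abs_def] using cont by (intro borel_measurable_continuous_on_if) auto
  have gM: "g \<in> borel_measurable ?M" by (rule measurable_borel_weighted[OF g])
  have intg: "integrable ?M g"
    using int by (subst (asm) Bochner_Integration.integrable_cong[of ?M ?M f g]) (auto simp: g_def)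
  let ?h = "\<lambda>(w, x::real). indicator {0..1} x *\<^sub>R g (?e x *s w)"
  have [measurable]: "?e \<in> borel_measurable borel" by measurable
  have hm [measurable]: "?h \<in> borel_measurable (?M \<Otimes>\<^sub>M lborel)" by measurable
  have rot: "integrable ?M (\<lambda>w. g (u *s w))" "(LINT w|?M. g (u *s w)) = (LINT w|?M. g w)"
     "(\<integral>\<^sup>+w. norm (g (u *s w)) \<partial>?M) = (\<integral>\<^sup>+w. norm (g w) \<partial>?M)" if "cmod u = 1" for u
  proof -
    note d = phase_weighted[OF \<alpha> that]
    show "integrable ?M (\<lambda>w. g (u *s w))" using integrable_distr_eq[OF d(1) gM] intg by (simp add: d(2))
    show "(LINT w|?M. g (u *s w)) = (LINT w|?M. g w)" using integral_distr[OF d(1) gM] by (simp add: d(2))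
    show "(\<integral>\<^sup>+w. norm (g (u *s w)) \<partial>?M) = (\<integral>\<^sup>+w. norm (g w) \<partial>?M)"
      using nn_integral_distr[OF d(1), of "\<lambda>w. norm (g w)"] gM by (simp add: d(2))
  qed
  have inth: "integrable (?M \<Otimes>\<^sub>M lborel) ?h"
  proof (rule integrableI_bounded)
    have "(\<integral>\<^sup>+p. norm (?h p) \<partial>(?M \<Otimes>\<^sub>M lborel)) = (\<integral>\<^sup>+x. \<integral>\<^sup>+w. norm (?h (w, x)) \<partial>?M \<partial>lborel)"
      by (rule P.nn_integral_snd[symmetric]) measurable
    also have "\<dots> = (\<integral>\<^sup>+x. indicator {0..1::real} x * (\<integral>\<^sup>+w. norm (g w) \<partial>?M) \<partial>lborel)"
    proof (rule nn_integral_cong)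
      fix x :: real
      show "(\<integral>\<^sup>+w. norm (?h (w, x)) \<partial>?M) = indicator {0..1} x * (\<integral>\<^sup>+w. norm (g w) \<partial>?M)"
        using rot(3)[OF e[of x]] by (auto simp: indicator_def)
    qed
    also have "\<dots> = (\<integral>\<^sup>+w. norm (g w) \<partial>?M)" by (subst nn_integral_multc) auto
    also have "\<dots> < \<infinity>" using intg by (simp add: integrable_iff_bounded)
    finally show "(\<integral>\<^sup>+p. norm (?h p) \<partial>(?M \<Otimes>\<^sub>M lborel)) < \<infinity>" .
  qed fact
  have "(LINT x|lborel. LINT w|?M. ?h (w, x)) = (LINT w|?M. LINT x|lborel. ?h (w, x))"
    using P.Fubini_integral[of "\<lambda>w x. ?h (w, x)"] inth by simp
  also have "(LINT x|lborel. LINT w|?M. ?h (w, x)) = (LINT x|lborel. indicator {0..1} (x::real) *\<^sub>R (LINT w|?M. g w))"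
    using rot(2)[OF e] by (intro Bochner_Integration.integral_cong) auto
  also have "\<dots> = (LINT w|?M. g w)" by simp
  also have "(LINT w|?M. LINT x|lborel. ?h (w, x)) = (LINT w|?M. f 0)"
  proof (rule Bochner_Integration.integral_cong)
    fix w assume "w \<in> space ?M"
    then have w: "norm w < 1" by simp
    have "g (?e x *s w) = f (?e x *s w)" for x using w by (simp add: g_def norm_scale_vec e)
    then show "(LINT x|lborel. ?h (w, x)) = f 0"
      using circle_mean_value[OF hol[OF w]] by simp
  qed simp
  also have "(LINT w|?M. f 0) = f 0" using emeasure_weighted_space[OF \<alpha>, where 'n='n] by (simp add: measure_def)
  also have "(LINT w|?M. g w) = (LINT w|?M. f w)" by (rule Bochner_Integration.integral_cong) (auto simp: g_def)
  finally show ?thesis .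
qed

section \<open>The reproducing formula\<close>

definition complex_diff_on_ball :: "(complex ^ 'n \<Rightarrow> complex) \<Rightarrow> bool" where
  "complex_diff_on_ball f \<longleftrightarrow>
     (\<forall>z\<in>ball 0 1. \<exists>D. (f has_derivative D) (at z) \<and> (\<forall>c v. D (c *s v) = c * D v))"

lemma complex_diff_continuous_on: "complex_diff_on_ball f \<Longrightarrow> continuous_on (ball 0 1) f"
  unfolding complex_diff_on_ball_def
  by (metis continuous_at_imp_continuous_on has_derivative_continuous)

lemma has_derivative_vec_componentwise:
  fixes g :: "'a::real_normed_vector \<Rightarrow> complex ^ 'n"
  assumes "\<And>i. ((\<lambda>x. g x $ i) has_derivative (\<lambda>h. G h $ i)) F"
  shows "(g has_derivative G) F"
proof -
  have bl: "bounded_linear (\<lambda>x. axis i x :: complex ^ 'n)" for i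
    unfolding linear_conv_bounded_linear[symmetric] by (rule linearI) (auto simp: axis_def vec_eq_iff)
  have "((\<lambda>x. \<Sum>i\<in>UNIV. axis i (g x $ i)) has_derivative (\<lambda>h. \<Sum>i\<in>UNIV. axis i (G h $ i))) F"
    by (intro has_derivative_sum bounded_linear.has_derivative[OF bl] assms)
  moreover have "(\<Sum>i\<in>UNIV. axis i (x $ i)) = x" for x :: "complex ^ 'n"
    by (simp add: vec_eq_iff axis_def if_distrib cong: if_cong)
  ultimately show ?thesis by simp
qed

text \<open>Only the slices l -> l w enter the mean value property; along such a slice every
  component of phi_a is a quotient of two affine functions of l.\<close>

lemma ball_aut_slice_derivative:
  fixes a w :: "complex ^ 'n"
  assumes a: "norm a < 1" and w: "norm (l *s w) < 1"
  shows "\<exists>v. ((\<lambda>l. ball_aut a (l *s w)) has_derivative (\<lambda>h. h *s v)) (at l)"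
proof -
  let ?b = "aut_lin a w" and ?t = "herm w a"
  have nz: "1 - l * ?t \<noteq> 0" using one_minus_herm_nz[OF w a] by (simp add: herm_lin)
  have eq: "ball_aut a (l *s w) $ i = (a $ i - l * ?b $ i) / (1 - l * ?t)" for l i
    by (simp add: ball_aut_altdef aut_lin_lin(2)[OF a] herm_lin diff_divide_distrib)
  let ?v = "\<chi> i. (- ?b $ i * (1 - l * ?t) + (a $ i - l * ?b $ i) * ?t) / (1 - l * ?t)\<^sup>2"
  have "((\<lambda>l. ball_aut a (l *s w)) has_derivative (\<lambda>h. h *s ?v)) (at l)"
  proof (rule has_derivative_vec_componentwise)
    fix i
    have "((\<lambda>l. (a $ i - l * ?b $ i) / (1 - l * ?t)) has_field_derivative ?v $ i) (at l)"
      using nz by (auto intro!: derivative_eq_intros simp: power2_eq_square field_simps)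
    then show "((\<lambda>l. ball_aut a (l *s w) $ i) has_derivative (\<lambda>h. (h *s ?v) $ i)) (at l)"
      unfolding eq has_field_derivative_def vector_smult_component mult_commute_abs .
  qed
  then show ?thesis by blast
qed

text \<open>With s = 1 - |z|^2, x = 1 - <v,z> and c = n + 1 + \<alpha>, the first factor is
  (s/x)^(-c) and |k_z(v)|^2 = s^c |x|^(-2c), so the product is cnj(x)^(-c). Since Re x > 0,
  principal logarithms add and the powers can be compared through exponents.\<close>

lemma bergman_kernel_factor:
  assumes z: "norm z < 1" and v: "norm v < 1"
  shows "(1 - herm (ball_aut z v) z) powr (- complex_of_real (real CARD('n) + 1 + \<alpha>)) *
     complex_of_real ((cmod (normalized_kernel \<alpha> z (v :: complex ^ 'n)))\<^sup>2) = cnj (bergman_kernel \<alpha> z v)"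
proof -
  let ?c = "real CARD('n) + 1 + \<alpha>"
  define x s where "x = 1 - herm v z" and "s = 1 - (norm z)\<^sup>2"
  have s: "s > 0" using one_minus_norm2_pos[OF z] by (simp add: s_def)
  have x: "Re x > 0" "x \<noteq> 0" unfolding x_def using Re_1_minus_herm[OF v z] by auto
  have cx: "complex_of_real (cmod x powr r) = exp (complex_of_real (r * Re (Ln x)))" for r
    using x by (simp add: powr_def exp_of_real[symmetric])
  have "(1 - herm (ball_aut z v) z) powr (- complex_of_real ?c) = (complex_of_real s / x) powr (- complex_of_real ?c)"
    unfolding one_minus_herm_ball_aut_center[OF z v] x_def s_def ..
  also have "\<dots> = exp (- complex_of_real ?c * (of_real (ln s) - Ln x))"
  proof -
    have "Ln (complex_of_real s / x) = of_real (ln s) + Ln (1 / x)"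
      using Ln_times_of_real[OF s, of "1/x"] x s by (simp add: Ln_of_real)
    also have "Ln (1 / x) = - Ln x"
      using x by (simp add: Ln_inverse complex_nonpos_Reals_iff flip: inverse_eq_divide)
    finally show ?thesis using x s by (simp add: powr_def)
  qed
  finally have 1: "(1 - herm (ball_aut z v) z) powr (- complex_of_real ?c) = exp (- complex_of_real ?c * (of_real (ln s) - Ln x))" .
  have 2: "complex_of_real ((cmod (normalized_kernel \<alpha> z v))\<^sup>2) = exp (complex_of_real ?c * of_real (ln s) + complex_of_real (- (2 * ?c) * Re (Ln x)))"
    unfolding normalized_kernel_sq[OF z] x_def[symmetric] s_def[symmetric] of_real_mult cx exp_add
    using s by (simp add: powr_def exp_of_real[symmetric])
  have 3: "cnj (bergman_kernel \<alpha> z v) = exp (- complex_of_real ?c * cnj (Ln x))"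
    using x by (simp add: bergman_kernel_def powr_def exp_cnj flip: x_def)
  have "cnj (Ln x) = complex_of_real (2 * Re (Ln x)) - Ln x" by (simp add: complex_eq_iff)
  then have "- complex_of_real ?c * (of_real (ln s) - Ln x) + (complex_of_real ?c * of_real (ln s) + complex_of_real (- (2 * ?c) * Re (Ln x)))
     = - complex_of_real ?c * cnj (Ln x)"
    by (simp only: of_real_mult of_real_minus) (simp add: algebra_simps)
  then show ?thesis unfolding 1 2 3 exp_add[symmetric] by simp
qed

lemma continuous_on_bergman_kernel:
  "norm z < 1 \<Longrightarrow> continuous_on (ball 0 1) (\<lambda>w. bergman_kernel \<alpha> z w)"
proof -
  assume z: "norm z < 1"
  have "continuous_on (ball 0 1) (\<lambda>w. exp (- complex_of_real (real CARD('a) + 1 + \<alpha>) * Ln (1 - herm w z)))"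
    using Re_1_minus_herm[OF _ z] unfolding herm_def
    by (intro continuous_intros) (fastforce simp: complex_nonpos_Reals_iff)
  then show ?thesis
    by (rule continuous_on_eq) (use one_minus_herm_nz[OF _ z] in \<open>auto simp: bergman_kernel_def powr_def\<close>)
qed

lemma borel_measurable_cnj_fun: "f \<in> borel_measurable M \<Longrightarrow> (\<lambda>x. cnj (f x)) \<in> borel_measurable M"
  by (rule measurable_compose[of f M borel cnj borel]) (auto intro: borel_measurable_continuous_onI continuous_intros)

lemma borel_measurable_bergman_kernel:
  "norm z < 1 \<Longrightarrow> bergman_kernel \<alpha> z \<in> borel_measurable (weighted_measure \<alpha>')"
  by (rule continuous_on_imp_measurable_weighted[OF continuous_on_bergman_kernel])

text \<open>The lower bound lets finiteness of one integral against |K_z| imply finiteness of the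
  unweighted integral.\<close>

lemma bergman_kernel_bound:
  fixes z w :: "complex ^ 'n"
  assumes \<alpha>: "\<alpha> > -1" and z: "norm z < 1" and w: "norm w < 1"
  shows "cmod (bergman_kernel \<alpha> z w) \<le> (1 - norm z) powr - (real CARD('n) + 1 + \<alpha>)"
    "2 powr - (real CARD('n) + 1 + \<alpha>) \<le> cmod (bergman_kernel \<alpha> z w)"
proof -
  have 1: "1 - norm z \<le> cmod (1 - herm w z)"
    unfolding cmod_1_minus_herm_commute[of w z] by (rule cmod_1_minus_herm_ge[OF w])
  then show "cmod (bergman_kernel \<alpha> z w) \<le> (1 - norm z) powr - (real CARD('n) + 1 + \<alpha>)"
    unfolding cmod_bergman_kernel using \<alpha> z by (intro powr_mono2') auto
  show "2 powr - (real CARD('n) + 1 + \<alpha>) \<le> cmod (bergman_kernel \<alpha> z w)"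
    unfolding cmod_bergman_kernel using \<alpha> cmod_1_minus_herm_le[OF w z] 1 z by (intro powr_mono2') auto
qed

lemma integrable_mult_bergman_kernel:
  fixes f :: "complex ^ 'n \<Rightarrow> complex"
  assumes \<alpha>: "\<alpha> > -1" and int: "integrable (weighted_measure \<alpha>) f" and z: "norm z < 1"
  shows "integrable (weighted_measure \<alpha>) (\<lambda>w. f w * cnj (bergman_kernel \<alpha> z w))"
proof (rule Bochner_Integration.integrable_bound)
  let ?B = "(1 - norm z) powr - (real CARD('n) + 1 + \<alpha>)"
  show "integrable (weighted_measure \<alpha>) (\<lambda>w. ?B * norm (f w))" using int by simp
  show "(\<lambda>w. f w * cnj (bergman_kernel \<alpha> z w)) \<in> borel_measurable (weighted_measure \<alpha>)"
    using int borel_measurable_bergman_kernel[OF z]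
    by (intro borel_measurable_times borel_measurable_integrable[OF int] borel_measurable_cnj_fun)
  show "AE w in weighted_measure \<alpha>. norm (f w * cnj (bergman_kernel \<alpha> z w)) \<le> norm (?B * norm (f w))"
    using bergman_kernel_bound(1)[OF \<alpha> z] by (intro AE_I2) (simp add: norm_mult mult.commute mult_left_mono abs_mult)
qed

text \<open>The mean value property is applied to F(w) = f(phi_z(w)) (1 - <w,z>)^(-c), for which
  F(0) = f(z). The change of variables w = phi_z(v) turns the mean of F into the integral of f
  against cnj(K_z), by \<open>bergman_kernel_factor\<close>.\<close>

theorem bergman_reproducing:
  fixes f :: "complex ^ 'n \<Rightarrow> complex"
  assumes \<alpha>: "\<alpha> > -1" and hol: "complex_diff_on_ball f"
    and int: "integrable (weighted_measure \<alpha>) f" and z: "norm z < 1"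
  shows "(LINT w|weighted_measure \<alpha>. f w * cnj (bergman_kernel \<alpha> z w)) = f z"
proof -
  let ?M = "weighted_measure \<alpha> :: (complex ^ 'n) measure"
  let ?c = "complex_of_real (real CARD('n) + 1 + \<alpha>)"
  define F where "F w = f (ball_aut z w) * (1 - herm w z) powr (- ?c)" for w
  define G where "G v = f v * (1 - herm (ball_aut z v) z) powr (- ?c)" for v
  note d = ball_aut_weighted[OF \<alpha> z]
  have FG: "F w = G (ball_aut z w)" if "w \<in> space ?M" for w
    using that by (simp add: F_def G_def ball_aut_involution[OF z])
  have fc: "continuous_on (ball 0 1) f" by (rule complex_diff_continuous_on[OF hol])
  have bc: "continuous_on (ball 0 1) (ball_aut z)"
    unfolding ball_aut_altdef[abs_def] aut_lin_def herm_def vector_scalar_mult_def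
    by (intro continuous_intros) (use one_minus_herm_nz[OF _ z] in \<open>auto simp: herm_def\<close>)
  have kc: "continuous_on (ball 0 1) (\<lambda>w. (1 - herm w z) powr (- ?c))"
    using continuous_on_bergman_kernel[OF z, of \<alpha>] by (simp add: bergman_kernel_def)
  have bb: "ball_aut z ` ball 0 1 \<subseteq> ball 0 1" using norm_ball_aut[OF z] by auto
  have Fc: "continuous_on (ball 0 1) F"
    unfolding F_def by (intro continuous_on_mult kc continuous_on_compose2[OF fc bc bb])
  have Gc: "continuous_on (ball 0 1) G"
    unfolding G_def by (intro continuous_on_mult fc continuous_on_compose2[OF kc bc bb])
  have Gm: "G \<in> borel_measurable ?M" by (rule continuous_on_imp_measurable_weighted[OF Gc])
  have km: "(\<lambda>w. (cmod (normalized_kernel \<alpha> z w))\<^sup>2) \<in> borel_measurable ?M"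
    by (rule measurable_borel_weighted[OF borel_measurable_normalized_kernel_sq[OF z]])
  have kG: "(cmod (normalized_kernel \<alpha> z v))\<^sup>2 *\<^sub>R G v = f v * cnj (bergman_kernel \<alpha> z v)" if "v \<in> space ?M" for v
    using bergman_kernel_factor[OF z, of v \<alpha>] that by (simp add: G_def scaleR_conv_of_real mult_ac)
  have "integrable ?M (\<lambda>v. (cmod (normalized_kernel \<alpha> z v))\<^sup>2 *\<^sub>R G v)"
    by (subst Bochner_Integration.integrable_cong[OF refl kG]) (auto intro: integrable_mult_bergman_kernel[OF \<alpha> int z])
  then have "integrable (distr ?M ?M (ball_aut z)) G"
    unfolding d(2) by (subst integrable_density[OF Gm km]) auto
  then have Fi: "integrable ?M F"
    by (subst Bochner_Integration.integrable_cong[OF refl FG]) (simp_all add: integrable_distr_eq[OF d(1) Gm])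
  have "(LINT w|?M. f w * cnj (bergman_kernel \<alpha> z w)) = (LINT v|?M. (cmod (normalized_kernel \<alpha> z v))\<^sup>2 *\<^sub>R G v)"
    by (rule Bochner_Integration.integral_cong[OF refl kG[symmetric]])
  also have "\<dots> = (LINT v|distr ?M ?M (ball_aut z). G v)"
    unfolding d(2) by (rule integral_density[OF Gm km, symmetric]) auto
  also have "\<dots> = (LINT w|?M. F w)"
    by (subst integral_distr[OF d(1) Gm]) (rule Bochner_Integration.integral_cong[OF refl FG[symmetric]])
  also have "\<dots> = F 0"
  proof (rule integral_weighted_mean_value[OF \<alpha> Fi Fc])
    fix w :: "complex ^ 'n" assume w: "norm w < 1"
    show "(\<lambda>l. F (l *s w)) holomorphic_on cball 0 1"
    proof (rule holomorphic_onI)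
      fix l :: complex assume "l \<in> cball 0 1"
      then have lw: "norm (l *s w) < 1" using w unfolding norm_scale_vec
        by (smt (verit) mem_cball_0 mult_left_le_one_le norm_ge_zero)
      obtain v where v: "((\<lambda>l. ball_aut z (l *s w)) has_derivative (\<lambda>h. h *s v)) (at l)"
        using ball_aut_slice_derivative[OF z lw] by blast
      have bl: "ball_aut z (l *s w) \<in> ball 0 1" using norm_ball_aut[OF z lw] by simp
      obtain D where D: "(f has_derivative D) (at (ball_aut z (l *s w)))" "\<And>c v. D (c *s v) = c * D v"
        using hol bl unfolding complex_diff_on_ball_def by blast
      have "((\<lambda>l. f (ball_aut z (l *s w))) has_derivative (\<lambda>h. D (h *s v))) (at l)"
        by (rule has_derivative_compose[OF v D(1)])
      then have 1: "((\<lambda>l. f (ball_aut z (l *s w))) has_field_derivative D v) (at l)"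
        unfolding has_field_derivative_def D(2) mult_commute_abs .
      have "1 - l * herm w z \<notin> \<real>\<^sub>\<le>\<^sub>0"
        using Re_1_minus_herm[OF lw z] by (auto simp: herm_lin complex_nonpos_Reals_iff)
      then have 2: "(\<lambda>l. (1 - l * herm w z) powr (- ?c)) field_differentiable at l"
        unfolding field_differentiable_def by (intro exI) (auto intro!: derivative_eq_intros)
      show "(\<lambda>l. F (l *s w)) field_differentiable at l within cball 0 1"
        unfolding F_def herm_scale_left
        by (rule field_differentiable_at_within[OF field_differentiable_mult[OF _ 2]])
           (unfold field_differentiable_def, rule exI, rule 1)
    qed
  qed
  also have "F 0 = f z" by (simp add: F_def ball_aut_0)
  finally show ?thesis .
qed

section \<open>Forelli-Rudin estimates and the Schur test\<close>

text \<open>The Taylor coefficients of (1 - x)^(-r), written with Pochhammer symbols so that they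
  are visibly positive for r > 0.\<close>

definition binom_coeff :: "real \<Rightarrow> nat \<Rightarrow> real" where
  "binom_coeff r k = pochhammer r k / fact k"

lemma binom_coeff_pos: "r > 0 \<Longrightarrow> binom_coeff r k > 0"
  by (simp add: binom_coeff_def pochhammer_pos)

lemma binom_coeff_Suc: "binom_coeff r (Suc k) = binom_coeff r k * ((r + real k) / (real k + 1))"
  by (simp add: binom_coeff_def pochhammer_Suc field_simps)

lemma binom_coeff_sums:
  fixes x :: complex
  assumes "cmod x < 1"
  shows "(\<lambda>k. complex_of_real (binom_coeff r k) * x ^ k) sums ((1 - x) powr (- complex_of_real r))"
proof -
  have "(\<lambda>n. ((- complex_of_real r) gchoose n) * (- x) ^ n) sums (1 + - x) powr (- complex_of_real r)"
    using assms by (intro gen_binomial_complex) simp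
  moreover have "((- complex_of_real r) gchoose n) * (- x) ^ n = complex_of_real (binom_coeff r n) * x ^ n" for n
  proof -
    have "((-1) ^ n * (-1) ^ n :: complex) = 1" by (simp flip: power_mult_distrib)
    then have "((-1) ^ n * p) * ((-1) ^ n * q) = p * q" for p q :: complex by (metis mult.assoc mult.left_commute mult_1)
    then show ?thesis
      unfolding gbinomial_pochhammer power_minus[of x n]
      by (simp add: binom_coeff_def pochhammer_of_real)
  qed
  ultimately show ?thesis by simp
qed

text \<open>The terms decay like k^(2b-1-c). Raabe's test detects this through the limit 1 + c - 2b,
  which exceeds 1 exactly when 2b < c.\<close>

lemma binom_coeff_ratio_summable:
  assumes b: "b > 0" and c: "2 * b < c"
  shows "summable (\<lambda>k. (binom_coeff b k)\<^sup>2 / binom_coeff c k)"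
proof (rule raabes_test_convergence)
  let ?f = "\<lambda>k. (binom_coeff b k)\<^sup>2 / binom_coeff c k"
  have pos: "binom_coeff b k > 0" "binom_coeff c k > 0" for k using binom_coeff_pos[of b] binom_coeff_pos[of c] b c by auto
  show "eventually (\<lambda>n. ?f n > 0) sequentially" by (intro always_eventually allI divide_pos_pos zero_less_power pos)
  have ratio: "?f n / ?f (Suc n) = ((real n + 1) * (c + real n)) / (b + real n)\<^sup>2" for n
  proof -
    have "(P\<^sup>2 / Q) / ((P * (x / m))\<^sup>2 / (Q * (y / m))) = m * y / x\<^sup>2"
      if "P > 0" "Q > 0" "m > 0" "x > 0" "y > 0" for P Q x y m :: real
      using that by (simp add: field_simps power2_eq_square)
    from this[OF pos(1)[of n] pos(2)[of n], of "real n + 1" "b + real n" "c + real n"] b c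
    show ?thesis unfolding binom_coeff_Suc by (simp add: add.commute)
  qed
  have "(\<lambda>n. real n * (((real n + 1) * (c + real n)) / (b + real n)\<^sup>2 - 1)) \<longlonglongrightarrow> 1 + c - 2 * b"
    using b by real_asymp
  then have "(\<lambda>n. ereal (of_nat n * (?f n / ?f (Suc n) - 1))) \<longlonglongrightarrow> ereal (1 + c - 2 * b)"
    unfolding ratio by simp
  then have "liminf (\<lambda>n. ereal (of_nat n * (?f n / ?f (Suc n) - 1))) = ereal (1 + c - 2 * b)"
    by (intro lim_imp_Liminf) auto
  then show "1 < liminf (\<lambda>n. ereal (of_nat n * (?f n / ?f (Suc n) - 1)))" using c by simp
qed

section \<open>Moments of the linear form <u,z>\<close>

context
  fixes \<alpha> :: real and z :: "complex ^ 'n"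
  assumes \<alpha>: "\<alpha> > -1" and z: "norm z < 1"
begin

lemma herm_continuous: "continuous_on A (\<lambda>u. herm u z)"
  unfolding herm_def by (intro continuous_intros)

lemma integrable_weighted_bounded:
  fixes f :: "complex ^ 'n \<Rightarrow> 'b::{banach, second_countable_topology}"
  assumes "f \<in> borel_measurable (weighted_measure \<alpha>)" "\<And>u. norm u < 1 \<Longrightarrow> norm (f u) \<le> B"
  shows "integrable (weighted_measure \<alpha>) f"
  by (rule finite_measure.integrable_const_bound[OF finite_measure_weighted[OF \<alpha>], of _ B])
     (use assms in \<open>auto intro!: AE_I2\<close>)

lemma herm_power_le: "norm u < 1 \<Longrightarrow> cmod (herm u z ^ j * cnj (herm u z) ^ k) \<le> norm z ^ (j + k)"
proof -
  assume u: "norm u < 1"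
  have "cmod (herm u z) \<le> norm z" using norm_herm_le[of u z] u
    by (smt (verit) mult_left_le_one_le norm_ge_zero)
  then have "cmod (herm u z) ^ (j + k) \<le> norm z ^ (j + k)" by (intro power_mono) auto
  then show ?thesis by (simp add: norm_mult norm_power power_add)
qed

lemma herm_power_integrable: "integrable (weighted_measure \<alpha>) (\<lambda>u. herm u z ^ j * cnj (herm u z) ^ k)"
  by (rule integrable_weighted_bounded[OF continuous_on_imp_measurable_weighted herm_power_le])
     (auto intro!: continuous_intros herm_continuous)

definition moment :: "nat \<Rightarrow> real" where
  "moment k = (LINT u|weighted_measure \<alpha>. (cmod (herm u z)) ^ (2 * k))"

lemma herm_power_self: "herm u z ^ k * cnj (herm u z) ^ k = complex_of_real ((cmod (herm u z)) ^ (2 * k))"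
proof -
  have "herm u z ^ k * cnj (herm u z) ^ k = (herm u z * cnj (herm u z)) ^ k" by (simp add: power_mult_distrib)
  also have "\<dots> = (complex_of_real ((cmod (herm u z))\<^sup>2)) ^ k" by (simp only: complex_norm_square)
  finally show ?thesis by (simp add: power_mult)
qed

text \<open>For j \<noteq> k the rotation by the angle t = pi / (j - k) multiplies the integrand by
  e^(i(j-k)t) = -1 and preserves the measure, so the integral equals its own negative.\<close>

lemma herm_power_orthogonal:
  "(LINT u|weighted_measure \<alpha>. herm u z ^ j * cnj (herm u z) ^ k) = (if j = k then complex_of_real (moment k) else 0)"
proof (cases "j = k")
  case True
  then show ?thesis unfolding moment_def by (simp add: herm_power_self integral_complex_of_real del: of_real_power)
next
  case False
  let ?M = "weighted_measure \<alpha> :: (complex ^ 'n) measure"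
  let ?f = "\<lambda>u. herm u z ^ j * cnj (herm u z) ^ k"
  define t where "t = pi / (real j - real k)"
  have "?f (cis t *s u) = (cis (real j * t) * cis (- (real k * t))) * ?f u" for u
  proof -
    have "cis (real j * t) = cis t ^ j" by (rule Complex.DeMoivre[symmetric])
    moreover have "cis (- (real k * t)) = cnj (cis t) ^ k" by (simp add: Complex.DeMoivre cis_cnj)
    ultimately show ?thesis by (simp only: herm_scale_left complex_cnj_mult power_mult_distrib mult_ac)
  qed
  moreover have "cis (real j * t) * cis (- (real k * t)) = cis ((real j - real k) * t)"
    by (simp add: cis_mult left_diff_distrib)
  moreover have "(real j - real k) * t = pi" using False by (simp add: t_def)
  ultimately have f: "?f (cis t *s u) = - ?f u" for u by simp
  note d = phase_weighted[OF \<alpha>, of "cis t", where 'n='n, simplified]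
  have "(LINT u|?M. ?f u) = (LINT u|distr ?M ?M ((*s) (cis t)). ?f u)" by (simp add: d)
  also have "\<dots> = (LINT u|?M. ?f (cis t *s u))"
    by (rule integral_distr[OF d(1)]) (use herm_power_integrable[of j k] in auto)
  also have "\<dots> = - (LINT u|?M. ?f u)" unfolding f by simp
  finally show ?thesis using False by simp
qed

text \<open>Apply the reproducing formula to <.,z>^k at the point z itself and expand the kernel in
  powers of cnj <u,z>: orthogonality leaves only the k-th term, which contains the moment.\<close>

lemma moment_eq: "binom_coeff (real CARD('n) + 1 + \<alpha>) k * moment k = norm z ^ (2 * k)"
proof -
  let ?M = "weighted_measure \<alpha> :: (complex ^ 'n) measure"
  let ?A = "binom_coeff (real CARD('n) + 1 + \<alpha>)"
  have bl: "bounded_linear (\<lambda>u. herm u z)"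
    unfolding linear_conv_bounded_linear[symmetric] by (rule linearI) (simp_all add: herm_lin herm_scaleR_left)
  have hol: "complex_diff_on_ball (\<lambda>u. herm u z ^ k)"
    unfolding complex_diff_on_ball_def
  proof
    fix u :: "complex ^ 'n"
    have "((\<lambda>u. herm u z ^ k) has_derivative (\<lambda>v. of_nat k * herm v z * herm u z ^ (k - 1))) (at u)"
      by (rule has_derivative_power[OF bounded_linear_imp_has_derivative[OF bl]])
    then show "\<exists>D. ((\<lambda>u. herm u z ^ k) has_derivative D) (at u) \<and> (\<forall>c v. D (c *s v) = c * D v)"
      by (intro exI conjI) (auto simp: herm_lin mult_ac)
  qed
  have Apos: "?A j > 0" for j using \<alpha> by (intro binom_coeff_pos) auto
  let ?g = "\<lambda>j u. complex_of_real (?A j) * (herm u z ^ k * cnj (herm u z) ^ j)"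
  have ker: "(\<lambda>j. ?g j u) sums (herm u z ^ k * cnj (bergman_kernel \<alpha> z u))" if u: "norm u < 1" for u
  proof -
    have "(\<lambda>j. complex_of_real (?A j) * cnj (herm u z) ^ j) sums ((1 - cnj (herm u z)) powr (- complex_of_real (real CARD('n) + 1 + \<alpha>)))"
      using herm_lt_1[OF u z] by (intro binom_coeff_sums) simp
    also have "(1 - cnj (herm u z)) powr (- complex_of_real (real CARD('n) + 1 + \<alpha>)) = cnj (bergman_kernel \<alpha> z u)"
      unfolding cnj_bergman_kernel[OF z u] by (simp add: bergman_kernel_def herm_cnj)
    finally have A: "(\<lambda>j. complex_of_real (?A j) * cnj (herm u z) ^ j) sums cnj (bergman_kernel \<alpha> z u)" .
    show ?thesis using sums_mult[OF A, of "herm u z ^ k"] by (simp add: mult_ac)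
  qed
  have int: "integrable ?M (?g j)" for j using herm_power_integrable by simp
  have norms: "cmod (?g j u) \<le> ?A j * norm z ^ j" if u: "norm u < 1" for j u
  proof -
    have "cmod (?g j u) \<le> ?A j * norm z ^ (k + j)"
      using herm_power_le[OF u, of k j] Apos[of j] by (simp only: norm_mult norm_of_real abs_of_pos mult_left_mono less_imp_le)
    also have "\<dots> \<le> ?A j * norm z ^ j"
      using Apos[of j] z by (intro mult_left_mono power_decreasing) auto
    finally show ?thesis .
  qed
  have summ: "summable (\<lambda>j. ?A j * norm z ^ j)"
  proof -
    have "summable (\<lambda>j. complex_of_real (?A j * norm z ^ j))"
      using binom_coeff_sums[of "complex_of_real (norm z)"] z by (auto simp: summable_def)
    then show ?thesis by (simp only: summable_complex_of_real)
  qed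
  \<comment> \<open>Termwise integration: the terms are dominated by the coefficients of (1 -
    x)^(-c) times |z|^j, a convergent series since |z| < 1.\<close>
  have "(\<lambda>j. LINT u|?M. ?g j u) sums (LINT u|?M. (\<Sum>j. ?g j u))"
  proof (rule sums_integral[OF int])
    show "AE u in ?M. summable (\<lambda>j. norm (?g j u))"
      by (intro AE_I2 summable_comparison_test'[OF summ, of 0]) (use norms in auto)
    have i1: "(LINT u|?M. norm (?g j u)) \<le> (LINT u|?M. ?A j * norm z ^ j)" for j
      by (rule integral_mono[OF integrable_norm[OF int]])
         (use norms finite_measure.integrable_const[OF finite_measure_weighted[OF \<alpha>]] in auto)
    have i2: "(LINT u|?M. ?A j * norm z ^ j) = ?A j * norm z ^ j" for j
      using emeasure_weighted_space[OF \<alpha>, where 'n='n] by (simp add: measure_def)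
    have le: "(LINT u|?M. norm (?g j u)) \<le> ?A j * norm z ^ j" for j
      by (rule order_trans[OF i1 eq_refl[OF i2]])
    show "summable (\<lambda>j. LINT u|?M. norm (?g j u))"
      by (rule summable_comparison_test'[OF summ, of 0], subst real_norm_def, subst abs_of_nonneg)
         (rule Bochner_Integration.integral_nonneg, simp, rule le)
  qed
  also have "(LINT u|?M. (\<Sum>j. ?g j u)) = (LINT u|?M. herm u z ^ k * cnj (bergman_kernel \<alpha> z u))"
    by (rule Bochner_Integration.integral_cong) (auto intro: sums_unique[symmetric] ker)
  also have "\<dots> = herm z z ^ k"
    by (rule bergman_reproducing[OF \<alpha> hol _ z]) (use herm_power_integrable[of k 0] in simp)
  also have "(\<lambda>j. LINT u|?M. ?g j u) = (\<lambda>j. if j = k then complex_of_real (?A k * moment k) else 0)"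
    by (auto simp: herm_power_orthogonal)
  finally have "(\<lambda>j. if j = k then complex_of_real (?A k * moment k) else 0) sums (herm z z ^ k)" .
  moreover have "(\<lambda>j. if j = k then complex_of_real (?A k * moment k) else 0) sums complex_of_real (?A k * moment k)"
    by (rule sums_single)
  ultimately have "herm z z ^ k = complex_of_real (?A k * moment k)" by (rule sums_unique2)
  then have "complex_of_real (norm z ^ (2 * k)) = complex_of_real (?A k * moment k)"
    by (simp add: herm_self power_mult)
  then show ?thesis by (simp only: of_real_eq_iff)
qed

lemma moment_le: "moment k \<le> 1 / binom_coeff (real CARD('n) + 1 + \<alpha>) k"
proof -
  have "binom_coeff (real CARD('n) + 1 + \<alpha>) k > 0" using \<alpha> by (intro binom_coeff_pos) auto
  moreover have "norm z ^ (2 * k) \<le> 1" using z by (intro power_le_one) auto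
  ultimately show ?thesis using moment_eq[of k] by (simp add: field_simps)
qed

text \<open>A Parseval argument: expand (1 - <u,z>)^(-b), compute the squared norms of the partial
  sums from the moments, and pass to the limit by Fatou. The bound is uniform in z because every
  moment is at most the reciprocal of its coefficient.\<close>

lemma nn_integral_power_le:
  assumes b: "b > 0"
  assumes summ: "summable (\<lambda>k. (binom_coeff b k)\<^sup>2 / binom_coeff (real CARD('n) + 1 + \<alpha>) k)"
  shows "(\<integral>\<^sup>+u. ennreal (cmod (1 - herm u z) powr - (2 * b)) \<partial>weighted_measure \<alpha>)
    \<le> ennreal (\<Sum>k. (binom_coeff b k)\<^sup>2 / binom_coeff (real CARD('n) + 1 + \<alpha>) k)"
proof -
  let ?M = "weighted_measure \<alpha> :: (complex ^ 'n) measure"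
  let ?S = "\<lambda>N u. \<Sum>k<N. complex_of_real (binom_coeff b k) * herm u z ^ k"
  let ?T = "\<lambda>k. (binom_coeff b k)\<^sup>2 / binom_coeff (real CARD('n) + 1 + \<alpha>) k"
  have Tpos: "?T k \<ge> 0" for k using binom_coeff_pos[of "real CARD('n) + 1 + \<alpha>" k] \<alpha> by (intro divide_nonneg_nonneg) auto
  have lim: "(\<lambda>N. (cmod (?S N u))\<^sup>2) \<longlonglongrightarrow> cmod (1 - herm u z) powr - (2 * b)" if u: "norm u < 1" for u
  proof -
    have "(\<lambda>N. ?S N u) \<longlonglongrightarrow> (1 - herm u z) powr (- complex_of_real b)"
      using binom_coeff_sums[OF herm_lt_1[OF u z]] by (simp add: sums_def)
    then have "(\<lambda>N. (cmod (?S N u))\<^sup>2) \<longlonglongrightarrow> (cmod ((1 - herm u z) powr (- complex_of_real b)))\<^sup>2"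
      by (intro tendsto_intros)
    also have "(cmod ((1 - herm u z) powr (- complex_of_real b)))\<^sup>2 = cmod (1 - herm u z) powr - (2 * b)"
      by (simp add: norm_powr_real_powr' power2_eq_square flip: powr_add)
    finally show ?thesis .
  qed
  have expand: "complex_of_real ((cmod (?S N u))\<^sup>2) = (\<Sum>j<N. \<Sum>k<N. complex_of_real (binom_coeff b j * binom_coeff b k) * (herm u z ^ j * cnj (herm u z) ^ k))" for N u
    unfolding complex_norm_square cnj_sum sum_product by (simp add: mult_ac)
  have int2: "integrable ?M (\<lambda>u. complex_of_real ((cmod (?S N u))\<^sup>2))" for N
    unfolding expand by (intro Bochner_Integration.integrable_sum integrable_mult_right herm_power_integrable)
  then have int: "integrable ?M (\<lambda>u. (cmod (?S N u))\<^sup>2)" for N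
    using integrable_Re[OF int2[of N]] by simp
  have val: "(\<integral>\<^sup>+u. ennreal ((cmod (?S N u))\<^sup>2) \<partial>?M) \<le> ennreal (\<Sum>k. ?T k)" for N
  proof -
    have "complex_of_real (LINT u|?M. (cmod (?S N u))\<^sup>2) = (LINT u|?M. complex_of_real ((cmod (?S N u))\<^sup>2))"
      by (simp only: integral_complex_of_real)
    also have "\<dots> = (\<Sum>j<N. \<Sum>k<N. complex_of_real (binom_coeff b j * binom_coeff b k) * (LINT u|?M. herm u z ^ j * cnj (herm u z) ^ k))"
      unfolding expand by (simp add: herm_power_integrable del: of_real_mult)
    also have "\<dots> = (\<Sum>j<N. complex_of_real ((binom_coeff b j)\<^sup>2 * moment j))"
      unfolding herm_power_orthogonal
      by (simp add: if_distrib sum.delta power2_eq_square mult.assoc cong: if_cong del: of_real_mult)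
         (simp add: mult.assoc)
    also have "\<dots> = complex_of_real (\<Sum>j<N. (binom_coeff b j)\<^sup>2 * moment j)" by (simp only: of_real_sum)
    finally have "(LINT u|?M. (cmod (?S N u))\<^sup>2) = (\<Sum>j<N. (binom_coeff b j)\<^sup>2 * moment j)" by (simp only: of_real_eq_iff)
    also have "\<dots> \<le> (\<Sum>j<N. ?T j)"
      using moment_le by (intro sum_mono) (metis mult_left_mono times_divide_eq_right mult.right_neutral zero_le_power2)
    also have "\<dots> \<le> (\<Sum>k. ?T k)" using Tpos by (intro sum_le_suminf[OF summ]) auto
    finally have "(LINT u|?M. (cmod (?S N u))\<^sup>2) \<le> (\<Sum>k. ?T k)" .
    then show ?thesis by (subst nn_integral_eq_integral[OF int]) (auto intro: ennreal_leI)
  qed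
  have "(\<integral>\<^sup>+u. ennreal (cmod (1 - herm u z) powr - (2 * b)) \<partial>?M) = (\<integral>\<^sup>+u. liminf (\<lambda>N. ennreal ((cmod (?S N u))\<^sup>2)) \<partial>?M)"
    by (rule nn_integral_cong) (auto intro!: lim_imp_Liminf[symmetric] tendsto_ennrealI lim)
  also have "\<dots> \<le> liminf (\<lambda>N. \<integral>\<^sup>+u. ennreal ((cmod (?S N u))\<^sup>2) \<partial>?M)"
    by (rule nn_integral_liminf) (use int in auto)
  also have "\<dots> \<le> liminf (\<lambda>N. ennreal (\<Sum>k. ?T k))"
    by (rule Liminf_mono) (simp add: val)
  also have "\<dots> = ennreal (\<Sum>k. ?T k)" by (simp add: Liminf_const)
  finally show ?thesis .
qed

end

text \<open>The subcritical case: half of a positive exponent is expanded, and c < n + 1 + \<alpha>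
  is the summability condition. For c \<le> 0 the integrand is bounded since |1 - <u,z>| \<le>
  2.\<close>

lemma bounded_power_integral:
  assumes \<alpha>: "\<alpha> > -1" and c: "c < real CARD('n) + 1 + \<alpha>"
  shows "\<exists>C>0. \<forall>z :: complex ^ 'n. norm z < 1 \<longrightarrow>
    (\<integral>\<^sup>+u. ennreal (cmod (1 - herm u z) powr - c) \<partial>weighted_measure \<alpha>) \<le> ennreal C"
proof (cases "c > 0")
  case True
  let ?T = "\<lambda>k. (binom_coeff (c/2) k)\<^sup>2 / binom_coeff (real CARD('n) + 1 + \<alpha>) k"
  have s: "summable ?T" by (rule binom_coeff_ratio_summable) (use True c in auto)
  have "(\<integral>\<^sup>+u. ennreal (cmod (1 - herm u z) powr - c) \<partial>weighted_measure \<alpha>) \<le> ennreal (\<bar>suminf ?T\<bar> + 1)"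
    if "norm z < 1" for z :: "complex ^ 'n"
  proof -
    have "(\<integral>\<^sup>+u. ennreal (cmod (1 - herm u z) powr - c) \<partial>weighted_measure \<alpha>) \<le> ennreal (suminf ?T)"
      using nn_integral_power_le[OF \<alpha> that _ s] True by simp
    also have "\<dots> \<le> ennreal (\<bar>suminf ?T\<bar> + 1)" by (rule ennreal_leI) simp
    finally show ?thesis .
  qed
  then show ?thesis by (intro exI[of _ "\<bar>suminf ?T\<bar> + 1"]) auto
next
  case False
  have "(\<integral>\<^sup>+u. ennreal (cmod (1 - herm u z) powr - c) \<partial>weighted_measure \<alpha>) \<le> ennreal (2 powr - c)"
    if z: "norm z < 1" for z :: "complex ^ 'n"
  proof -
    have "(\<integral>\<^sup>+u. ennreal (cmod (1 - herm u z) powr - c) \<partial>weighted_measure \<alpha>) \<le> (\<integral>\<^sup>+u. ennreal (2 powr - c) \<partial>(weighted_measure \<alpha> :: (complex ^ 'n) measure))"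
      using False by (intro nn_integral_mono ennreal_leI powr_mono2) (auto intro: cmod_1_minus_herm_le[OF _ z])
    also have "\<dots> = ennreal (2 powr - c)" using emeasure_weighted_space[OF \<alpha>, where 'n='n] by simp
    finally show ?thesis .
  qed
  then show ?thesis by (intro exI[of _ "2 powr - c"]) auto
qed

section \<open>Weighted Forelli-Rudin integrals\<close>

lemma nn_integral_weight_shift:
  fixes F :: "complex ^ 'n \<Rightarrow> ennreal"
  assumes \<alpha>: "\<alpha> > -1" and p: "p < 1 + \<alpha>" and [measurable]: "F \<in> borel_measurable borel"
  shows "(\<integral>\<^sup>+u. F u * ennreal ((1 - (norm u)\<^sup>2) powr - p) \<partial>weighted_measure \<alpha>) =
    ennreal (norm_const TYPE('n) \<alpha> / norm_const TYPE('n) (\<alpha> - p)) * (\<integral>\<^sup>+u. F u \<partial>weighted_measure (\<alpha> - p))"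
proof -
  let ?C = "norm_const TYPE('n) \<alpha>" and ?D = "norm_const TYPE('n) (\<alpha> - p)"
  have C: "?C > 0" "?D > 0" using weight_integral(1)[OF \<alpha>, where 'n='n] weight_integral(1)[of "\<alpha> - p", where 'n='n] p by auto
  have e: "ennreal ((1 - (norm u)\<^sup>2) powr - p) * ennreal (?C * (1 - (norm u)\<^sup>2) powr \<alpha>) =
     ennreal (?C / ?D) * ennreal (?D * (1 - (norm u)\<^sup>2) powr (\<alpha> - p))" for u :: "complex ^ 'n"
  proof -
    have "(1 - (norm u)\<^sup>2) powr - p * (1 - (norm u)\<^sup>2) powr \<alpha> = (1 - (norm u)\<^sup>2) powr (\<alpha> - p)"
      by (simp flip: powr_add)
    then show ?thesis using C by (simp add: ennreal_mult[symmetric] mult_ac)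
  qed
  have "(\<integral>\<^sup>+u. F u * ennreal ((1 - (norm u)\<^sup>2) powr - p) \<partial>weighted_measure \<alpha>) =
     (\<integral>\<^sup>+u. ennreal (?C / ?D) * (indicator (ball 0 1) u * (F u * ennreal (?D * (1 - (norm u)\<^sup>2) powr (\<alpha> - p)))) \<partial>lborel)"
    by (subst nn_integral_weighted) (measurable, auto intro!: nn_integral_cong simp: mult.assoc e, simp add: mult_ac)
  also have "\<dots> = ennreal (?C / ?D) * (\<integral>\<^sup>+u. F u \<partial>weighted_measure (\<alpha> - p))"
    by (subst nn_integral_cmult) (simp, measurable, simp add: nn_integral_weighted)
  finally show ?thesis .
qed

text \<open>The power of 1 - |u|^2 is absorbed into the measure, and the substitution phi_z replaces
  the exponent C by 2s - C while a power of 1 - |z|^2 comes out. It is kept as an equality because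
  for C = 2s the remaining integral is exactly 1.\<close>

lemma forelli_rudin_eq:
  fixes z :: "complex ^ 'n"
  assumes \<alpha>: "\<alpha> > -1" and p: "p < 1 + \<alpha>" and z: "norm z < 1"
  defines "s \<equiv> real CARD('n) + 1 + \<alpha> - p"
  shows "(\<integral>\<^sup>+u. ennreal (cmod (1 - herm u z) powr - C * (1 - (norm u)\<^sup>2) powr - p) \<partial>weighted_measure \<alpha>) =
    ennreal (norm_const TYPE('n) \<alpha> / norm_const TYPE('n) (\<alpha> - p) * (1 - (norm z)\<^sup>2) powr - (C - s)) *
    (\<integral>\<^sup>+u. ennreal (cmod (1 - herm u z) powr - (2 * s - C)) \<partial>weighted_measure (\<alpha> - p))"
proof -
  let ?r = "norm_const TYPE('n) \<alpha> / norm_const TYPE('n) (\<alpha> - p)" and ?t = "1 - (norm z)\<^sup>2"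
  have t: "?t > 0" by (rule one_minus_norm2_pos[OF z])
  have r: "?r > 0" using weight_integral(1)[OF \<alpha>, where 'n='n] weight_integral(1)[of "\<alpha> - p", where 'n='n] p by auto
  have p': "\<alpha> - p > -1" using p by simp
  have s: "s = real CARD('n) + 1 + (\<alpha> - p)" by (simp add: s_def)
  define G where "G u = ennreal (cmod (1 - herm u z) powr (2 * s - C) * ?t powr - s)" for u
  have [measurable]: "G \<in> borel_measurable borel" unfolding G_def[abs_def] by measurable
  have "(\<integral>\<^sup>+u. ennreal (cmod (1 - herm u z) powr - C * (1 - (norm u)\<^sup>2) powr - p) \<partial>weighted_measure \<alpha>) =
     (\<integral>\<^sup>+u. ennreal (cmod (1 - herm u z) powr - C) * ennreal ((1 - (norm u)\<^sup>2) powr - p) \<partial>weighted_measure \<alpha>)"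
    by (simp add: ennreal_mult)
  also have "\<dots> = ennreal ?r * (\<integral>\<^sup>+u. ennreal (cmod (1 - herm u z) powr - C) \<partial>weighted_measure (\<alpha> - p))"
    by (rule nn_integral_weight_shift[OF \<alpha> p]) measurable
  also have "(\<integral>\<^sup>+u. ennreal (cmod (1 - herm u z) powr - C) \<partial>weighted_measure (\<alpha> - p)) =
    (\<integral>\<^sup>+u. ennreal ((cmod (normalized_kernel (\<alpha> - p) z u))\<^sup>2) * G u \<partial>weighted_measure (\<alpha> - p))"
  proof (rule nn_integral_cong)
    fix u :: "complex ^ 'n"
    have "?t powr s * cmod (1 - herm u z) powr - (2 * s) * (cmod (1 - herm u z) powr (2 * s - C) * ?t powr - s)
       = (?t powr s * ?t powr - s) * (cmod (1 - herm u z) powr - (2 * s) * cmod (1 - herm u z) powr (2 * s - C))" by simp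
    also have "\<dots> = cmod (1 - herm u z) powr - C" using t by (simp flip: powr_add)
    finally show "ennreal (cmod (1 - herm u z) powr - C) = ennreal ((cmod (normalized_kernel (\<alpha> - p) z u))\<^sup>2) * G u"
      unfolding G_def normalized_kernel_sq[OF z] s[symmetric] by (simp add: ennreal_mult[symmetric])
  qed
  also have "\<dots> = (\<integral>\<^sup>+u. G (ball_aut z u) \<partial>weighted_measure (\<alpha> - p))"
    by (rule nn_integral_ball_aut[OF p' z, symmetric]) measurable
  also have "\<dots> = (\<integral>\<^sup>+u. ennreal (?t powr - (C - s)) * ennreal (cmod (1 - herm u z) powr - (2 * s - C)) \<partial>weighted_measure (\<alpha> - p))"
  proof (rule nn_integral_cong)
    fix u :: "complex ^ 'n" assume "u \<in> space (weighted_measure (\<alpha> - p))"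
    then have u: "norm u < 1" by simp
    have x: "cmod (1 - herm u z) > 0" using one_minus_herm_nz[OF u z] by simp
    have "cmod (1 - herm (ball_aut z u) z) = ?t / cmod (1 - herm u z)"
      unfolding one_minus_herm_ball_aut_center[OF z u] norm_divide norm_of_real using t by simp
    then have "cmod (1 - herm (ball_aut z u) z) powr (2 * s - C) * ?t powr - s = ?t powr (2 * s - C) / cmod (1 - herm u z) powr (2 * s - C) * ?t powr - s"
      using t x by (simp add: powr_divide)
    also have "\<dots> = (?t powr (2 * s - C) * ?t powr - s) * cmod (1 - herm u z) powr - (2 * s - C)"
      unfolding powr_minus[of _ "2 * s - C"] by (simp add: field_simps)
    also have "?t powr (2 * s - C) * ?t powr - s = ?t powr - (C - s)" by (simp flip: powr_add)
    finally show "G (ball_aut z u) = ennreal (?t powr - (C - s)) * ennreal (cmod (1 - herm u z) powr - (2 * s - C))"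
      by (simp add: G_def ennreal_mult)
  qed
  also have "\<dots> = ennreal (?t powr - (C - s)) * (\<integral>\<^sup>+u. ennreal (cmod (1 - herm u z) powr - (2 * s - C)) \<partial>weighted_measure (\<alpha> - p))"
    by (rule nn_integral_cmult) (rule measurable_borel_weighted, measurable)
  finally show ?thesis unfolding ennreal_mult[OF less_imp_le[OF r] powr_ge_zero] mult.assoc .
qed

text \<open>The hypothesis on C says C > s, that is 2s - C < s = n + 1 + (\<alpha> - p): the
  exponent left after the substitution is subcritical for the shifted weight.\<close>

lemma forelli_rudin_bound:
  assumes \<alpha>: "\<alpha> > -1" and p: "p < 1 + \<alpha>" and C: "real CARD('n) + 1 + \<alpha> < C + p"
  shows "\<exists>K>0. \<forall>z :: complex ^ 'n. norm z < 1 \<longrightarrow>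
    (\<integral>\<^sup>+u. ennreal (cmod (1 - herm u z) powr - C * (1 - (norm u)\<^sup>2) powr - p) \<partial>weighted_measure \<alpha>)
      \<le> ennreal (K * (1 - (norm z)\<^sup>2) powr - (C + p - (real CARD('n) + 1 + \<alpha>)))"
proof -
  let ?r = "norm_const TYPE('n) \<alpha> / norm_const TYPE('n) (\<alpha> - p)"
  let ?s = "real CARD('n) + 1 + \<alpha> - p"
  have r: "?r > 0" using weight_integral(1)[OF \<alpha>, where 'n='n] weight_integral(1)[of "\<alpha> - p", where 'n='n] p by auto
  have "2 * ?s - C < real CARD('n) + 1 + (\<alpha> - p)" using C by simp
  from bounded_power_integral[OF _ this] p obtain B where B: "B > 0"
    "\<And>z :: complex ^ 'n. norm z < 1 \<Longrightarrow> (\<integral>\<^sup>+u. ennreal (cmod (1 - herm u z) powr - (2 * ?s - C)) \<partial>weighted_measure (\<alpha> - p)) \<le> ennreal B"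
    by auto
  show ?thesis
  proof (intro exI[of _ "?r * B"] conjI allI impI)
    show "?r * B > 0" by (rule mult_pos_pos[OF r B(1)])
    fix z :: "complex ^ 'n" assume z: "norm z < 1"
    have e: "C + p - (real CARD('n) + 1 + \<alpha>) = C - ?s" by simp
    have "(\<integral>\<^sup>+u. ennreal (cmod (1 - herm u z) powr - C * (1 - (norm u)\<^sup>2) powr - p) \<partial>weighted_measure \<alpha>)
      \<le> ennreal (?r * (1 - (norm z)\<^sup>2) powr - (C - ?s)) * ennreal B"
      unfolding forelli_rudin_eq[OF \<alpha> p z] by (intro mult_left_mono B(2)[OF z]) simp
    also have "\<dots> = ennreal (?r * B * (1 - (norm z)\<^sup>2) powr - (C + p - (real CARD('n) + 1 + \<alpha>)))"
      unfolding e
      by (subst ennreal_mult[symmetric, OF mult_nonneg_nonneg[OF less_imp_le[OF r] powr_ge_zero] less_imp_le[OF B(1)]])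
         (simp only: mult_ac)
    finally show "(\<integral>\<^sup>+u. ennreal (cmod (1 - herm u z) powr - C * (1 - (norm u)\<^sup>2) powr - p) \<partial>weighted_measure \<alpha>)
      \<le> ennreal (?r * B * (1 - (norm z)\<^sup>2) powr - (C + p - (real CARD('n) + 1 + \<alpha>)))" .
  qed
qed

text \<open>Row and column constants are kept separate, because later only one of them is small. All
  quantities are extended nonnegative reals, so no integrability of k or \<phi> has to be
  assumed.\<close>

lemma schur_test:
  fixes k :: "'a \<times> 'a \<Rightarrow> ennreal" and h :: "'a \<Rightarrow> real" and \<phi> :: "'a \<Rightarrow> ennreal"
  assumes "sigma_finite_measure M"
    and [measurable]: "k \<in> borel_measurable (M \<Otimes>\<^sub>M M)" "h \<in> borel_measurable M" "\<phi> \<in> borel_measurable M"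
    and h: "\<And>x. x \<in> space M \<Longrightarrow> h x > 0"
    and row: "\<And>v. v \<in> space M \<Longrightarrow> (\<integral>\<^sup>+u. k (v, u) * ennreal (h u) \<partial>M) \<le> A * ennreal (h v)"
    and col: "\<And>u. u \<in> space M \<Longrightarrow> (\<integral>\<^sup>+v. k (v, u) * ennreal (h v) \<partial>M) \<le> B * ennreal (h u)"
  shows "(\<integral>\<^sup>+u. (\<integral>\<^sup>+v. k (v, u) * \<phi> v \<partial>M)\<^sup>2 \<partial>M) \<le> A * B * (\<integral>\<^sup>+v. (\<phi> v)\<^sup>2 \<partial>M)"
proof -
  interpret sigma_finite_measure M by fact
  interpret P: pair_sigma_finite M M by unfold_locales
  have one: "ennreal (h v) * ennreal (1 / h v) = 1" if "v \<in> space M" for v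
    using h[OF that] by (simp add: ennreal_mult[symmetric])
  \<comment> \<open>Cauchy-Schwarz for \<phi> / h against the measure with density k(.,u) h, whose
    total mass is at most B h(u).\<close>
  have cs: "(\<integral>\<^sup>+v. k (v, u) * \<phi> v \<partial>M)\<^sup>2 \<le> B * ennreal (h u) * (\<integral>\<^sup>+v. k (v, u) * ((\<phi> v)\<^sup>2 * ennreal (1 / h v)) \<partial>M)" if u: "u \<in> space M" for u
  proof -
    let ?D = "density M (\<lambda>v. k (v, u) * ennreal (h v))"
    have [measurable]: "(\<lambda>v. k (v, u)) \<in> borel_measurable M" using u by measurable
    have "(\<integral>\<^sup>+v. k (v, u) * \<phi> v \<partial>M) = (\<integral>\<^sup>+v. (\<phi> v * ennreal (1 / h v)) * 1 \<partial>?D)"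
      by (subst nn_integral_density, measurable, measurable, rule nn_integral_cong)
         (metis one mult.assoc mult.commute mult.right_neutral)
    then have "(\<integral>\<^sup>+v. k (v, u) * \<phi> v \<partial>M)\<^sup>2 \<le> (\<integral>\<^sup>+v. (\<phi> v * ennreal (1 / h v))\<^sup>2 \<partial>?D) * (\<integral>\<^sup>+v. 1\<^sup>2 \<partial>?D)"
      using Cauchy_Schwarz_nn_integral[of "\<lambda>v. \<phi> v * ennreal (1 / h v)" ?D "\<lambda>_. 1"] by simp
    also have "(\<integral>\<^sup>+v. 1\<^sup>2 \<partial>?D) = (\<integral>\<^sup>+v. k (v, u) * ennreal (h v) \<partial>M)"
      by (subst nn_integral_density) auto
    also have "(\<integral>\<^sup>+v. (\<phi> v * ennreal (1 / h v))\<^sup>2 \<partial>?D) = (\<integral>\<^sup>+v. k (v, u) * ((\<phi> v)\<^sup>2 * ennreal (1 / h v)) \<partial>M)"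
    proof (subst nn_integral_density, measurable, measurable, rule nn_integral_cong)
      fix v assume v: "v \<in> space M"
      have "k (v, u) * ennreal (h v) * (\<phi> v * ennreal (1 / h v))\<^sup>2 = k (v, u) * ((\<phi> v)\<^sup>2 * ennreal (1 / h v)) * (ennreal (h v) * ennreal (1 / h v))"
        by (simp add: power2_eq_square mult_ac)
      then show "k (v, u) * ennreal (h v) * (\<phi> v * ennreal (1 / h v))\<^sup>2 = k (v, u) * ((\<phi> v)\<^sup>2 * ennreal (1 / h v))"
        unfolding one[OF v] by simp
    qed
    also have "\<dots> * (\<integral>\<^sup>+v. k (v, u) * ennreal (h v) \<partial>M) \<le> (\<integral>\<^sup>+v. k (v, u) * ((\<phi> v)\<^sup>2 * ennreal (1 / h v)) \<partial>M) * (B * ennreal (h u))"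
      by (intro mult_left_mono col[OF u]) simp
    finally show ?thesis by (simp add: mult_ac)
  qed
  have "(\<integral>\<^sup>+u. (\<integral>\<^sup>+v. k (v, u) * \<phi> v \<partial>M)\<^sup>2 \<partial>M) \<le> (\<integral>\<^sup>+u. B * ennreal (h u) * (\<integral>\<^sup>+v. k (v, u) * ((\<phi> v)\<^sup>2 * ennreal (1 / h v)) \<partial>M) \<partial>M)"
    by (intro nn_integral_mono cs)
  also have "\<dots> = (\<integral>\<^sup>+u. B * (\<integral>\<^sup>+v. ennreal (h u) * (k (v, u) * ((\<phi> v)\<^sup>2 * ennreal (1 / h v))) \<partial>M) \<partial>M)"
  proof (rule nn_integral_cong)
    fix u assume u: "u \<in> space M"
    have [measurable]: "(\<lambda>v. k (v, u)) \<in> borel_measurable M" using u by measurable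
    show "B * ennreal (h u) * (\<integral>\<^sup>+v. k (v, u) * ((\<phi> v)\<^sup>2 * ennreal (1 / h v)) \<partial>M) = B * (\<integral>\<^sup>+v. ennreal (h u) * (k (v, u) * ((\<phi> v)\<^sup>2 * ennreal (1 / h v))) \<partial>M)"
      by (subst nn_integral_cmult) (measurable, simp add: mult.assoc)
  qed
  also have "\<dots> = B * (\<integral>\<^sup>+u. \<integral>\<^sup>+v. ennreal (h u) * (k (v, u) * ((\<phi> v)\<^sup>2 * ennreal (1 / h v))) \<partial>M \<partial>M)"
    by (rule nn_integral_cmult) measurable
  also have "(\<integral>\<^sup>+u. \<integral>\<^sup>+v. ennreal (h u) * (k (v, u) * ((\<phi> v)\<^sup>2 * ennreal (1 / h v))) \<partial>M \<partial>M) =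
     (\<integral>\<^sup>+v. \<integral>\<^sup>+u. ennreal (h u) * (k (v, u) * ((\<phi> v)\<^sup>2 * ennreal (1 / h v))) \<partial>M \<partial>M)"
    by (rule P.Fubini') measurable
  also have "\<dots> \<le> (\<integral>\<^sup>+v. A * (\<phi> v)\<^sup>2 \<partial>M)"
  proof (rule nn_integral_mono)
    fix v assume v: "v \<in> space M"
    have [measurable]: "(\<lambda>u. k (v, u)) \<in> borel_measurable M" using v by measurable
    have "(\<integral>\<^sup>+u. ennreal (h u) * (k (v, u) * ((\<phi> v)\<^sup>2 * ennreal (1 / h v))) \<partial>M) = (\<integral>\<^sup>+u. k (v, u) * ennreal (h u) * ((\<phi> v)\<^sup>2 * ennreal (1 / h v)) \<partial>M)"
      by (rule nn_integral_cong) (simp add: mult_ac)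
    also have "\<dots> = (\<integral>\<^sup>+u. k (v, u) * ennreal (h u) \<partial>M) * ((\<phi> v)\<^sup>2 * ennreal (1 / h v))"
      by (rule nn_integral_multc) measurable
    also have "\<dots> \<le> A * ennreal (h v) * ((\<phi> v)\<^sup>2 * ennreal (1 / h v))"
      by (intro mult_right_mono row[OF v]) simp
    also have "\<dots> = A * (\<phi> v)\<^sup>2 * (ennreal (h v) * ennreal (1 / h v))" by (simp add: mult_ac)
    finally show "(\<integral>\<^sup>+u. ennreal (h u) * (k (v, u) * ((\<phi> v)\<^sup>2 * ennreal (1 / h v))) \<partial>M) \<le> A * (\<phi> v)\<^sup>2"
      unfolding one[OF v] by simp
  qed
  also have "\<dots> = A * (\<integral>\<^sup>+v. (\<phi> v)\<^sup>2 \<partial>M)" by (rule nn_integral_cmult) measurable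
  finally have "(\<integral>\<^sup>+u. (\<integral>\<^sup>+v. k (v, u) * \<phi> v \<partial>M)\<^sup>2 \<partial>M) \<le> B * (A * (\<integral>\<^sup>+v. (\<phi> v)\<^sup>2 \<partial>M))"
    by (simp add: mult_left_mono)
  then show ?thesis by (simp add: mult_ac)
qed

section \<open>The modulus of the kernel composed with itself\<close>

definition abs_kernel :: "real \<Rightarrow> complex ^ 'n \<Rightarrow> complex ^ 'n \<Rightarrow> ennreal" where
  "abs_kernel \<alpha> z w = ennreal (cmod (1 - herm w z) powr - (real CARD('n) + 1 + \<alpha>))"

lemma abs_kernel_bergman: "abs_kernel \<alpha> z w = ennreal (cmod (bergman_kernel \<alpha> z w))"
  by (simp add: abs_kernel_def cmod_bergman_kernel)

lemma abs_kernel_commute: "abs_kernel \<alpha> z w = abs_kernel \<alpha> w z"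
  by (simp add: abs_kernel_def cmod_1_minus_herm_commute)

text \<open>The kernel of the positive operator: integrate against |K|, multiply by g, integrate
  against |K| again. With g = ||b|| it dominates T_b on A^2.\<close>

definition abs_kernel2 :: "real \<Rightarrow> (complex ^ 'n \<Rightarrow> ennreal) \<Rightarrow> complex ^ 'n \<Rightarrow> complex ^ 'n \<Rightarrow> ennreal" where
  "abs_kernel2 \<alpha> g z u = (\<integral>\<^sup>+w. g w * (abs_kernel \<alpha> z w * abs_kernel \<alpha> u w) \<partial>weighted_measure \<alpha>)"

lemma borel_measurable_abs_kernel [measurable]:
  assumes [measurable]: "f \<in> borel_measurable M" "g \<in> borel_measurable M"
  shows "(\<lambda>x. abs_kernel \<alpha> (f x) (g x :: complex ^ 'n)) \<in> borel_measurable M"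
  unfolding abs_kernel_def by measurable

lemma borel_measurable_abs_kernel2 [measurable]:
  assumes \<alpha>: "\<alpha> > -1" and [measurable]: "g \<in> borel_measurable (weighted_measure \<alpha>)"
    "f \<in> borel_measurable M" "f' \<in> borel_measurable M"
  shows "(\<lambda>x. abs_kernel2 \<alpha> g (f x) (f' x :: complex ^ 'n)) \<in> borel_measurable M"
proof -
  interpret finite_measure "weighted_measure \<alpha> :: (complex ^ 'n) measure" by (rule finite_measure_weighted[OF \<alpha>])
  show ?thesis unfolding abs_kernel2_def by measurable
qed

text \<open>A measure \<open>g d\<nu>\<^sub>\<alpha>\<close> with bounded Berezin transform can be replaced by \<open>d\<nu>\<^sub>\<alpha>\<close>, because
  \<open>F(w) \<le> C \<integral> F(v) |k\<^sub>v(w)|\<^sup>2 d\<nu>\<^sub>\<alpha>(v)\<close> for \<open>F = |K\<^sub>z K\<^sub>u|\<close>.\<close>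

lemma abs_kernel2_carleson:
  assumes \<alpha>: "\<alpha> > -1"
  shows "\<exists>C>0. \<forall>g B. g \<in> borel_measurable (weighted_measure \<alpha>) \<longrightarrow>
    (AE v in weighted_measure \<alpha>. (\<integral>\<^sup>+w. g w * ennreal ((cmod (normalized_kernel \<alpha> v w))\<^sup>2) \<partial>weighted_measure \<alpha>) \<le> B) \<longrightarrow>
    (\<forall>z u :: complex ^ 'n. norm z < 1 \<longrightarrow> norm u < 1 \<longrightarrow> abs_kernel2 \<alpha> g z u \<le> ennreal C * B * abs_kernel2 \<alpha> (\<lambda>_. 1) z u)"
proof -
  let ?M = "weighted_measure \<alpha> :: (complex ^ 'n) measure"
  let ?c = "real CARD('n) + 1 + \<alpha>"
  interpret M: finite_measure ?M by (rule finite_measure_weighted[OF \<alpha>])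
  interpret P: pair_sigma_finite ?M ?M by unfold_locales
  let ?r = "norm_const TYPE('n) \<alpha> / norm_const TYPE('n) (\<alpha> - - ?c)"
  have c: "?c > 0" using \<alpha> by simp
  have r: "?r > 0" using weight_integral(1)[OF \<alpha>, where 'n='n] weight_integral(1)[of "\<alpha> + ?c", where 'n='n] \<alpha> c by auto
  \<comment> \<open>Forced by \<open>low\<close>: two uses of \<open>kernel_submult\<close> lose the
    factor 2^(2c), and 1/?r compensates the exact value of the Forelli-Rudin integral.\<close>
  define C where "C = 2 powr (2 * ?c) / ?r"
  have C: "C > 0" unfolding C_def by (rule divide_pos_pos[OF _ r]) simp
  define k2 :: "complex ^ 'n \<Rightarrow> complex ^ 'n \<Rightarrow> ennreal" where
    "k2 v w = ennreal ((1 - (norm v)\<^sup>2) powr ?c * cmod (1 - herm w v) powr - (2 * ?c))" for v w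
  have [measurable]: "(\<lambda>x. k2 (f x) (g x)) \<in> borel_measurable N" if [measurable]: "f \<in> borel_measurable N" "g \<in> borel_measurable N" for f g and N :: "'x measure"
    unfolding k2_def by measurable
  have k2m: "(\<lambda>x. k2 (f x) (g x)) \<in> borel_measurable (?M \<Otimes>\<^sub>M ?M)" if [measurable]: "f \<in> borel_measurable (?M \<Otimes>\<^sub>M ?M)" "g \<in> borel_measurable (?M \<Otimes>\<^sub>M ?M)" for f g
    unfolding k2_def by measurable
  have k2w: "(\<lambda>x. k2 (f x) (g x)) \<in> borel_measurable ?M" if [measurable]: "f \<in> borel_measurable ?M" "g \<in> borel_measurable ?M" for f g
    unfolding k2_def by measurable
  note [measurable] = k2m k2w
  let ?F = "\<lambda>z u v. abs_kernel \<alpha> z v * abs_kernel \<alpha> u v"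
  have sub: "cmod (1 - herm w z) powr - ?c * (2 * cmod (1 - herm v w)) powr - ?c * (1 - (norm w)\<^sup>2) powr ?c \<le> cmod (1 - herm v z) powr - ?c"
    if z: "norm z < 1" and v: "norm v < 1" and w: "norm w < 1" for z v w :: "complex ^ 'n"
  proof -
    have t: "1 - (norm w)\<^sup>2 > 0" "cmod (1 - herm v z) > 0" "cmod (1 - herm w z) > 0" "cmod (1 - herm v w) > 0"
      using one_minus_norm2_pos[OF w] one_minus_herm_nz v z w by auto
    have "cmod (1 - herm v z) \<le> (cmod (1 - herm w z) * (2 * cmod (1 - herm v w))) / (1 - (norm w)\<^sup>2)"
      using kernel_submult[OF v z w] t by (simp add: field_simps)
    then have "((cmod (1 - herm w z) * (2 * cmod (1 - herm v w))) / (1 - (norm w)\<^sup>2)) powr - ?c \<le> cmod (1 - herm v z) powr - ?c"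
      using t c by (intro powr_mono2') auto
    moreover have "(X * Y / T) powr - ?c = X powr - ?c * Y powr - ?c * T powr ?c" if "X > 0" "Y > 0" "T > 0" for X Y T :: real
    proof -
      have "(X * Y / T) powr - ?c = X powr - ?c * Y powr - ?c / T powr - ?c"
        using that by (simp add: powr_divide powr_mult)
      then show ?thesis unfolding powr_minus[of T] by (simp only: divide_inverse inverse_inverse_eq)
    qed
    ultimately show ?thesis using t by simp
  qed
  \<comment> \<open>\<open>sub\<close> is used once for z and once for u. What remains is the
    integral over v of |1 - <v,w>|^(-4c) (1 - |v|^2)^c, half of whose negative exponent comes from
    \<open>k2\<close>; its value is a multiple of (1 - |w|^2)^(-2c).\<close>
  have low: "?F z u w \<le> ennreal C * (\<integral>\<^sup>+v. ?F z u v * k2 v w \<partial>?M)"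
    if z: "norm z < 1" and u: "norm u < 1" and w: "norm w < 1" for z u w :: "complex ^ 'n"
  proof -
    let ?t = "1 - (norm w)\<^sup>2"
    have t: "?t > 0" using one_minus_norm2_pos[OF w] .
    let ?A = "cmod (1 - herm w z) powr - ?c * cmod (1 - herm w u) powr - ?c"
    have pt: "ennreal (?A * 2 powr - (2 * ?c) * ?t powr (2 * ?c)) * ennreal (cmod (1 - herm v w) powr - (4 * ?c) * (1 - (norm v)\<^sup>2) powr - (- ?c)) \<le> ?F z u v * k2 v w"
      if v: "norm v < 1" for v
    proof -
      have x: "cmod (1 - herm v w) > 0" using one_minus_herm_nz[OF v w] by simp
      have "(cmod (1 - herm w z) powr - ?c * (2 * cmod (1 - herm v w)) powr - ?c * ?t powr ?c) *
          (cmod (1 - herm w u) powr - ?c * (2 * cmod (1 - herm v w)) powr - ?c * ?t powr ?c)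
          \<le> cmod (1 - herm v z) powr - ?c * cmod (1 - herm v u) powr - ?c"
        by (intro mult_mono sub z u v w) auto
      also have "(cmod (1 - herm w z) powr - ?c * (2 * cmod (1 - herm v w)) powr - ?c * ?t powr ?c) *
          (cmod (1 - herm w u) powr - ?c * (2 * cmod (1 - herm v w)) powr - ?c * ?t powr ?c) =
          ?A * ((2 * cmod (1 - herm v w)) powr - ?c * (2 * cmod (1 - herm v w)) powr - ?c) * (?t powr ?c * ?t powr ?c)"
        by (simp only: mult_ac)
      also have "(2 * cmod (1 - herm v w)) powr - ?c * (2 * cmod (1 - herm v w)) powr - ?c = 2 powr - (2 * ?c) * cmod (1 - herm v w) powr - (2 * ?c)"
        by (subst powr_add[symmetric], subst powr_mult[symmetric]) (use x in \<open>auto simp: algebra_simps\<close>)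
      also have "?t powr ?c * ?t powr ?c = ?t powr (2 * ?c)" by (subst powr_add[symmetric]) (simp add: algebra_simps)
      finally have "?A * (2 powr - (2 * ?c) * cmod (1 - herm v w) powr - (2 * ?c)) * ?t powr (2 * ?c) * ((1 - (norm v)\<^sup>2) powr ?c * cmod (1 - herm w v) powr - (2 * ?c))
        \<le> cmod (1 - herm v z) powr - ?c * cmod (1 - herm v u) powr - ?c * ((1 - (norm v)\<^sup>2) powr ?c * cmod (1 - herm w v) powr - (2 * ?c))"
        by (rule mult_right_mono) simp
      note ineq = this
      have pq: "cmod (1 - herm v w) powr - (2 * ?c) * cmod (1 - herm w v) powr - (2 * ?c) = cmod (1 - herm v w) powr - (4 * ?c)"
        unfolding cmod_1_minus_herm_commute[of w v] by (subst powr_add[symmetric]) (simp add: algebra_simps)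
      have "?A * 2 powr - (2 * ?c) * ?t powr (2 * ?c) * (cmod (1 - herm v w) powr - (4 * ?c) * (1 - (norm v)\<^sup>2) powr - (- ?c))
        \<le> cmod (1 - herm v z) powr - ?c * cmod (1 - herm v u) powr - ?c * ((1 - (norm v)\<^sup>2) powr ?c * cmod (1 - herm w v) powr - (2 * ?c))"
        using ineq unfolding pq[symmetric] by (simp only: mult_ac minus_minus)
      then show ?thesis unfolding abs_kernel_def k2_def by (simp add: ennreal_mult[symmetric] ennreal_leI)
    qed
    have "(\<integral>\<^sup>+v. ennreal (?A * 2 powr - (2 * ?c) * ?t powr (2 * ?c)) * ennreal (cmod (1 - herm v w) powr - (4 * ?c) * (1 - (norm v)\<^sup>2) powr - (- ?c)) \<partial>?M)
      \<le> (\<integral>\<^sup>+v. ?F z u v * k2 v w \<partial>?M)"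
      by (rule nn_integral_mono, rule pt) simp
    also have "(\<integral>\<^sup>+v. ennreal (?A * 2 powr - (2 * ?c) * ?t powr (2 * ?c)) * ennreal (cmod (1 - herm v w) powr - (4 * ?c) * (1 - (norm v)\<^sup>2) powr - (- ?c)) \<partial>?M)
      = ennreal (?A * 2 powr - (2 * ?c) * ?t powr (2 * ?c)) * (\<integral>\<^sup>+v. ennreal (cmod (1 - herm v w) powr - (4 * ?c) * (1 - (norm v)\<^sup>2) powr - (- ?c)) \<partial>?M)"
      by (rule nn_integral_cmult) (rule measurable_borel_weighted, measurable)
    also have "(\<integral>\<^sup>+v. ennreal (cmod (1 - herm v w) powr - (4 * ?c) * (1 - (norm v)\<^sup>2) powr - (- ?c)) \<partial>?M) = ennreal (?r * ?t powr - (2 * ?c))"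
    proof -
      \<comment> \<open>The choice p = -c and exponent 4c gives s = 2c, hence 2s - 4c = 0, and the
        remaining integral is a total mass.\<close>
      have p: "- ?c < 1 + \<alpha>" using \<alpha> c by simp
      have e: "2 * (?c - - ?c) - 4 * ?c = 0" "4 * ?c - (?c - - ?c) = 2 * ?c" by simp_all
      have one: "(\<integral>\<^sup>+v. ennreal (cmod (1 - herm v w) powr - 0) \<partial>(weighted_measure (\<alpha> - - ?c) :: (complex ^ 'n) measure)) = 1"
      proof -
        have "\<alpha> - - ?c > -1" using \<alpha> c by simp
        have "(\<integral>\<^sup>+v. ennreal (cmod (1 - herm v w) powr - 0) \<partial>(weighted_measure (\<alpha> - - ?c) :: (complex ^ 'n) measure)) = (\<integral>\<^sup>+v. 1 \<partial>(weighted_measure (\<alpha> - - ?c) :: (complex ^ 'n) measure))"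
          by (rule nn_integral_cong) (use one_minus_herm_nz[OF _ w] in auto)
        also have "\<dots> = 1" using emeasure_weighted_space[OF \<open>\<alpha> - - ?c > -1\<close>, where 'n='n] by simp
        finally show ?thesis .
      qed
      show ?thesis
        by (subst forelli_rudin_eq[OF \<alpha> p w]) (simp only: e one mult_1_right)
    qed
    also have "ennreal (?A * 2 powr - (2 * ?c) * ?t powr (2 * ?c)) * ennreal (?r * ?t powr - (2 * ?c)) = ennreal (?A / C)"
    proof -
      have "?t powr (2 * ?c) * ?t powr - (2 * ?c) = 1" using t by (subst powr_add[symmetric]) simp
      moreover have "(X * P * T) * (R * T') = X * (R * P) * (T * T')" for X P T R T' :: real
        by (simp only: mult_ac)
      ultimately have "(?A * 2 powr - (2 * ?c) * ?t powr (2 * ?c)) * (?r * ?t powr - (2 * ?c)) = ?A * (?r * 2 powr - (2 * ?c))"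
        by (simp only: mult_1_right)
      also have "?r * 2 powr - (2 * ?c) = 1 / C"
        unfolding C_def powr_minus by (simp only: divide_inverse inverse_mult_distrib inverse_inverse_eq mult_ac mult_1_left mult_1_right)
      finally have eqn: "(?A * 2 powr - (2 * ?c) * ?t powr (2 * ?c)) * (?r * ?t powr - (2 * ?c)) = ?A * (1 / C)" .
      show ?thesis
        by (subst ennreal_mult[symmetric, OF _ mult_nonneg_nonneg[OF less_imp_le[OF r] powr_ge_zero]])
           (simp, simp only: eqn times_divide_eq_right mult_1_right)
    qed
    finally have "ennreal C * ennreal (?A / C) \<le> ennreal C * (\<integral>\<^sup>+v. ?F z u v * k2 v w \<partial>?M)" by (rule mult_left_mono) simp
    moreover have "ennreal C * ennreal (?A / C) = ?F z u w" using C by (simp add: abs_kernel_def ennreal_mult[symmetric])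
    ultimately show ?thesis by simp
  qed
  show ?thesis
  proof (intro exI[of _ C] conjI allI impI C)
    fix g B and z u :: "complex ^ 'n"
    assume g [measurable]: "g \<in> borel_measurable ?M" and z: "norm z < 1" and u: "norm u < 1"
      and B: "AE v in ?M. (\<integral>\<^sup>+w. g w * ennreal ((cmod (normalized_kernel \<alpha> v w))\<^sup>2) \<partial>?M) \<le> B"
    have "abs_kernel2 \<alpha> g z u \<le> (\<integral>\<^sup>+w. g w * (ennreal C * (\<integral>\<^sup>+v. ?F z u v * k2 v w \<partial>?M)) \<partial>?M)"
      unfolding abs_kernel2_def by (intro nn_integral_mono mult_left_mono low z u) auto
    also have "\<dots> = (\<integral>\<^sup>+w. ennreal C * (\<integral>\<^sup>+v. g w * (?F z u v * k2 v w) \<partial>?M) \<partial>?M)"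
    proof (rule nn_integral_cong)
      fix w
      show "g w * (ennreal C * (\<integral>\<^sup>+v. ?F z u v * k2 v w \<partial>?M)) = ennreal C * (\<integral>\<^sup>+v. g w * (?F z u v * k2 v w) \<partial>?M)"
        by (subst nn_integral_cmult) (measurable, simp only: mult_ac)
    qed
    also have "\<dots> = ennreal C * (\<integral>\<^sup>+w. \<integral>\<^sup>+v. g w * (?F z u v * k2 v w) \<partial>?M \<partial>?M)"
      by (rule nn_integral_cmult) measurable
    also have "(\<integral>\<^sup>+w. \<integral>\<^sup>+v. g w * (?F z u v * k2 v w) \<partial>?M \<partial>?M) = (\<integral>\<^sup>+v. \<integral>\<^sup>+w. g w * (?F z u v * k2 v w) \<partial>?M \<partial>?M)"
      by (rule P.Fubini') measurable
    also have "\<dots> \<le> (\<integral>\<^sup>+v. B * ?F z u v \<partial>?M)"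
    proof (rule nn_integral_mono_AE)
      show "AE v in ?M. (\<integral>\<^sup>+w. g w * (?F z u v * k2 v w) \<partial>?M) \<le> B * ?F z u v"
        using B AE_space
      proof eventually_elim
        case (elim v)
        then have v: "norm v < 1" by simp
        have "(\<integral>\<^sup>+w. g w * (?F z u v * k2 v w) \<partial>?M) = (\<integral>\<^sup>+w. g w * ennreal ((cmod (normalized_kernel \<alpha> v w))\<^sup>2) * ?F z u v \<partial>?M)"
          unfolding k2_def normalized_kernel_sq[OF v] by (rule nn_integral_cong) (simp only: mult_ac)
        also have "\<dots> = (\<integral>\<^sup>+w. g w * ennreal ((cmod (normalized_kernel \<alpha> v w))\<^sup>2) \<partial>?M) * ?F z u v"
          unfolding normalized_kernel_sq[OF v] by (rule nn_integral_multc) measurable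
        also have "\<dots> \<le> B * ?F z u v" using elim(1) by (intro mult_right_mono) auto
        finally show ?case .
      qed
    qed
    also have "(\<integral>\<^sup>+v. B * ?F z u v \<partial>?M) = B * abs_kernel2 \<alpha> (\<lambda>_. 1) z u"
    proof -
      have "(\<lambda>v. ?F z u v) \<in> borel_measurable ?M"
        by (intro borel_measurable_times_ennreal borel_measurable_abs_kernel measurable_ident_weighted) simp_all
      from nn_integral_cmult[OF this] show ?thesis unfolding abs_kernel2_def by simp
    qed
    finally show "abs_kernel2 \<alpha> g z u \<le> ennreal C * B * abs_kernel2 \<alpha> (\<lambda>_. 1) z u"
      by (simp add: mult.assoc mult_left_mono)
  qed
qed

text \<open>The powers (1 - |u|^2)^(-p) with 0 < p < 1 + \<alpha> are the usual Schur weights; the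
  midpoint leaves equal room (1 + \<alpha>)/2 on both sides, which the exponent \<epsilon> of the
  far estimate consumes.\<close>

definition schur_weight :: "real \<Rightarrow> complex ^ 'n \<Rightarrow> real" where
  "schur_weight \<alpha> u = (1 - (norm u)\<^sup>2) powr - ((1 + \<alpha>) / 2)"

lemma schur_weight_pos: "norm u < 1 \<Longrightarrow> schur_weight \<alpha> u > 0"
  using one_minus_norm2_pos[of u] by (simp add: schur_weight_def)

lemma borel_measurable_schur_weight [measurable]:
  "f \<in> borel_measurable M \<Longrightarrow> (\<lambda>x. schur_weight \<alpha> (f x)) \<in> borel_measurable M"
  unfolding schur_weight_def supply measurable_ident_weighted [measurable del] by measurable

text \<open>The points \<open>u\<close> with \<open>1 - |\<phi>\<^sub>v(u)|\<^sup>2 \<le> \<delta>\<close>, i.e. far from \<open>v\<close> in the Bergman metric.\<close>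

definition far :: "real \<Rightarrow> complex ^ 'n \<Rightarrow> complex ^ 'n \<Rightarrow> bool" where
  "far \<delta> v u \<longleftrightarrow> (1 - (norm v)\<^sup>2) * (1 - (norm u)\<^sup>2) \<le> \<delta> * (cmod (1 - herm v u))\<^sup>2"

text \<open>For \<open>\<epsilon> = 0\<close> the bound needs no restriction to far points and is the usual row estimate.\<close>

lemma schur_far:
  assumes \<alpha>: "\<alpha> > -1" and \<epsilon>: "0 \<le> \<epsilon>" "\<epsilon> < (1 + \<alpha>) / 2"
  shows "\<exists>K>0. \<forall>\<delta>>0. \<forall>v :: complex ^ 'n. norm v < 1 \<longrightarrow>
    (\<integral>\<^sup>+u. indicator {u. \<epsilon> = 0 \<or> far \<delta> v u} u * (abs_kernel2 \<alpha> (\<lambda>_. 1) v u * ennreal (schur_weight \<alpha> u)) \<partial>weighted_measure \<alpha>)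
      \<le> ennreal (K * \<delta> powr \<epsilon>) * ennreal (schur_weight \<alpha> v)"
proof -
  let ?M = "weighted_measure \<alpha> :: (complex ^ 'n) measure"
  let ?c = "real CARD('n) + 1 + \<alpha>" and ?t = "(1 + \<alpha>) / 2"
  interpret M: finite_measure ?M by (rule finite_measure_weighted[OF \<alpha>])
  interpret P: pair_sigma_finite ?M ?M by unfold_locales
  \<comment> \<open>Each of the two kernels gives up 2\<epsilon> of its exponent in exchange for the
    factor \<delta>^\<epsilon>.\<close>
  let ?C = "?c - 2 * \<epsilon>"
  have 1: "?t + \<epsilon> < 1 + \<alpha>" "real CARD('n) + 1 + \<alpha> < ?C + (?t + \<epsilon>)" using \<epsilon> by (auto simp: field_simps)
  have e1: "?C + (?t + \<epsilon>) - (real CARD('n) + 1 + \<alpha>) = ?t - \<epsilon>" by simp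
  obtain K where K: "K > 0" "\<And>z :: complex ^ 'n. norm z < 1 \<Longrightarrow>
    (\<integral>\<^sup>+u. ennreal (cmod (1 - herm u z) powr - ?C * (1 - (norm u)\<^sup>2) powr - (?t + \<epsilon>)) \<partial>weighted_measure \<alpha>)
      \<le> ennreal (K * (1 - (norm z)\<^sup>2) powr - (?t - \<epsilon>))"
    using forelli_rudin_bound[OF \<alpha> 1] unfolding e1 by blast
  show ?thesis
  proof (intro exI[of _ "2 powr (2 * \<epsilon>) * K * K"] conjI allI impI)
    show "2 powr (2 * \<epsilon>) * K * K > 0" using K by simp
    fix \<delta> :: real and v :: "complex ^ 'n" assume \<delta>: "\<delta> > 0" and v: "norm v < 1"
    let ?s = "\<lambda>z :: complex ^ 'n. 1 - (norm z)\<^sup>2"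
    have sv: "?s v > 0" using one_minus_norm2_pos[OF v] .
    let ?G = "\<lambda>w u. ennreal (cmod (1 - herm w v) powr - ?C * ?s w powr - (2 * \<epsilon>)) * ennreal (cmod (1 - herm u w) powr - ?C * ?s u powr - (?t + \<epsilon>))"
    let ?A = "2 powr (2 * \<epsilon>) * \<delta> powr \<epsilon> * ?s v powr - \<epsilon>"
    have pt: "indicator {u. \<epsilon> = 0 \<or> far \<delta> v u} u * (abs_kernel \<alpha> v w * abs_kernel \<alpha> u w * ennreal (schur_weight \<alpha> u)) \<le> ennreal ?A * ?G w u"
      if w: "norm w < 1" and u: "norm u < 1" for w u
    proof (cases "\<epsilon> = 0 \<or> far \<delta> v u")
      case True
      have sw: "?s w > 0" "?s u > 0" using one_minus_norm2_pos w u by auto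
      have x: "cmod (1 - herm w v) > 0" "cmod (1 - herm u w) > 0" "cmod (1 - herm v u) > 0"
        using one_minus_herm_nz v w u by auto
      \<comment> \<open>Farness of u from v, combined with \<open>kernel_submult\<close> through the
        intermediate point w, shows that this product is at least 1. Multiplying the integrand by it
        trades decay of the kernels for a power of \<delta>.\<close>
      have "1 \<le> ?A * cmod (1 - herm w v) powr (2 * \<epsilon>) * cmod (1 - herm u w) powr (2 * \<epsilon>) * ?s w powr - (2 * \<epsilon>) * ?s u powr - \<epsilon>"
      proof (cases "\<epsilon> = 0")
        case True then show ?thesis using x sw sv \<delta> by simp
      next
        case False
        have "?s v * ?s u \<le> \<delta> * (cmod (1 - herm v u))\<^sup>2" using True False by (simp add: far_def)
        also have "\<dots> \<le> \<delta> * (2 * (cmod (1 - herm w v) * cmod (1 - herm u w)) / ?s w)\<^sup>2"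
        proof (intro mult_left_mono power_mono)
          have "cmod (1 - herm v u) * ?s w \<le> 2 * (cmod (1 - herm w v) * cmod (1 - herm u w))"
            using kernel_submult[OF v u w] by (simp add: cmod_1_minus_herm_commute[of w v] cmod_1_minus_herm_commute[of u w])
          then show "cmod (1 - herm v u) \<le> 2 * (cmod (1 - herm w v) * cmod (1 - herm u w)) / ?s w"
            using sw by (simp add: field_simps)
        qed (use \<delta> in auto)
        finally have fin: "(?s v * ?s u) powr \<epsilon> \<le> (\<delta> * (2 * (cmod (1 - herm w v) * cmod (1 - herm u w)) / ?s w)\<^sup>2) powr \<epsilon>"
          using \<epsilon> sv sw by (intro powr_mono2) auto
        have pp: "(\<delta> * (2 * (X * Y) / W)\<^sup>2) powr \<epsilon> = \<delta> powr \<epsilon> * 2 powr (2 * \<epsilon>) * X powr (2 * \<epsilon>) * Y powr (2 * \<epsilon>) * W powr - (2 * \<epsilon>)"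
          if "X > 0" "Y > 0" "W > 0" for X Y W
        proof -
          have "(\<delta> * (2 * (X * Y) / W)\<^sup>2) powr \<epsilon> = \<delta> powr \<epsilon> * ((2 * (X * Y) / W) powr 2) powr \<epsilon>"
            using that \<delta> by (simp add: powr_mult)
          also have "((2 * (X * Y) / W) powr 2) powr \<epsilon> = (2 * (X * Y) / W) powr (2 * \<epsilon>)" by (rule powr_powr)
          also have "\<dots> = 2 powr (2 * \<epsilon>) * X powr (2 * \<epsilon>) * Y powr (2 * \<epsilon>) / W powr (2 * \<epsilon>)"
            using that by (simp add: powr_mult powr_divide)
          finally show ?thesis by (simp only: powr_minus divide_inverse mult_ac)
        qed
        have "(?s v powr - \<epsilon> * ?s u powr - \<epsilon>) * (?s v * ?s u) powr \<epsilon> \<le> (?s v powr - \<epsilon> * ?s u powr - \<epsilon>) *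
           (\<delta> powr \<epsilon> * 2 powr (2 * \<epsilon>) * cmod (1 - herm w v) powr (2 * \<epsilon>) * cmod (1 - herm u w) powr (2 * \<epsilon>) * ?s w powr - (2 * \<epsilon>))"
          by (rule mult_left_mono[OF fin[unfolded pp[OF x(1,2) sw(1)]]]) simp
        moreover have gen: "(a powr - \<epsilon> * b powr - \<epsilon>) * (a * b) powr \<epsilon> = 1" if "a > 0" "b > 0" for a b :: real
          using that by (simp add: powr_mult powr_minus field_simps)
        ultimately show ?thesis unfolding gen[OF sv sw(2)] by (simp only: mult_ac)
      qed
      then have "1 * (cmod (1 - herm w v) powr - ?c * cmod (1 - herm u w) powr - ?c * ?s u powr - ?t) \<le>
         (?A * cmod (1 - herm w v) powr (2 * \<epsilon>) * cmod (1 - herm u w) powr (2 * \<epsilon>) * ?s w powr - (2 * \<epsilon>) * ?s u powr - \<epsilon>) *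
         (cmod (1 - herm w v) powr - ?c * cmod (1 - herm u w) powr - ?c * ?s u powr - ?t)"
        by (rule mult_right_mono) simp
      also have "\<dots> = ?A * ((cmod (1 - herm w v) powr (2 * \<epsilon>) * cmod (1 - herm w v) powr - ?c) * ?s w powr - (2 * \<epsilon>)) *
         ((cmod (1 - herm u w) powr (2 * \<epsilon>) * cmod (1 - herm u w) powr - ?c) * (?s u powr - \<epsilon> * ?s u powr - ?t))"
        by (simp only: mult_ac)
      finally have chain: "1 * (cmod (1 - herm w v) powr - ?c * cmod (1 - herm u w) powr - ?c * ?s u powr - ?t) \<le>
         ?A * ((cmod (1 - herm w v) powr (2 * \<epsilon>) * cmod (1 - herm w v) powr - ?c) * ?s w powr - (2 * \<epsilon>)) *
         ((cmod (1 - herm u w) powr (2 * \<epsilon>) * cmod (1 - herm u w) powr - ?c) * (?s u powr - \<epsilon> * ?s u powr - ?t))" .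
      have pw: "x powr (2 * \<epsilon>) * x powr - ?c = x powr - ?C" for x :: real
        by (subst powr_add[symmetric]) (simp add: algebra_simps)
      have pu: "?s u powr - \<epsilon> * ?s u powr - ?t = ?s u powr - (?t + \<epsilon>)"
        by (subst powr_add[symmetric]) (simp add: algebra_simps)
      have "cmod (1 - herm w v) powr - ?c * cmod (1 - herm u w) powr - ?c * ?s u powr - ?t \<le>
          ?A * (cmod (1 - herm w v) powr - ?C * ?s w powr - (2 * \<epsilon>)) * (cmod (1 - herm u w) powr - ?C * ?s u powr - (?t + \<epsilon>))"
        using chain unfolding pw pu by (simp only: mult_1_left)
      then show ?thesis using True unfolding abs_kernel_def schur_weight_def cmod_1_minus_herm_commute[of w u]
        by (simp add: ennreal_mult[symmetric] mult.assoc ennreal_leI)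
    qed simp
    have Gm: "(\<lambda>u. ?G w u) \<in> borel_measurable ?M" for w
      by (rule measurable_borel_weighted) measurable
    \<comment> \<open>Integrating in u leaves (1 - |w|^2)^(-(t-\<epsilon>)), which together with the
      traded factor (1 - |w|^2)^(-2\<epsilon>) is again the exponent -(t+\<epsilon>). So the same
      estimate with the same K applies to the integral in w.\<close>
    have inner: "(\<integral>\<^sup>+u. ?G w u \<partial>?M) \<le> ennreal K * ennreal (cmod (1 - herm w v) powr - ?C * ?s w powr - (?t + \<epsilon>))" if w: "norm w < 1" for w
    proof -
      have "(\<integral>\<^sup>+u. ?G w u \<partial>?M) = ennreal (cmod (1 - herm w v) powr - ?C * ?s w powr - (2 * \<epsilon>)) * (\<integral>\<^sup>+u. ennreal (cmod (1 - herm u w) powr - ?C * ?s u powr - (?t + \<epsilon>)) \<partial>?M)"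
        by (rule nn_integral_cmult) (rule measurable_borel_weighted, measurable)
      also have "\<dots> \<le> ennreal (cmod (1 - herm w v) powr - ?C * ?s w powr - (2 * \<epsilon>)) * ennreal (K * ?s w powr - (?t - \<epsilon>))"
        by (intro mult_left_mono K(2)[OF w]) simp
      also have "\<dots> = ennreal ((cmod (1 - herm w v) powr - ?C * ?s w powr - (2 * \<epsilon>)) * (K * ?s w powr - (?t - \<epsilon>)))"
        using K(1) by (subst ennreal_mult) auto
      also have "(cmod (1 - herm w v) powr - ?C * ?s w powr - (2 * \<epsilon>)) * (K * ?s w powr - (?t - \<epsilon>)) =
         K * (cmod (1 - herm w v) powr - ?C * (?s w powr - (2 * \<epsilon>) * ?s w powr - (?t - \<epsilon>)))"
        by (simp only: mult_ac)
      also have "?s w powr - (2 * \<epsilon>) * ?s w powr - (?t - \<epsilon>) = ?s w powr - (?t + \<epsilon>)" by (subst powr_add[symmetric]) (simp add: algebra_simps)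
      finally show ?thesis using K(1) by (simp add: ennreal_mult)
    qed
    have farm: "{u. \<epsilon> = 0 \<or> far \<delta> v u} \<in> sets borel"
      unfolding far_def by measurable
    have "(\<integral>\<^sup>+u. indicator {u. \<epsilon> = 0 \<or> far \<delta> v u} u * (abs_kernel2 \<alpha> (\<lambda>_. 1) v u * ennreal (schur_weight \<alpha> u)) \<partial>?M)
      = (\<integral>\<^sup>+u. \<integral>\<^sup>+w. indicator {u. \<epsilon> = 0 \<or> far \<delta> v u} u * (abs_kernel \<alpha> v w * abs_kernel \<alpha> u w * ennreal (schur_weight \<alpha> u)) \<partial>?M \<partial>?M)"
    proof (rule nn_integral_cong)
      fix u
      have m: "(\<lambda>w. abs_kernel \<alpha> v w * abs_kernel \<alpha> u w) \<in> borel_measurable ?M"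
        by (rule measurable_borel_weighted) measurable
      show "indicator {u. \<epsilon> = 0 \<or> far \<delta> v u} u * (abs_kernel2 \<alpha> (\<lambda>_. 1) v u * ennreal (schur_weight \<alpha> u))
        = (\<integral>\<^sup>+w. indicator {u. \<epsilon> = 0 \<or> far \<delta> v u} u * (abs_kernel \<alpha> v w * abs_kernel \<alpha> u w * ennreal (schur_weight \<alpha> u)) \<partial>?M)"
        using m by (simp add: abs_kernel2_def nn_integral_cmult nn_integral_multc)
    qed
    also have "\<dots> \<le> (\<integral>\<^sup>+u. \<integral>\<^sup>+w. ennreal ?A * ?G w u \<partial>?M \<partial>?M)"
      by (intro nn_integral_mono pt) auto
    also have "\<dots> = (\<integral>\<^sup>+w. \<integral>\<^sup>+u. ennreal ?A * ?G w u \<partial>?M \<partial>?M)"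
      by (rule P.Fubini') measurable
    also have "\<dots> \<le> (\<integral>\<^sup>+w. ennreal (?A * K) * ennreal (cmod (1 - herm w v) powr - ?C * ?s w powr - (?t + \<epsilon>)) \<partial>?M)"
    proof (rule nn_integral_mono)
      fix w assume "w \<in> space ?M"
      then have w: "norm w < 1" by simp
      have "(\<integral>\<^sup>+u. ennreal ?A * ?G w u \<partial>?M) = ennreal ?A * (\<integral>\<^sup>+u. ?G w u \<partial>?M)" by (rule nn_integral_cmult[OF Gm])
      also have "\<dots> \<le> ennreal ?A * (ennreal K * ennreal (cmod (1 - herm w v) powr - ?C * ?s w powr - (?t + \<epsilon>)))"
        by (intro mult_left_mono inner w) simp
      also have "\<dots> = ennreal (?A * K) * ennreal (cmod (1 - herm w v) powr - ?C * ?s w powr - (?t + \<epsilon>))"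
        using K(1) by (simp add: ennreal_mult mult.assoc)
      finally show "(\<integral>\<^sup>+u. ennreal ?A * ?G w u \<partial>?M) \<le> ennreal (?A * K) * ennreal (cmod (1 - herm w v) powr - ?C * ?s w powr - (?t + \<epsilon>))" .
    qed
    also have "\<dots> = ennreal (?A * K) * (\<integral>\<^sup>+w. ennreal (cmod (1 - herm w v) powr - ?C * ?s w powr - (?t + \<epsilon>)) \<partial>?M)"
      by (rule nn_integral_cmult) (rule measurable_borel_weighted, measurable)
    also have "\<dots> \<le> ennreal (?A * K) * ennreal (K * ?s v powr - (?t - \<epsilon>))"
      by (intro mult_left_mono K(2)[OF v]) simp
    also have "\<dots> = ennreal ((?A * K) * (K * ?s v powr - (?t - \<epsilon>)))"
      using K(1) by (subst ennreal_mult) auto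
    also have "(?A * K) * (K * ?s v powr - (?t - \<epsilon>)) = (2 powr (2 * \<epsilon>) * K * K * \<delta> powr \<epsilon>) * (?s v powr - \<epsilon> * ?s v powr - (?t - \<epsilon>))"
      by (simp only: mult_ac)
    also have "?s v powr - \<epsilon> * ?s v powr - (?t - \<epsilon>) = schur_weight \<alpha> v"
      unfolding schur_weight_def by (subst powr_add[symmetric]) (simp add: algebra_simps)
    finally show "(\<integral>\<^sup>+u. indicator {u. \<epsilon> = 0 \<or> far \<delta> v u} u * (abs_kernel2 \<alpha> (\<lambda>_. 1) v u * ennreal (schur_weight \<alpha> u)) \<partial>?M)
      \<le> ennreal (2 powr (2 * \<epsilon>) * K * K * \<delta> powr \<epsilon>) * ennreal (schur_weight \<alpha> v)"
      using K(1) schur_weight_pos[OF v, of \<alpha>] by (simp add: ennreal_mult)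
  qed
qed

lemma schur_row:
  assumes \<alpha>: "\<alpha> > -1"
  shows "\<exists>K>0. \<forall>v :: complex ^ 'n. norm v < 1 \<longrightarrow>
    (\<integral>\<^sup>+u. abs_kernel2 \<alpha> (\<lambda>_. 1) v u * ennreal (schur_weight \<alpha> u) \<partial>weighted_measure \<alpha>)
      \<le> ennreal K * ennreal (schur_weight \<alpha> v)"
proof -
  obtain K where K: "K > 0" "\<And>(\<delta>::real) v :: complex ^ 'n. \<delta> > 0 \<Longrightarrow> norm v < 1 \<Longrightarrow>
    (\<integral>\<^sup>+u. indicator {u. (0::real) = 0 \<or> far \<delta> v u} u * (abs_kernel2 \<alpha> (\<lambda>_. 1) v u * ennreal (schur_weight \<alpha> u)) \<partial>weighted_measure \<alpha>)
      \<le> ennreal (K * \<delta> powr 0) * ennreal (schur_weight \<alpha> v)"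
    using schur_far[OF \<alpha>, of 0] \<alpha> by auto
  show ?thesis using K(1) K(2)[of 1] by (intro exI[of _ K]) auto
qed

lemma abs_kernel2_commute: "abs_kernel2 \<alpha> g v u = abs_kernel2 \<alpha> g u v"
  by (simp add: abs_kernel2_def mult.commute)

section \<open>Bochner integration in sequence and operator spaces\<close>

lemma coord_add: "coord (x + y) i = coord x i + coord y i" by (simp add: plus_ell2.rep_eq)
lemma coord_diff: "coord (x - y) i = coord x i - coord y i" by (simp add: minus_ell2.rep_eq)
lemma coord_0 [simp]: "coord 0 i = 0" by (simp add: zero_ell2.rep_eq)
lemma coord_scaleC: "coord (c *\<^sub>C x) i = c * coord x i" by (simp add: scaleC.rep_eq)
lemma coord_scaleR: "coord (r *\<^sub>R x) i = r *\<^sub>R coord x i"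
  by (simp add: scaleR_ell2_def coord_scaleC scaleR_conv_of_real)
lemma ell2_eqI: "(\<And>i. coord x i = coord y i) \<Longrightarrow> x = y"
  by (simp add: coord_inject[symmetric] fun_eq_iff)

lemma bounded_linear_coord: "bounded_linear (\<lambda>x. coord x i)"
  by (rule bounded_linear_intro[of _ 1]) (auto simp: coord_add coord_scaleR coord_le_norm_ell2)

lemma norm_scaleC: "norm (c *\<^sub>C x) = cmod c * norm x"
proof -
  have "(norm (c *\<^sub>C x))\<^sup>2 = (cmod c * norm x)\<^sup>2"
    unfolding norm_ell2_sq power_mult_distrib coord_scaleC norm_mult
    by (rule suminf_mult[OF summable_coord])
  then show ?thesis by (rule power2_eq_imp_eq) auto
qed

lemma bounded_bilinear_scaleC: "bounded_bilinear (*\<^sub>C)"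
proof (rule bounded_bilinear.intro)
  show "\<exists>K. \<forall>a b. norm (a *\<^sub>C b) \<le> norm a * norm b * K"
    by (rule exI[of _ 1]) (simp add: norm_scaleC)
qed (auto intro!: ell2_eqI simp: coord_scaleC coord_add coord_scaleR algebra_simps scaleR_conv_of_real)

interpretation scaleC: bounded_bilinear "(*\<^sub>C)" by (rule bounded_bilinear_scaleC)

lemma scaleC_scaleC: "a *\<^sub>C b *\<^sub>C x = (a * b) *\<^sub>C x" by (rule ell2_eqI) (simp add: coord_scaleC)
lemma scaleC_1 [simp]: "1 *\<^sub>C x = x" by (rule ell2_eqI) (simp add: coord_scaleC)

text \<open>Finite lists with entries in a countable dense set of complex numbers. Separability
  makes l^2 second countable, so that the ordinary theory of measurable and integrable functions
  applies to functions with values in it.\<close>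

lemma ell2_countable_dense: "\<exists>D :: ell2 set. countable D \<and> (\<forall>x e. 0 < e \<longrightarrow> (\<exists>y\<in>D. dist x y < e))"
proof -
  obtain Q :: "complex set" where Q: "countable Q" "\<And>X. open X \<Longrightarrow> X \<noteq> {} \<Longrightarrow> \<exists>q\<in>Q. q \<in> X"
    by (rule countable_dense_setE) blast
  define vec :: "complex list \<Rightarrow> ell2" where "vec l = Abs_ell2 (\<lambda>i. if i < length l then l ! i else 0)" for l
  have cv: "coord (vec l) i = (if i < length l then l ! i else 0)" for l i
  proof -
    have "summable (\<lambda>i. (cmod (if i < length l then l ! i else 0))\<^sup>2)"
      by (rule summable_finite[of "{..<length l}"]) auto
    then show ?thesis by (simp add: vec_def Abs_ell2_inverse)
  qed
  show ?thesis
  proof (intro exI[of _ "vec ` lists Q"] conjI allI impI)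
    show "countable (vec ` lists Q)" using Q(1) by simp
    fix x :: ell2 and e :: real assume e: "0 < e"
    let ?f = "\<lambda>i. (cmod (coord x i))\<^sup>2"
    obtain N where N: "norm (\<Sum>i. ?f (i + N)) < e\<^sup>2 / 4"
      using suminf_exist_split[of "e\<^sup>2 / 4" ?f] summable_coord[of x] e by auto
    \<comment> \<open>Makes (N + 1) r = e/2, so the first N coordinates contribute at most e^2/4 to
      the squared distance; the tail contributes less than e^2/4.\<close>
    define r where "r = e / (2 * (real N + 1))"
    have r: "r > 0" using e by (simp add: r_def)
    have "\<exists>q\<in>Q. q \<in> ball (coord x i) r" for i using Q(2)[of "ball (coord x i) r"] r by auto
    then obtain q where q: "\<And>i. q i \<in> Q" "\<And>i. q i \<in> ball (coord x i) r" by metis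
    let ?l = "map q [0..<N]"
    have "(norm (x - vec ?l))\<^sup>2 = (\<Sum>i. (cmod (coord (x - vec ?l) i))\<^sup>2)" by (rule norm_ell2_sq)
    also have "\<dots> = (\<Sum>i. (cmod (coord (x - vec ?l) (i + N)))\<^sup>2) + (\<Sum>i<N. (cmod (coord (x - vec ?l) i))\<^sup>2)"
      by (rule suminf_split_initial_segment[OF summable_coord])
    also have "(\<Sum>i. (cmod (coord (x - vec ?l) (i + N)))\<^sup>2) = (\<Sum>i. ?f (i + N))"
      by (simp add: coord_diff cv)
    also have "(\<Sum>i<N. (cmod (coord (x - vec ?l) i))\<^sup>2) \<le> (\<Sum>i<N. r\<^sup>2)"
      using q(2) by (intro sum_mono power_mono) (auto simp: coord_diff cv dist_norm less_imp_le)
    also have "(\<Sum>i<N. r\<^sup>2) \<le> e\<^sup>2 / 4"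
    proof -
      have "real N * r\<^sup>2 \<le> (real N + 1)\<^sup>2 * r\<^sup>2"
        by (intro mult_right_mono) (auto simp: power2_eq_square algebra_simps)
      also have "\<dots> = ((real N + 1) * r)\<^sup>2" by (simp add: power_mult_distrib)
      also have "(real N + 1) * r = e / 2" by (simp add: r_def field_simps)
      also have "(e / 2)\<^sup>2 = e\<^sup>2 / 4" by (simp add: power_divide)
      finally show ?thesis by simp
    qed
    finally have "(norm (x - vec ?l))\<^sup>2 \<le> norm (\<Sum>i. ?f (i + N)) + e\<^sup>2 / 4" by simp
    also have "\<dots> < e\<^sup>2" using N e by (simp add: field_simps)
    finally have "dist x (vec ?l) < e" unfolding dist_norm using e by (simp add: power_less_imp_less_base)
    moreover have "vec ?l \<in> vec ` lists Q" using q(1) by (intro imageI) (auto simp: in_lists_conv_set)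
    ultimately show "\<exists>y\<in>vec ` lists Q. dist x y < e" by blast
  qed
qed

instance ell2 :: second_countable_topology
proof
  obtain D :: "ell2 set" where D: "countable D" "\<And>x e. 0 < e \<Longrightarrow> \<exists>y\<in>D. dist x y < e"
    using ell2_countable_dense by blast
  let ?B = "(\<lambda>(y, n). ball y (1 / real (Suc n))) ` (D \<times> (UNIV :: nat set))"
  have "topological_basis ?B"
  proof (rule topological_basisI)
    show "open b" if "b \<in> ?B" for b using that by auto
    fix O' :: "ell2 set" and x assume "open O'" "x \<in> O'"
    then obtain e where e: "e > 0" "ball x e \<subseteq> O'" by (meson open_contains_ball)
    obtain n where n: "1 / real (Suc n) < e / 2" using e(1) by (metis half_gt_zero nat_approx_posE)
    obtain y where y: "y \<in> D" "dist x y < 1 / real (Suc n)" using D(2)[of "1 / real (Suc n)" x] by auto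
    have "ball y (1 / real (Suc n)) \<subseteq> ball x e"
    proof
      fix z assume "z \<in> ball y (1 / real (Suc n))"
      then have "dist x z < e" using dist_triangle[of x z y] y n by simp
      then show "z \<in> ball x e" by simp
    qed
    then show "\<exists>b\<in>?B. x \<in> b \<and> b \<subseteq> O'"
      using y e by (intro bexI[of _ "ball y (1 / real (Suc n))"]) (auto simp: dist_commute)
  qed
  then show "\<exists>B :: ell2 set set. countable B \<and> open = generate_topology B"
    using D(1) by (intro exI[of _ ?B]) (auto intro: topological_basis_imp_subbasis)
qed

section \<open>Bochner integrals in normed spaces of points\<close>

locale normed_nspace =
  fixes E :: "'v::real_vector nspace"
  assumes pts_0: "0 \<in> pts E"
    and pts_add: "\<And>x y. x \<in> pts E \<Longrightarrow> y \<in> pts E \<Longrightarrow> x + y \<in> pts E"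
    and pts_scaleR: "\<And>r x. x \<in> pts E \<Longrightarrow> r *\<^sub>R x \<in> pts E"
    and nrm_nonneg: "\<And>x. x \<in> pts E \<Longrightarrow> 0 \<le> nrm E x"
    and nrm_add: "\<And>x y. x \<in> pts E \<Longrightarrow> y \<in> pts E \<Longrightarrow> nrm E (x + y) \<le> nrm E x + nrm E y"
    and nrm_scaleR: "\<And>r x. x \<in> pts E \<Longrightarrow> nrm E (r *\<^sub>R x) = \<bar>r\<bar> * nrm E x"
    and nrm_eq_0: "\<And>x. x \<in> pts E \<Longrightarrow> nrm E x = 0 \<Longrightarrow> x = 0"
begin

lemma nrm_0: "nrm E 0 = 0" using nrm_scaleR[OF pts_0, of 0] by simp
lemma pts_diff: "x \<in> pts E \<Longrightarrow> y \<in> pts E \<Longrightarrow> x - y \<in> pts E"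
  using pts_add[of x "(-1) *\<^sub>R y"] pts_scaleR[of y "-1"] by simp
lemma nrm_minus: "x \<in> pts E \<Longrightarrow> nrm E (- x) = nrm E x" using nrm_scaleR[of x "-1"] by simp
lemma nrm_diff_commute: "x \<in> pts E \<Longrightarrow> y \<in> pts E \<Longrightarrow> nrm E (x - y) = nrm E (y - x)"
  using nrm_minus[OF pts_diff, of x y] by simp
lemma nrm_triangle: "x \<in> pts E \<Longrightarrow> y \<in> pts E \<Longrightarrow> z \<in> pts E \<Longrightarrow> nrm E (x - z) \<le> nrm E (x - y) + nrm E (y - z)"
  using nrm_add[OF pts_diff pts_diff, of x y y z] by simp
lemma nrm_triangle': "x \<in> pts E \<Longrightarrow> y \<in> pts E \<Longrightarrow> \<bar>nrm E x - nrm E y\<bar> \<le> nrm E (x - y)"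
  using nrm_triangle[of x y 0] nrm_triangle[of y x 0] nrm_diff_commute[of x y] pts_0 by simp
lemma pts_sum: "(\<And>i. i \<in> I \<Longrightarrow> f i \<in> pts E) \<Longrightarrow> sum f I \<in> pts E"
  by (induction I rule: infinite_finite_induct) (auto intro: pts_0 pts_add)
lemma nrm_sum: "(\<And>i. i \<in> I \<Longrightarrow> f i \<in> pts E) \<Longrightarrow> nrm E (sum f I) \<le> (\<Sum>i\<in>I. nrm E (f i))"
proof (induction I rule: infinite_finite_induct)
  case (insert x F)
  then show ?case using nrm_add[of "f x" "sum f F"] pts_sum[of F f] by fastforce
qed (auto simp: nrm_0)

lemma simple_integral_pts:
  assumes "s \<in> space M \<rightarrow> pts E"
  shows "Bochner_Integration.simple_bochner_integral M s \<in> pts E"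
  unfolding simple_bochner_integral_def using assms by (intro pts_sum pts_scaleR) auto

lemma simple_integral_bound:
  assumes s: "Bochner_Integration.simple_bochner_integrable M s" "s \<in> space M \<rightarrow> pts E"
  shows "ennreal (nrm E (Bochner_Integration.simple_bochner_integral M s)) \<le> (\<integral>\<^sup>+x. ennreal (nrm E (s x)) \<partial>M)"
proof -
  have sf: "simple_function M s" using s(1) by (auto elim: simple_bochner_integrable.cases)
  \<comment> \<open>\<open>nrm E\<close> carries no sign outside \<open>pts E\<close>, so the norm
    of s is set to 0 off the space before it is treated as a nonnegative function.\<close>
  define t where "t x = (if x \<in> space M then nrm E (s x) else 0)" for x
  have st: "Bochner_Integration.simple_bochner_integrable M (\<lambda>x. nrm E (s x))"
    using simple_bochner_integrable_compose2[of "\<lambda>x y. nrm E x", OF nrm_0 s(1) s(1)] .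
  have tt: "Bochner_Integration.simple_bochner_integrable M t"
  proof -
    have "simple_function M t" using st by (auto elim!: simple_bochner_integrable.cases simp: t_def cong: simple_function_cong)
    moreover have "{y \<in> space M. t y \<noteq> 0} = {y \<in> space M. nrm E (s y) \<noteq> 0}" by (auto simp: t_def)
    ultimately show ?thesis using st by (auto elim!: simple_bochner_integrable.cases intro!: simple_bochner_integrable.intros)
  qed
  have "nrm E (Bochner_Integration.simple_bochner_integral M s) \<le> (\<Sum>y\<in>s ` space M. nrm E (measure M {x \<in> space M. s x = y} *\<^sub>R y))"
    unfolding simple_bochner_integral_def using s(2) by (intro nrm_sum pts_scaleR) auto
  also have "\<dots> = (\<Sum>y\<in>s ` space M. measure M {x \<in> space M. s x = y} *\<^sub>R nrm E y)"
    using s(2) by (intro sum.cong) (auto simp: nrm_scaleR Pi_iff)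
  also have "\<dots> = Bochner_Integration.simple_bochner_integral M (\<lambda>x. nrm E (s x))"
    using s(1) by (intro simple_bochner_integral_partition[symmetric])
       (auto intro: st elim: simple_bochner_integrable.cases)
  also have "\<dots> = Bochner_Integration.simple_bochner_integral M t"
    unfolding simple_bochner_integral_def by (intro sum.cong arg_cong2[where f = scaleR] arg_cong[of _ _ "measure M"]) (auto simp: t_def)
  finally have "ennreal (nrm E (Bochner_Integration.simple_bochner_integral M s)) \<le> ennreal (Bochner_Integration.simple_bochner_integral M t)" by (rule ennreal_leI)
  also have "\<dots> = (\<integral>\<^sup>+x. t x \<partial>M)"
    by (rule simple_bochner_integral_eq_nn_integral[OF tt]) (use s(2) nrm_nonneg in \<open>auto simp: t_def Pi_iff\<close>)
  also have "\<dots> = (\<integral>\<^sup>+x. ennreal (nrm E (s x)) \<partial>M)" by (rule nn_integral_cong) (simp add: t_def)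
  finally show ?thesis .
qed

end

lemma normed_nspace_type_space: "normed_nspace (type_space :: 'v::real_normed_vector nspace)"
  by standard (auto simp: type_space_def norm_triangle_ineq)

text \<open>Completeness of \<open>weighted_measure\<close> makes \<open>\<parallel>f - s\<parallel>\<close> measurable, which the definition of the
  Bochner integral does not provide by itself.\<close>

lemma (in normed_nspace) measurable_nrm_diff:
  fixes f :: "complex ^ 'n \<Rightarrow> 'v"
  assumes \<alpha>: "\<alpha> > -1" and f: "strongly_measurable E (weighted_measure \<alpha>) f"
    and s: "simple_function (weighted_measure \<alpha>) s" "s \<in> space (weighted_measure \<alpha>) \<rightarrow> pts E"
  shows "(\<lambda>x. nrm E (f x - s x)) \<in> borel_measurable (weighted_measure \<alpha>)"
proof -
  let ?M = "weighted_measure \<alpha> :: (complex ^ 'n) measure"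
  obtain t where t: "\<And>i. simple_function ?M (t i)" "\<And>i. t i \<in> space ?M \<rightarrow> pts E"
    "AE x in ?M. (\<lambda>i::nat. nrm E (f x - t i x)) \<longlonglongrightarrow> 0" and fp: "f \<in> space ?M \<rightarrow> pts E"
    using f unfolding strongly_measurable_def by blast
  show ?thesis
  proof (rule borel_measurable_weighted_AE_limit[OF \<alpha>])
    show "(\<lambda>x. nrm E (t i x - s x)) \<in> borel_measurable ?M" for i
      by (intro borel_measurable_simple_function simple_function_compose2[OF t(1) s(1)])
    show "AE x in ?M. (\<lambda>i. nrm E (t i x - s x)) \<longlonglongrightarrow> nrm E (f x - s x)"
      using t(3) AE_space
    proof eventually_elim
      case (elim x)
      note p = funcset_mem[OF fp elim(2)] funcset_mem[OF s(2) elim(2)] funcset_mem[OF t(2) elim(2)]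
      have "(\<lambda>i. nrm E (t i x - s x) - nrm E (f x - s x)) \<longlonglongrightarrow> 0"
      proof (rule tendsto_0_le[OF elim(1), of _ 1])
        show "\<forall>\<^sub>F i in sequentially. norm (nrm E (t i x - s x) - nrm E (f x - s x)) \<le> norm (nrm E (f x - t i x)) * 1"
        proof (intro always_eventually allI)
          fix i
          have "norm (nrm E (t i x - s x) - nrm E (f x - s x)) \<le> nrm E ((t i x - s x) - (f x - s x))"
            using nrm_triangle'[OF pts_diff[OF p(3) p(2)] pts_diff[OF p(1,2)], of i] by simp
          also have "\<dots> = nrm E (f x - t i x)" using nrm_diff_commute[OF p(3) p(1)] by simp
          finally show "norm (nrm E (t i x - s x) - nrm E (f x - s x)) \<le> norm (nrm E (f x - t i x)) * 1" by simp
        qed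
      qed
      then show ?case by (simp add: LIM_zero_iff)
    qed
  qed
qed

text \<open>Two approximating sequences are compared in L^1 through f. Splitting the integral of the
  sum of the two errors is where measurability of these errors is required.\<close>

lemma (in normed_nspace) has_Bochner_integral_unique:
  fixes f :: "complex ^ 'n \<Rightarrow> 'v"
  assumes \<alpha>: "\<alpha> > -1" and v: "has_Bochner_integral E (weighted_measure \<alpha>) f v" and w: "has_Bochner_integral E (weighted_measure \<alpha>) f w"
  shows "v = w"
proof -
  let ?M = "weighted_measure \<alpha> :: (complex ^ 'n) measure"
  obtain s where s: "\<And>i. Bochner_Integration.simple_bochner_integrable ?M (s i)" "\<And>i. s i \<in> space ?M \<rightarrow> pts E"
    "(\<lambda>i::nat. \<integral>\<^sup>+x. ennreal (nrm E (f x - s i x)) \<partial>?M) \<longlonglongrightarrow> 0"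
    "(\<lambda>i. nrm E (Bochner_Integration.simple_bochner_integral ?M (s i) - v)) \<longlonglongrightarrow> 0"
    and f: "strongly_measurable E ?M f" and vp: "v \<in> pts E" using v unfolding has_Bochner_integral_def by blast
  obtain t where t: "\<And>i. Bochner_Integration.simple_bochner_integrable ?M (t i)" "\<And>i. t i \<in> space ?M \<rightarrow> pts E"
    "(\<lambda>i::nat. \<integral>\<^sup>+x. ennreal (nrm E (f x - t i x)) \<partial>?M) \<longlonglongrightarrow> 0"
    "(\<lambda>i. nrm E (Bochner_Integration.simple_bochner_integral ?M (t i) - w)) \<longlonglongrightarrow> 0" and wp: "w \<in> pts E" using w unfolding has_Bochner_integral_def by blast
  have fp: "f \<in> space ?M \<rightarrow> pts E" using f by (simp add: strongly_measurable_def)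
  let ?I = "Bochner_Integration.simple_bochner_integral ?M"
  have sf: "simple_function ?M (s i)" "simple_function ?M (t i)" for i
    using s(1) t(1) by (auto elim: simple_bochner_integrable.cases)
  have Ip: "?I (s i) \<in> pts E" "?I (t i) \<in> pts E" for i using simple_integral_pts[OF s(2)] simple_integral_pts[OF t(2)] by auto
  have bound: "ennreal (nrm E (v - w)) \<le> ennreal (nrm E (?I (s i) - v)) + ((\<integral>\<^sup>+x. ennreal (nrm E (f x - s i x)) \<partial>?M) + (\<integral>\<^sup>+x. ennreal (nrm E (f x - t i x)) \<partial>?M)) + ennreal (nrm E (?I (t i) - w))" for i
  proof -
    have "nrm E (v - w) \<le> nrm E (v - ?I (s i)) + (nrm E (?I (s i) - ?I (t i)) + nrm E (?I (t i) - w))"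
      using nrm_triangle[OF vp Ip(1) wp, of i] nrm_triangle[OF Ip(1) Ip(2) wp, of i i] by linarith
    also have "nrm E (v - ?I (s i)) = nrm E (?I (s i) - v)" by (rule nrm_diff_commute[OF vp Ip(1)])
    finally have "ennreal (nrm E (v - w)) \<le> ennreal (nrm E (?I (s i) - v) + (nrm E (?I (s i) - ?I (t i)) + nrm E (?I (t i) - w)))" by (rule ennreal_leI)
    also have "\<dots> = ennreal (nrm E (?I (s i) - v)) + (ennreal (nrm E (?I (s i) - ?I (t i))) + ennreal (nrm E (?I (t i) - w)))"
      using nrm_nonneg[OF pts_diff[OF Ip(1) vp]] nrm_nonneg[OF pts_diff[OF Ip(1) Ip(2)]] nrm_nonneg[OF pts_diff[OF Ip(2) wp]] by simp
    also have "ennreal (nrm E (?I (s i) - ?I (t i))) \<le> (\<integral>\<^sup>+x. ennreal (nrm E (s i x - t i x)) \<partial>?M)"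
    proof -
      have "Bochner_Integration.simple_bochner_integrable ?M (\<lambda>x. s i x - t i x)"
        by (rule simple_bochner_integrable_compose2[OF _ s(1) t(1)]) simp
      from simple_integral_bound[OF this] show ?thesis
        using s(2) t(2) by (simp add: simple_bochner_integral_diff[OF s(1) t(1)] Pi_iff pts_diff)
    qed
    also have "(\<integral>\<^sup>+x. ennreal (nrm E (s i x - t i x)) \<partial>?M) \<le> (\<integral>\<^sup>+x. ennreal (nrm E (f x - s i x)) + ennreal (nrm E (f x - t i x)) \<partial>?M)"
    proof (rule nn_integral_mono)
      fix x assume x: "x \<in> space ?M"
      note p = funcset_mem[OF fp x] funcset_mem[OF s(2) x, of i] funcset_mem[OF t(2) x, of i]
      have "nrm E (s i x - t i x) \<le> nrm E (f x - s i x) + nrm E (f x - t i x)"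
        using nrm_triangle[OF p(2,1,3)] nrm_diff_commute[OF p(1,2)] by simp
      then show "ennreal (nrm E (s i x - t i x)) \<le> ennreal (nrm E (f x - s i x)) + ennreal (nrm E (f x - t i x))"
        using nrm_nonneg[OF pts_diff[OF p(1,2)]] nrm_nonneg[OF pts_diff[OF p(1,3)]]
        by (metis ennreal_leI ennreal_plus)
    qed
    also have "\<dots> = (\<integral>\<^sup>+x. ennreal (nrm E (f x - s i x)) \<partial>?M) + (\<integral>\<^sup>+x. ennreal (nrm E (f x - t i x)) \<partial>?M)"
      by (intro nn_integral_add measurable_compose[OF measurable_nrm_diff[OF \<alpha> f] measurable_ennreal] sf s(2) t(2))
    finally show ?thesis by (simp add: add_mono add.assoc)
  qed
  have "(\<lambda>i. ennreal (nrm E (?I (s i) - v)) + ((\<integral>\<^sup>+x. ennreal (nrm E (f x - s i x)) \<partial>?M) + (\<integral>\<^sup>+x. ennreal (nrm E (f x - t i x)) \<partial>?M)) + ennreal (nrm E (?I (t i) - w))) \<longlonglongrightarrow> ennreal 0 + (0 + 0) + ennreal 0"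
    by (intro tendsto_add tendsto_ennrealI s t)
  then have "ennreal (nrm E (v - w)) \<le> ennreal 0 + (0 + 0) + ennreal 0"
    by (rule LIMSEQ_le_const) (use bound in auto)
  then have "nrm E (v - w) = 0" using nrm_nonneg[OF pts_diff[OF vp wp]] by (simp add: ennreal_eq_0_iff)
  then show ?thesis using nrm_eq_0[OF pts_diff[OF vp wp]] by simp
qed

lemma (in normed_nspace) Bochner_integral_eq:
  "\<alpha> > -1 \<Longrightarrow> has_Bochner_integral E (weighted_measure \<alpha> :: (complex ^ 'n) measure) f v \<Longrightarrow> Bochner_integral E (weighted_measure \<alpha>) f = v"
  unfolding Bochner_integral_def by (rule the_equality) (auto intro: has_Bochner_integral_unique)

lemma simple_function_finite_integrable:
  fixes s :: "complex ^ 'n \<Rightarrow> 'b::real_vector"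
  assumes "\<alpha> > -1" and s: "simple_function (weighted_measure \<alpha>) s"
  shows "Bochner_Integration.simple_bochner_integrable (weighted_measure \<alpha>) s"
proof -
  interpret finite_measure "weighted_measure \<alpha> :: (complex ^ 'n) measure" by (rule finite_measure_weighted[OF assms(1)])
  show ?thesis using emeasure_finite s by (intro simple_bochner_integrable.intros) auto
qed

text \<open>Truncated simple functions converge to f in L^1 by dominated convergence, so their
  integrals form a Cauchy sequence. Completeness of the space enters here only, as a premise rather
  than as part of the locale.\<close>

lemma (in normed_nspace) has_Bochner_integral_exists:
  fixes f :: "complex ^ 'n \<Rightarrow> 'v"
  assumes \<alpha>: "\<alpha> > -1" and f: "strongly_measurable E (weighted_measure \<alpha>) f"
    and fin: "(\<integral>\<^sup>+x. ennreal (nrm E (f x)) \<partial>weighted_measure \<alpha>) < \<infinity>"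
    and complete: "\<And>X :: nat \<Rightarrow> 'v. (\<And>i. X i \<in> pts E) \<Longrightarrow> (\<And>\<epsilon>. \<epsilon> > 0 \<Longrightarrow> \<exists>N. \<forall>i\<ge>N. \<forall>j\<ge>N. nrm E (X i - X j) < \<epsilon>) \<Longrightarrow>
       \<exists>v\<in>pts E. (\<lambda>i. nrm E (X i - v)) \<longlonglongrightarrow> 0"
  shows "\<exists>v. has_Bochner_integral E (weighted_measure \<alpha>) f v"
proof -
  let ?M = "weighted_measure \<alpha> :: (complex ^ 'n) measure"
  obtain s where s: "\<And>i. simple_function ?M (s i)" "\<And>i. s i \<in> space ?M \<rightarrow> pts E"
    "AE x in ?M. (\<lambda>i::nat. nrm E (f x - s i x)) \<longlonglongrightarrow> 0" and fp: "f \<in> space ?M \<rightarrow> pts E"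
    using f unfolding strongly_measurable_def by blast
  have fm: "(\<lambda>x. nrm E (f x)) \<in> borel_measurable ?M"
    using measurable_nrm_diff[OF \<alpha> f, of "\<lambda>_. 0"] pts_0 by simp
  have sm: "(\<lambda>x. nrm E (s i x)) \<in> borel_measurable ?M" for i
    using borel_measurable_simple_function[OF simple_function_compose1[OF s(1)]] .
  \<comment> \<open>The cutoff keeps the approximants below 2 ||f||, hence the errors below 3 ||f||,
    the dominating function. Where f is nonzero the cutoff is eventually inactive; where f = 0 it
    forces the approximant to be 0.\<close>
  define t where "t i x = (if nrm E (s i x) \<le> 2 * nrm E (f x) then s i x else 0)" for i x
  have Am: "{x \<in> space ?M. nrm E (s i x) \<le> 2 * nrm E (f x)} \<in> sets ?M" for i
    using fm sm[of i] by measurable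
  have t1: "simple_function ?M (t i)" for i
    unfolding t_def by (rule simple_function_If[OF s(1) simple_function_const Am])
  have t2: "t i \<in> space ?M \<rightarrow> pts E" for i using s(2) pts_0 by (auto simp: t_def Pi_iff)
  have t3: "AE x in ?M. (\<lambda>i. nrm E (f x - t i x)) \<longlonglongrightarrow> 0"
    using s(3) AE_space
  proof eventually_elim
    case (elim x)
    note p = funcset_mem[OF fp elim(2)] funcset_mem[OF s(2) elim(2)]
    show ?case
    proof (cases "nrm E (f x) = 0")
      case True
      then have "f x = 0" using nrm_eq_0 p by blast
      have "t i x = 0" for i
        using True nrm_eq_0[OF p(2)] nrm_nonneg[OF p(2)] by (auto simp: t_def intro: antisym)
      then show ?thesis using \<open>f x = 0\<close> by (simp add: nrm_0)
    next
      case False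
      then have pos: "nrm E (f x) > 0" using nrm_nonneg[OF p(1)] by simp
      have "\<forall>\<^sub>F i in sequentially. nrm E (f x - s i x) < nrm E (f x)" using elim(1) pos by (rule order_tendstoD)
      then have "\<forall>\<^sub>F i in sequentially. nrm E (f x - s i x) = nrm E (f x - t i x)"
      proof eventually_elim
        case (elim i)
        have "nrm E (s i x) \<le> 2 * nrm E (f x)" using nrm_triangle'[OF p(1) p(2), of i] elim by linarith
        then show ?case by (simp add: t_def)
      qed
      then show ?thesis by (rule Lim_transform_eventually[OF elim(1)])
    qed
  qed
  have lim: "(\<lambda>i. \<integral>\<^sup>+x. ennreal (nrm E (f x - t i x)) \<partial>?M) \<longlonglongrightarrow> (\<integral>\<^sup>+x. 0 \<partial>?M)"
  proof (rule nn_integral_dominated_convergence[where w = "\<lambda>x. ennreal (3 * nrm E (f x))"])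
    show "(\<lambda>x. ennreal (nrm E (f x - t i x))) \<in> borel_measurable ?M" for i
      by (rule measurable_compose[OF measurable_nrm_diff[OF \<alpha> f t1 t2] measurable_ennreal])
    show "(\<lambda>x. ennreal (3 * nrm E (f x))) \<in> borel_measurable ?M" using fm by measurable
    show "AE x in ?M. ennreal (nrm E (f x - t i x)) \<le> ennreal (3 * nrm E (f x))" for i
    proof (intro AE_I2 ennreal_leI)
      fix x assume x: "x \<in> space ?M"
      note p = funcset_mem[OF fp x] funcset_mem[OF t2 x, of i]
      have "nrm E (t i x) \<le> 2 * nrm E (f x)" using nrm_nonneg[OF p(1)] by (auto simp: t_def nrm_0)
      moreover have "nrm E (f x - t i x) \<le> nrm E (f x) + nrm E (t i x)"
        using nrm_triangle[OF p(1) pts_0 p(2)] nrm_minus[OF p(2)] by simp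
      ultimately show "nrm E (f x - t i x) \<le> 3 * nrm E (f x)" by simp
    qed
    have "(\<integral>\<^sup>+x. ennreal (3 * nrm E (f x)) \<partial>?M) = 3 * (\<integral>\<^sup>+x. ennreal (nrm E (f x)) \<partial>?M)"
      by (subst nn_integral_cmult[symmetric]) (use fm in \<open>auto simp: ennreal_mult'\<close>)
    also have "\<dots> < \<infinity>" using fin by (simp add: ennreal_mult_less_top)
    finally show "(\<integral>\<^sup>+x. ennreal (3 * nrm E (f x)) \<partial>?M) < \<infinity>" .
    show "AE x in ?M. (\<lambda>i. ennreal (nrm E (f x - t i x))) \<longlonglongrightarrow> 0"
      using t3 by eventually_elim (use tendsto_ennrealI in fastforce)
  qed simp
  let ?I = "Bochner_Integration.simple_bochner_integral ?M"
  have ti: "Bochner_Integration.simple_bochner_integrable ?M (t i)" for i by (rule simple_function_finite_integrable[OF \<alpha> t1])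
  have Ip: "?I (t i) \<in> pts E" for i by (rule simple_integral_pts[OF t2])
  have d: "ennreal (nrm E (?I (t i) - ?I (t j))) \<le> (\<integral>\<^sup>+x. ennreal (nrm E (f x - t i x)) \<partial>?M) + (\<integral>\<^sup>+x. ennreal (nrm E (f x - t j x)) \<partial>?M)" for i j
  proof -
    have "Bochner_Integration.simple_bochner_integrable ?M (\<lambda>x. t i x - t j x)"
      by (rule simple_bochner_integrable_compose2[OF _ ti ti]) simp
    from simple_integral_bound[OF this] have "ennreal (nrm E (?I (t i) - ?I (t j))) \<le> (\<integral>\<^sup>+x. ennreal (nrm E (t i x - t j x)) \<partial>?M)"
      using t2 by (simp add: simple_bochner_integral_diff[OF ti ti] Pi_iff pts_diff)
    also have "\<dots> \<le> (\<integral>\<^sup>+x. ennreal (nrm E (f x - t i x)) + ennreal (nrm E (f x - t j x)) \<partial>?M)"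
    proof (rule nn_integral_mono)
      fix x assume x: "x \<in> space ?M"
      note p = funcset_mem[OF fp x] funcset_mem[OF t2 x, of i] funcset_mem[OF t2 x, of j]
      have "nrm E (t i x - t j x) \<le> nrm E (f x - t i x) + nrm E (f x - t j x)"
        using nrm_triangle[OF p(2,1,3)] nrm_diff_commute[OF p(1,2)] by simp
      then show "ennreal (nrm E (t i x - t j x)) \<le> ennreal (nrm E (f x - t i x)) + ennreal (nrm E (f x - t j x))"
        using nrm_nonneg[OF pts_diff[OF p(1,2)]] nrm_nonneg[OF pts_diff[OF p(1,3)]]
        by (metis ennreal_leI ennreal_plus)
    qed
    also have "\<dots> = (\<integral>\<^sup>+x. ennreal (nrm E (f x - t i x)) \<partial>?M) + (\<integral>\<^sup>+x. ennreal (nrm E (f x - t j x)) \<partial>?M)"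
      by (intro nn_integral_add measurable_compose[OF measurable_nrm_diff[OF \<alpha> f t1 t2] measurable_ennreal])
    finally show ?thesis .
  qed
  have "\<exists>v\<in>pts E. (\<lambda>i. nrm E (?I (t i) - v)) \<longlonglongrightarrow> 0"
  proof (rule complete[OF Ip])
    fix \<epsilon> :: real assume e: "\<epsilon> > 0"
    have "\<forall>\<^sub>F i in sequentially. (\<integral>\<^sup>+x. ennreal (nrm E (f x - t i x)) \<partial>?M) < ennreal (\<epsilon> / 2)"
      using lim e by (intro order_tendstoD(2)) auto
    then obtain N where N: "\<And>i. i \<ge> N \<Longrightarrow> (\<integral>\<^sup>+x. ennreal (nrm E (f x - t i x)) \<partial>?M) < ennreal (\<epsilon> / 2)"
      by (auto simp: eventually_sequentially)
    show "\<exists>N. \<forall>i\<ge>N. \<forall>j\<ge>N. nrm E (?I (t i) - ?I (t j)) < \<epsilon>"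
    proof (intro exI[of _ N] allI impI)
      fix i j assume "i \<ge> N" "j \<ge> N"
      then have "ennreal (nrm E (?I (t i) - ?I (t j))) < ennreal (\<epsilon> / 2) + ennreal (\<epsilon> / 2)"
        using d[of i j] N[of i] N[of j] by (meson add_strict_mono le_less_trans)
      also have "\<dots> = ennreal \<epsilon>" using e by (simp flip: ennreal_plus)
      finally show "nrm E (?I (t i) - ?I (t j)) < \<epsilon>" using e by (simp add: ennreal_less_iff nrm_nonneg[OF pts_diff[OF Ip Ip]])
    qed
  qed
  then obtain v where v: "v \<in> pts E" "(\<lambda>i. nrm E (?I (t i) - v)) \<longlonglongrightarrow> 0" by blast
  show ?thesis
    unfolding has_Bochner_integral_def
    using f v ti t2 lim by (intro exI[of _ v] conjI exI[of _ t]) auto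
qed

lemma strongly_measurable_borel:
  fixes f :: "'a \<Rightarrow> 'b::{real_normed_vector, second_countable_topology}"
  assumes f: "f \<in> borel_measurable M"
  shows "strongly_measurable type_space M f"
proof -
  obtain F where F: "\<And>i. simple_function M (F i)" "\<And>x. x \<in> space M \<Longrightarrow> (\<lambda>i. F i x) \<longlonglongrightarrow> f x"
    using borel_measurable_implies_sequence_metric[OF f, of 0] by blast
  have "AE x in M. (\<lambda>i. norm (f x - F i x)) \<longlonglongrightarrow> 0"
  proof (rule AE_I2)
    fix x assume "x \<in> space M"
    then have "(\<lambda>i. norm (F i x - f x)) \<longlonglongrightarrow> 0" using F(2) by (simp add: LIM_zero tendsto_norm_zero)
    then show "(\<lambda>i. norm (f x - F i x)) \<longlonglongrightarrow> 0" by (simp add: norm_minus_commute)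
  qed
  then show ?thesis using F(1) unfolding strongly_measurable_def type_space_def by auto
qed

text \<open>The bridge to the standard integral for separable Banach targets; Toeplitz integrals and
  scalar Berezin transforms are treated through it.\<close>

lemma Bochner_integral_type_space:
  fixes f :: "complex ^ 'n \<Rightarrow> 'b::{banach, second_countable_topology}"
  assumes \<alpha>: "\<alpha> > -1" and f: "integrable (weighted_measure \<alpha>) f"
  shows "Bochner_integral type_space (weighted_measure \<alpha>) f = (LINT x|weighted_measure \<alpha>. f x)"
proof -
  let ?M = "weighted_measure \<alpha> :: (complex ^ 'n) measure"
  interpret normed_nspace "type_space :: 'b nspace" by (rule normed_nspace_type_space)
  have sm: "strongly_measurable type_space ?M f"
    by (rule strongly_measurable_borel[OF borel_measurable_integrable[OF f]])
  have "Bochner_Integration.has_bochner_integral ?M f (LINT x|?M. f x)" by (rule has_bochner_integral_integrable[OF f])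
  then obtain s where s: "\<And>i. Bochner_Integration.simple_bochner_integrable ?M (s i)" "(\<lambda>i::nat. \<integral>\<^sup>+x. norm (f x - s i x) \<partial>?M) \<longlonglongrightarrow> 0"
    "(\<lambda>i. Bochner_Integration.simple_bochner_integral ?M (s i)) \<longlonglongrightarrow> (LINT x|?M. f x)"
    by (auto elim!: has_bochner_integral.cases)
  have "has_Bochner_integral type_space ?M f (LINT x|?M. f x)"
    unfolding has_Bochner_integral_def
    using sm s tendsto_norm_zero[OF LIM_zero[OF s(3)]]
    by (intro conjI exI[of _ s]) (auto simp: type_space_def)
  then show ?thesis by (rule Bochner_integral_eq[OF \<alpha>])
qed

section \<open>The inner product of l^2 and the admissible target spaces\<close>

lemma summable_cinner: "summable (\<lambda>i. coord x i * cnj (coord y i))"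
  by (rule summable_norm_cancel) (use summable_coord_norm_mult[of x y] in \<open>simp add: norm_mult\<close>)

lemma cinner_add: "cinner (x + y) z = cinner x z + cinner y z"
  by (simp add: cinner_def coord_add distrib_right suminf_add summable_cinner)

lemma cinner_scaleC: "cinner (c *\<^sub>C x) z = c * cinner x z"
  unfolding cinner_def coord_scaleC mult.assoc by (rule suminf_mult[OF summable_cinner])

lemma Re_cinner: "Re (cinner x y) = inner x y"
proof -
  have "Re (cinner x y) = (\<Sum>i. Re (coord x i * cnj (coord y i)))"
    unfolding cinner_def by (rule bounded_linear.suminf[OF bounded_linear_Re summable_cinner, symmetric, THEN sym])
  then show ?thesis by (simp add: inner_ell2_def inner_complex_def)
qed

lemma norm_cinner_le: "cmod (cinner x y) \<le> norm x * norm y"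
proof (cases "cinner x y = 0")
  case False
  define u where "u = cnj (sgn (cinner x y))"
  have u: "cmod u = 1" using False by (simp add: u_def norm_sgn)
  have "complex_of_real (cmod (cinner x y)) = cinner (u *\<^sub>C x) y"
    using False by (simp add: cinner_scaleC u_def sgn_eq complex_norm_square field_simps
        flip: complex_norm_square power2_eq_square)
  then have "cmod (cinner x y) = inner (u *\<^sub>C x) y" by (metis Re_cinner Re_complex_of_real)
  also have "\<dots> \<le> norm (u *\<^sub>C x) * norm y" by (rule norm_cauchy_schwarz)
  finally show ?thesis by (simp add: norm_scaleC u)
qed simp

lemma cinner_scaleR: "cinner (r *\<^sub>R x) z = r *\<^sub>R cinner x z"
  by (simp add: scaleR_ell2_def cinner_scaleC scaleR_conv_of_real)

lemma bounded_linear_cinner: "bounded_linear (\<lambda>x. cinner x y)"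
  by (rule bounded_linear_intro[of _ "norm y"]) (auto simp: cinner_add cinner_scaleR norm_cinner_le)

text \<open>The two added properties make operator spaces into the target complete: operators
  converge in the ordinary operator norm because it is dominated, and bounds in the finer norm
  survive the limit by lower semicontinuity.\<close>

locale l2_target = normed_nspace F for F :: "ell2 nspace" +
  assumes norm_le_nrm: "\<And>x. x \<in> pts F \<Longrightarrow> norm x \<le> nrm F x"
    and nrm_lsc: "\<And>X x C. (\<And>i::nat. X i \<in> pts F) \<Longrightarrow> (\<And>i. nrm F (X i) \<le> C) \<Longrightarrow> X \<longlonglongrightarrow> x \<Longrightarrow> x \<in> pts F \<and> nrm F x \<le> C"

text \<open>Lower semicontinuity is Fatou's argument for series: each finite partial sum of the l^1
  norm is continuous in l^2, so the bound C passes to every partial sum of the limit and then to the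
  whole series.\<close>

lemma l2_target_l1_cap_l2: "l2_target (l1_cap_l2_space e)"
proof -
  let ?F = "l1_cap_l2_space e"
  have pts: "x \<in> pts ?F \<longleftrightarrow> summable (\<lambda>i. cmod (cinner x (e i)))" for x
    by (simp add: l1_cap_l2_space_def l1_space_def type_space_def)
  have nrm: "nrm ?F x = max (\<Sum>i. cmod (cinner x (e i))) (norm x)" for x
    by (simp add: l1_cap_l2_space_def l1_space_def type_space_def)
  have s_add: "summable (\<lambda>i. cmod (cinner (x + y) (e i)))"
    if "summable (\<lambda>i. cmod (cinner x (e i)))" "summable (\<lambda>i. cmod (cinner y (e i)))" for x y
    by (rule summable_comparison_test'[OF summable_add[OF that], of 0]) (simp add: cinner_add norm_triangle_ineq)
  have s_scale: "summable (\<lambda>i. cmod (cinner (r *\<^sub>R x) (e i)))" if "summable (\<lambda>i. cmod (cinner x (e i)))" for r x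
    using summable_mult[OF that, of "\<bar>r\<bar>"] by (simp add: cinner_scaleR)
  interpret bl: bounded_linear "\<lambda>x. cinner x (e i)" for i by (rule bounded_linear_cinner)
  show ?thesis
  proof
    show "0 \<in> pts ?F" by (simp add: pts bl.zero)
    fix x y :: ell2 and r :: real assume x: "x \<in> pts ?F"
    show "r *\<^sub>R x \<in> pts ?F" using x by (simp only: pts s_scale)
    show "0 \<le> nrm ?F x" "norm x \<le> nrm ?F x" by (simp_all add: nrm le_max_iff_disj)
    show "nrm ?F x = 0 \<Longrightarrow> x = 0" unfolding nrm by (metis max.cobounded2 norm_le_zero_iff)
    have "(\<Sum>i. cmod (cinner (r *\<^sub>R x) (e i))) = \<bar>r\<bar> * (\<Sum>i. cmod (cinner x (e i)))"
      using suminf_mult[of "\<lambda>i. cmod (cinner x (e i))" "\<bar>r\<bar>"] x by (simp add: cinner_scaleR pts)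
    then show "nrm ?F (r *\<^sub>R x) = \<bar>r\<bar> * nrm ?F x" by (simp add: nrm max_mult_distrib_left)
    assume y: "y \<in> pts ?F"
    show "x + y \<in> pts ?F" using x y by (simp only: pts s_add)
    have "(\<Sum>i. cmod (cinner (x + y) (e i))) \<le> (\<Sum>i. cmod (cinner x (e i)) + cmod (cinner y (e i)))"
      using x y by (intro suminf_le summable_add s_add) (auto simp: pts cinner_add norm_triangle_ineq)
    also have "\<dots> = (\<Sum>i. cmod (cinner x (e i))) + (\<Sum>i. cmod (cinner y (e i)))"
      using x y by (intro suminf_add[symmetric]) (auto simp: pts)
    finally show "nrm ?F (x + y) \<le> nrm ?F x + nrm ?F y"
      using norm_triangle_ineq[of x y] unfolding nrm by linarith
  next
    fix X x C assume X: "\<And>i::nat. X i \<in> pts ?F" "\<And>i. nrm ?F (X i) \<le> C" "X \<longlonglongrightarrow> x"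
    have part: "(\<Sum>k<K. cmod (cinner x (e k))) \<le> C" for K
    proof (rule LIMSEQ_le_const2)
      show "(\<lambda>i. \<Sum>k<K. cmod (cinner (X i) (e k))) \<longlonglongrightarrow> (\<Sum>k<K. cmod (cinner x (e k)))"
        by (intro tendsto_sum tendsto_norm bl.tendsto X(3))
      have "(\<Sum>k<K. cmod (cinner (X i) (e k))) \<le> C" for i
      proof -
        have "(\<Sum>k<K. cmod (cinner (X i) (e k))) \<le> (\<Sum>k. cmod (cinner (X i) (e k)))"
          using X(1) by (intro sum_le_suminf) (auto simp: pts)
        also have "\<dots> \<le> C" using X(2)[of i] by (simp add: nrm)
        finally show ?thesis .
      qed
      then show "\<exists>N. \<forall>n\<ge>N. (\<Sum>k<K. cmod (cinner (X n) (e k))) \<le> C" by blast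
    qed
    have s: "summable (\<lambda>k. cmod (cinner x (e k)))"
      by (rule bounded_imp_summable[of _ C]) (use part[of "Suc _"] in \<open>auto simp: lessThan_Suc_atMost\<close>)
    have "norm x \<le> C"
      by (rule LIMSEQ_le_const2[OF tendsto_norm[OF X(3)]]) (use X(2) in \<open>auto simp: nrm\<close>)
    moreover have "(\<Sum>k. cmod (cinner x (e k))) \<le> C" by (rule suminf_le_const[OF s part])
    ultimately show "x \<in> pts ?F \<and> nrm ?F x \<le> C" using s by (simp add: pts nrm)
  qed
qed

lemma l2_target_l2: "l2_target l2_space"
proof -
  interpret normed_nspace l2_space by (rule normed_nspace_type_space)
  show ?thesis
  proof
    fix X :: "nat \<Rightarrow> ell2" and x C assume "\<And>i. nrm l2_space (X i) \<le> C" "X \<longlonglongrightarrow> x"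
    then show "x \<in> pts l2_space \<and> nrm l2_space x \<le> C"
      by (auto simp: type_space_def intro!: LIMSEQ_le_const2[OF tendsto_norm])
  qed (simp add: type_space_def)
qed

section \<open>The operator spaces L(l^2, F)\<close>

context l2_target
begin

lemma ops_pts: "T \<in> pts (ops_from_l2 F) \<longleftrightarrow> (\<forall>c x. blinfun_apply T (c *\<^sub>C x) = c *\<^sub>C blinfun_apply T x) \<and>
    (\<forall>x. blinfun_apply T x \<in> pts F) \<and> (\<exists>C. \<forall>x. nrm F (blinfun_apply T x) \<le> C * norm x)"
  by (simp add: ops_from_l2_def)

lemma ops_nrm: "nrm (ops_from_l2 F) T = (SUP x\<in>{x. norm x \<le> 1}. nrm F (blinfun_apply T x))"
  by (simp add: ops_from_l2_def)

lemma ops_bound: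
  assumes T: "T \<in> pts (ops_from_l2 F)"
  shows "nrm F (blinfun_apply T x) \<le> nrm (ops_from_l2 F) T * norm x"
proof (cases "x = 0")
  case True then show ?thesis by (simp add: blinfun.zero_right nrm_0)
next
  case False
  obtain C where C: "\<And>x. nrm F (blinfun_apply T x) \<le> C * norm x" and p: "\<And>x. blinfun_apply T x \<in> pts F" using T by (auto simp: ops_pts)
  have "nrm F (blinfun_apply T y) \<le> \<bar>C\<bar>" if "norm y \<le> 1" for y
  proof -
    have "nrm F (blinfun_apply T y) \<le> C * norm y" by (rule C)
    also have "\<dots> \<le> \<bar>C\<bar> * norm y" by (intro mult_right_mono) auto
    also have "\<dots> \<le> \<bar>C\<bar>" using that by (simp add: mult_left_le)
    finally show ?thesis .
  qed
  then have bdd: "bdd_above ((\<lambda>x. nrm F (blinfun_apply T x)) ` {x. norm x \<le> 1})" by (intro bdd_aboveI2) auto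
  have "nrm F (blinfun_apply T ((1 / norm x) *\<^sub>R x)) \<le> nrm (ops_from_l2 F) T"
    unfolding ops_nrm using False by (intro cSUP_upper[OF _ bdd]) simp
  then show ?thesis using False p[of x] by (simp add: blinfun.scaleR_right nrm_scaleR field_simps)
qed

lemma ops_nrm_le:
  assumes "\<And>x. nrm F (blinfun_apply T x) \<le> C * norm x" "C \<ge> 0"
  shows "nrm (ops_from_l2 F) T \<le> C"
  unfolding ops_nrm
proof (rule cSUP_least)
  show "{x :: ell2. norm x \<le> 1} \<noteq> {}" by (auto intro: exI[of _ 0])
  fix x :: ell2 assume "x \<in> {x. norm x \<le> 1}"
  then show "nrm F (blinfun_apply T x) \<le> C" using assms(1)[of x] mult_left_le[of "norm x" C] assms(2) by simp
qed

lemma ops_nrm_nonneg: "T \<in> pts (ops_from_l2 F) \<Longrightarrow> 0 \<le> nrm (ops_from_l2 F) T"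
proof -
  assume T: "T \<in> pts (ops_from_l2 F)"
  \<comment> \<open>The first coordinate vector; any nonzero vector would do, since the sign of the
    supremum is read off from a single value.\<close>
  define x where "x = Abs_ell2 (\<lambda>i. if i = 0 then 1 else 0)"
  have "summable (\<lambda>i::nat. (cmod (if i = 0 then 1 else 0))\<^sup>2)" by (rule summable_finite[of "{0}"]) auto
  then have cx: "coord x i = (if i = 0 then 1 else 0)" for i by (simp add: x_def Abs_ell2_inverse)
  have "norm x > 0" using cx[of 0] by auto
  have "0 \<le> nrm F (blinfun_apply T x)" using T by (intro nrm_nonneg) (auto simp: ops_pts)
  also have "\<dots> \<le> nrm (ops_from_l2 F) T * norm x" by (rule ops_bound[OF T])
  finally show ?thesis using \<open>norm x > 0\<close> by (simp add: zero_le_mult_iff)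
qed

lemma ops_norm_le: "T \<in> pts (ops_from_l2 F) \<Longrightarrow> norm T \<le> nrm (ops_from_l2 F) T"
proof (rule norm_blinfun_bound)
  assume T: "T \<in> pts (ops_from_l2 F)"
  show "0 \<le> nrm (ops_from_l2 F) T" by (rule ops_nrm_nonneg[OF T])
  fix x
  have "norm (blinfun_apply T x) \<le> nrm F (blinfun_apply T x)" using T by (intro norm_le_nrm) (auto simp: ops_pts)
  also have "\<dots> \<le> nrm (ops_from_l2 F) T * norm x" by (rule ops_bound[OF T])
  finally show "norm (blinfun_apply T x) \<le> nrm (ops_from_l2 F) T * norm x" .
qed

lemma ops_normed: "normed_nspace (ops_from_l2 F)"
proof
  show "0 \<in> pts (ops_from_l2 F)" by (auto simp: ops_pts pts_0 nrm_0 scaleC.zero_right intro: exI[of _ 0])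
  have le_sc: "nrm (ops_from_l2 F) (r *\<^sub>R T) \<le> \<bar>r\<bar> * nrm (ops_from_l2 F) T" if T: "T \<in> pts (ops_from_l2 F)" for r T
  proof (rule ops_nrm_le)
    fix x
    have "blinfun_apply T x \<in> pts F" using T by (simp add: ops_pts)
    then show "nrm F (blinfun_apply (r *\<^sub>R T) x) \<le> \<bar>r\<bar> * nrm (ops_from_l2 F) T * norm x"
      using mult_left_mono[OF ops_bound[OF T, of x], of "\<bar>r\<bar>"] by (simp add: blinfun.scaleR_left nrm_scaleR mult.assoc)
  qed (use ops_nrm_nonneg[OF T] in simp)
  have rT: "r *\<^sub>R T \<in> pts (ops_from_l2 F)" if T: "T \<in> pts (ops_from_l2 F)" for r T
    unfolding ops_pts
  proof (intro conjI allI exI)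
    fix c x
    show "blinfun_apply (r *\<^sub>R T) (c *\<^sub>C x) = c *\<^sub>C blinfun_apply (r *\<^sub>R T) x"
      using T by (simp add: ops_pts blinfun.scaleR_left scaleC.scaleR_right)
    show "blinfun_apply (r *\<^sub>R T) x \<in> pts F" using T by (simp add: ops_pts blinfun.scaleR_left pts_scaleR)
    have "blinfun_apply T x \<in> pts F" using T by (simp add: ops_pts)
    then show "nrm F (blinfun_apply (r *\<^sub>R T) x) \<le> \<bar>r\<bar> * nrm (ops_from_l2 F) T * norm x"
      using mult_left_mono[OF ops_bound[OF T, of x], of "\<bar>r\<bar>"] by (simp add: blinfun.scaleR_left nrm_scaleR mult.assoc)
  qed
  fix T U :: "ell2 \<Rightarrow>\<^sub>L ell2" and r :: real assume T: "T \<in> pts (ops_from_l2 F)"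
  show "r *\<^sub>R T \<in> pts (ops_from_l2 F)" by (rule rT[OF T])
  show "0 \<le> nrm (ops_from_l2 F) T" by (rule ops_nrm_nonneg[OF T])
  show "nrm (ops_from_l2 F) (r *\<^sub>R T) = \<bar>r\<bar> * nrm (ops_from_l2 F) T"
  proof (cases "r = 0")
    case True
    then show ?thesis using le_sc[OF T, of 0] ops_nrm_nonneg[OF rT[OF T, of 0]] by simp
  next
    case False
    then have "nrm (ops_from_l2 F) T \<le> \<bar>1 / r\<bar> * nrm (ops_from_l2 F) (r *\<^sub>R T)"
      using le_sc[OF rT[OF T, of r], of "1 / r"] by simp
    then show ?thesis using le_sc[OF T, of r] False by (simp add: field_simps)
  qed
  show "nrm (ops_from_l2 F) T = 0 \<Longrightarrow> T = 0" using ops_norm_le[OF T] by simp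
  assume U: "U \<in> pts (ops_from_l2 F)"
  have b: "nrm F (blinfun_apply (T + U) x) \<le> (nrm (ops_from_l2 F) T + nrm (ops_from_l2 F) U) * norm x" for x
    using nrm_add[of "blinfun_apply T x" "blinfun_apply U x"] T U ops_bound[OF T, of x] ops_bound[OF U, of x]
    by (simp add: ops_pts blinfun.add_left distrib_right)
  show "T + U \<in> pts (ops_from_l2 F)"
    unfolding ops_pts using T U b
    by (intro conjI allI exI[of _ "nrm (ops_from_l2 F) T + nrm (ops_from_l2 F) U"])
       (auto simp: ops_pts blinfun.add_left scaleC.add_right pts_add)
  show "nrm (ops_from_l2 F) (T + U) \<le> nrm (ops_from_l2 F) T + nrm (ops_from_l2 F) U"
    by (rule ops_nrm_le[OF b]) (use ops_nrm_nonneg T U in simp)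
qed

text \<open>The limit T is found in the ordinary operator norm. Lower semicontinuity of the norm of
  F, applied to X i x - X j x as j grows, then transfers the Cauchy bound to X i - T.\<close>

lemma ops_complete:
  assumes X: "\<And>i::nat. X i \<in> pts (ops_from_l2 F)"
    and cauchy: "\<And>\<epsilon>. \<epsilon> > 0 \<Longrightarrow> \<exists>N. \<forall>i\<ge>N. \<forall>j\<ge>N. nrm (ops_from_l2 F) (X i - X j) < \<epsilon>"
  shows "\<exists>v\<in>pts (ops_from_l2 F). (\<lambda>i. nrm (ops_from_l2 F) (X i - v)) \<longlonglongrightarrow> 0"
proof -
  interpret O: normed_nspace "ops_from_l2 F" by (rule ops_normed)
  have "Cauchy X"
  proof (rule metric_CauchyI)
    fix \<epsilon> :: real assume "\<epsilon> > 0"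
    then obtain N where "\<forall>i\<ge>N. \<forall>j\<ge>N. nrm (ops_from_l2 F) (X i - X j) < \<epsilon>" using cauchy by blast
    then show "\<exists>M. \<forall>m\<ge>M. \<forall>n\<ge>M. dist (X m) (X n) < \<epsilon>"
      using ops_norm_le[OF O.pts_diff[OF X X]] unfolding dist_norm by (meson le_less_trans)
  qed
  then obtain T where T: "X \<longlonglongrightarrow> T" by (metis Cauchy_convergent_iff convergent_def)
  have Tx: "(\<lambda>j. blinfun_apply (X j) x) \<longlonglongrightarrow> blinfun_apply T x" for x
    by (rule blinfun.tendsto[OF T tendsto_const])
  have key: "blinfun_apply (X i) x - blinfun_apply T x \<in> pts F \<and> nrm F (blinfun_apply (X i) x - blinfun_apply T x) \<le> \<epsilon> * norm x"
    if N: "\<forall>i\<ge>N. \<forall>j\<ge>N. nrm (ops_from_l2 F) (X i - X j) < \<epsilon>" and i: "i \<ge> N" for N \<epsilon> i x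
  proof (rule nrm_lsc[where X = "\<lambda>j. blinfun_apply (X i) x - blinfun_apply (X (j + N)) x"])
    show "blinfun_apply (X i) x - blinfun_apply (X (j + N)) x \<in> pts F" for j
      using X by (intro pts_diff) (auto simp: ops_pts)
    show "nrm F (blinfun_apply (X i) x - blinfun_apply (X (j + N)) x) \<le> \<epsilon> * norm x" for j
    proof -
      have "nrm F (blinfun_apply (X i - X (j + N)) x) \<le> nrm (ops_from_l2 F) (X i - X (j + N)) * norm x"
        by (rule ops_bound[OF O.pts_diff[OF X X]])
      also have "\<dots> \<le> \<epsilon> * norm x" using N i by (intro mult_right_mono) (auto simp: less_imp_le)
      finally show ?thesis by (simp add: blinfun.diff_left)
    qed
    show "(\<lambda>j. blinfun_apply (X i) x - blinfun_apply (X (j + N)) x) \<longlonglongrightarrow> blinfun_apply (X i) x - blinfun_apply T x"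
      by (intro tendsto_diff tendsto_const LIMSEQ_ignore_initial_segment Tx)
  qed
  obtain N1 where N1: "\<forall>i\<ge>N1. \<forall>j\<ge>N1. nrm (ops_from_l2 F) (X i - X j) < 1" using cauchy[of 1] by auto
  have hom: "blinfun_apply T (c *\<^sub>C x) = c *\<^sub>C blinfun_apply T x" for c x
  proof (rule LIMSEQ_unique[OF Tx[of "c *\<^sub>C x"]])
    have "blinfun_apply (X j) (c *\<^sub>C x) = c *\<^sub>C blinfun_apply (X j) x" for j using X by (simp add: ops_pts)
    then show "(\<lambda>j. blinfun_apply (X j) (c *\<^sub>C x)) \<longlonglongrightarrow> c *\<^sub>C blinfun_apply T x"
      by (simp add: scaleC.tendsto[OF tendsto_const Tx])
  qed
  \<comment> \<open>The bound in F is available for the difference X N1 - T only; membership of T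
    follows by subtracting it from X N1.\<close>
  have D: "X N1 - T \<in> pts (ops_from_l2 F)"
    unfolding ops_pts using key[OF N1 order_refl] X hom
    by (auto simp: ops_pts blinfun.diff_left scaleC.diff_right intro!: exI[of _ 1])
  have Tp: "T \<in> pts (ops_from_l2 F)" using O.pts_diff[OF X[of N1] D] by simp
  have "(\<lambda>i. nrm (ops_from_l2 F) (X i - T)) \<longlonglongrightarrow> 0"
  proof (rule metric_LIMSEQ_I)
    fix \<epsilon> :: real assume e: "\<epsilon> > 0"
    then obtain N where N: "\<forall>i\<ge>N. \<forall>j\<ge>N. nrm (ops_from_l2 F) (X i - X j) < \<epsilon> / 2" using cauchy[of "\<epsilon> / 2"] by auto
    have "dist (nrm (ops_from_l2 F) (X i - T)) 0 < \<epsilon>" if "i \<ge> N" for i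
    proof -
      have "nrm (ops_from_l2 F) (X i - T) \<le> \<epsilon> / 2"
        by (rule ops_nrm_le) (use key[OF N that] e in \<open>auto simp: blinfun.diff_left\<close>)
      then show ?thesis using ops_nrm_nonneg[OF O.pts_diff[OF X Tp]] e by simp
    qed
    then show "\<exists>no. \<forall>n\<ge>no. dist (nrm (ops_from_l2 F) (X n - T)) 0 < \<epsilon>" by blast
  qed
  then show ?thesis using Tp by blast
qed

end

section \<open>Operator norm and operator-valued measurability\<close>

lemma norm_le_ops_l2: "norm T \<le> nrm (ops_from_l2 l2_space) T"
proof (rule norm_blinfun_bound)
  have bdd: "bdd_above ((\<lambda>x. norm (blinfun_apply T x)) ` {x. norm x \<le> 1})"
  proof (rule bdd_aboveI2)
    fix x :: ell2 assume "x \<in> {x. norm x \<le> 1}"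
    then show "norm (blinfun_apply T x) \<le> norm T"
      using norm_blinfun[of T x] mult_left_le[of "norm x" "norm T"] by simp
  qed
  have n: "nrm (ops_from_l2 l2_space) T = (SUP x\<in>{x. norm x \<le> 1}. norm (blinfun_apply T x))"
    by (simp add: ops_from_l2_def type_space_def)
  have 1: "norm (blinfun_apply T x) \<le> nrm (ops_from_l2 l2_space) T" if "norm x \<le> 1" for x
    unfolding n using that by (intro cSUP_upper[OF _ bdd]) simp
  show "0 \<le> nrm (ops_from_l2 l2_space) T" using 1[of 0] by (simp add: blinfun.zero_right)
  fix x
  show "norm (blinfun_apply T x) \<le> nrm (ops_from_l2 l2_space) T * norm x"
  proof (cases "x = 0")
    case False
    then show ?thesis using 1[of "(1 / norm x) *\<^sub>R x"] by (simp add: blinfun.scaleR_right field_simps)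
  qed (simp add: blinfun.zero_right)
qed

lemma ops_l2_le_norm: "nrm (ops_from_l2 l2_space) T \<le> norm T"
proof -
  interpret l2_target l2_space by (rule l2_target_l2)
  show ?thesis by (rule ops_nrm_le) (use norm_blinfun[of T] in \<open>auto simp: type_space_def\<close>)
qed

lemma ops_l2_nrm: "nrm (ops_from_l2 l2_space) T = norm T"
  using norm_le_ops_l2 ops_l2_le_norm by (rule antisym[rotated])

text \<open>Strong measurability in the plain operator norm, with the target space forgotten. It
  survives composition with a fixed operator and is enough for w -> b(w)(f(w)) to be
  measurable.\<close>

definition op_measurable :: "'a measure \<Rightarrow> ('a \<Rightarrow> ell2 \<Rightarrow>\<^sub>L ell2) \<Rightarrow> bool" where
  "op_measurable M b \<longleftrightarrow> (\<exists>s. (\<forall>i. simple_function M (s i)) \<and> (AE x in M. (\<lambda>i::nat. s i x) \<longlonglongrightarrow> b x))"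

lemma op_measurable_norm:
  fixes b :: "complex ^ 'n \<Rightarrow> ell2 \<Rightarrow>\<^sub>L ell2"
  assumes \<alpha>: "\<alpha> > -1" and b: "op_measurable (weighted_measure \<alpha>) b"
  shows "(\<lambda>x. norm (b x - T)) \<in> borel_measurable (weighted_measure \<alpha>)"
proof -
  let ?M = "weighted_measure \<alpha> :: (complex ^ 'n) measure"
  obtain s where s: "\<And>i. simple_function ?M (s i)" "AE x in ?M. (\<lambda>i::nat. s i x) \<longlonglongrightarrow> b x"
    using b unfolding op_measurable_def by blast
  show ?thesis
  proof (rule borel_measurable_weighted_AE_limit[OF \<alpha>])
    show "(\<lambda>x. norm (s i x - T)) \<in> borel_measurable ?M" for i
      by (rule borel_measurable_simple_function[OF simple_function_compose1[OF s(1)]])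
    show "AE x in ?M. (\<lambda>i. norm (s i x - T)) \<longlonglongrightarrow> norm (b x - T)"
      using s(2) by eventually_elim (intro tendsto_intros)
  qed
qed

text \<open>A simple operator function has finitely many values, and for each fixed value the map is
  a continuous operator composed with f; the general case is an almost everywhere limit.\<close>

lemma op_measurable_apply:
  fixes b :: "complex ^ 'n \<Rightarrow> ell2 \<Rightarrow>\<^sub>L ell2"
  assumes \<alpha>: "\<alpha> > -1" and b: "op_measurable (weighted_measure \<alpha>) b" and f: "f \<in> borel_measurable (weighted_measure \<alpha>)"
  shows "(\<lambda>x. blinfun_apply (b x) (f x)) \<in> borel_measurable (weighted_measure \<alpha>)"
proof -
  let ?M = "weighted_measure \<alpha> :: (complex ^ 'n) measure"
  obtain s where s: "\<And>i. simple_function ?M (s i)" "AE x in ?M. (\<lambda>i::nat. s i x) \<longlonglongrightarrow> b x"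
    using b unfolding op_measurable_def by blast
  show ?thesis
  proof (rule borel_measurable_weighted_AE_limit[OF \<alpha>])
    show "(\<lambda>x. blinfun_apply (s i x) (f x)) \<in> borel_measurable ?M" for i
    proof (rule measurable_compose_countable'[where f = "\<lambda>T x. blinfun_apply T (f x)" and I = "s i ` space ?M"])
      show "(\<lambda>x. blinfun_apply T (f x)) \<in> borel_measurable ?M" for T
        by (rule measurable_compose[OF f]) (intro borel_measurable_continuous_onI continuous_intros)
      show "s i \<in> measurable ?M (count_space (s i ` space ?M))"
        by (rule measurable_count_space_extend[OF subset_UNIV _ measurable_simple_function[OF s(1)]]) auto
      show "countable (s i ` space ?M)" using simple_functionD(1)[OF s(1)[of i]] by (rule countable_finite)
    qed
    show "AE x in ?M. (\<lambda>i. blinfun_apply (s i x) (f x)) \<longlonglongrightarrow> blinfun_apply (b x) (f x)"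
      using s(2) by eventually_elim (intro blinfun.tendsto tendsto_const)
  qed
qed

lemma op_measurable_compose:
  assumes "op_measurable M b"
  shows "op_measurable M (\<lambda>x. b x o\<^sub>L T)"
proof -
  obtain s where s: "\<And>i. simple_function M (s i)" "AE x in M. (\<lambda>i::nat. s i x) \<longlonglongrightarrow> b x"
    using assms unfolding op_measurable_def by blast
  show ?thesis unfolding op_measurable_def
  proof (intro exI[of _ "\<lambda>i x. s i x o\<^sub>L T"] conjI allI)
    show "simple_function M (\<lambda>x. s i x o\<^sub>L T)" for i by (rule simple_function_compose1[OF s(1)])
    show "AE x in M. (\<lambda>i. s i x o\<^sub>L T) \<longlonglongrightarrow> (b x o\<^sub>L T)"
      using s(2) by eventually_elim (intro bounded_bilinear.tendsto[OF bounded_bilinear_blinfun_compose] tendsto_const)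
  qed
qed

section \<open>Symbols of bounded mean oscillation\<close>

lemma Lp_norm_1:
  assumes "\<And>x. x \<in> space M \<Longrightarrow> nrm E (f x) \<ge> 0"
  shows "Lp_norm E M 1 f = (\<integral>\<^sup>+x. ennreal (nrm E (f x)) \<partial>M)"
proof -
  have "(\<integral>\<^sup>+x. ennreal (nrm E (f x) powr 1) \<partial>M) = (\<integral>\<^sup>+x. ennreal (nrm E (f x)) \<partial>M)"
    by (rule nn_integral_cong) (use assms in simp)
  then show ?thesis
    by (cases "\<integral>\<^sup>+x. ennreal (nrm E (f x)) \<partial>M") (auto simp: Lp_norm_def Let_def)
qed

lemma A2_norm_sq: "(A2_norm \<alpha> (f :: complex ^ 'n \<Rightarrow> ell2))\<^sup>2 = (\<integral>\<^sup>+x. ennreal ((norm (f x))\<^sup>2) \<partial>weighted_measure \<alpha>)"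
proof -
  have "(\<integral>\<^sup>+x. ennreal (nrm l2_space (f x) powr 2) \<partial>weighted_measure \<alpha>) = (\<integral>\<^sup>+x. ennreal ((norm (f x))\<^sup>2) \<partial>weighted_measure \<alpha>)"
    by (rule nn_integral_cong) (simp add: type_space_def)
  then have n: "A2_norm \<alpha> f = (let I = \<integral>\<^sup>+x. ennreal ((norm (f x))\<^sup>2) \<partial>weighted_measure \<alpha>
      in if I = \<infinity> then \<infinity> else ennreal (enn2real I powr (1 / 2)))"
    by (simp add: A2_norm_def Lp_norm_def)
  show ?thesis
  proof (cases "\<integral>\<^sup>+x. ennreal ((norm (f x))\<^sup>2) \<partial>weighted_measure \<alpha>")
    case (real r)
    have "(r powr (1 / 2))\<^sup>2 = r" using real(1) by (simp add: powr_half_sqrt)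
    then show ?thesis unfolding n Let_def real(2) using real(1) by (simp add: ennreal_power)
  next
    case top
    then show ?thesis unfolding n Let_def by (simp add: power_eq_top_ennreal)
  qed
qed

lemma ennreal_square_le_imp_le:
  assumes "x\<^sup>2 \<le> y\<^sup>2"
  shows "x \<le> (y :: ennreal)"
proof (cases y)
  case y: (real s)
  then have "y\<^sup>2 = ennreal (s\<^sup>2)" by (simp add: ennreal_power)
  then have "x\<^sup>2 \<le> ennreal (s\<^sup>2)" using assms by simp
  moreover obtain r where r: "x = ennreal r" "0 \<le> r"
  proof (cases x)
    case top
    then have "x\<^sup>2 = top" by (simp add: power_eq_top_ennreal)
    then show ?thesis using \<open>x\<^sup>2 \<le> ennreal (s\<^sup>2)\<close> by (simp add: top_unique)
  qed auto
  ultimately have "r\<^sup>2 \<le> s\<^sup>2" by (simp add: ennreal_power)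
  then show ?thesis unfolding y(2) r(1) using y(1) by (rule ennreal_leI[OF power2_le_imp_le])
qed simp

lemma nn_integral_normalized_kernel_sq:
  assumes \<alpha>: "\<alpha> > -1" and z: "norm (z :: complex ^ 'n) < 1"
  shows "(\<integral>\<^sup>+w. ennreal ((cmod (normalized_kernel \<alpha> z w))\<^sup>2) \<partial>weighted_measure \<alpha>) = 1"
proof -
  have "(\<integral>\<^sup>+w. 1 \<partial>(weighted_measure \<alpha> :: (complex ^ 'n) measure)) = (\<integral>\<^sup>+w. ennreal ((cmod (normalized_kernel \<alpha> z w))\<^sup>2) * 1 \<partial>weighted_measure \<alpha>)"
    using nn_integral_ball_aut[OF \<alpha> z, of "\<lambda>_. 1"] by simp
  then show ?thesis using emeasure_weighted_space[OF \<alpha>, where 'n='n] by simp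
qed

lemma normalized_kernel_sq_bound:
  assumes \<alpha>: "\<alpha> > -1" and z: "norm z < 1" and w: "norm w < 1"
  shows "(cmod (normalized_kernel \<alpha> z (w :: complex ^ 'n)))\<^sup>2 \<le> (1 - norm z) powr - (2 * (real CARD('n) + 1 + \<alpha>))"
proof -
  let ?c = "real CARD('n) + 1 + \<alpha>"
  have "1 - norm z \<le> cmod (1 - herm w z)"
    unfolding cmod_1_minus_herm_commute[of w z] by (rule cmod_1_minus_herm_ge[OF w])
  then have "cmod (1 - herm w z) powr - (2 * ?c) \<le> (1 - norm z) powr - (2 * ?c)"
    using \<alpha> z by (intro powr_mono2') auto
  moreover have "(1 - (norm z)\<^sup>2) powr ?c \<le> 1"
    using one_minus_norm2_pos[OF z] \<alpha> by (intro powr_le1) auto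
  ultimately show ?thesis unfolding normalized_kernel_sq[OF z]
    using mult_mono[of "(1 - (norm z)\<^sup>2) powr ?c" 1 "cmod (1 - herm w z) powr - (2 * ?c)" "(1 - norm z) powr - (2 * ?c)"] by simp
qed

context
  fixes \<alpha> :: real and F :: "ell2 nspace" and b :: "complex ^ 'n \<Rightarrow> ell2 \<Rightarrow>\<^sub>L ell2"
  assumes \<alpha>: "\<alpha> > -1" and F: "l2_target F" and bmo: "b \<in> BMO1 \<alpha> (ops_from_l2 F)"
begin

lemma bmo_pts: "norm w < 1 \<Longrightarrow> b w \<in> pts (ops_from_l2 F)"
  using bmo by (auto simp: BMO1_def Lp_def strongly_measurable_def)

lemma bmo_strongly_measurable: "strongly_measurable (ops_from_l2 F) (weighted_measure \<alpha>) b"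
  using bmo by (auto simp: BMO1_def Lp_def)

lemma bmo_homogeneous: "norm w < 1 \<Longrightarrow> blinfun_apply (b w) (c *\<^sub>C x) = c *\<^sub>C blinfun_apply (b w) x"
  using bmo_pts by (simp add: l2_target.ops_pts[OF F])

lemma bmo_op_measurable: "op_measurable (weighted_measure \<alpha>) b"
proof -
  let ?M = "weighted_measure \<alpha> :: (complex ^ 'n) measure"
  obtain s where s: "\<And>i. simple_function ?M (s i)" "\<And>i. s i \<in> space ?M \<rightarrow> pts (ops_from_l2 F)"
    "AE x in ?M. (\<lambda>i::nat. nrm (ops_from_l2 F) (b x - s i x)) \<longlonglongrightarrow> 0"
    using bmo_strongly_measurable unfolding strongly_measurable_def by blast
  interpret O: normed_nspace "ops_from_l2 F" by (rule l2_target.ops_normed[OF F])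
  have "AE x in ?M. (\<lambda>i. s i x) \<longlonglongrightarrow> b x"
    using s(3) AE_space
  proof eventually_elim
    case (elim x)
    have "norm (s i x - b x) \<le> nrm (ops_from_l2 F) (b x - s i x)" for i
      using l2_target.ops_norm_le[OF F O.pts_diff[OF bmo_pts funcset_mem[OF s(2) elim(2)]], of x i] elim(2)
      by (simp add: norm_minus_commute)
    then have "(\<lambda>i. s i x - b x) \<longlonglongrightarrow> 0"
      by (intro Lim_null_comparison[OF _ elim(1)]) (auto intro: always_eventually)
    then show ?case by (rule LIM_zero_cancel)
  qed
  then show ?thesis using s(1) unfolding op_measurable_def by blast
qed

lemma bmo_nrm_measurable: "(\<lambda>w. nrm (ops_from_l2 F) (b w)) \<in> borel_measurable (weighted_measure \<alpha>)"
proof -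
  interpret O: normed_nspace "ops_from_l2 F" by (rule l2_target.ops_normed[OF F])
  show ?thesis using O.measurable_nrm_diff[OF \<alpha> bmo_strongly_measurable, of "\<lambda>_. 0"] O.pts_0 by simp
qed

lemma bmo_nrm_finite: "(\<integral>\<^sup>+w. ennreal (nrm (ops_from_l2 F) (b w)) \<partial>weighted_measure \<alpha>) < \<infinity>"
  using bmo Lp_norm_1[of "weighted_measure \<alpha>" "ops_from_l2 F" b] bmo_pts l2_target.ops_nrm_nonneg[OF F]
  by (auto simp: BMO1_def Lp_def)

lemma bmo_norm_le: "norm w < 1 \<Longrightarrow> norm (b w) \<le> nrm (ops_from_l2 F) (b w)"
  using bmo_pts l2_target.ops_norm_le[OF F] by auto

lemma bmo_norm_measurable: "(\<lambda>w. norm (b w)) \<in> borel_measurable (weighted_measure \<alpha>)"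
  using op_measurable_norm[OF \<alpha> bmo_op_measurable, of 0] by simp

lemma bmo_norm_integrable: "integrable (weighted_measure \<alpha>) (\<lambda>w. norm (b w))"
proof (rule integrableI_bounded[OF bmo_norm_measurable])
  have "(\<integral>\<^sup>+w. ennreal (norm (norm (b w))) \<partial>weighted_measure \<alpha>) \<le> (\<integral>\<^sup>+w. ennreal (nrm (ops_from_l2 F) (b w)) \<partial>weighted_measure \<alpha>)"
    by (intro nn_integral_mono ennreal_leI) (use bmo_norm_le in auto)
  then show "(\<integral>\<^sup>+w. ennreal (norm (norm (b w))) \<partial>weighted_measure \<alpha>) < \<infinity>" using bmo_nrm_finite by (rule le_less_trans)
qed

text \<open>For fixed z the factor |k_z|^2 is bounded on the ball, so the integrand has finite L^1
  norm. Since \<open>berezin\<close> is a definite description, this existence statement is what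
  gives it a meaning.\<close>

lemma bmo_berezin_exists:
  assumes z: "norm z < 1"
  shows "has_Bochner_integral (ops_from_l2 F) (weighted_measure \<alpha>) (\<lambda>w. (cmod (normalized_kernel \<alpha> z w))\<^sup>2 *\<^sub>R b w) (berezin \<alpha> (ops_from_l2 F) b z)"
proof -
  let ?M = "weighted_measure \<alpha> :: (complex ^ 'n) measure"
  let ?k = "\<lambda>w. (cmod (normalized_kernel \<alpha> z w))\<^sup>2"
  let ?B = "(1 - norm z) powr - (2 * (real CARD('n) + 1 + \<alpha>))"
  interpret O: normed_nspace "ops_from_l2 F" by (rule l2_target.ops_normed[OF F])
  have km: "?k \<in> borel_measurable ?M" by (rule measurable_borel_weighted[OF borel_measurable_normalized_kernel_sq[OF z]])
  obtain s where s: "\<And>i. simple_function ?M (s i)" "\<And>i. s i \<in> space ?M \<rightarrow> pts (ops_from_l2 F)"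
    "AE x in ?M. (\<lambda>i::nat. nrm (ops_from_l2 F) (b x - s i x)) \<longlonglongrightarrow> 0"
    using bmo_strongly_measurable unfolding strongly_measurable_def by blast
  obtain t where t: "\<And>i. simple_function ?M (t i)" "\<And>x. x \<in> space ?M \<Longrightarrow> (\<lambda>i. t i x) \<longlonglongrightarrow> ?k x"
    using borel_measurable_implies_sequence_metric[OF km, of 0] by blast
  have sm: "strongly_measurable (ops_from_l2 F) ?M (\<lambda>w. ?k w *\<^sub>R b w)"
    unfolding strongly_measurable_def
  proof (intro conjI exI[of _ "\<lambda>i w. t i w *\<^sub>R s i w"] allI)
    show "(\<lambda>w. ?k w *\<^sub>R b w) \<in> space ?M \<rightarrow> pts (ops_from_l2 F)" using bmo_pts O.pts_scaleR by auto
    show "simple_function ?M (\<lambda>w. t i w *\<^sub>R s i w)" for i by (rule simple_function_compose2[OF t(1) s(1)])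
    show "(\<lambda>w. t i w *\<^sub>R s i w) \<in> space ?M \<rightarrow> pts (ops_from_l2 F)" for i using s(2)[of i] O.pts_scaleR by (auto simp: Pi_iff)
    show "AE w in ?M. (\<lambda>i. nrm (ops_from_l2 F) (?k w *\<^sub>R b w - t i w *\<^sub>R s i w)) \<longlonglongrightarrow> 0"
      using s(3) AE_space
    proof eventually_elim
      case (elim w)
      let ?n = "nrm (ops_from_l2 F)"
      have bw: "b w \<in> pts (ops_from_l2 F)" using elim(2) bmo_pts by simp
      note sw = funcset_mem[OF s(2) elim(2)]
      show ?case
      proof (rule tendsto_sandwich[OF _ _ tendsto_const])
        show "\<forall>\<^sub>F i in sequentially. 0 \<le> ?n (?k w *\<^sub>R b w - t i w *\<^sub>R s i w)"
          by (intro always_eventually allI O.nrm_nonneg O.pts_diff O.pts_scaleR bw sw)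
        show "\<forall>\<^sub>F i in sequentially. ?n (?k w *\<^sub>R b w - t i w *\<^sub>R s i w) \<le> \<bar>t i w\<bar> * ?n (b w - s i w) + \<bar>?k w - t i w\<bar> * ?n (b w)"
        proof (intro always_eventually allI)
          fix i
          have "?k w *\<^sub>R b w - t i w *\<^sub>R s i w = t i w *\<^sub>R (b w - s i w) + (?k w - t i w) *\<^sub>R b w"
            by (simp add: algebra_simps)
          then show "?n (?k w *\<^sub>R b w - t i w *\<^sub>R s i w) \<le> \<bar>t i w\<bar> * ?n (b w - s i w) + \<bar>?k w - t i w\<bar> * ?n (b w)"
            using O.nrm_add[OF O.pts_scaleR[OF O.pts_diff[OF bw sw]] O.pts_scaleR[OF bw], of "t i w" i "?k w - t i w"]
            by (simp add: O.nrm_scaleR[OF O.pts_diff[OF bw sw]] O.nrm_scaleR[OF bw])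
        qed
        have "(\<lambda>i. \<bar>t i w\<bar> * ?n (b w - s i w) + \<bar>?k w - t i w\<bar> * ?n (b w)) \<longlonglongrightarrow> \<bar>?k w\<bar> * 0 + \<bar>?k w - ?k w\<bar> * ?n (b w)"
          by (intro tendsto_intros t(2) elim)
        then show "(\<lambda>i. \<bar>t i w\<bar> * ?n (b w - s i w) + \<bar>?k w - t i w\<bar> * ?n (b w)) \<longlonglongrightarrow> 0" by simp
      qed
    qed
  qed
  have "(\<integral>\<^sup>+w. ennreal (nrm (ops_from_l2 F) (?k w *\<^sub>R b w)) \<partial>?M) \<le> (\<integral>\<^sup>+w. ennreal ?B * ennreal (nrm (ops_from_l2 F) (b w)) \<partial>?M)"
  proof (rule nn_integral_mono)
    fix w assume "w \<in> space ?M"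
    then have w: "norm w < 1" by simp
    have "nrm (ops_from_l2 F) (?k w *\<^sub>R b w) \<le> ?B * nrm (ops_from_l2 F) (b w)"
      unfolding O.nrm_scaleR[OF bmo_pts[OF w]]
      using normalized_kernel_sq_bound[OF \<alpha> z w] O.nrm_nonneg[OF bmo_pts[OF w]] by (intro mult_right_mono) auto
    then show "ennreal (nrm (ops_from_l2 F) (?k w *\<^sub>R b w)) \<le> ennreal ?B * ennreal (nrm (ops_from_l2 F) (b w))"
      by (subst ennreal_mult'[symmetric]) (auto intro: ennreal_leI)
  qed
  also have "\<dots> = ennreal ?B * (\<integral>\<^sup>+w. ennreal (nrm (ops_from_l2 F) (b w)) \<partial>?M)"
    using bmo_nrm_measurable by (intro nn_integral_cmult) auto
  also have "\<dots> < \<infinity>" using bmo_nrm_finite by (simp add: ennreal_mult_less_top)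
  finally have "(\<integral>\<^sup>+w. ennreal (nrm (ops_from_l2 F) (?k w *\<^sub>R b w)) \<partial>?M) < \<infinity>" .
  from O.has_Bochner_integral_exists[OF \<alpha> sm this l2_target.ops_complete[OF F]]
  obtain v where v: "has_Bochner_integral (ops_from_l2 F) ?M (\<lambda>w. ?k w *\<^sub>R b w) v" by blast
  then show ?thesis unfolding berezin_def O.Bochner_integral_eq[OF \<alpha> v] .
qed

text \<open>The integral of ||b|| |k_z|^2 is that of ||b o phi_z||, at most ||b o phi_z - b~(z)||_1
  + ||b~(z)||, where b~ is the Berezin transform. The BMO norm N bounds the first term for every z,
  and the essential supremum D of ||b~|| bounds the second for almost every z.\<close>

lemma bmo_berezin_bounded:
  assumes linf: "berezin \<alpha> (ops_from_l2 F) b \<in> Linf (ops_from_l2 l2_space) ball_measure"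
  shows "\<exists>B\<ge>0. AE z in weighted_measure \<alpha>. (\<integral>\<^sup>+w. ennreal (norm (b w)) * ennreal ((cmod (normalized_kernel \<alpha> z w))\<^sup>2) \<partial>weighted_measure \<alpha>) \<le> ennreal B"
proof -
  let ?M = "weighted_measure \<alpha> :: (complex ^ 'n) measure"
  let ?bt = "berezin \<alpha> (ops_from_l2 F) b"
  interpret O: normed_nspace "ops_from_l2 F" by (rule l2_target.ops_normed[OF F])
  have btp: "?bt z \<in> pts (ops_from_l2 F)" if "norm z < 1" for z
    using bmo_berezin_exists[OF that] by (simp add: has_Bochner_integral_def)
  have "BMO1_norm \<alpha> (ops_from_l2 F) b < \<infinity>" using bmo by (simp add: BMO1_def)
  then obtain N where N: "N \<ge> 0" "BMO1_norm \<alpha> (ops_from_l2 F) b = ennreal N" by (cases "BMO1_norm \<alpha> (ops_from_l2 F) b") auto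
  have osc: "(\<integral>\<^sup>+w. ennreal (nrm (ops_from_l2 F) (b (ball_aut z w) - ?bt z)) \<partial>?M) \<le> ennreal N" if z: "norm z < 1" for z
  proof -
    have "Lp_norm (ops_from_l2 F) ?M 1 (\<lambda>w. b (ball_aut z w) - ?bt z) \<le> ennreal N"
      unfolding N(2)[symmetric] BMO1_norm_def by (rule SUP_upper) (use z in simp)
    then show ?thesis
      by (subst (asm) Lp_norm_1) (auto intro!: O.nrm_nonneg O.pts_diff bmo_pts norm_ball_aut z btp)
  qed
  have "Linf_norm (ops_from_l2 l2_space) ball_measure ?bt < \<infinity>" using linf by (simp add: Linf_def)
  then have fin: "esssup (ball_measure :: (complex ^ 'n) measure) (\<lambda>x. ennreal (norm (?bt x))) < \<infinity>" by (simp add: Linf_norm_def ops_l2_nrm)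
  then obtain D where D: "D \<ge> 0" "esssup (ball_measure :: (complex ^ 'n) measure) (\<lambda>x. ennreal (norm (?bt x))) = ennreal D"
    by (cases "esssup (ball_measure :: (complex ^ 'n) measure) (\<lambda>x. ennreal (norm (?bt x)))") auto
  have "AE z in (ball_measure :: (complex ^ 'n) measure). ennreal (norm (?bt z)) \<le> ennreal D"
    using esssup_AE[of "\<lambda>x. ennreal (norm (?bt x))" "ball_measure :: (complex ^ 'n) measure"] unfolding D(2) .
  then have "AE z in ?M. norm (?bt z) \<le> D" unfolding AE_weighted[OF \<alpha>] using D(1) by simp
  then have "AE z in ?M. (\<integral>\<^sup>+w. ennreal (norm (b w)) * ennreal ((cmod (normalized_kernel \<alpha> z w))\<^sup>2) \<partial>?M) \<le> ennreal (N + D)"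
    using AE_space
  proof eventually_elim
    case (elim z)
    then have z: "norm z < 1" by simp
    let ?k = "\<lambda>w. ennreal ((cmod (normalized_kernel \<alpha> z w))\<^sup>2)"
    have km: "?k \<in> borel_measurable ?M"
      by (rule measurable_compose[OF measurable_borel_weighted[OF borel_measurable_normalized_kernel_sq[OF z]] measurable_ennreal])
    define G where "G v = ennreal (norm (b v - ?bt z))" for v
    have Gm: "G \<in> borel_measurable ?M"
      unfolding G_def by (rule measurable_compose[OF op_measurable_norm[OF \<alpha> bmo_op_measurable] measurable_ennreal])
    note d = ball_aut_weighted[OF \<alpha> z]
    have "(\<integral>\<^sup>+w. ?k w * G w \<partial>?M) = (\<integral>\<^sup>+w. G w \<partial>distr ?M ?M (ball_aut z))"
      unfolding d(2) by (rule nn_integral_density[OF km Gm, symmetric])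
    also have "\<dots> = (\<integral>\<^sup>+w. G (ball_aut z w) \<partial>?M)" by (rule nn_integral_distr[OF d(1)]) (use Gm in simp)
    also have "\<dots> \<le> (\<integral>\<^sup>+w. ennreal (nrm (ops_from_l2 F) (b (ball_aut z w) - ?bt z)) \<partial>?M)"
      unfolding G_def by (intro nn_integral_mono ennreal_leI l2_target.ops_norm_le[OF F] O.pts_diff bmo_pts btp z) (auto intro: norm_ball_aut[OF z])
    also have "\<dots> \<le> ennreal N" by (rule osc[OF z])
    finally have GN: "(\<integral>\<^sup>+w. ?k w * G w \<partial>?M) \<le> ennreal N" .
    have "(\<integral>\<^sup>+w. ennreal (norm (b w)) * ?k w \<partial>?M) \<le> (\<integral>\<^sup>+w. ?k w * G w + ennreal D * ?k w \<partial>?M)"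
    proof (rule nn_integral_mono)
      fix w
      have "ennreal (norm (b w)) \<le> ennreal (norm (b w - ?bt z) + D)"
        using norm_triangle_ineq[of "b w - ?bt z" "?bt z"] elim(1) by (intro ennreal_leI) simp
      also have "\<dots> = G w + ennreal D" using D(1) by (simp add: G_def)
      finally have "ennreal (norm (b w)) * ?k w \<le> (G w + ennreal D) * ?k w" by (rule mult_right_mono) simp
      then show "ennreal (norm (b w)) * ?k w \<le> ?k w * G w + ennreal D * ?k w" by (simp add: distrib_right mult.commute)
    qed
    also have "\<dots> = (\<integral>\<^sup>+w. ?k w * G w \<partial>?M) + (\<integral>\<^sup>+w. ennreal D * ?k w \<partial>?M)"
      by (intro nn_integral_add borel_measurable_times_ennreal km Gm) auto
    also have "(\<integral>\<^sup>+w. ennreal D * ?k w \<partial>?M) = ennreal D"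
      by (subst nn_integral_cmult[OF km]) (simp add: nn_integral_normalized_kernel_sq[OF \<alpha> z])
    also have "(\<integral>\<^sup>+w. ?k w * G w \<partial>?M) + ennreal D \<le> ennreal N + ennreal D" using GN by (rule add_right_mono)
    finally show ?case using N(1) D(1) by simp
  qed
  then show ?thesis using N(1) D(1) by (intro exI[of _ "N + D"]) auto
qed

end

section \<open>The truncated symbols b_(d)\<close>

lift_definition tail_proj :: "(nat \<Rightarrow> ell2) \<Rightarrow> nat \<Rightarrow> ell2 \<Rightarrow>\<^sub>L ell2" is
  "\<lambda>e d x. x - (\<Sum>i<d. cinner x (e i) *\<^sub>C e i)"
  by (intro bounded_linear_sub bounded_linear_ident bounded_linear_sum
      scaleC.bounded_linear_left[THEN bounded_linear_compose] bounded_linear_cinner)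

text \<open>For an orthonormal basis \<open>tail_proj e d\<close> kills the first d basis vectors
  and fixes the others. A bounded complex-linear operator is determined by its values on the basis,
  through the expansion of x, so the description defining \<open>tail_op\<close> singles out this
  composition.\<close>

lemma tail_op_eq:
  assumes e: "orthonormal_basis e" and T: "\<And>c x. blinfun_apply T (c *\<^sub>C x) = c *\<^sub>C blinfun_apply T x"
  shows "tail_op e d T = T o\<^sub>L tail_proj e d"
  unfolding tail_op_def
proof (rule the_equality)
  let ?P = "\<lambda>S. S \<in> pts (ops_from_l2 l2_space) \<and> (\<forall>i. blinfun_apply S (e i) = (if i < d then 0 else blinfun_apply T (e i)))"
  interpret l2_target l2_space by (rule l2_target_l2)
  have pts: "S \<in> pts (ops_from_l2 l2_space) \<longleftrightarrow> (\<forall>c x. blinfun_apply S (c *\<^sub>C x) = c *\<^sub>C blinfun_apply S x)" for S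
    unfolding ops_pts using norm_blinfun[of S] by (auto simp: type_space_def)
  have ei: "(\<Sum>j<d. cinner (e i) (e j) *\<^sub>C e j) = (if i < d then e i else 0)" for i
  proof -
    have "(\<Sum>j<d. cinner (e i) (e j) *\<^sub>C e j) = (\<Sum>j<d. if i = j then e j else 0)"
      using e by (intro sum.cong) (auto simp: orthonormal_basis_def scaleC.zero_left)
    then show ?thesis by simp
  qed
  show P: "?P (T o\<^sub>L tail_proj e d)"
  proof (intro conjI allI)
    show "T o\<^sub>L tail_proj e d \<in> pts (ops_from_l2 l2_space)"
      by (simp add: pts T tail_proj.rep_eq cinner_scaleC scaleC.diff_right scaleC.sum_right scaleC_scaleC flip: T)
    show "blinfun_apply (T o\<^sub>L tail_proj e d) (e i) = (if i < d then 0 else blinfun_apply T (e i))" for i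
      by (simp add: tail_proj.rep_eq ei blinfun.zero_right)
  qed
  fix S assume S: "?P S"
  show "S = T o\<^sub>L tail_proj e d"
  proof (rule blinfun_eqI)
    fix x
    have sums: "(\<lambda>i. cinner x (e i) *\<^sub>C e i) sums x" using e by (simp add: orthonormal_basis_def)
    have "(\<lambda>i. blinfun_apply U (cinner x (e i) *\<^sub>C e i)) sums blinfun_apply U x" for U :: "ell2 \<Rightarrow>\<^sub>L ell2"
      by (rule bounded_linear.sums[OF blinfun.bounded_linear_right sums])
    note U = this[of S] this[of "T o\<^sub>L tail_proj e d"]
    have val: "blinfun_apply U (c *\<^sub>C e i) = c *\<^sub>C (if i < d then 0 else blinfun_apply T (e i))" if "?P U" for U c i
      using that unfolding pts by simp
    have "(\<lambda>i. blinfun_apply (T o\<^sub>L tail_proj e d) (cinner x (e i) *\<^sub>C e i)) sums blinfun_apply S x"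
      using U(1) by (simp only: val[OF S] val[OF P])
    then show "blinfun_apply S x = blinfun_apply (T o\<^sub>L tail_proj e d) x" using U(2) by (rule sums_unique2)
  qed
qed

text \<open>For a nonnegative scalar function the Berezin transform is an ordinary nonnegative
  integral, so the limit hypothesis becomes an almost everywhere bound of the same shape as for b,
  with an arbitrarily small constant.\<close>

lemma tail_berezin_small:
  fixes b :: "complex ^ 'n \<Rightarrow> ell2 \<Rightarrow>\<^sub>L ell2"
  assumes \<alpha>: "\<alpha> > -1" and e: "orthonormal_basis e"
    and b: "op_measurable (weighted_measure \<alpha>) b" and int: "integrable (weighted_measure \<alpha>) (\<lambda>w. norm (b w))"
    and hom: "\<And>w c x. norm w < 1 \<Longrightarrow> blinfun_apply (b w) (c *\<^sub>C x) = c *\<^sub>C blinfun_apply (b w) x"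
    and lim: "(\<lambda>d. Linf_norm C_space (ball_measure :: (complex ^ 'n) measure)
            (berezin \<alpha> C_space (\<lambda>w. complex_of_real (nrm (ops_from_l2 l2_space) (tail_op e d (b w)))))) \<longlonglongrightarrow> 0"
    and \<epsilon>: "\<epsilon> > 0"
  shows "\<exists>d>0. AE z in weighted_measure \<alpha>. (\<integral>\<^sup>+w. ennreal (norm (b w o\<^sub>L tail_proj e d)) * ennreal ((cmod (normalized_kernel \<alpha> z w))\<^sup>2) \<partial>weighted_measure \<alpha>) \<le> ennreal \<epsilon>"
proof -
  let ?M = "weighted_measure \<alpha> :: (complex ^ 'n) measure"
  let ?g = "\<lambda>d w. norm (b w o\<^sub>L tail_proj e d)"
  have "\<forall>\<^sub>F d in sequentially. Linf_norm C_space (ball_measure :: (complex ^ 'n) measure)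
            (berezin \<alpha> C_space (\<lambda>w. complex_of_real (nrm (ops_from_l2 l2_space) (tail_op e d (b w))))) < ennreal \<epsilon>"
    using lim \<epsilon> by (intro order_tendstoD(2)) auto
  then obtain N where N: "\<And>d. d \<ge> N \<Longrightarrow> Linf_norm C_space (ball_measure :: (complex ^ 'n) measure)
            (berezin \<alpha> C_space (\<lambda>w. complex_of_real (nrm (ops_from_l2 l2_space) (tail_op e d (b w))))) < ennreal \<epsilon>"
    unfolding eventually_sequentially by blast
  \<comment> \<open>The successor, because d has to be positive.\<close>
  define d where "d = Suc N"
  have d: "d > 0" "Linf_norm C_space (ball_measure :: (complex ^ 'n) measure)
            (berezin \<alpha> C_space (\<lambda>w. complex_of_real (nrm (ops_from_l2 l2_space) (tail_op e d (b w))))) < ennreal \<epsilon>"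
    using N[of d] by (auto simp: d_def)
  have gm: "?g d \<in> borel_measurable ?M" using op_measurable_norm[OF \<alpha> op_measurable_compose[OF b], of _ 0] by simp
  have gi: "integrable ?M (?g d)"
  proof (rule Bochner_Integration.integrable_bound[OF integrable_mult_left[OF int, of "norm (tail_proj e d)"] gm])
    show "AE w in ?M. norm (?g d w) \<le> norm (norm (b w) * norm (tail_proj e d))"
      using norm_blinfun_compose by (intro AE_I2) simp
  qed
  let ?bt = "berezin \<alpha> C_space (\<lambda>w. complex_of_real (nrm (ops_from_l2 l2_space) (tail_op e d (b w))))"
  have bt: "ennreal (cmod (?bt z)) = (\<integral>\<^sup>+w. ennreal (?g d w) * ennreal ((cmod (normalized_kernel \<alpha> z w))\<^sup>2) \<partial>?M)" if z: "norm z < 1" for z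
  proof -
    let ?k = "\<lambda>w. (cmod (normalized_kernel \<alpha> z w))\<^sup>2"
    have km: "?k \<in> borel_measurable ?M" by (rule measurable_borel_weighted[OF borel_measurable_normalized_kernel_sq[OF z]])
    have kgi: "integrable ?M (\<lambda>w. ?k w * ?g d w)"
    proof (rule Bochner_Integration.integrable_bound[OF integrable_mult_right[OF gi, of "(1 - norm z) powr - (2 * (real CARD('n) + 1 + \<alpha>))"]])
      show "(\<lambda>w. ?k w * ?g d w) \<in> borel_measurable ?M" using km gm by measurable
      show "AE w in ?M. norm (?k w * ?g d w) \<le> norm ((1 - norm z) powr - (2 * (real CARD('n) + 1 + \<alpha>)) * ?g d w)"
        using normalized_kernel_sq_bound[OF \<alpha> z] by (intro AE_I2) (auto intro!: mult_right_mono simp: abs_mult)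
    qed
    let ?f = "\<lambda>w. ?k w *\<^sub>R complex_of_real (nrm (ops_from_l2 l2_space) (tail_op e d (b w)))"
    have eq: "?f w = complex_of_real (?k w * ?g d w)" if "w \<in> space ?M" for w
    proof -
      have "tail_op e d (b w) = b w o\<^sub>L tail_proj e d" by (rule tail_op_eq[OF e hom]) (use that in simp)
      then show ?thesis by (simp add: ops_l2_nrm scaleR_conv_of_real)
    qed
    have "integrable ?M ?f"
      by (subst Bochner_Integration.integrable_cong[OF refl eq]) (use kgi in \<open>auto simp del: of_real_mult of_real_power\<close>)
    then have "?bt z = (LINT w|?M. ?f w)" unfolding berezin_def by (rule Bochner_integral_type_space[OF \<alpha>])
    also have "\<dots> = (LINT w|?M. complex_of_real (?k w * ?g d w))" by (rule Bochner_Integration.integral_cong[OF refl eq])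
    also have "\<dots> = complex_of_real (LINT w|?M. ?k w * ?g d w)" by (rule integral_complex_of_real)
    finally have "cmod (?bt z) = (LINT w|?M. ?k w * ?g d w)" by simp
    then have "ennreal (cmod (?bt z)) = (\<integral>\<^sup>+w. ennreal (?k w * ?g d w) \<partial>?M)"
      by (subst nn_integral_eq_integral[OF kgi]) auto
    then show ?thesis by (simp add: ennreal_mult mult.commute)
  qed
  have "AE z in (ball_measure :: (complex ^ 'n) measure). ennreal (cmod (?bt z)) \<le> Linf_norm C_space (ball_measure :: (complex ^ 'n) measure) ?bt"
    unfolding Linf_norm_def using esssup_AE[of "\<lambda>x. ennreal (nrm C_space (?bt x))" "ball_measure :: (complex ^ 'n) measure"] by (simp add: type_space_def)
  then have "AE z in ?M. ennreal (cmod (?bt z)) \<le> ennreal \<epsilon>"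
    unfolding AE_weighted[OF \<alpha>] by eventually_elim (rule order_trans[OF _ less_imp_le[OF d(2)]])
  then have "AE z in ?M. (\<integral>\<^sup>+w. ennreal (?g d w) * ennreal ((cmod (normalized_kernel \<alpha> z w))\<^sup>2) \<partial>?M) \<le> ennreal \<epsilon>"
    using AE_space by eventually_elim (simp add: bt)
  then show ?thesis using d(1) by blast
qed

section \<open>Bounded Toeplitz operators\<close>

lemma holomorphic_on_ball_continuous: "holomorphic_on_ball f \<Longrightarrow> continuous_on (ball 0 1) f"
  unfolding holomorphic_on_ball_def
  by (metis continuous_at_imp_continuous_on has_derivative_continuous)

lemma holomorphic_on_ball_coord:
  assumes "holomorphic_on_ball f"
  shows "complex_diff_on_ball (\<lambda>w. coord (f w) i)"
  unfolding complex_diff_on_ball_def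
proof
  fix z :: "complex ^ 'a" assume "z \<in> ball 0 1"
  then obtain D where D: "(f has_derivative D) (at z)" "\<And>c v. D (c *s v) = c *\<^sub>C D v"
    using assms unfolding holomorphic_on_ball_def by blast
  have "((\<lambda>w. coord (f w) i) has_derivative (\<lambda>v. coord (D v) i)) (at z)"
    by (rule bounded_linear.has_derivative[OF bounded_linear_coord D(1)])
  then show "\<exists>D. ((\<lambda>w. coord (f w) i) has_derivative D) (at z) \<and> (\<forall>c v. D (c *s v) = c * D v)"
    by (intro exI conjI) (auto simp: D(2) coord_scaleC)
qed

lemma A2_iff:
  fixes f :: "complex ^ 'n \<Rightarrow> ell2"
  shows "f \<in> A2 \<alpha> \<longleftrightarrow> holomorphic_on_ball f \<and> (\<integral>\<^sup>+x. ennreal ((norm (f x))\<^sup>2) \<partial>weighted_measure \<alpha>) < \<infinity>"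
proof -
  have "Lp_norm l2_space (weighted_measure \<alpha>) 2 f < \<infinity> \<longleftrightarrow> (\<integral>\<^sup>+x. ennreal ((norm (f x))\<^sup>2) \<partial>weighted_measure \<alpha>) < \<infinity>"
    unfolding A2_norm_sq[symmetric] by (simp add: A2_norm_def less_top[symmetric] power_eq_top_ennreal)
  moreover have "strongly_measurable l2_space (weighted_measure \<alpha>) f" if "holomorphic_on_ball f"
    by (rule strongly_measurable_borel[OF continuous_on_imp_measurable_weighted[OF holomorphic_on_ball_continuous[OF that]]])
  ultimately show ?thesis unfolding A2_def Lp_def by blast
qed

lemma A2_measurable: "f \<in> A2 \<alpha> \<Longrightarrow> f \<in> borel_measurable (weighted_measure \<alpha>)"
  by (rule continuous_on_imp_measurable_weighted) (simp add: A2_iff holomorphic_on_ball_continuous)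

lemma A2_integrable:
  fixes f :: "complex ^ 'n \<Rightarrow> ell2"
  assumes \<alpha>: "\<alpha> > -1" and f: "f \<in> A2 \<alpha>"
  shows "integrable (weighted_measure \<alpha>) f"
proof (rule integrableI_bounded[OF A2_measurable[OF f]])
  let ?M = "weighted_measure \<alpha> :: (complex ^ 'n) measure"
  have "(\<integral>\<^sup>+x. ennreal (norm (f x)) \<partial>?M) \<le> (\<integral>\<^sup>+x. 1 + ennreal ((norm (f x))\<^sup>2) \<partial>?M)"
  proof (rule nn_integral_mono)
    fix x
    have "norm (f x) \<le> 1 + (norm (f x))\<^sup>2"
      using sum_squares_bound[of 1 "norm (f x)"] norm_ge_zero[of "f x"] unfolding one_power2 mult_1_right by linarith
    then have "ennreal (norm (f x)) \<le> ennreal (1 + (norm (f x))\<^sup>2)" by (rule ennreal_leI)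
    then show "ennreal (norm (f x)) \<le> 1 + ennreal ((norm (f x))\<^sup>2)" by simp
  qed
  also have "\<dots> = (\<integral>\<^sup>+x. 1 \<partial>?M) + (\<integral>\<^sup>+x. ennreal ((norm (f x))\<^sup>2) \<partial>?M)"
    using A2_measurable[OF f] by (intro nn_integral_add) auto
  also have "\<dots> < \<infinity>" using f emeasure_weighted_space[OF \<alpha>, where 'n='n] by (simp add: A2_iff)
  finally show "(\<integral>\<^sup>+x. ennreal (norm (f x)) \<partial>?M) < \<infinity>" .
qed

lemma measurable_kernel_scaleC:
  fixes h :: "complex ^ 'n \<Rightarrow> ell2"
  assumes h: "h \<in> borel_measurable (weighted_measure \<alpha>)" and z: "norm z < 1"
  shows "(\<lambda>w. cnj (bergman_kernel \<alpha> z w) *\<^sub>C h w) \<in> borel_measurable (weighted_measure \<alpha>)"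
proof -
  have "continuous_on UNIV (\<lambda>p. fst p *\<^sub>C snd p)"
    by (intro scaleC.continuous_on continuous_on_fst continuous_on_snd continuous_on_id)
  from borel_measurable_continuous_Pair[OF borel_measurable_cnj_fun[OF borel_measurable_bergman_kernel[OF z]] h this]
  show ?thesis by simp
qed

lemma integrable_kernel_scaleC:
  fixes h :: "complex ^ 'n \<Rightarrow> ell2"
  assumes \<alpha>: "\<alpha> > -1" and h: "integrable (weighted_measure \<alpha>) h" and z: "norm z < 1"
  shows "integrable (weighted_measure \<alpha>) (\<lambda>w. cnj (bergman_kernel \<alpha> z w) *\<^sub>C h w)"
proof (rule Bochner_Integration.integrable_bound)
  let ?B = "(1 - norm z) powr - (real CARD('n) + 1 + \<alpha>)"
  show "integrable (weighted_measure \<alpha>) (\<lambda>w. ?B * norm (h w))" using h by simp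
  show "(\<lambda>w. cnj (bergman_kernel \<alpha> z w) *\<^sub>C h w) \<in> borel_measurable (weighted_measure \<alpha>)"
    by (rule measurable_kernel_scaleC[OF borel_measurable_integrable[OF h] z])
  show "AE w in weighted_measure \<alpha>. norm (cnj (bergman_kernel \<alpha> z w) *\<^sub>C h w) \<le> norm (?B * norm (h w))"
    using bergman_kernel_bound(1)[OF \<alpha> z] by (intro AE_I2) (auto simp: norm_scaleC abs_mult intro!: mult_right_mono)
qed

lemma A2_reproducing:
  fixes f :: "complex ^ 'n \<Rightarrow> ell2"
  assumes \<alpha>: "\<alpha> > -1" and f: "f \<in> A2 \<alpha>" and z: "norm z < 1"
  shows "(LINT w|weighted_measure \<alpha>. cnj (bergman_kernel \<alpha> z w) *\<^sub>C f w) = f z"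
proof (rule ell2_eqI)
  fix i
  let ?M = "weighted_measure \<alpha> :: (complex ^ 'n) measure"
  have int: "integrable ?M (\<lambda>w. coord (f w) i)"
    by (rule integrable_bounded_linear[OF bounded_linear_coord A2_integrable[OF \<alpha> f]])
  have "coord (LINT w|?M. cnj (bergman_kernel \<alpha> z w) *\<^sub>C f w) i = (LINT w|?M. coord (cnj (bergman_kernel \<alpha> z w) *\<^sub>C f w) i)"
    by (rule integral_bounded_linear[OF bounded_linear_coord integrable_kernel_scaleC[OF \<alpha> A2_integrable[OF \<alpha> f] z], symmetric])
  also have "\<dots> = (LINT w|?M. coord (f w) i * cnj (bergman_kernel \<alpha> z w))" by (simp add: coord_scaleC mult.commute)
  also have "\<dots> = coord (f z) i"
    by (rule bergman_reproducing[OF \<alpha> holomorphic_on_ball_coord int z]) (use f in \<open>simp add: A2_iff\<close>)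
  finally show "coord (LINT w|?M. cnj (bergman_kernel \<alpha> z w) *\<^sub>C f w) i = coord (f z) i" .
qed

lemma norm_integral_kernel_le:
  fixes h :: "complex ^ 'n \<Rightarrow> ell2"
  assumes \<alpha>: "\<alpha> > -1" and h: "integrable (weighted_measure \<alpha>) h" and z: "norm z < 1"
  shows "ennreal (norm (LINT w|weighted_measure \<alpha>. cnj (bergman_kernel \<alpha> z w) *\<^sub>C h w)) \<le> (\<integral>\<^sup>+w. abs_kernel \<alpha> z w * ennreal (norm (h w)) \<partial>weighted_measure \<alpha>)"
proof -
  let ?M = "weighted_measure \<alpha> :: (complex ^ 'n) measure"
  have "ennreal (norm (LINT w|?M. cnj (bergman_kernel \<alpha> z w) *\<^sub>C h w)) \<le> (\<integral>\<^sup>+w. ennreal (norm (cnj (bergman_kernel \<alpha> z w) *\<^sub>C h w)) \<partial>?M)"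
    by (rule integral_norm_bound_ennreal[OF integrable_kernel_scaleC[OF \<alpha> h z]])
  also have "\<dots> = (\<integral>\<^sup>+w. abs_kernel \<alpha> z w * ennreal (norm (h w)) \<partial>?M)"
    by (rule nn_integral_cong) (simp add: norm_scaleC abs_kernel_bergman ennreal_mult)
  finally show ?thesis .
qed

lemma toeplitz_eq:
  fixes b :: "complex ^ 'n \<Rightarrow> ell2 \<Rightarrow>\<^sub>L ell2"
  assumes \<alpha>: "\<alpha> > -1" and int: "integrable (weighted_measure \<alpha>) (\<lambda>w. blinfun_apply (b w) (f w))" and z: "norm z < 1"
  shows "toeplitz \<alpha> b f z = (LINT w|weighted_measure \<alpha>. cnj (bergman_kernel \<alpha> z w) *\<^sub>C blinfun_apply (b w) (f w))"
  unfolding toeplitz_def by (rule Bochner_integral_type_space[OF \<alpha> integrable_kernel_scaleC[OF \<alpha> int z]])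

section \<open>Holomorphy of kernel integrals\<close>

lemma powr_second_order:
  assumes c: "c > 0" and \<rho>: "0 \<le> \<rho>" "\<rho> < 1"
  shows "\<exists>B\<ge>0. \<forall>x y. cmod x \<le> \<rho> \<longrightarrow> cmod y \<le> \<rho> \<longrightarrow>
    cmod ((1 - y) powr - complex_of_real c - (1 - x) powr - complex_of_real c
      - complex_of_real c * (1 - x) powr (- complex_of_real c - 1) * (y - x)) \<le> B * (cmod (y - x))\<^sup>2"
proof -
  let ?c = "complex_of_real c"
  define q where "q i x = (if i = 0 then (1 - x) powr - ?c else if i = 1 then ?c * (1 - x) powr (- ?c - 1)
     else ?c * (?c + 1) * (1 - x) powr (- ?c - 2))" for i :: nat and x
  \<comment> \<open>A bound for the second derivative of (1 - x)^(-c) on |x| \<le> \<rho>, where |1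
    - x| \<ge> 1 - \<rho>.\<close>
  let ?B = "c * (c + 1) * (1 - \<rho>) powr (- c - 2)"
  have pos: "1 - x \<notin> \<real>\<^sub>\<le>\<^sub>0" if "cmod x \<le> \<rho>" for x
    using that \<rho> complex_Re_le_cmod[of x] by (auto simp: complex_nonpos_Reals_iff)
  have "cmod (q 0 y - (\<Sum>i\<le>1. q i x * (y - x) ^ i / fact i)) \<le> ?B * cmod (y - x) ^ Suc 1 / fact 1"
    if x: "cmod x \<le> \<rho>" and y: "cmod y \<le> \<rho>" for x y
  proof (rule complex_Taylor[where S = "cball 0 \<rho>"])
    fix i and x :: complex assume x: "x \<in> cball 0 \<rho>" "i \<le> (1::nat)"
    then have p: "1 - x \<notin> \<real>\<^sub>\<le>\<^sub>0" using pos by simp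
    consider "i = 0" | "i = 1" using x(2) by linarith
    then show "(q i has_field_derivative q (Suc i) x) (at x within cball 0 \<rho>)"
    proof cases
      case 1
      have "((\<lambda>x. (1 - x) powr - ?c) has_field_derivative ?c * (1 - x) powr (- ?c - 1)) (at x within cball 0 \<rho>)"
        using p by (auto intro!: derivative_eq_intros)
      then show ?thesis using 1 by (simp add: q_def[abs_def])
    next
      case 2
      have "((\<lambda>x. ?c * (1 - x) powr (- ?c - 1)) has_field_derivative ?c * (?c + 1) * (1 - x) powr (- ?c - 2)) (at x within cball 0 \<rho>)"
        using p by (auto intro!: derivative_eq_intros simp: algebra_simps)
      then show ?thesis using 2 by (simp add: q_def[abs_def])
    qed
  next
    fix x :: complex assume "x \<in> cball 0 \<rho>"
    then have x: "cmod x \<le> \<rho>" by simp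
    have "1 - \<rho> \<le> cmod (1 - x)" using x norm_triangle_ineq2[of 1 x] by simp
    then have "cmod (1 - x) powr (- c - 2) \<le> (1 - \<rho>) powr (- c - 2)" using \<rho> c by (intro powr_mono2') auto
    moreover have "cmod ((1 - x) powr (- ?c - 2)) = cmod (1 - x) powr (- c - 2)"
      using norm_powr_real_powr'[of "- ?c - 2" "1 - x"] by simp
    moreover have "cmod (?c + 1) = c + 1" using c by (metis norm_of_real of_real_1 of_real_add abs_of_pos add_pos_pos zero_less_one)
    ultimately show "cmod (q (Suc 1) x) \<le> ?B" using c by (simp add: q_def norm_mult)
  qed (use x y in auto)
  then have "cmod ((1 - y) powr - ?c - (1 - x) powr - ?c - ?c * (1 - x) powr (- ?c - 1) * (y - x)) \<le> ?B * (cmod (y - x))\<^sup>2"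
    if "cmod x \<le> \<rho>" "cmod y \<le> \<rho>" for x y
    using that by (simp add: q_def power2_eq_square diff_diff_eq)
  then show ?thesis using c by (intro exI[of _ ?B]) auto
qed

text \<open>The kernel is (1 - <z,w>)^(-c) with |<z,w>| \<le> |z|, so its second-order Taylor
  remainder in z is bounded uniformly in w. Mere integrability of h therefore suffices for
  differentiation under the integral sign.\<close>

lemma holomorphic_kernel_integral:
  fixes h :: "complex ^ 'n \<Rightarrow> ell2"
  assumes \<alpha>: "\<alpha> > -1" and h: "integrable (weighted_measure \<alpha>) h"
    and S: "\<And>z. norm z < 1 \<Longrightarrow> S z = (LINT w|weighted_measure \<alpha>. cnj (bergman_kernel \<alpha> z w) *\<^sub>C h w)"
  shows "holomorphic_on_ball S"
  unfolding holomorphic_on_ball_def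
proof
  let ?M = "weighted_measure \<alpha> :: (complex ^ 'n) measure"
  let ?c = "real CARD('n) + 1 + \<alpha>"
  fix z :: "complex ^ 'n" assume "z \<in> ball 0 1"
  then have z: "norm z < 1" by simp
  have c: "?c > 0" using \<alpha> by simp
  \<comment> \<open>The midpoint between |z| and 1: perturbations of size below (1 - |z|)/2 keep z +
    v in the ball of radius \<rho>.\<close>
  define \<rho> where "\<rho> = (1 + norm z) / 2"
  have \<rho>: "0 \<le> \<rho>" "\<rho> < 1" "norm z \<le> \<rho>" using z by (auto simp: \<rho>_def)
  let ?q = "\<lambda>x. (1 - x) powr - complex_of_real ?c" and ?q' = "\<lambda>x. complex_of_real ?c * (1 - x) powr (- complex_of_real ?c - 1)"
  obtain B where B: "B \<ge> 0" "\<And>x y. cmod x \<le> \<rho> \<Longrightarrow> cmod y \<le> \<rho> \<Longrightarrow> cmod (?q y - ?q x - ?q' x * (y - x)) \<le> B * (cmod (y - x))\<^sup>2"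
    using powr_second_order[OF c \<rho>(1,2)] by blast
  have K: "cnj (bergman_kernel \<alpha> u w) = ?q (herm u w)" if "norm u < 1" "norm w < 1" for u w :: "complex ^ 'n"
    unfolding cnj_bergman_kernel[OF that] by (simp only: bergman_kernel_def)
  have hle: "cmod (herm u w) \<le> norm u" if "norm w < 1" for u w :: "complex ^ 'n"
    using norm_herm_le[of u w] that by (smt (verit) mult_left_le norm_ge_zero)
  define k where "k v w = ?q' (herm z w) * herm v w" for v w
  define D where "D v = (LINT w|?M. k v w *\<^sub>C h w)" for v
  have qc: "continuous_on (ball 0 1) (\<lambda>w. ?q' (herm z w))"
  proof -
    have "continuous_on (ball 0 1) (\<lambda>w. complex_of_real ?c * exp ((- complex_of_real ?c - 1) * Ln (1 - herm z w)))"
      using Re_1_minus_herm[OF z] unfolding herm_def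
      by (intro continuous_intros) (fastforce simp: complex_nonpos_Reals_iff)
    then show ?thesis
      by (rule continuous_on_eq) (use one_minus_herm_nz[OF z] in \<open>auto simp: powr_def\<close>)
  qed
  define Q where "Q = ?c * (1 - \<rho>) powr (- ?c - 1)"
  have qb: "cmod (?q' (herm z w)) \<le> Q" if w: "norm w < 1" for w
  proof -
    have "1 - \<rho> \<le> cmod (1 - herm z w)" using hle[OF w, of z] \<rho>(3) norm_triangle_ineq2[of 1 "herm z w"] by simp
    then have "cmod (1 - herm z w) powr (- ?c - 1) \<le> (1 - \<rho>) powr (- ?c - 1)" using \<rho> c by (intro powr_mono2') auto
    moreover have "cmod ((1 - herm z w) powr (- complex_of_real ?c - 1)) = cmod (1 - herm z w) powr (- ?c - 1)"
      using norm_powr_real_powr'[of "- complex_of_real ?c - 1" "1 - herm z w"] by simp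
    ultimately show ?thesis using c unfolding Q_def norm_mult norm_of_real by (intro mult_mono) auto
  qed
  have Q: "Q \<ge> 0" using c by (simp add: Q_def)
  have kb: "norm (k v w *\<^sub>C h w) \<le> Q * norm v * norm (h w)" if w: "norm w < 1" for v w
    unfolding norm_scaleC k_def norm_mult[of "?q' (herm z w)"]
    by (rule mult_right_mono[OF mult_mono[OF qb[OF w] hle[OF w] Q norm_ge_zero] norm_ge_zero])
  have km: "(\<lambda>w. k v w *\<^sub>C h w) \<in> borel_measurable ?M" for v
  proof -
    have "continuous_on (ball 0 1) (\<lambda>w. herm v w)" unfolding herm_def by (intro continuous_intros)
    then have 1: "k v \<in> borel_measurable ?M" unfolding k_def
      by (intro continuous_on_imp_measurable_weighted continuous_on_mult qc)
    have "continuous_on UNIV (\<lambda>p. fst p *\<^sub>C snd p)"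
      by (intro scaleC.continuous_on continuous_on_fst continuous_on_snd continuous_on_id)
    from borel_measurable_continuous_Pair[OF 1 borel_measurable_integrable[OF h] this] show ?thesis by simp
  qed
  have hi: "integrable ?M (\<lambda>w. norm (h w))" using h by simp
  have ki: "integrable ?M (\<lambda>w. k v w *\<^sub>C h w)" for v
    by (rule Bochner_Integration.integrable_bound[OF integrable_mult_right[OF hi, of "Q * norm v"] km])
       (use kb Q in \<open>auto intro!: AE_I2 simp: abs_mult\<close>)
  let ?H = "LINT w|?M. norm (h w)"
  have H: "?H \<ge> 0" by simp
  have Dlin: "bounded_linear D"
  proof (rule bounded_linear_intro[of _ "Q * ?H"])
    show "D (u + v) = D u + D v" for u v
      unfolding D_def using ki by (subst Bochner_Integration.integral_add[symmetric]) (auto simp: k_def herm_lin distrib_left scaleC.add_left)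
    show "D (r *\<^sub>R v) = r *\<^sub>R D v" for r v
      unfolding D_def by (subst integral_scaleR_right[symmetric]) (auto simp: k_def herm_scaleR_left scaleC.scaleR_left)
    show "norm (D v) \<le> norm v * (Q * ?H)" for v
    proof -
      have "norm (D v) \<le> (LINT w|?M. norm (k v w *\<^sub>C h w))" unfolding D_def by (rule integral_norm_bound)
      also have "\<dots> \<le> (LINT w|?M. Q * norm v * norm (h w))"
        by (rule integral_mono[OF integrable_norm[OF ki] integrable_mult_right[OF hi]]) (use kb in auto)
      finally show ?thesis by (simp add: mult_ac)
    qed
  qed
  have hom: "D (a *s v) = a *\<^sub>C D v" for a v
  proof -
    have "D (a *s v) = (LINT w|?M. a *\<^sub>C (k v w *\<^sub>C h w))" unfolding D_def by (simp add: k_def herm_lin scaleC_scaleC mult_ac)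
    also have "\<dots> = a *\<^sub>C D v" unfolding D_def by (rule integral_bounded_linear[OF scaleC.bounded_linear_right ki])
    finally show ?thesis .
  qed
  have "(S has_derivative D) (at z)"
    unfolding has_derivative_at
  proof (intro conjI Dlin)
    show "(\<lambda>v. norm (S (z + v) - S z - D v) / norm v) \<midarrow>0\<rightarrow> 0"
    proof (rule tendsto_sandwich[OF _ _ tendsto_const])
      show "\<forall>\<^sub>F v in at 0. 0 \<le> norm (S (z + v) - S z - D v) / norm v" by simp
      show "\<forall>\<^sub>F v in at 0. norm (S (z + v) - S z - D v) / norm v \<le> B * ?H * norm v"
        unfolding eventually_at
      proof (intro exI[of _ "(1 - norm z) / 2"] conjI ballI impI)
        show "(1 - norm z) / 2 > 0" using z by simp
        fix v :: "complex ^ 'n" assume v: "v \<noteq> 0 \<and> dist v 0 < (1 - norm z) / 2"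
        have zv: "norm (z + v) \<le> \<rho>" using norm_triangle_ineq[of z v] v by (simp add: \<rho>_def field_simps)
        then have zv1: "norm (z + v) < 1" using \<rho> by simp
        let ?e = "\<lambda>w. cnj (bergman_kernel \<alpha> (z + v) w) *\<^sub>C h w - cnj (bergman_kernel \<alpha> z w) *\<^sub>C h w - k v w *\<^sub>C h w"
        note i1 = integrable_kernel_scaleC[OF \<alpha> h zv1] and i2 = integrable_kernel_scaleC[OF \<alpha> h z]
        have ei: "integrable ?M ?e" by (intro Bochner_Integration.integrable_diff i1 i2 ki)
        have "S (z + v) - S z - D v = (LINT w|?M. ?e w)"
          unfolding S[OF zv1] S[OF z] D_def
          by (simp add: i1 i2 ki Bochner_Integration.integral_diff Bochner_Integration.integrable_diff)
        then have "norm (S (z + v) - S z - D v) \<le> (LINT w|?M. norm (?e w))" by simp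
        also have "\<dots> \<le> (LINT w|?M. (B * (norm v)\<^sup>2) * norm (h w))"
        proof (rule integral_mono[OF integrable_norm[OF ei] integrable_mult_right[OF hi]])
          fix w assume "w \<in> space ?M"
          then have w: "norm w < 1" by simp
          have "?e w = (?q (herm (z + v) w) - ?q (herm z w) - ?q' (herm z w) * (herm (z + v) w - herm z w)) *\<^sub>C h w"
            unfolding K[OF zv1 w] K[OF z w] k_def by (simp add: scaleC.diff_left herm_lin)
          then have "norm (?e w) = cmod (?q (herm (z + v) w) - ?q (herm z w) - ?q' (herm z w) * (herm (z + v) w - herm z w)) * norm (h w)"
            by (simp only: norm_scaleC)
          also have "\<dots> \<le> (B * (cmod (herm (z + v) w - herm z w))\<^sup>2) * norm (h w)"
            by (intro mult_right_mono B(2)) (use hle[OF w, of z] hle[OF w, of "z + v"] \<rho>(3) zv in auto)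
          also have "\<dots> \<le> (B * (norm v)\<^sup>2) * norm (h w)"
            using hle[OF w, of v] B(1) by (intro mult_right_mono mult_left_mono power_mono) (auto simp: herm_lin)
          finally show "norm (?e w) \<le> (B * (norm v)\<^sup>2) * norm (h w)" .
        qed
        also have "\<dots> = B * ?H * norm v * norm v" by (simp add: power2_eq_square mult_ac)
        finally show "norm (S (z + v) - S z - D v) / norm v \<le> B * ?H * norm v" using v by (simp add: field_simps)
      qed
      show "(\<lambda>v. B * ?H * norm v) \<midarrow>0\<rightarrow> 0" by (intro tendsto_mult_right_zero tendsto_norm_zero tendsto_ident_at)
    qed
  qed
  then show "\<exists>D. (S has_derivative D) (at z) \<and> (\<forall>c v. D (c *s v) = c *\<^sub>C D v)" using hom by blast
qed

section \<open>Boundedness via the Schur test\<close>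

lemma schur_L2:
  assumes \<alpha>: "\<alpha> > -1"
  shows "\<exists>K>0. \<forall>\<phi> :: complex ^ 'n \<Rightarrow> ennreal. \<phi> \<in> borel_measurable (weighted_measure \<alpha>) \<longrightarrow>
    (\<integral>\<^sup>+u. (\<integral>\<^sup>+v. abs_kernel2 \<alpha> (\<lambda>_. 1) v u * \<phi> v \<partial>weighted_measure \<alpha>)\<^sup>2 \<partial>weighted_measure \<alpha>)
      \<le> ennreal (K\<^sup>2) * (\<integral>\<^sup>+v. (\<phi> v)\<^sup>2 \<partial>weighted_measure \<alpha>)"
proof -
  let ?M = "weighted_measure \<alpha> :: (complex ^ 'n) measure"
  interpret finite_measure ?M by (rule finite_measure_weighted[OF \<alpha>])
  obtain K where K: "K > 0" "\<And>v :: complex ^ 'n. norm v < 1 \<Longrightarrow>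
    (\<integral>\<^sup>+u. abs_kernel2 \<alpha> (\<lambda>_. 1) v u * ennreal (schur_weight \<alpha> u) \<partial>weighted_measure \<alpha>) \<le> ennreal K * ennreal (schur_weight \<alpha> v)"
    using schur_row[OF \<alpha>] by blast
  show ?thesis
  proof (intro exI[of _ K] conjI allI impI K(1))
    fix \<phi> :: "complex ^ 'n \<Rightarrow> ennreal" assume \<phi>: "\<phi> \<in> borel_measurable ?M"
    define k where "k p = abs_kernel2 \<alpha> (\<lambda>_. 1) (fst p) (snd p)" for p :: "(complex ^ 'n) \<times> (complex ^ 'n)"
    have kvu: "k (v, u) = abs_kernel2 \<alpha> (\<lambda>_. 1) v u" for v u by (simp add: k_def)
    have "(\<integral>\<^sup>+u. (\<integral>\<^sup>+v. k (v, u) * \<phi> v \<partial>?M)\<^sup>2 \<partial>?M) \<le> ennreal K * ennreal K * (\<integral>\<^sup>+v. (\<phi> v)\<^sup>2 \<partial>?M)"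
    proof (rule schur_test[where h = "schur_weight \<alpha>"])
      show "sigma_finite_measure ?M" by unfold_locales
      show "k \<in> borel_measurable (?M \<Otimes>\<^sub>M ?M)"
        unfolding k_def
        by (intro borel_measurable_abs_kernel2[OF \<alpha>] measurable_compose[OF measurable_fst measurable_ident_weighted] measurable_compose[OF measurable_snd measurable_ident_weighted]) simp
      show "schur_weight \<alpha> \<in> borel_measurable ?M" using borel_measurable_schur_weight[OF measurable_ident_weighted] by simp
      show "(\<integral>\<^sup>+v. k (v, u) * ennreal (schur_weight \<alpha> v) \<partial>?M) \<le> ennreal K * ennreal (schur_weight \<alpha> u)" if "u \<in> space ?M" for u
        using K(2)[of u] that unfolding kvu by (simp add: abs_kernel2_commute[of \<alpha> _ _ u])
      show "(\<integral>\<^sup>+u. k (v, u) * ennreal (schur_weight \<alpha> u) \<partial>?M) \<le> ennreal K * ennreal (schur_weight \<alpha> v)" if "v \<in> space ?M" for v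
        using K(2)[of v] that unfolding kvu by simp
    qed (use \<phi> schur_weight_pos in auto)
    then show "(\<integral>\<^sup>+u. (\<integral>\<^sup>+v. abs_kernel2 \<alpha> (\<lambda>_. 1) v u * \<phi> v \<partial>?M)\<^sup>2 \<partial>?M) \<le> ennreal (K\<^sup>2) * (\<integral>\<^sup>+v. (\<phi> v)\<^sup>2 \<partial>?M)"
      using K(1) unfolding kvu by (simp add: power2_eq_square ennreal_mult)
  qed
qed

text \<open>||b|| d nu_alpha is a Carleson measure with constant B, expressed by its Berezin
  transform. B is explicit because ||T_b|| will depend linearly on it, which makes truncated symbols
  with small B operators of small norm.\<close>

definition carleson_symbol :: "real \<Rightarrow> (complex ^ 'n \<Rightarrow> ell2 \<Rightarrow>\<^sub>L ell2) \<Rightarrow> real \<Rightarrow> bool" where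
  "carleson_symbol \<alpha> b B \<longleftrightarrow> op_measurable (weighted_measure \<alpha>) b \<and> B \<ge> 0 \<and>
     (AE z in weighted_measure \<alpha>. (\<integral>\<^sup>+w. ennreal (norm (b w)) * ennreal ((cmod (normalized_kernel \<alpha> z w))\<^sup>2) \<partial>weighted_measure \<alpha>) \<le> ennreal B)"

lemma carleson_norm_measurable:
  "\<alpha> > -1 \<Longrightarrow> carleson_symbol \<alpha> b B \<Longrightarrow> (\<lambda>w. ennreal (norm (b w))) \<in> borel_measurable (weighted_measure \<alpha>)"
  using measurable_compose[OF op_measurable_norm[of \<alpha> b 0] measurable_ennreal] by (simp add: carleson_symbol_def)

lemma carleson_abs_kernel2:
  assumes \<alpha>: "\<alpha> > -1"
  shows "\<exists>C>0. \<forall>(b :: complex ^ 'n \<Rightarrow> ell2 \<Rightarrow>\<^sub>L ell2) B. carleson_symbol \<alpha> b B \<longrightarrow>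
    (\<forall>v u. norm v < 1 \<longrightarrow> norm u < 1 \<longrightarrow> abs_kernel2 \<alpha> (\<lambda>w. ennreal (norm (b w))) v u \<le> ennreal (C * B) * abs_kernel2 \<alpha> (\<lambda>_. 1) v u)"
proof -
  obtain C where C: "C > 0" "\<And>g B (z :: complex ^ 'n) u. g \<in> borel_measurable (weighted_measure \<alpha>) \<Longrightarrow>
    (AE v in weighted_measure \<alpha>. (\<integral>\<^sup>+w. g w * ennreal ((cmod (normalized_kernel \<alpha> v w))\<^sup>2) \<partial>weighted_measure \<alpha>) \<le> B) \<Longrightarrow>
    norm z < 1 \<Longrightarrow> norm u < 1 \<Longrightarrow> abs_kernel2 \<alpha> g z u \<le> ennreal C * B * abs_kernel2 \<alpha> (\<lambda>_. 1) z u"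
    using abs_kernel2_carleson[OF \<alpha>, where 'n='n] by blast
  show ?thesis
  proof (intro exI[of _ C] conjI allI impI C(1))
    fix b :: "complex ^ 'n \<Rightarrow> ell2 \<Rightarrow>\<^sub>L ell2" and B and v u :: "complex ^ 'n"
    assume b: "carleson_symbol \<alpha> b B" and v: "norm v < 1" and u: "norm u < 1"
    have "abs_kernel2 \<alpha> (\<lambda>w. ennreal (norm (b w))) v u \<le> ennreal C * ennreal B * abs_kernel2 \<alpha> (\<lambda>_. 1) v u"
      by (rule C(2)[OF carleson_norm_measurable[OF \<alpha> b] _ v u]) (use b in \<open>simp add: carleson_symbol_def\<close>)
    then show "abs_kernel2 \<alpha> (\<lambda>w. ennreal (norm (b w))) v u \<le> ennreal (C * B) * abs_kernel2 \<alpha> (\<lambda>_. 1) v u"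
      using C(1) b by (simp add: ennreal_mult carleson_symbol_def)
  qed
qed

lemma abs_kernel2_iterated:
  fixes g \<phi> :: "complex ^ 'n \<Rightarrow> ennreal"
  assumes \<alpha>: "\<alpha> > -1" and [measurable]: "g \<in> borel_measurable (weighted_measure \<alpha>)" "\<phi> \<in> borel_measurable (weighted_measure \<alpha>)"
  shows "(\<integral>\<^sup>+w. abs_kernel \<alpha> u w * (g w * (\<integral>\<^sup>+v. abs_kernel \<alpha> w v * \<phi> v \<partial>weighted_measure \<alpha>)) \<partial>weighted_measure \<alpha>)
    = (\<integral>\<^sup>+v. abs_kernel2 \<alpha> g v u * \<phi> v \<partial>weighted_measure \<alpha>)"
proof -
  let ?M = "weighted_measure \<alpha> :: (complex ^ 'n) measure"
  interpret M: finite_measure ?M by (rule finite_measure_weighted[OF \<alpha>])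
  interpret P: pair_sigma_finite ?M ?M by unfold_locales
  have km: "(\<lambda>w. abs_kernel \<alpha> x w) \<in> borel_measurable ?M" for x
    by (intro borel_measurable_abs_kernel measurable_ident_weighted) simp
  have km2: "(\<lambda>p. abs_kernel \<alpha> (fst p) (snd p)) \<in> borel_measurable (?M \<Otimes>\<^sub>M ?M)"
    by (intro borel_measurable_abs_kernel measurable_compose[OF measurable_fst measurable_ident_weighted] measurable_compose[OF measurable_snd measurable_ident_weighted])
  have "(\<integral>\<^sup>+w. abs_kernel \<alpha> u w * (g w * (\<integral>\<^sup>+v. abs_kernel \<alpha> w v * \<phi> v \<partial>?M)) \<partial>?M) =
    (\<integral>\<^sup>+w. \<integral>\<^sup>+v. abs_kernel \<alpha> u w * (g w * (abs_kernel \<alpha> w v * \<phi> v)) \<partial>?M \<partial>?M)"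
  proof (rule nn_integral_cong)
    fix w
    have "(\<lambda>v. abs_kernel \<alpha> w v * \<phi> v) \<in> borel_measurable ?M" using km[of w] by measurable
    then show "abs_kernel \<alpha> u w * (g w * (\<integral>\<^sup>+v. abs_kernel \<alpha> w v * \<phi> v \<partial>?M)) = (\<integral>\<^sup>+v. abs_kernel \<alpha> u w * (g w * (abs_kernel \<alpha> w v * \<phi> v)) \<partial>?M)"
      by (simp add: nn_integral_cmult)
  qed
  also have "\<dots> = (\<integral>\<^sup>+v. \<integral>\<^sup>+w. abs_kernel \<alpha> u w * (g w * (abs_kernel \<alpha> w v * \<phi> v)) \<partial>?M \<partial>?M)"
  proof (rule P.Fubini')
    have 1: "(\<lambda>p. abs_kernel \<alpha> u (snd p)) \<in> borel_measurable (?M \<Otimes>\<^sub>M ?M)" "(\<lambda>p. g (snd p)) \<in> borel_measurable (?M \<Otimes>\<^sub>M ?M)"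
      "(\<lambda>p. \<phi> (fst p)) \<in> borel_measurable (?M \<Otimes>\<^sub>M ?M)" "(\<lambda>p. abs_kernel \<alpha> (snd p) (fst p)) \<in> borel_measurable (?M \<Otimes>\<^sub>M ?M)"
      using km[of u] km2 by (auto simp: abs_kernel_commute[of \<alpha> "snd _" "fst _"])
    then show "(\<lambda>(v, w). abs_kernel \<alpha> u w * (g w * (abs_kernel \<alpha> w v * \<phi> v))) \<in> borel_measurable (?M \<Otimes>\<^sub>M ?M)"
      unfolding split_beta' by (intro borel_measurable_times_ennreal)
  qed
  also have "\<dots> = (\<integral>\<^sup>+v. abs_kernel2 \<alpha> g v u * \<phi> v \<partial>?M)"
  proof (rule nn_integral_cong)
    fix v
    have "(\<lambda>w. g w * (abs_kernel \<alpha> v w * abs_kernel \<alpha> u w)) \<in> borel_measurable ?M" using km[of v] km[of u] by measurable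
    then have "abs_kernel2 \<alpha> g v u * \<phi> v = (\<integral>\<^sup>+w. g w * (abs_kernel \<alpha> v w * abs_kernel \<alpha> u w) * \<phi> v \<partial>?M)"
      unfolding abs_kernel2_def by (simp add: nn_integral_multc)
    then show "(\<integral>\<^sup>+w. abs_kernel \<alpha> u w * (g w * (abs_kernel \<alpha> w v * \<phi> v)) \<partial>?M) = abs_kernel2 \<alpha> g v u * \<phi> v"
      by (simp add: mult_ac abs_kernel_commute[of \<alpha> v])
  qed
  finally show ?thesis .
qed

lemma A2_pointwise_le:
  fixes f :: "complex ^ 'n \<Rightarrow> ell2"
  assumes "\<alpha> > -1" "f \<in> A2 \<alpha>" "norm w < 1"
  shows "ennreal (norm (f w)) \<le> (\<integral>\<^sup>+v. abs_kernel \<alpha> w v * ennreal (norm (f v)) \<partial>weighted_measure \<alpha>)"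
  using norm_integral_kernel_le[OF assms(1) A2_integrable[OF assms(1,2)] assms(3)] A2_reproducing[OF assms] by simp

lemma AE_finite_abs_kernel2:
  fixes \<phi> :: "complex ^ 'n \<Rightarrow> ennreal"
  assumes \<alpha>: "\<alpha> > -1" and \<phi>: "\<phi> \<in> borel_measurable (weighted_measure \<alpha>)" and fin: "(\<integral>\<^sup>+v. (\<phi> v)\<^sup>2 \<partial>weighted_measure \<alpha>) < \<infinity>"
  shows "AE u in weighted_measure \<alpha>. (\<integral>\<^sup>+v. abs_kernel2 \<alpha> (\<lambda>_. 1) v u * \<phi> v \<partial>weighted_measure \<alpha>) < \<infinity>"
    "(\<lambda>u. \<integral>\<^sup>+v. abs_kernel2 \<alpha> (\<lambda>_. 1) v u * \<phi> v \<partial>weighted_measure \<alpha>) \<in> borel_measurable (weighted_measure \<alpha>)"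
proof -
  let ?M = "weighted_measure \<alpha> :: (complex ^ 'n) measure"
  let ?P = "\<lambda>u. \<integral>\<^sup>+v. abs_kernel2 \<alpha> (\<lambda>_. 1) v u * \<phi> v \<partial>?M"
  interpret M: finite_measure ?M by (rule finite_measure_weighted[OF \<alpha>])
  have "(\<lambda>p. abs_kernel2 \<alpha> (\<lambda>_. 1) (snd p) (fst p) * \<phi> (snd p)) \<in> borel_measurable (?M \<Otimes>\<^sub>M ?M)"
    by (intro borel_measurable_times_ennreal borel_measurable_abs_kernel2[OF \<alpha>] measurable_compose[OF measurable_fst measurable_ident_weighted]
       measurable_compose[OF measurable_snd measurable_ident_weighted] measurable_compose[OF measurable_snd \<phi>]) simp
  then show m: "?P \<in> borel_measurable ?M"
    using M.borel_measurable_nn_integral[of "\<lambda>u v. abs_kernel2 \<alpha> (\<lambda>_. 1) v u * \<phi> v" ?M] by (simp add: split_beta')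
  obtain K where K: "(\<integral>\<^sup>+u. (?P u)\<^sup>2 \<partial>?M) \<le> ennreal (K\<^sup>2) * (\<integral>\<^sup>+v. (\<phi> v)\<^sup>2 \<partial>?M)"
    using schur_L2[OF \<alpha>] \<phi> by blast
  have "(\<integral>\<^sup>+u. (?P u)\<^sup>2 \<partial>?M) < \<infinity>" by (rule le_less_trans[OF K]) (use fin in \<open>simp add: ennreal_mult_less_top\<close>)
  then have "AE u in ?M. (?P u)\<^sup>2 \<noteq> \<infinity>" using m by (intro nn_integral_PInf_AE) auto
  then show "AE u in ?M. ?P u < \<infinity>" by eventually_elim (auto simp: power_eq_top_ennreal less_top)
qed

lemma exists_ball_of_AE:
  assumes \<alpha>: "\<alpha> > -1" and "AE u in (weighted_measure \<alpha> :: (complex ^ 'n) measure). P u"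
  shows "\<exists>u. norm u < 1 \<and> P u"
proof (rule ccontr)
  assume "\<not> ?thesis"
  with assms(2) have "AE u in (weighted_measure \<alpha> :: (complex ^ 'n) measure). False"
    using AE_space by (auto elim: eventually_mono)
  then have "emeasure (weighted_measure \<alpha>) (space (weighted_measure \<alpha> :: (complex ^ 'n) measure)) = 0"
    by (simp add: eventually_False ae_filter_eq_bot_iff)
  then show False using emeasure_weighted_space[OF \<alpha>, where 'n='n] by simp
qed

text \<open>The reproducing formula bounds ||f(w)|| by the integral of |K_w| ||f||. After Tonelli
  ||b|| occurs only inside \<open>abs_kernel2\<close>, where the Carleson condition replaces it by a
  constant.\<close>

lemma toeplitz_weight_bound:
  assumes \<alpha>: "\<alpha> > -1"
  shows "\<exists>C>0. \<forall>(b :: complex ^ 'n \<Rightarrow> ell2 \<Rightarrow>\<^sub>L ell2) B f u. carleson_symbol \<alpha> b B \<longrightarrow> f \<in> A2 \<alpha> \<longrightarrow> norm u < 1 \<longrightarrow>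
    (\<integral>\<^sup>+w. abs_kernel \<alpha> u w * (ennreal (norm (b w)) * ennreal (norm (f w))) \<partial>weighted_measure \<alpha>)
      \<le> ennreal (C * B) * (\<integral>\<^sup>+v. abs_kernel2 \<alpha> (\<lambda>_. 1) v u * ennreal (norm (f v)) \<partial>weighted_measure \<alpha>)"
proof -
  let ?M = "weighted_measure \<alpha> :: (complex ^ 'n) measure"
  obtain C where C: "C > 0" "\<And>(b :: complex ^ 'n \<Rightarrow> ell2 \<Rightarrow>\<^sub>L ell2) B v u. carleson_symbol \<alpha> b B \<Longrightarrow> norm v < 1 \<Longrightarrow> norm u < 1 \<Longrightarrow>
    abs_kernel2 \<alpha> (\<lambda>w. ennreal (norm (b w))) v u \<le> ennreal (C * B) * abs_kernel2 \<alpha> (\<lambda>_. 1) v u"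
    using carleson_abs_kernel2[OF \<alpha>, where 'n='n] by blast
  show ?thesis
  proof (intro exI[of _ C] conjI allI impI C(1))
    fix b :: "complex ^ 'n \<Rightarrow> ell2 \<Rightarrow>\<^sub>L ell2" and B and f :: "complex ^ 'n \<Rightarrow> ell2" and u :: "complex ^ 'n"
    assume b: "carleson_symbol \<alpha> b B" and f: "f \<in> A2 \<alpha>" and u: "norm u < 1"
    have nf: "(\<lambda>v. ennreal (norm (f v))) \<in> borel_measurable ?M" using A2_measurable[OF f] by measurable
    have "(\<integral>\<^sup>+w. abs_kernel \<alpha> u w * (ennreal (norm (b w)) * ennreal (norm (f w))) \<partial>?M) \<le>
      (\<integral>\<^sup>+w. abs_kernel \<alpha> u w * (ennreal (norm (b w)) * (\<integral>\<^sup>+v. abs_kernel \<alpha> w v * ennreal (norm (f v)) \<partial>?M)) \<partial>?M)"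
      by (intro nn_integral_mono mult_left_mono A2_pointwise_le[OF \<alpha> f]) auto
    also have "\<dots> = (\<integral>\<^sup>+v. abs_kernel2 \<alpha> (\<lambda>w. ennreal (norm (b w))) v u * ennreal (norm (f v)) \<partial>?M)"
      by (rule abs_kernel2_iterated[OF \<alpha> carleson_norm_measurable[OF \<alpha> b] nf])
    also have "\<dots> \<le> (\<integral>\<^sup>+v. ennreal (C * B) * (abs_kernel2 \<alpha> (\<lambda>_. 1) v u * ennreal (norm (f v))) \<partial>?M)"
      unfolding mult.assoc[symmetric] by (intro nn_integral_mono mult_right_mono C(2)[OF b _ u]) auto
    also have "\<dots> = ennreal (C * B) * (\<integral>\<^sup>+v. abs_kernel2 \<alpha> (\<lambda>_. 1) v u * ennreal (norm (f v)) \<partial>?M)"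
      by (intro nn_integral_cmult borel_measurable_times_ennreal nf borel_measurable_abs_kernel2[OF \<alpha>] measurable_ident_weighted) auto
    finally show "(\<integral>\<^sup>+w. abs_kernel \<alpha> u w * (ennreal (norm (b w)) * ennreal (norm (f w))) \<partial>?M)
      \<le> ennreal (C * B) * (\<integral>\<^sup>+v. abs_kernel2 \<alpha> (\<lambda>_. 1) v u * ennreal (norm (f v)) \<partial>?M)" .
  qed
qed

lemma nn_integral_norm_power2: "(\<integral>\<^sup>+v. (ennreal (norm (f v)))\<^sup>2 \<partial>M) = (\<integral>\<^sup>+v. ennreal ((norm (f v))\<^sup>2) \<partial>M)"
  by (simp add: ennreal_power)

text \<open>By the Schur bound the dominating integral is finite for almost every u. At one such u
  the factor |K_u| is bounded below on the ball, so it can be removed and b f itself is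
  integrable.\<close>

lemma toeplitz_integrable:
  fixes b :: "complex ^ 'n \<Rightarrow> ell2 \<Rightarrow>\<^sub>L ell2"
  assumes \<alpha>: "\<alpha> > -1" and b: "carleson_symbol \<alpha> b B" and f: "f \<in> A2 \<alpha>"
  shows "integrable (weighted_measure \<alpha>) (\<lambda>w. blinfun_apply (b w) (f w))"
proof (rule integrableI_bounded)
  let ?M = "weighted_measure \<alpha> :: (complex ^ 'n) measure" and ?c = "real CARD('n) + 1 + \<alpha>"
  show "(\<lambda>w. blinfun_apply (b w) (f w)) \<in> borel_measurable ?M"
    by (rule op_measurable_apply[OF \<alpha> _ A2_measurable[OF f]]) (use b in \<open>simp add: carleson_symbol_def\<close>)
  obtain C where C: "\<And>u. norm u < 1 \<Longrightarrow>
    (\<integral>\<^sup>+w. abs_kernel \<alpha> u w * (ennreal (norm (b w)) * ennreal (norm (f w))) \<partial>?M)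
      \<le> ennreal (C * B) * (\<integral>\<^sup>+v. abs_kernel2 \<alpha> (\<lambda>_. 1) v u * ennreal (norm (f v)) \<partial>?M)"
    using toeplitz_weight_bound[OF \<alpha>] b f by blast
  have nf: "(\<lambda>v. ennreal (norm (f v))) \<in> borel_measurable ?M" using A2_measurable[OF f] by measurable
  have "(\<integral>\<^sup>+v. (ennreal (norm (f v)))\<^sup>2 \<partial>?M) < \<infinity>" using f unfolding nn_integral_norm_power2 by (simp add: A2_iff)
  from exists_ball_of_AE[OF \<alpha> AE_finite_abs_kernel2(1)[OF \<alpha> nf this]]
  obtain u where u: "norm u < 1" "(\<integral>\<^sup>+v. abs_kernel2 \<alpha> (\<lambda>_. 1) v u * ennreal (norm (f v)) \<partial>?M) < \<infinity>" by blast
  have m: "(\<lambda>w. abs_kernel \<alpha> u w * (ennreal (norm (b w)) * ennreal (norm (f w)))) \<in> borel_measurable ?M"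
    by (intro borel_measurable_times_ennreal carleson_norm_measurable[OF \<alpha> b] nf borel_measurable_abs_kernel measurable_ident_weighted) simp
  have "(\<integral>\<^sup>+w. ennreal (norm (blinfun_apply (b w) (f w))) \<partial>?M) \<le> (\<integral>\<^sup>+w. ennreal (2 powr ?c) * (abs_kernel \<alpha> u w * (ennreal (norm (b w)) * ennreal (norm (f w)))) \<partial>?M)"
  proof (rule nn_integral_mono)
    fix w assume "w \<in> space ?M"
    then have w: "norm w < 1" by simp
    have "1 \<le> 2 powr ?c * cmod (bergman_kernel \<alpha> u w)"
      using mult_left_mono[OF bergman_kernel_bound(2)[OF \<alpha> u(1) w], of "2 powr ?c"] by (simp flip: powr_add)
    then have "1 * (norm (b w) * norm (f w)) \<le> (2 powr ?c * cmod (bergman_kernel \<alpha> u w)) * (norm (b w) * norm (f w))"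
      by (rule mult_right_mono) simp
    then have "norm (blinfun_apply (b w) (f w)) \<le> 2 powr ?c * (cmod (bergman_kernel \<alpha> u w) * (norm (b w) * norm (f w)))"
      using norm_blinfun[of "b w" "f w"] by (simp add: mult.assoc)
    then show "ennreal (norm (blinfun_apply (b w) (f w))) \<le> ennreal (2 powr ?c) * (abs_kernel \<alpha> u w * (ennreal (norm (b w)) * ennreal (norm (f w))))"
      by (simp add: abs_kernel_bergman ennreal_mult[symmetric] ennreal_leI)
  qed
  also have "\<dots> = ennreal (2 powr ?c) * (\<integral>\<^sup>+w. abs_kernel \<alpha> u w * (ennreal (norm (b w)) * ennreal (norm (f w))) \<partial>?M)"
    by (rule nn_integral_cmult[OF m])
  also have "\<dots> \<le> ennreal (2 powr ?c) * (ennreal (C * B) * (\<integral>\<^sup>+v. abs_kernel2 \<alpha> (\<lambda>_. 1) v u * ennreal (norm (f v)) \<partial>?M))"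
    by (intro mult_left_mono C u(1)) simp
  also have "\<dots> < \<infinity>" using u(2) by (simp add: ennreal_mult_less_top)
  finally show "(\<integral>\<^sup>+w. ennreal (norm (blinfun_apply (b w) (f w))) \<partial>?M) < \<infinity>" .
qed

lemma toeplitz_holomorphic:
  assumes "\<alpha> > -1" "carleson_symbol \<alpha> b B" "f \<in> A2 \<alpha>"
  shows "holomorphic_on_ball (toeplitz \<alpha> b f)"
  by (rule holomorphic_kernel_integral[OF assms(1) toeplitz_integrable[OF assms] toeplitz_eq[OF assms(1) toeplitz_integrable[OF assms]]])

lemma toeplitz_pointwise_le:
  fixes b :: "complex ^ 'n \<Rightarrow> ell2 \<Rightarrow>\<^sub>L ell2"
  assumes \<alpha>: "\<alpha> > -1" and b: "carleson_symbol \<alpha> b B" and f: "f \<in> A2 \<alpha>" and u: "norm u < 1"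
  shows "ennreal (norm (toeplitz \<alpha> b f u)) \<le> (\<integral>\<^sup>+w. abs_kernel \<alpha> u w * (ennreal (norm (b w)) * ennreal (norm (f w))) \<partial>weighted_measure \<alpha>)"
proof -
  note int = toeplitz_integrable[OF \<alpha> b f]
  have "ennreal (norm (toeplitz \<alpha> b f u)) \<le> (\<integral>\<^sup>+w. abs_kernel \<alpha> u w * ennreal (norm (blinfun_apply (b w) (f w))) \<partial>weighted_measure \<alpha>)"
    unfolding toeplitz_eq[OF \<alpha> int u] by (rule norm_integral_kernel_le[OF \<alpha> int u])
  also have "\<dots> \<le> (\<integral>\<^sup>+w. abs_kernel \<alpha> u w * (ennreal (norm (b w)) * ennreal (norm (f w))) \<partial>weighted_measure \<alpha>)"
    by (intro nn_integral_mono mult_left_mono) (simp_all add: ennreal_mult[symmetric] ennreal_leI norm_blinfun)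
  finally show ?thesis .
qed

text \<open>C depends on the measure only, not on b, and B enters linearly; both facts are needed
  when the bound is applied to truncated symbols.\<close>

lemma toeplitz_L2_bound:
  assumes \<alpha>: "\<alpha> > -1"
  shows "\<exists>C>0. \<forall>(b :: complex ^ 'n \<Rightarrow> ell2 \<Rightarrow>\<^sub>L ell2) B f. carleson_symbol \<alpha> b B \<longrightarrow> f \<in> A2 \<alpha> \<longrightarrow>
    (A2_norm \<alpha> (toeplitz \<alpha> b f))\<^sup>2 \<le> (ennreal (C * B) * A2_norm \<alpha> f)\<^sup>2"
proof -
  let ?M = "weighted_measure \<alpha> :: (complex ^ 'n) measure"
  let ?P = "\<lambda>f u. \<integral>\<^sup>+v. abs_kernel2 \<alpha> (\<lambda>_. 1) v u * ennreal (norm (f v)) \<partial>?M"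
  obtain C where C: "C > 0" "\<And>(b :: complex ^ 'n \<Rightarrow> ell2 \<Rightarrow>\<^sub>L ell2) B f u. carleson_symbol \<alpha> b B \<Longrightarrow> f \<in> A2 \<alpha> \<Longrightarrow> norm u < 1 \<Longrightarrow>
    (\<integral>\<^sup>+w. abs_kernel \<alpha> u w * (ennreal (norm (b w)) * ennreal (norm (f w))) \<partial>?M) \<le> ennreal (C * B) * ?P f u"
    using toeplitz_weight_bound[OF \<alpha>, where 'n='n] by blast
  obtain K where K: "K > 0" "\<And>\<phi> :: complex ^ 'n \<Rightarrow> ennreal. \<phi> \<in> borel_measurable ?M \<Longrightarrow>
    (\<integral>\<^sup>+u. (\<integral>\<^sup>+v. abs_kernel2 \<alpha> (\<lambda>_. 1) v u * \<phi> v \<partial>?M)\<^sup>2 \<partial>?M) \<le> ennreal (K\<^sup>2) * (\<integral>\<^sup>+v. (\<phi> v)\<^sup>2 \<partial>?M)"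
    using schur_L2[OF \<alpha>, where 'n='n] by blast
  show ?thesis
  proof (intro exI[of _ "C * K"] conjI allI impI)
    show "C * K > 0" using C K by simp
    fix b :: "complex ^ 'n \<Rightarrow> ell2 \<Rightarrow>\<^sub>L ell2" and B and f :: "complex ^ 'n \<Rightarrow> ell2"
    assume b: "carleson_symbol \<alpha> b B" and f: "f \<in> A2 \<alpha>"
    have B: "B \<ge> 0" using b by (simp add: carleson_symbol_def)
    have nf: "(\<lambda>v. ennreal (norm (f v))) \<in> borel_measurable ?M" using A2_measurable[OF f] by measurable
    have fin: "(\<integral>\<^sup>+v. (ennreal (norm (f v)))\<^sup>2 \<partial>?M) < \<infinity>" using f unfolding nn_integral_norm_power2 by (simp add: A2_iff)
    have "(A2_norm \<alpha> (toeplitz \<alpha> b f))\<^sup>2 = (\<integral>\<^sup>+u. (ennreal (norm (toeplitz \<alpha> b f u)))\<^sup>2 \<partial>?M)"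
      unfolding A2_norm_sq nn_integral_norm_power2 ..
    also have "\<dots> \<le> (\<integral>\<^sup>+u. (ennreal (C * B) * ?P f u)\<^sup>2 \<partial>?M)"
      by (intro nn_integral_mono power_mono order_trans[OF toeplitz_pointwise_le[OF \<alpha> b f] C(2)[OF b f]]) auto
    also have "\<dots> = (ennreal (C * B))\<^sup>2 * (\<integral>\<^sup>+u. (?P f u)\<^sup>2 \<partial>?M)"
      unfolding power_mult_distrib by (intro nn_integral_cmult borel_measurable_power_ennreal AE_finite_abs_kernel2(2)[OF \<alpha> nf fin])
    also have "\<dots> \<le> (ennreal (C * B))\<^sup>2 * (ennreal (K\<^sup>2) * (\<integral>\<^sup>+v. (ennreal (norm (f v)))\<^sup>2 \<partial>?M))"
      by (intro mult_left_mono K(2) nf) simp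
    also have "\<dots> = (ennreal (C * K * B) * A2_norm \<alpha> f)\<^sup>2"
      unfolding nn_integral_norm_power2 A2_norm_sq[symmetric] power_mult_distrib mult.assoc[symmetric]
      using C K B by (simp add: ennreal_power ennreal_mult[symmetric] power_mult_distrib mult_ac)
    finally show "(A2_norm \<alpha> (toeplitz \<alpha> b f))\<^sup>2 \<le> (ennreal (C * K * B) * A2_norm \<alpha> f)\<^sup>2" .
  qed
qed

section \<open>T_b as a linear operator on A^2\<close>

lemma A2_norm_finite_iff: "A2_norm \<alpha> (f :: complex ^ 'n \<Rightarrow> ell2) < \<infinity> \<longleftrightarrow> (\<integral>\<^sup>+x. ennreal ((norm (f x))\<^sup>2) \<partial>weighted_measure \<alpha>) < \<infinity>"
  unfolding A2_norm_sq[symmetric] by (simp add: less_top[symmetric] power_eq_top_ennreal)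

lemma A2_iff_norm: "f \<in> A2 \<alpha> \<longleftrightarrow> holomorphic_on_ball f \<and> A2_norm \<alpha> f < \<infinity>"
  by (simp only: A2_iff A2_norm_finite_iff)

lemma toeplitz_in_A2:
  assumes "\<alpha> > -1" "carleson_symbol \<alpha> b B" "f \<in> A2 \<alpha>"
  shows "toeplitz \<alpha> b f \<in> A2 \<alpha>"
proof -
  obtain C where "(A2_norm \<alpha> (toeplitz \<alpha> b f))\<^sup>2 \<le> (ennreal (C * B) * A2_norm \<alpha> f)\<^sup>2"
    using toeplitz_L2_bound[OF assms(1)] assms(2,3) by blast
  then have "A2_norm \<alpha> (toeplitz \<alpha> b f) \<le> ennreal (C * B) * A2_norm \<alpha> f" by (rule ennreal_square_le_imp_le)
  also have "\<dots> < \<infinity>" using assms(3) by (simp add: A2_iff_norm ennreal_mult_less_top)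
  finally show ?thesis using toeplitz_holomorphic[OF assms] by (simp add: A2_iff_norm)
qed

lemma holomorphic_on_ball_lincomb:
  assumes "holomorphic_on_ball f" "holomorphic_on_ball g"
  shows "holomorphic_on_ball (\<lambda>w. a *\<^sub>C f w + c *\<^sub>C g w)"
  unfolding holomorphic_on_ball_def
proof
  fix z :: "complex ^ 'a" assume z: "z \<in> ball 0 1"
  obtain D where D: "(f has_derivative D) (at z)" "\<And>c v. D (c *s v) = c *\<^sub>C D v"
    using assms(1) z unfolding holomorphic_on_ball_def by blast
  obtain D' where D': "(g has_derivative D') (at z)" "\<And>c v. D' (c *s v) = c *\<^sub>C D' v"
    using assms(2) z unfolding holomorphic_on_ball_def by blast
  have "((\<lambda>w. a *\<^sub>C f w + c *\<^sub>C g w) has_derivative (\<lambda>v. a *\<^sub>C D v + c *\<^sub>C D' v)) (at z)"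
    by (intro has_derivative_add bounded_linear.has_derivative[OF scaleC.bounded_linear_right] D(1) D'(1))
  then show "\<exists>D. ((\<lambda>w. a *\<^sub>C f w + c *\<^sub>C g w) has_derivative D) (at z) \<and> (\<forall>c v. D (c *s v) = c *\<^sub>C D v)"
    by (intro exI conjI) (auto simp: D(2) D'(2) scaleC.add_right scaleC_scaleC mult.commute)
qed

lemma A2_norm_lincomb_finite:
  assumes "f \<in> A2 \<alpha>" "g \<in> A2 \<alpha>"
  shows "A2_norm \<alpha> (\<lambda>w. a *\<^sub>C f w + c *\<^sub>C g w :: ell2) < \<infinity>"
  unfolding A2_norm_finite_iff
proof -
  let ?M = "weighted_measure \<alpha> :: (complex ^ 'a) measure"
  have "(\<integral>\<^sup>+x. ennreal ((norm (a *\<^sub>C f x + c *\<^sub>C g x))\<^sup>2) \<partial>?M) \<le> (\<integral>\<^sup>+x. ennreal (2 * (cmod a)\<^sup>2) * ennreal ((norm (f x))\<^sup>2) + ennreal (2 * (cmod c)\<^sup>2) * ennreal ((norm (g x))\<^sup>2) \<partial>?M)"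
  proof (rule nn_integral_mono)
    fix x
    have "(norm (a *\<^sub>C f x + c *\<^sub>C g x))\<^sup>2 \<le> (cmod a * norm (f x) + cmod c * norm (g x))\<^sup>2"
      using norm_triangle_ineq[of "a *\<^sub>C f x" "c *\<^sub>C g x"] by (intro power_mono) (auto simp: norm_scaleC)
    also have "\<dots> \<le> 2 * (cmod a)\<^sup>2 * (norm (f x))\<^sup>2 + 2 * (cmod c)\<^sup>2 * (norm (g x))\<^sup>2"
      using sum_squares_bound[of "cmod a * norm (f x)" "cmod c * norm (g x)"] by (simp add: power2_sum power_mult_distrib)
    finally show "ennreal ((norm (a *\<^sub>C f x + c *\<^sub>C g x))\<^sup>2) \<le> ennreal (2 * (cmod a)\<^sup>2) * ennreal ((norm (f x))\<^sup>2) + ennreal (2 * (cmod c)\<^sup>2) * ennreal ((norm (g x))\<^sup>2)"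
      by (simp add: ennreal_mult[symmetric] ennreal_plus[symmetric] ennreal_leI del: ennreal_plus)
  qed
  also have "\<dots> = ennreal (2 * (cmod a)\<^sup>2) * (\<integral>\<^sup>+x. ennreal ((norm (f x))\<^sup>2) \<partial>?M) + ennreal (2 * (cmod c)\<^sup>2) * (\<integral>\<^sup>+x. ennreal ((norm (g x))\<^sup>2) \<partial>?M)"
    using A2_measurable[OF assms(1)] A2_measurable[OF assms(2)] by (subst nn_integral_add) (auto simp: nn_integral_cmult)
  also have "\<dots> < \<infinity>" using assms by (simp add: A2_iff ennreal_mult_less_top)
  finally show "(\<integral>\<^sup>+x. ennreal ((norm (a *\<^sub>C f x + c *\<^sub>C g x))\<^sup>2) \<partial>?M) < \<infinity>" .
qed

lemma A2_lincomb:
  assumes "f \<in> A2 \<alpha>" "g \<in> A2 \<alpha>"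
  shows "(\<lambda>w. a *\<^sub>C f w + c *\<^sub>C g w) \<in> A2 \<alpha>"
  using holomorphic_on_ball_lincomb[of f g a c] A2_norm_lincomb_finite[OF assms, of a c] assms by (simp add: A2_iff_norm)

lemma toeplitz_lincomb:
  fixes b :: "complex ^ 'n \<Rightarrow> ell2 \<Rightarrow>\<^sub>L ell2"
  assumes \<alpha>: "\<alpha> > -1" and b: "carleson_symbol \<alpha> b B" and f: "f \<in> A2 \<alpha>" and g: "g \<in> A2 \<alpha>" and z: "norm z < 1"
    and hom: "\<And>w c x. norm w < 1 \<Longrightarrow> blinfun_apply (b w) (c *\<^sub>C x) = c *\<^sub>C blinfun_apply (b w) x"
  shows "toeplitz \<alpha> b (\<lambda>w. a *\<^sub>C f w + c *\<^sub>C g w) z = a *\<^sub>C toeplitz \<alpha> b f z + c *\<^sub>C toeplitz \<alpha> b g z"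
proof -
  let ?M = "weighted_measure \<alpha> :: (complex ^ 'n) measure"
  let ?k = "\<lambda>w. cnj (bergman_kernel \<alpha> z w)"
  note i = toeplitz_integrable[OF \<alpha> b f] toeplitz_integrable[OF \<alpha> b g]
  note ki = integrable_kernel_scaleC[OF \<alpha> i(1) z] integrable_kernel_scaleC[OF \<alpha> i(2) z]
  have "toeplitz \<alpha> b (\<lambda>w. a *\<^sub>C f w + c *\<^sub>C g w) z = (LINT w|?M. ?k w *\<^sub>C blinfun_apply (b w) (a *\<^sub>C f w + c *\<^sub>C g w))"
    by (rule toeplitz_eq[OF \<alpha> toeplitz_integrable[OF \<alpha> b A2_lincomb[OF f g]] z])
  also have "\<dots> = (LINT w|?M. a *\<^sub>C (?k w *\<^sub>C blinfun_apply (b w) (f w)) + c *\<^sub>C (?k w *\<^sub>C blinfun_apply (b w) (g w)))"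
    by (rule Bochner_Integration.integral_cong) (auto simp: blinfun.add_right hom scaleC.add_right scaleC_scaleC mult.commute)
  also have "\<dots> = a *\<^sub>C (LINT w|?M. ?k w *\<^sub>C blinfun_apply (b w) (f w)) + c *\<^sub>C (LINT w|?M. ?k w *\<^sub>C blinfun_apply (b w) (g w))"
    by (subst Bochner_Integration.integral_add)
       (auto intro!: integrable_bounded_linear[OF scaleC.bounded_linear_right] ki simp: integral_bounded_linear[OF scaleC.bounded_linear_right ki(1)] integral_bounded_linear[OF scaleC.bounded_linear_right ki(2)])
  finally show ?thesis unfolding toeplitz_eq[OF \<alpha> i(1) z] toeplitz_eq[OF \<alpha> i(2) z] .
qed

theorem toeplitz_bounded_operator:
  fixes b :: "complex ^ 'n \<Rightarrow> ell2 \<Rightarrow>\<^sub>L ell2"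
  assumes \<alpha>: "\<alpha> > -1" and b: "carleson_symbol \<alpha> b B"
    and hom: "\<And>w c x. norm w < 1 \<Longrightarrow> blinfun_apply (b w) (c *\<^sub>C x) = c *\<^sub>C blinfun_apply (b w) x"
  shows "bounded_operator_A2 \<alpha> (toeplitz \<alpha> b)"
  unfolding bounded_operator_A2_def
proof (intro conjI ballI allI)
  note lin = toeplitz_lincomb[OF \<alpha> b _ _ _ hom]
  show "toeplitz \<alpha> b f \<in> A2 \<alpha>" if "f \<in> A2 \<alpha>" for f by (rule toeplitz_in_A2[OF \<alpha> b that])
  fix f :: "complex ^ 'n \<Rightarrow> ell2" and z :: "complex ^ 'n" assume f: "f \<in> A2 \<alpha>" and z: "z \<in> ball 0 1"
  show "toeplitz \<alpha> b (\<lambda>w. f w + g w) z = toeplitz \<alpha> b f z + toeplitz \<alpha> b g z" if g: "g \<in> A2 \<alpha>" for g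
    using lin[OF f g, of z 1 1] z by simp
  show "toeplitz \<alpha> b (\<lambda>w. c *\<^sub>C f w) z = c *\<^sub>C toeplitz \<alpha> b f z" for c
    using lin[OF f f, of z c 0] z by (simp add: scaleC.zero_left)
next
  show "\<exists>C::real. \<forall>f\<in>A2 \<alpha>. A2_norm \<alpha> (toeplitz \<alpha> b f) \<le> ennreal C * A2_norm \<alpha> f"
    using toeplitz_L2_bound[OF \<alpha>] b ennreal_square_le_imp_le by blast
qed

section \<open>Compact Toeplitz operators\<close>

text \<open>At bounded Bergman distance from v, both 1 - |u|^2 and |1 - <v,u>| are bounded below or
  above by multiples of 1 - |v|^2. Hence the squared Schur weight at u is at most a constant times
  (1 - |v|^2)^c |k_v(u)|^2 times its value at v, where c = n + 1 + \<alpha>, and |k_v|^2 has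
  integral 1.\<close>

lemma near_weight_bound:
  fixes v :: "complex ^ 'n"
  assumes \<alpha>: "\<alpha> > -1" and \<delta>: "\<delta> > 0" and v: "norm v < 1"
  shows "(\<integral>\<^sup>+u. indicator {u. \<not> far \<delta> v u} u * (ennreal (schur_weight \<alpha> u))\<^sup>2 \<partial>weighted_measure \<alpha>)
    \<le> ennreal ((\<delta> / 4) powr - (1 + \<alpha>) * (2 / \<delta>) powr (2 * (real CARD('n) + 1 + \<alpha>)) *
        (1 - (norm v)\<^sup>2) powr (real CARD('n) + 1 + \<alpha>) * (schur_weight \<alpha> v)\<^sup>2)"
proof -
  let ?M = "weighted_measure \<alpha> :: (complex ^ 'n) measure" and ?c = "real CARD('n) + 1 + \<alpha>"
  let ?s = "\<lambda>z :: complex ^ 'n. 1 - (norm z)\<^sup>2"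
  let ?A = "(\<delta> / 4) powr - (1 + \<alpha>) * (2 / \<delta>) powr (2 * ?c) * ?s v powr ?c * (schur_weight \<alpha> v)\<^sup>2"
  have sv: "?s v > 0" by (rule one_minus_norm2_pos[OF v])
  have sq: "(schur_weight \<alpha> z)\<^sup>2 = ?s z powr - (1 + \<alpha>)" for z :: "complex ^ 'n"
    unfolding schur_weight_def by (subst power2_eq_square, subst powr_add[symmetric]) (rule arg_cong[of _ _ "\<lambda>p. _ powr p"], simp)
  have pt: "indicator {u. \<not> far \<delta> v u} u * (ennreal (schur_weight \<alpha> u))\<^sup>2 \<le> ennreal ?A * ennreal ((cmod (normalized_kernel \<alpha> v u))\<^sup>2)"
    if u: "norm u < 1" for u
  proof (cases "far \<delta> v u")
    case False
    let ?x = "cmod (1 - herm v u)"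
    have su: "?s u > 0" by (rule one_minus_norm2_pos[OF u])
    have x: "?x > 0" using one_minus_herm_nz[OF v u] by simp
    have near: "\<delta> * ?x\<^sup>2 < ?s v * ?s u" using False by (simp add: far_def)
    have half: "?s z / 2 \<le> 1 - norm z" if "norm z < 1" for z :: "complex ^ 'n"
      using that sum_squares_bound[of 1 "norm z"] by simp
    have xv: "?s v / 2 \<le> ?x" using half[OF v] cmod_1_minus_herm_ge[OF u, of v] by linarith
    have xu: "?s u / 2 \<le> ?x" using half[OF u] cmod_1_minus_herm_ge[OF v, of u] unfolding cmod_1_minus_herm_commute[of u v] by linarith
    \<comment> \<open>Nearness gives \<delta> |1 - <v,u>|^2 < (1 - |v|^2)(1 - |u|^2), while |1 -
      <v,u>| is at least (1 - |v|^2)/2; one factor 1 - |v|^2 cancels.\<close>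
    have su_low: "\<delta> / 4 * ?s v \<le> ?s u"
    proof -
      have "\<delta> * (?s v / 2)\<^sup>2 \<le> \<delta> * ?x\<^sup>2" using \<delta> sv xv by (intro mult_left_mono power_mono) auto
      moreover have "a * (\<delta> / 4 * a) = \<delta> * (a / 2)\<^sup>2" for a by (simp add: power2_eq_square)
      ultimately have "?s v * (\<delta> / 4 * ?s v) \<le> ?s v * ?s u" using near by (simp only:)
      then show ?thesis using sv by (simp only: mult_le_cancel_left_pos)
    qed
    have x_up: "?x \<le> 2 / \<delta> * ?s v"
    proof -
      have "?s v * ?s u \<le> ?s v * (2 * ?x)" using sv xu by (intro mult_left_mono) auto
      then have "?x * (\<delta> * ?x) \<le> ?x * (2 * ?s v)" using near by (simp only: power2_eq_square mult_ac)
      then have "\<delta> * ?x \<le> 2 * ?s v" using x by (simp only: mult_le_cancel_left_pos)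
      then show ?thesis using \<delta> by (simp add: field_simps)
    qed
    have "(schur_weight \<alpha> u)\<^sup>2 \<le> (\<delta> / 4 * ?s v) powr - (1 + \<alpha>)"
      unfolding sq using su_low \<delta> sv \<alpha> by (intro powr_mono2') auto
    also have "\<dots> = (\<delta> / 4) powr - (1 + \<alpha>) * (schur_weight \<alpha> v)\<^sup>2"
      unfolding sq using \<delta> sv by (subst powr_mult) auto
    finally have 1: "(schur_weight \<alpha> u)\<^sup>2 \<le> (\<delta> / 4) powr - (1 + \<alpha>) * (schur_weight \<alpha> v)\<^sup>2" .
    have "(2 / \<delta> * ?s v) powr - (2 * ?c) \<le> ?x powr - (2 * ?c)" using x_up x \<alpha> by (intro powr_mono2') auto
    then have "(2 / \<delta>) powr (2 * ?c) * ?s v powr (2 * ?c) * (2 / \<delta> * ?s v) powr - (2 * ?c) \<le> (2 / \<delta>) powr (2 * ?c) * ?s v powr (2 * ?c) * ?x powr - (2 * ?c)"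
      by (intro mult_left_mono) auto
    moreover have pw: "a powr p * b powr p * (a * b) powr - p = 1" if "a > 0" "b > 0" for a b p :: real
      using that by (simp add: powr_mult powr_minus field_simps)
    ultimately have "1 \<le> (2 / \<delta>) powr (2 * ?c) * ?s v powr (2 * ?c) * ?x powr - (2 * ?c)"
      using pw[of "2 / \<delta>" "?s v" "2 * ?c"] \<delta> sv by (simp only: divide_pos_pos zero_less_numeral)
    also have "?s v powr (2 * ?c) = ?s v powr ?c * ?s v powr ?c" by (simp add: algebra_simps flip: powr_add)
    finally have 2: "1 \<le> (2 / \<delta>) powr (2 * ?c) * ?s v powr ?c * (cmod (normalized_kernel \<alpha> v u))\<^sup>2"
      unfolding normalized_kernel_sq[OF v] cmod_1_minus_herm_commute[of u v] by (simp only: mult_ac)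
    have "(schur_weight \<alpha> u)\<^sup>2 * 1 \<le> ((\<delta> / 4) powr - (1 + \<alpha>) * (schur_weight \<alpha> v)\<^sup>2) * ((2 / \<delta>) powr (2 * ?c) * ?s v powr ?c * (cmod (normalized_kernel \<alpha> v u))\<^sup>2)"
      by (rule mult_mono[OF 1 2]) auto
    then have "(schur_weight \<alpha> u)\<^sup>2 \<le> ?A * (cmod (normalized_kernel \<alpha> v u))\<^sup>2" by (simp only: mult_ac mult_1_right mult_1_left)
    then have "ennreal ((schur_weight \<alpha> u)\<^sup>2) \<le> ennreal ?A * ennreal ((cmod (normalized_kernel \<alpha> v u))\<^sup>2)"
      by (subst ennreal_mult[symmetric]) (auto intro: ennreal_leI)
    then show ?thesis using False schur_weight_pos[OF u, of \<alpha>] by (simp add: ennreal_power)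
  qed simp
  have "(\<integral>\<^sup>+u. indicator {u. \<not> far \<delta> v u} u * (ennreal (schur_weight \<alpha> u))\<^sup>2 \<partial>?M) \<le> (\<integral>\<^sup>+u. ennreal ?A * ennreal ((cmod (normalized_kernel \<alpha> v u))\<^sup>2) \<partial>?M)"
    by (intro nn_integral_mono pt) auto
  also have "\<dots> = ennreal ?A"
    by (subst nn_integral_cmult) (auto simp: nn_integral_normalized_kernel_sq[OF \<alpha> v] intro: measurable_borel_weighted[OF borel_measurable_normalized_kernel_sq[OF v]])
  finally show ?thesis .
qed

lemma borel_measurable_scaleC:
  assumes "f \<in> borel_measurable M" "g \<in> borel_measurable M"
  shows "(\<lambda>x. f x *\<^sub>C g x) \<in> borel_measurable M"
proof -
  have "continuous_on UNIV (\<lambda>p. fst p *\<^sub>C snd p)"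
    by (intro scaleC.continuous_on continuous_on_fst continuous_on_snd continuous_on_id)
  from borel_measurable_continuous_Pair[OF assms this] show ?thesis by simp
qed

text \<open>Joint measurability in both points. The power is continuous only away from the branch
  cut, so it is cut off to the right half plane, where all values of 1 - <w,z> lie.\<close>

lemma borel_measurable_bergman_kernel2:
  fixes f g :: "'a \<Rightarrow> complex ^ 'n"
  assumes fg: "f \<in> borel_measurable N" "g \<in> borel_measurable N"
    and b: "\<And>x. x \<in> space N \<Longrightarrow> norm (f x) < 1" "\<And>x. x \<in> space N \<Longrightarrow> norm (g x) < 1"
  shows "(\<lambda>x. bergman_kernel \<alpha> (f x) (g x)) \<in> borel_measurable N"
proof -
  let ?c = "- complex_of_real (real CARD('n) + 1 + \<alpha>)"
  let ?q = "\<lambda>x. if x \<in> {x. Re x > 0} then exp (?c * Ln x) else 0"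
  have "?q \<in> borel_measurable borel"
  proof (rule borel_measurable_continuous_on_if)
    show "{x. 0 < Re x} \<in> sets borel" by (intro borel_open open_halfspace_Re_gt)
    show "continuous_on {x. 0 < Re x} (\<lambda>x. exp (?c * Ln x))" by (intro continuous_intros) (auto simp: complex_nonpos_Reals_iff)
  qed auto
  moreover have "(\<lambda>x. 1 - herm (g x) (f x)) \<in> borel_measurable N"
    by (intro borel_measurable_diff borel_measurable_const borel_measurable_herm fg)
  ultimately have "(\<lambda>x. ?q (1 - herm (g x) (f x))) \<in> borel_measurable N" by (rule measurable_compose[rotated])
  also have "?this \<longleftrightarrow> ?thesis"
  proof (rule measurable_cong)
    fix x assume x: "x \<in> space N"
    show "?q (1 - herm (g x) (f x)) = bergman_kernel \<alpha> (f x) (g x)"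
      using Re_1_minus_herm[OF b(2)[OF x] b(1)[OF x]] one_minus_herm_nz[OF b(2)[OF x] b(1)[OF x]]
      by (simp add: bergman_kernel_def powr_def)
  qed
  finally show ?thesis .
qed

lemma kernel_vector_A2:
  fixes v :: "complex ^ 'n"
  assumes \<alpha>: "\<alpha> > -1" and v: "norm v < 1"
  shows "(\<lambda>w. bergman_kernel \<alpha> v w *\<^sub>C x) \<in> A2 \<alpha>"
  unfolding A2_iff
proof
  let ?c = "complex_of_real (real CARD('n) + 1 + \<alpha>)"
  show "holomorphic_on_ball (\<lambda>w. bergman_kernel \<alpha> v w *\<^sub>C x)"
    unfolding holomorphic_on_ball_def
  proof
    fix w :: "complex ^ 'n" assume "w \<in> ball 0 1"
    then have w: "norm w < 1" by simp
    have bl: "bounded_linear (\<lambda>u. herm u v)"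
      unfolding linear_conv_bounded_linear[symmetric] by (rule linearI) (simp_all add: herm_lin herm_scaleR_left)
    have "1 - herm w v \<notin> \<real>\<^sub>\<le>\<^sub>0" using Re_1_minus_herm[OF w v] by (auto simp: complex_nonpos_Reals_iff)
    then have "((\<lambda>t. (1 - t) powr - ?c) has_field_derivative - ?c * (1 - herm w v) powr (- ?c - 1) * (0 - 1)) (at (herm w v))"
      by (intro DERIV_chain2[of "\<lambda>t. t powr - ?c"] has_field_derivative_powr derivative_intros)
    then have "((\<lambda>t. (1 - t) powr - ?c) has_field_derivative ?c * (1 - herm w v) powr (- ?c - 1)) (at (herm w v))"
      by (simp only: mult_minus_left mult_minus_right diff_0 mult_1_right minus_minus)
    then have "((\<lambda>t. (1 - t) powr - ?c) has_derivative (\<lambda>h. ?c * (1 - herm w v) powr (- ?c - 1) * h)) (at (herm w v))"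
      by (simp add: has_field_derivative_def)
    from has_derivative_compose[OF bounded_linear_imp_has_derivative[OF bl] this]
    have "((\<lambda>w. bergman_kernel \<alpha> v w) has_derivative (\<lambda>h. ?c * (1 - herm w v) powr (- ?c - 1) * herm h v)) (at w)"
      by (simp add: bergman_kernel_def)
    from bounded_linear.has_derivative[OF scaleC.bounded_linear_left this]
    show "\<exists>D. ((\<lambda>w. bergman_kernel \<alpha> v w *\<^sub>C x) has_derivative D) (at w) \<and> (\<forall>c v. D (c *s v) = c *\<^sub>C D v)"
      by (intro exI conjI) (auto simp: herm_lin scaleC_scaleC mult_ac)
  qed
  let ?B = "((1 - norm v) powr - (real CARD('n) + 1 + \<alpha>) * norm x)\<^sup>2"
  have "(\<integral>\<^sup>+w. ennreal ((norm (bergman_kernel \<alpha> v w *\<^sub>C x))\<^sup>2) \<partial>weighted_measure \<alpha>) \<le> (\<integral>\<^sup>+w. ennreal ?B \<partial>(weighted_measure \<alpha> :: (complex ^ 'n) measure))"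
    using bergman_kernel_bound(1)[OF \<alpha> v]
    by (intro nn_integral_mono ennreal_leI power_mono) (auto simp: norm_scaleC intro!: mult_right_mono)
  also have "\<dots> < \<infinity>" using emeasure_weighted_space[OF \<alpha>, where 'n='n] by simp
  finally show "(\<integral>\<^sup>+w. ennreal ((norm (bergman_kernel \<alpha> v w *\<^sub>C x))\<^sup>2) \<partial>weighted_measure \<alpha>) < \<infinity>" .
qed

section \<open>T_b on multiples of one fixed vector\<close>

context
  fixes \<alpha> B :: real and b :: "complex ^ 'n \<Rightarrow> ell2 \<Rightarrow>\<^sub>L ell2" and x :: ell2
  assumes \<alpha>: "\<alpha> > -1" and b: "carleson_symbol \<alpha> b B"
    and hom: "\<And>w c x. norm w < 1 \<Longrightarrow> blinfun_apply (b w) (c *\<^sub>C x) = c *\<^sub>C blinfun_apply (b w) x"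
begin

text \<open>The norm of T_b(K_v x)(u), written as a single integral with the two kernels in front,
  so that joint measurability in v and u can be seen directly.\<close>

definition ker_norm :: "complex ^ 'n \<Rightarrow> complex ^ 'n \<Rightarrow> ennreal" where
  "ker_norm v u = ennreal (norm (LINT w|weighted_measure \<alpha>. (cnj (bergman_kernel \<alpha> u w) * bergman_kernel \<alpha> v w) *\<^sub>C blinfun_apply (b w) x))"

lemma apply_symbol_measurable: "(\<lambda>w. blinfun_apply (b w) x) \<in> borel_measurable (weighted_measure \<alpha>)"
  by (rule op_measurable_apply[OF \<alpha>]) (use b in \<open>auto simp: carleson_symbol_def\<close>)

lemma ker_norm_toeplitz:
  assumes "norm v < 1" "norm u < 1"
  shows "ker_norm v u = ennreal (norm (toeplitz \<alpha> b (\<lambda>w. bergman_kernel \<alpha> v w *\<^sub>C x) u))"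
  unfolding ker_norm_def toeplitz_eq[OF \<alpha> toeplitz_integrable[OF \<alpha> b kernel_vector_A2[OF \<alpha> assms(1)]] assms(2)]
  by (intro arg_cong[of _ _ ennreal] arg_cong[of _ _ norm] Bochner_Integration.integral_cong) (auto simp: hom scaleC_scaleC)

lemma ker_norm_measurable:
  "(\<lambda>p. ker_norm (fst p) (snd p)) \<in> borel_measurable (weighted_measure \<alpha> \<Otimes>\<^sub>M weighted_measure \<alpha>)"
proof -
  let ?M = "weighted_measure \<alpha> :: (complex ^ 'n) measure"
  interpret M: finite_measure ?M by (rule finite_measure_weighted[OF \<alpha>])
  note id = measurable_ident_weighted[of \<alpha>]
  have 1: "(\<lambda>q. fst (fst q)) \<in> borel_measurable ((?M \<Otimes>\<^sub>M ?M) \<Otimes>\<^sub>M ?M)" "(\<lambda>q. snd (fst q)) \<in> borel_measurable ((?M \<Otimes>\<^sub>M ?M) \<Otimes>\<^sub>M ?M)"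
    "(\<lambda>q. snd q) \<in> borel_measurable ((?M \<Otimes>\<^sub>M ?M) \<Otimes>\<^sub>M ?M)"
    by (auto intro: measurable_compose[OF _ id] measurable_compose[OF measurable_fst] measurable_fst measurable_snd)
  have "(\<lambda>q. (cnj (bergman_kernel \<alpha> (snd (fst q)) (snd q)) * bergman_kernel \<alpha> (fst (fst q)) (snd q)) *\<^sub>C blinfun_apply (b (snd q)) x)
      \<in> borel_measurable ((?M \<Otimes>\<^sub>M ?M) \<Otimes>\<^sub>M ?M)"
    by (intro borel_measurable_scaleC borel_measurable_times borel_measurable_cnj_fun borel_measurable_bergman_kernel2 1 measurable_compose[OF measurable_snd apply_symbol_measurable])
       (auto simp: space_pair_measure)
  then have "(\<lambda>p. LINT w|?M. (cnj (bergman_kernel \<alpha> (snd p) w) * bergman_kernel \<alpha> (fst p) w) *\<^sub>C blinfun_apply (b w) x) \<in> borel_measurable (?M \<Otimes>\<^sub>M ?M)"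
    by (intro M.borel_measurable_lebesgue_integral) (simp add: split_beta')
  then show ?thesis unfolding ker_norm_def by measurable
qed

lemma ker_norm_le:
  assumes C: "\<And>v u. norm v < 1 \<Longrightarrow> norm u < 1 \<Longrightarrow> abs_kernel2 \<alpha> (\<lambda>w. ennreal (norm (b w))) v u \<le> ennreal C * abs_kernel2 \<alpha> (\<lambda>_. 1) v u"
    and v: "norm v < 1" and u: "norm u < 1" and "C \<ge> 0"
  shows "ker_norm v u \<le> ennreal (norm x * C) * abs_kernel2 \<alpha> (\<lambda>_. 1) v u"
proof -
  let ?M = "weighted_measure \<alpha> :: (complex ^ 'n) measure"
  have m: "(\<lambda>w. ennreal (norm (b w)) * (abs_kernel \<alpha> v w * abs_kernel \<alpha> u w)) \<in> borel_measurable ?M"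
    by (intro borel_measurable_times_ennreal carleson_norm_measurable[OF \<alpha> b] borel_measurable_abs_kernel measurable_ident_weighted) simp_all
  have "ker_norm v u \<le> (\<integral>\<^sup>+w. abs_kernel \<alpha> u w * (ennreal (norm (b w)) * ennreal (norm (bergman_kernel \<alpha> v w *\<^sub>C x))) \<partial>?M)"
    unfolding ker_norm_toeplitz[OF v u] by (rule toeplitz_pointwise_le[OF \<alpha> b kernel_vector_A2[OF \<alpha> v] u])
  also have "\<dots> = (\<integral>\<^sup>+w. ennreal (norm x) * (ennreal (norm (b w)) * (abs_kernel \<alpha> v w * abs_kernel \<alpha> u w)) \<partial>?M)"
    by (rule nn_integral_cong) (simp add: norm_scaleC abs_kernel_bergman ennreal_mult mult_ac)
  also have "\<dots> = ennreal (norm x) * abs_kernel2 \<alpha> (\<lambda>w. ennreal (norm (b w))) v u"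
    unfolding abs_kernel2_def by (rule nn_integral_cmult[OF m])
  also have "\<dots> \<le> ennreal (norm x) * (ennreal C * abs_kernel2 \<alpha> (\<lambda>_. 1) v u)" by (intro mult_left_mono C v u) simp
  finally show ?thesis using \<open>C \<ge> 0\<close> by (simp add: ennreal_mult mult.assoc)
qed

text \<open>k_v is (1 - |v|^2)^(c/2) K_v, so a row of the kernel has the L^2 norm of T_b(k_v x) up
  to this factor. This is where the boundary hypothesis on T_b enters the kernel estimates.\<close>

lemma ker_norm_L2:
  assumes v: "norm v < 1"
  shows "(\<integral>\<^sup>+u. (ker_norm v u)\<^sup>2 \<partial>weighted_measure \<alpha>) =
    ennreal ((1 - (norm v)\<^sup>2) powr - (real CARD('n) + 1 + \<alpha>)) * (A2_norm \<alpha> (toeplitz \<alpha> b (\<lambda>w. normalized_kernel \<alpha> v w *\<^sub>C x)))\<^sup>2"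
proof -
  let ?M = "weighted_measure \<alpha> :: (complex ^ 'n) measure" and ?c = "real CARD('n) + 1 + \<alpha>" and ?s = "1 - (norm v)\<^sup>2"
  let ?T = "toeplitz \<alpha> b (\<lambda>w. bergman_kernel \<alpha> v w *\<^sub>C x)"
  have s: "?s > 0" by (rule one_minus_norm2_pos[OF v])
  have Tm: "?T \<in> borel_measurable ?M" by (rule A2_measurable[OF toeplitz_in_A2[OF \<alpha> b kernel_vector_A2[OF \<alpha> v]]])
  have T: "toeplitz \<alpha> b (\<lambda>w. normalized_kernel \<alpha> v w *\<^sub>C x) u = complex_of_real (?s powr (?c / 2)) *\<^sub>C ?T u" if u: "norm u < 1" for u
    using toeplitz_lincomb[OF \<alpha> b kernel_vector_A2[OF \<alpha> v] kernel_vector_A2[OF \<alpha> v] u hom, of "complex_of_real (?s powr (?c / 2))" x 0 x]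
    by (simp add: normalized_kernel_def scaleC_scaleC scaleC.zero_left)
  have "(A2_norm \<alpha> (toeplitz \<alpha> b (\<lambda>w. normalized_kernel \<alpha> v w *\<^sub>C x)))\<^sup>2 = (\<integral>\<^sup>+u. ennreal (?s powr ?c) * ennreal ((norm (?T u))\<^sup>2) \<partial>?M)"
    unfolding A2_norm_sq
  proof (rule nn_integral_cong)
    fix u assume "u \<in> space ?M"
    then have u: "norm u < 1" by simp
    have "(?s powr (?c / 2))\<^sup>2 = ?s powr ?c" by (simp add: power2_eq_square flip: powr_add)
    then have "(norm (toeplitz \<alpha> b (\<lambda>w. normalized_kernel \<alpha> v w *\<^sub>C x) u))\<^sup>2 = ?s powr ?c * (norm (?T u))\<^sup>2"
      unfolding T[OF u] norm_scaleC power_mult_distrib norm_of_real power2_abs by simp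
    then show "ennreal ((norm (toeplitz \<alpha> b (\<lambda>w. normalized_kernel \<alpha> v w *\<^sub>C x) u))\<^sup>2) = ennreal (?s powr ?c) * ennreal ((norm (?T u))\<^sup>2)"
      by (simp add: ennreal_mult)
  qed
  also have "\<dots> = ennreal (?s powr ?c) * (\<integral>\<^sup>+u. ennreal ((norm (?T u))\<^sup>2) \<partial>?M)"
    by (rule nn_integral_cmult) (use Tm in measurable)
  also have "(\<integral>\<^sup>+u. ennreal ((norm (?T u))\<^sup>2) \<partial>?M) = (\<integral>\<^sup>+u. (ker_norm v u)\<^sup>2 \<partial>?M)"
    unfolding nn_integral_norm_power2[symmetric] by (rule nn_integral_cong) (simp add: ker_norm_toeplitz[OF v])
  finally have "ennreal (?s powr - ?c) * (A2_norm \<alpha> (toeplitz \<alpha> b (\<lambda>w. normalized_kernel \<alpha> v w *\<^sub>C x)))\<^sup>2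
    = (ennreal (?s powr - ?c) * ennreal (?s powr ?c)) * (\<integral>\<^sup>+u. (ker_norm v u)\<^sup>2 \<partial>?M)"
    by (simp only: mult.assoc)
  also have "ennreal (?s powr - ?c) * ennreal (?s powr ?c) = 1"
    using s by (subst ennreal_mult[symmetric]) (auto simp flip: powr_add)
  finally show ?thesis by simp
qed

text \<open>Insert the reproducing formula for \<phi> under the Toeplitz integral and interchange
  the order: T_b(\<phi> x)(u) is the integral of \<phi>(v) T_b(K_v x)(u). Absolute convergence holds
  at every u where the Schur integral is finite, hence almost everywhere.\<close>

lemma toeplitz_scalar_le:
  assumes \<phi>: "complex_diff_on_ball \<phi>" "(\<lambda>w. \<phi> w *\<^sub>C x) \<in> A2 \<alpha>" "integrable (weighted_measure \<alpha>) \<phi>"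
    and L2: "(\<integral>\<^sup>+v. (ennreal (cmod (\<phi> v)))\<^sup>2 \<partial>weighted_measure \<alpha>) < \<infinity>"
  shows "AE u in weighted_measure \<alpha>. ennreal (norm (toeplitz \<alpha> b (\<lambda>w. \<phi> w *\<^sub>C x) u)) \<le> (\<integral>\<^sup>+v. ker_norm v u * ennreal (cmod (\<phi> v)) \<partial>weighted_measure \<alpha>)"
proof -
  let ?M = "weighted_measure \<alpha> :: (complex ^ 'n) measure"
  interpret M: finite_measure ?M by (rule finite_measure_weighted[OF \<alpha>])
  interpret P: pair_sigma_finite ?M ?M by unfold_locales
  note id = measurable_ident_weighted[of \<alpha>]
  have \<phi>m: "\<phi> \<in> borel_measurable ?M" using \<phi>(3) by simp
  have \<phi>n: "(\<lambda>v. ennreal (cmod (\<phi> v))) \<in> borel_measurable ?M" using \<phi>m by measurable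
  obtain C where C: "\<And>v u. norm v < 1 \<Longrightarrow> norm u < 1 \<Longrightarrow> abs_kernel2 \<alpha> (\<lambda>w. ennreal (norm (b w))) v u \<le> ennreal (C * B) * abs_kernel2 \<alpha> (\<lambda>_. 1) v u"
    using carleson_abs_kernel2[OF \<alpha>] b by blast
  show ?thesis
    using AE_finite_abs_kernel2(1)[OF \<alpha> \<phi>n L2] AE_space
  proof eventually_elim
    case (elim u)
    then have u: "norm u < 1" by simp
    \<comment> \<open>The integrand of the double integral: integrating over v gives the Toeplitz
      integrand of \<phi> x, integrating over w gives \<phi>(v) T_b(K_v x)(u).\<close>
    define h where "h = (\<lambda>(v, w). (cnj (bergman_kernel \<alpha> u w) * (bergman_kernel \<alpha> v w * \<phi> v)) *\<^sub>C blinfun_apply (b w) x)"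
    have hm: "h \<in> borel_measurable (?M \<Otimes>\<^sub>M ?M)"
      unfolding h_def split_beta'
      by (intro borel_measurable_scaleC borel_measurable_times borel_measurable_cnj_fun borel_measurable_bergman_kernel2
          measurable_compose[OF measurable_snd id] measurable_compose[OF measurable_fst id] measurable_compose[OF measurable_fst \<phi>m]
          measurable_compose[OF measurable_snd apply_symbol_measurable]) (auto simp: space_pair_measure u)
    have hn: "ennreal (norm (h (v, w))) \<le> ennreal (norm x) * (abs_kernel \<alpha> u w * (ennreal (norm (b w)) * (abs_kernel \<alpha> w v * ennreal (cmod (\<phi> v)))))" for v w
    proof -
      have "norm (h (v, w)) \<le> cmod (bergman_kernel \<alpha> u w) * (cmod (bergman_kernel \<alpha> v w) * cmod (\<phi> v)) * (norm (b w) * norm x)"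
        unfolding h_def by (simp add: norm_scaleC norm_mult mult_left_mono norm_blinfun)
      then have "ennreal (norm (h (v, w))) \<le> ennreal (norm x * (cmod (bergman_kernel \<alpha> u w) * (norm (b w) * (cmod (bergman_kernel \<alpha> v w) * cmod (\<phi> v)))))"
        by (intro ennreal_leI) (simp only: mult_ac)
      then show ?thesis by (simp add: abs_kernel_bergman ennreal_mult cmod_bergman_kernel_commute[of \<alpha> v w])
    qed
    have "integrable (?M \<Otimes>\<^sub>M ?M) h"
    proof (rule integrableI_bounded[OF hm])
      have km: "(\<lambda>w. abs_kernel \<alpha> y w) \<in> borel_measurable ?M" for y
        by (intro borel_measurable_abs_kernel id) simp
      have im: "(\<lambda>v. abs_kernel \<alpha> w v * ennreal (cmod (\<phi> v))) \<in> borel_measurable ?M" for w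
        by (intro borel_measurable_times_ennreal km \<phi>n)
      have im2: "(\<lambda>w. \<integral>\<^sup>+v. abs_kernel \<alpha> w v * ennreal (cmod (\<phi> v)) \<partial>?M) \<in> borel_measurable ?M"
      proof (rule M.borel_measurable_nn_integral)
        show "(\<lambda>(w, v). abs_kernel \<alpha> w v * ennreal (cmod (\<phi> v))) \<in> borel_measurable (?M \<Otimes>\<^sub>M ?M)"
          unfolding split_beta'
          by (intro borel_measurable_times_ennreal borel_measurable_abs_kernel measurable_compose[OF measurable_snd id] measurable_compose[OF measurable_fst id] measurable_compose[OF measurable_snd \<phi>n])
      qed
      have "(\<integral>\<^sup>+p. ennreal (norm (h p)) \<partial>(?M \<Otimes>\<^sub>M ?M)) = (\<integral>\<^sup>+w. \<integral>\<^sup>+v. ennreal (norm (h (v, w))) \<partial>?M \<partial>?M)"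
        by (rule P.nn_integral_snd[symmetric, OF measurable_compose[OF measurable_compose[OF hm borel_measurable_norm] measurable_ennreal]])
      also have "\<dots> \<le> (\<integral>\<^sup>+w. \<integral>\<^sup>+v. ennreal (norm x) * (abs_kernel \<alpha> u w * (ennreal (norm (b w)) * (abs_kernel \<alpha> w v * ennreal (cmod (\<phi> v))))) \<partial>?M \<partial>?M)"
        by (intro nn_integral_mono hn)
      also have "\<dots> = (\<integral>\<^sup>+w. ennreal (norm x) * (abs_kernel \<alpha> u w * (ennreal (norm (b w)) * (\<integral>\<^sup>+v. abs_kernel \<alpha> w v * ennreal (cmod (\<phi> v)) \<partial>?M))) \<partial>?M)"
        by (rule nn_integral_cong) (simp only: nn_integral_cmult im borel_measurable_times_ennreal borel_measurable_const)
      also have "\<dots> = ennreal (norm x) * (\<integral>\<^sup>+w. abs_kernel \<alpha> u w * (ennreal (norm (b w)) * (\<integral>\<^sup>+v. abs_kernel \<alpha> w v * ennreal (cmod (\<phi> v)) \<partial>?M)) \<partial>?M)"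
        by (intro nn_integral_cmult borel_measurable_times_ennreal km carleson_norm_measurable[OF \<alpha> b] im2)
      also have "\<dots> = ennreal (norm x) * (\<integral>\<^sup>+v. abs_kernel2 \<alpha> (\<lambda>w. ennreal (norm (b w))) v u * ennreal (cmod (\<phi> v)) \<partial>?M)"
        unfolding abs_kernel2_iterated[OF \<alpha> carleson_norm_measurable[OF \<alpha> b] \<phi>n] ..
      also have "\<dots> \<le> ennreal (norm x) * (\<integral>\<^sup>+v. ennreal (C * B) * (abs_kernel2 \<alpha> (\<lambda>_. 1) v u * ennreal (cmod (\<phi> v))) \<partial>?M)"
        unfolding mult.assoc[symmetric] by (intro mult_left_mono nn_integral_mono mult_right_mono C u) auto
      also have "\<dots> = ennreal (norm x) * (ennreal (C * B) * (\<integral>\<^sup>+v. abs_kernel2 \<alpha> (\<lambda>_. 1) v u * ennreal (cmod (\<phi> v)) \<partial>?M))"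
        by (subst nn_integral_cmult) (intro borel_measurable_times_ennreal \<phi>n borel_measurable_abs_kernel2[OF \<alpha>] id, simp_all)
      also have "\<dots> < \<infinity>" using elim(1) by (simp add: ennreal_mult_less_top)
      finally show "(\<integral>\<^sup>+p. ennreal (norm (h p)) \<partial>(?M \<Otimes>\<^sub>M ?M)) < \<infinity>" .
    qed
    then have fub: "(LINT w|?M. LINT v|?M. h (v, w)) = (LINT v|?M. LINT w|?M. h (v, w))"
      using P.Fubini_integral[of "\<lambda>v w. h (v, w)"] by simp
    have inner_v: "(LINT v|?M. h (v, w)) = cnj (bergman_kernel \<alpha> u w) *\<^sub>C blinfun_apply (b w) (\<phi> w *\<^sub>C x)" if "w \<in> space ?M" for w
    proof -
      have w: "norm w < 1" using that by simp
      have eq: "bergman_kernel \<alpha> v w * \<phi> v = \<phi> v * cnj (bergman_kernel \<alpha> w v)" if "v \<in> space ?M" for v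
        using cnj_bergman_kernel[OF w, of v \<alpha>] that by (simp add: mult.commute)
      have i: "integrable ?M (\<lambda>v. bergman_kernel \<alpha> v w * \<phi> v)"
        by (subst Bochner_Integration.integrable_cong[OF refl eq]) (auto intro: integrable_mult_bergman_kernel[OF \<alpha> \<phi>(3) w])
      have "(LINT v|?M. bergman_kernel \<alpha> v w * \<phi> v) = \<phi> w"
        using bergman_reproducing[OF \<alpha> \<phi>(1,3) w] by (subst Bochner_Integration.integral_cong[OF refl eq]) auto
      moreover have "(LINT v|?M. h (v, w)) = (cnj (bergman_kernel \<alpha> u w) * (LINT v|?M. bergman_kernel \<alpha> v w * \<phi> v)) *\<^sub>C blinfun_apply (b w) x"
        unfolding h_def split_conv
        using integral_bounded_linear[OF bounded_linear_compose[OF scaleC.bounded_linear_left bounded_linear_mult_right] i, of "cnj (bergman_kernel \<alpha> u w)" "blinfun_apply (b w) x"]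
        by simp
      ultimately show ?thesis by (simp add: hom[OF w] scaleC_scaleC)
    qed
    have "toeplitz \<alpha> b (\<lambda>w. \<phi> w *\<^sub>C x) u = (LINT w|?M. LINT v|?M. h (v, w))"
      unfolding toeplitz_eq[OF \<alpha> toeplitz_integrable[OF \<alpha> b \<phi>(2)] u]
      by (rule Bochner_Integration.integral_cong[OF refl inner_v[symmetric]])
    also have "\<dots> = (LINT v|?M. LINT w|?M. h (v, w))" by (rule fub)
    finally have T: "toeplitz \<alpha> b (\<lambda>w. \<phi> w *\<^sub>C x) u = (LINT v|?M. LINT w|?M. h (v, w))" .
    have "ennreal (norm (LINT v|?M. LINT w|?M. h (v, w))) \<le> (\<integral>\<^sup>+v. ennreal (norm (LINT w|?M. h (v, w))) \<partial>?M)"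
    proof (cases "integrable ?M (\<lambda>v. LINT w|?M. h (v, w))")
      \<comment> \<open>The case split is a formality: a non-integrable function has integral 0 by
        convention, and the bound is then trivial.\<close>
      case True then show ?thesis by (rule integral_norm_bound_ennreal)
    qed (simp add: not_integrable_integral_eq)
    also have "\<dots> = (\<integral>\<^sup>+v. ker_norm v u * ennreal (cmod (\<phi> v)) \<partial>?M)"
    proof (rule nn_integral_cong)
      fix v assume "v \<in> space ?M"
      then have v: "norm v < 1" by simp
      let ?k = "\<lambda>w. cnj (bergman_kernel \<alpha> u w) *\<^sub>C blinfun_apply (b w) (bergman_kernel \<alpha> v w *\<^sub>C x)"
      have ki: "integrable ?M ?k" by (rule integrable_kernel_scaleC[OF \<alpha> toeplitz_integrable[OF \<alpha> b kernel_vector_A2[OF \<alpha> v]] u])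
      have "(LINT w|?M. h (v, w)) = (LINT w|?M. \<phi> v *\<^sub>C ?k w)"
        unfolding h_def by (rule Bochner_Integration.integral_cong) (auto simp: hom scaleC_scaleC mult_ac)
      also have "\<dots> = \<phi> v *\<^sub>C (LINT w|?M. ?k w)" by (rule integral_bounded_linear[OF scaleC.bounded_linear_right ki])
      also have "(LINT w|?M. ?k w) = toeplitz \<alpha> b (\<lambda>w. bergman_kernel \<alpha> v w *\<^sub>C x) u"
        by (rule toeplitz_eq[OF \<alpha> toeplitz_integrable[OF \<alpha> b kernel_vector_A2[OF \<alpha> v]] u, symmetric])
      finally show "ennreal (norm (LINT w|?M. h (v, w))) = ker_norm v u * ennreal (cmod (\<phi> v))"
        by (simp add: norm_scaleC ker_norm_toeplitz[OF v u] ennreal_mult mult.commute)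
    qed
    finally show ?case unfolding T .
  qed
qed

end

lemma ennreal_power2_add_le: "((a :: ennreal) + b)\<^sup>2 \<le> 2 * a\<^sup>2 + 2 * b\<^sup>2"
proof (cases "a = \<infinity> \<or> b = \<infinity>")
  case False
  then obtain x y where xy: "a = ennreal x" "x \<ge> 0" "b = ennreal y" "y \<ge> 0" by (metis ennreal_cases infinity_ennreal_def)
  have "(x + y)\<^sup>2 \<le> 2 * x\<^sup>2 + 2 * y\<^sup>2" using sum_squares_bound[of x y] by (simp add: power2_sum)
  then have "ennreal ((x + y)\<^sup>2) \<le> ennreal (2 * x\<^sup>2 + 2 * y\<^sup>2)" by (rule ennreal_leI)
  also have "\<dots> = 2 * ennreal (x\<^sup>2) + 2 * ennreal (y\<^sup>2)" by (subst ennreal_plus) (simp_all add: ennreal_mult)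
  finally have "ennreal ((x + y)\<^sup>2) \<le> 2 * ennreal (x\<^sup>2) + 2 * ennreal (y\<^sup>2)" .
  then show ?thesis using xy by (simp add: ennreal_power flip: ennreal_plus)
qed (auto simp: ennreal_mult_top)

lemma eventually_to_boundary:
  "eventually P to_boundary \<longleftrightarrow> (\<exists>r<1. \<forall>z. r < norm z \<longrightarrow> norm z < 1 \<longrightarrow> P z)"
  unfolding to_boundary_def eventually_filtercomap eventually_at_left_field
proof
  assume "\<exists>r<1. \<forall>z. r < norm z \<longrightarrow> norm z < 1 \<longrightarrow> P z"
  then obtain r where "r < 1" "\<And>z. r < norm z \<Longrightarrow> norm z < 1 \<Longrightarrow> P z" by blast
  then show "\<exists>Q. (\<exists>b<1. \<forall>y>b. y < 1 \<longrightarrow> Q y) \<and> (\<forall>x. Q (norm x) \<longrightarrow> P x)"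
    by (intro exI[of _ "\<lambda>t. r < t \<and> t < 1"]) auto
next
  assume "\<exists>Q. (\<exists>b<1. \<forall>y>b. y < 1 \<longrightarrow> Q y) \<and> (\<forall>x. Q (norm x) \<longrightarrow> P x)"
  then obtain Q b where "b < 1" "\<And>y. b < y \<Longrightarrow> y < 1 \<Longrightarrow> Q y" "\<And>x. Q (norm x) \<Longrightarrow> P x" by blast
  then show "\<exists>r<1. \<forall>z. r < norm z \<longrightarrow> norm z < 1 \<longrightarrow> P z" by (intro exI[of _ b]) auto
qed

lemma sets_far: "{u :: complex ^ 'n. far \<delta> v u} \<in> sets borel"
proof -
  have "closed {u. (1 - (norm v)\<^sup>2) * (1 - (norm u)\<^sup>2) \<le> \<delta> * (cmod (1 - herm v u))\<^sup>2}"
    by (intro closed_Collect_le continuous_intros) (simp_all add: herm_def continuous_intros)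
  then show ?thesis unfolding far_def by (rule borel_closed)
qed

text \<open>Each row is split into points far from v and points near v, with \<epsilon>/2 for each.
  The far part is small by \<open>schur_far\<close>. The near part is handled by Cauchy-Schwarz: the
  powers of 1 - |v|^2 from \<open>ker_norm_L2\<close> and \<open>near_weight_bound\<close> cancel,
  and ||T_b(k_v x)|| supplies the smallness.\<close>

lemma ker_norm_row:
  fixes b :: "complex ^ 'n \<Rightarrow> ell2 \<Rightarrow>\<^sub>L ell2"
  assumes \<alpha>: "\<alpha> > -1" and b: "carleson_symbol \<alpha> b B"
    and hom: "\<And>w c x. norm w < 1 \<Longrightarrow> blinfun_apply (b w) (c *\<^sub>C x) = c *\<^sub>C blinfun_apply (b w) x"
    and lim: "((\<lambda>z. A2_norm \<alpha> (toeplitz \<alpha> b (\<lambda>w. normalized_kernel \<alpha> z w *\<^sub>C x))) \<longlongrightarrow> 0) to_boundary"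
    and \<epsilon>: "\<epsilon> > 0"
  shows "\<exists>r<1. \<forall>v. r \<le> norm v \<longrightarrow> norm v < 1 \<longrightarrow>
    (\<integral>\<^sup>+u. ker_norm \<alpha> b x v u * ennreal (schur_weight \<alpha> u) \<partial>weighted_measure \<alpha>) \<le> ennreal \<epsilon> * ennreal (schur_weight \<alpha> v)"
proof -
  let ?M = "weighted_measure \<alpha> :: (complex ^ 'n) measure" and ?c = "real CARD('n) + 1 + \<alpha>"
  let ?N = "ker_norm \<alpha> b x" and ?T = "\<lambda>z. A2_norm \<alpha> (toeplitz \<alpha> b (\<lambda>w. normalized_kernel \<alpha> z w *\<^sub>C x))"
  let ?h = "\<lambda>u :: complex ^ 'n. ennreal (schur_weight \<alpha> u)"
  \<comment> \<open>An admissible exponent for \<open>schur_far\<close>: below (1 + \<alpha>)/2, and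
    positive so that a small \<delta> gains something.\<close>
  let ?\<epsilon> = "(1 + \<alpha>) / 4"
  interpret M: finite_measure ?M by (rule finite_measure_weighted[OF \<alpha>])
  note id = measurable_ident_weighted[of \<alpha>]
  obtain C where C: "C > 0" "\<And>v u. norm v < 1 \<Longrightarrow> norm u < 1 \<Longrightarrow> abs_kernel2 \<alpha> (\<lambda>w. ennreal (norm (b w))) v u \<le> ennreal (C * B) * abs_kernel2 \<alpha> (\<lambda>_. 1) v u"
    using carleson_abs_kernel2[OF \<alpha>] b by blast
  define D where "D = norm x * (C * B)"
  have CB: "C * B \<ge> 0" using C(1) b by (simp add: carleson_symbol_def)
  then have D: "D \<ge> 0" by (simp add: D_def)
  have ND: "?N v u \<le> ennreal D * abs_kernel2 \<alpha> (\<lambda>_. 1) v u" if "norm v < 1" "norm u < 1" for v u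
    unfolding D_def by (rule ker_norm_le[OF \<alpha> b hom C(2) that CB])
  obtain K where K: "K > 0" "\<And>\<delta> v. \<delta> > 0 \<Longrightarrow> norm v < 1 \<Longrightarrow>
    (\<integral>\<^sup>+u. indicator {u. ?\<epsilon> = 0 \<or> far \<delta> v u} u * (abs_kernel2 \<alpha> (\<lambda>_. 1) v u * ?h u) \<partial>?M) \<le> ennreal (K * \<delta> powr ?\<epsilon>) * ?h v"
    using schur_far[OF \<alpha>, of ?\<epsilon>, where 'n='n] \<alpha> by auto
  \<comment> \<open>Solves D K \<delta>^((1+\<alpha>)/4) \<le> \<epsilon>/2 for the far part; the +
    1 keeps the denominator positive when D K = 0.\<close>
  define \<delta> where "\<delta> = (\<epsilon> / 2 / (D * K + 1)) powr (1 / ?\<epsilon>)"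
  have DK: "D * K \<ge> 0" using D K by simp
  have \<delta>: "\<delta> > 0" using DK \<epsilon> by (simp add: \<delta>_def)
  have \<delta>\<epsilon>: "D * (K * \<delta> powr ?\<epsilon>) \<le> \<epsilon> / 2"
  proof -
    have "1 / ?\<epsilon> * ?\<epsilon> = 1" using \<alpha> by simp
    then have "\<delta> powr ?\<epsilon> = \<epsilon> / 2 / (D * K + 1)" unfolding \<delta>_def powr_powr using DK \<epsilon> by (simp only:) simp
    then have "D * (K * \<delta> powr ?\<epsilon>) = (\<epsilon> / 2) * ((D * K) / (D * K + 1))" by simp
    also have "\<dots> \<le> (\<epsilon> / 2) * 1" using DK \<epsilon> by (intro mult_left_mono) auto
    finally show ?thesis by simp
  qed
  define A where "A = (\<delta> / 4) powr - (1 + \<alpha>) * (2 / \<delta>) powr (2 * ?c)"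
  have A: "A \<ge> 0" by (simp add: A_def)
  \<comment> \<open>The size that ||T_b(k_v x)|| must fall below, so that A \<eta>^2 \<le>
    (\<epsilon>/2)^2 with A the constant of the near estimate.\<close>
  define \<eta> where "\<eta> = \<epsilon> / 2 / sqrt (A + 1)"
  have \<eta>: "\<eta> > 0" using A \<epsilon> by (simp add: \<eta>_def)
  have A\<eta>: "A * \<eta>\<^sup>2 \<le> (\<epsilon> / 2)\<^sup>2"
  proof -
    have "A * \<eta>\<^sup>2 = (\<epsilon> / 2)\<^sup>2 * (A / (A + 1))" using A by (simp add: \<eta>_def power_divide)
    also have "\<dots> \<le> (\<epsilon> / 2)\<^sup>2 * 1" using A by (intro mult_left_mono) auto
    finally show ?thesis by simp
  qed
  have "eventually (\<lambda>z. ?T z < ennreal \<eta>) to_boundary" using order_tendstoD(2)[OF lim] \<eta> by simp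
  then obtain r where r: "r < 1" "\<And>z. r < norm z \<Longrightarrow> norm z < 1 \<Longrightarrow> ?T z < ennreal \<eta>"
    unfolding eventually_to_boundary by blast
  show ?thesis
  proof (intro exI[of _ "(r + 1) / 2"] conjI allI impI)
    \<comment> \<open>The midpoint between r and 1, so that the non-strict condition on |v| implies
      the strict inequality r < |v| of the filter.\<close>
    show "(r + 1) / 2 < 1" using r by simp
    fix v :: "complex ^ 'n" assume v': "(r + 1) / 2 \<le> norm v" and v: "norm v < 1"
    have T: "?T v < ennreal \<eta>" using r v v' by (intro r(2)) auto
    let ?F = "{u. far \<delta> v u}" and ?G = "{u. \<not> far \<delta> v u}" and ?s = "1 - (norm v)\<^sup>2"
    have s: "?s > 0" by (rule one_minus_norm2_pos[OF v])
    have hv: "schur_weight \<alpha> v > 0" by (rule schur_weight_pos[OF v])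
    have L2: "(\<integral>\<^sup>+u. (?N v u)\<^sup>2 \<partial>?M) = ennreal (?s powr - ?c) * (?T v)\<^sup>2"
      by (rule ker_norm_L2[OF \<alpha> b hom v])
    have Nm: "?N v \<in> borel_measurable ?M"
      using measurable_compose[OF measurable_Pair1' ker_norm_measurable[OF \<alpha> b hom, of x], of v] v by simp
    have hm: "?h \<in> borel_measurable ?M"
      by (intro measurable_compose[OF borel_measurable_schur_weight[OF id] measurable_ennreal])
    have am: "(\<lambda>u. abs_kernel2 \<alpha> (\<lambda>_. 1) v u) \<in> borel_measurable ?M" by (intro borel_measurable_abs_kernel2[OF \<alpha>] id) auto
    have Fs: "?F \<in> sets borel" "?G \<in> sets borel" using sets_far[of \<delta> v] borel_comp[OF sets_far[of \<delta> v]] by (simp_all add: Compl_eq)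
    have Fm: "(\<lambda>u. indicator ?F u :: ennreal) \<in> borel_measurable ?M" "(\<lambda>u. indicator ?G u :: ennreal) \<in> borel_measurable ?M"
      by (intro measurable_borel_weighted borel_measurable_indicator Fs)+
    have "(\<integral>\<^sup>+u. ?N v u * ?h u \<partial>?M) = (\<integral>\<^sup>+u. indicator ?F u * (?N v u * ?h u) + indicator ?G u * (?N v u * ?h u) \<partial>?M)"
      by (intro nn_integral_cong) (auto simp: indicator_def)
    also have "\<dots> = (\<integral>\<^sup>+u. indicator ?F u * (?N v u * ?h u) \<partial>?M) + (\<integral>\<^sup>+u. ?N v u * (indicator ?G u * ?h u) \<partial>?M)"
      by (subst nn_integral_add) (auto intro!: borel_measurable_times_ennreal Fm Nm hm simp: mult_ac)
    also have "\<dots> \<le> ennreal (\<epsilon> / 2) * ?h v + ennreal (\<epsilon> / 2) * ?h v"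
    proof (rule add_mono)
      have "(\<integral>\<^sup>+u. indicator ?F u * (?N v u * ?h u) \<partial>?M) \<le> (\<integral>\<^sup>+u. ennreal D * (indicator ?F u * (abs_kernel2 \<alpha> (\<lambda>_. 1) v u * ?h u)) \<partial>?M)"
      proof (rule nn_integral_mono)
        fix u assume "u \<in> space ?M"
        then have "?N v u * ?h u \<le> (ennreal D * abs_kernel2 \<alpha> (\<lambda>_. 1) v u) * ?h u" by (intro mult_right_mono ND v) auto
        then show "indicator ?F u * (?N v u * ?h u) \<le> ennreal D * (indicator ?F u * (abs_kernel2 \<alpha> (\<lambda>_. 1) v u * ?h u))"
          by (auto simp: indicator_def mult.assoc)
      qed
      also have "\<dots> = ennreal D * (\<integral>\<^sup>+u. indicator ?F u * (abs_kernel2 \<alpha> (\<lambda>_. 1) v u * ?h u) \<partial>?M)"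
        by (intro nn_integral_cmult borel_measurable_times_ennreal Fm am hm)
      also have "\<dots> \<le> ennreal D * (ennreal (K * \<delta> powr ?\<epsilon>) * ?h v)"
        using K(2)[OF \<delta> v] \<alpha> by (intro mult_left_mono) simp_all
      also have "\<dots> \<le> ennreal (\<epsilon> / 2) * ?h v"
        unfolding mult.assoc[symmetric] ennreal_mult'[OF D, symmetric] using \<delta>\<epsilon> by (intro mult_right_mono ennreal_leI) (simp_all add: mult_ac)
      finally show "(\<integral>\<^sup>+u. indicator ?F u * (?N v u * ?h u) \<partial>?M) \<le> ennreal (\<epsilon> / 2) * ?h v" .
      show "(\<integral>\<^sup>+u. ?N v u * (indicator ?G u * ?h u) \<partial>?M) \<le> ennreal (\<epsilon> / 2) * ?h v"
      proof (rule ennreal_square_le_imp_le)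
        have "(\<integral>\<^sup>+u. ?N v u * (indicator ?G u * ?h u) \<partial>?M)\<^sup>2 \<le> (\<integral>\<^sup>+u. (?N v u)\<^sup>2 \<partial>?M) * (\<integral>\<^sup>+u. (indicator ?G u * ?h u)\<^sup>2 \<partial>?M)"
          by (intro Cauchy_Schwarz_nn_integral Nm borel_measurable_times_ennreal Fm hm)
        also have "(\<integral>\<^sup>+u. (indicator ?G u * ?h u)\<^sup>2 \<partial>?M) = (\<integral>\<^sup>+u. indicator ?G u * (?h u)\<^sup>2 \<partial>?M)"
          by (intro nn_integral_cong) (auto simp: indicator_def)
        also have "(\<integral>\<^sup>+u. (?N v u)\<^sup>2 \<partial>?M) * (\<integral>\<^sup>+u. indicator ?G u * (?h u)\<^sup>2 \<partial>?M)
          \<le> (ennreal (?s powr - ?c) * (ennreal \<eta>)\<^sup>2) * ennreal (A * ?s powr ?c * (schur_weight \<alpha> v)\<^sup>2)"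
          unfolding A_def L2
          using T by (intro mult_mono near_weight_bound[OF \<alpha> \<delta> v] power_mono order_refl) auto
        also have "\<dots> = ennreal (?s powr - ?c * \<eta>\<^sup>2 * (A * ?s powr ?c * (schur_weight \<alpha> v)\<^sup>2))"
          using \<eta> A by (simp add: ennreal_power ennreal_mult)
        also have "?s powr - ?c * \<eta>\<^sup>2 * (A * ?s powr ?c * (schur_weight \<alpha> v)\<^sup>2) = (?s powr - ?c * ?s powr ?c) * (A * \<eta>\<^sup>2 * (schur_weight \<alpha> v)\<^sup>2)"
          by (simp only: mult_ac)
        also have "?s powr - ?c * ?s powr ?c = 1" using s by (simp flip: powr_add)
        also have "ennreal (1 * (A * \<eta>\<^sup>2 * (schur_weight \<alpha> v)\<^sup>2)) \<le> ennreal ((\<epsilon> / 2)\<^sup>2 * (schur_weight \<alpha> v)\<^sup>2)"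
          unfolding mult_1_left by (intro ennreal_leI mult_right_mono A\<eta>) simp
        also have "\<dots> = (ennreal (\<epsilon> / 2) * ?h v)\<^sup>2"
          using \<epsilon> hv by (simp add: ennreal_mult[symmetric] ennreal_power power_mult_distrib power_divide)
        finally show "(\<integral>\<^sup>+u. ?N v u * (indicator ?G u * ?h u) \<partial>?M)\<^sup>2 \<le> (ennreal (\<epsilon> / 2) * ?h v)\<^sup>2" .
      qed
    qed
    also have "\<dots> = ennreal \<epsilon> * ?h v"
      using \<epsilon> by (simp add: distrib_right[symmetric] ennreal_plus[symmetric] del: ennreal_plus)
    finally show "(\<integral>\<^sup>+u. ?N v u * ?h u \<partial>?M) \<le> ennreal \<epsilon> * ?h v" .
  qed
qed

text \<open>The kernel restricted to v close to the sphere has small Schur constant. The rest is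
  charged to the mass of \<phi> on |v| < r; its constant C' may be large, because this mass tends to
  0 along the differences of the chosen subsequence.\<close>

lemma toeplitz_vector_small:
  fixes b :: "complex ^ 'n \<Rightarrow> ell2 \<Rightarrow>\<^sub>L ell2"
  assumes \<alpha>: "\<alpha> > -1" and b: "carleson_symbol \<alpha> b B"
    and hom: "\<And>w c x. norm w < 1 \<Longrightarrow> blinfun_apply (b w) (c *\<^sub>C x) = c *\<^sub>C blinfun_apply (b w) x"
    and lim: "((\<lambda>z. A2_norm \<alpha> (toeplitz \<alpha> b (\<lambda>w. normalized_kernel \<alpha> z w *\<^sub>C x))) \<longlongrightarrow> 0) to_boundary"
    and \<epsilon>: "\<epsilon> > 0"
  shows "\<exists>r<1. \<exists>C'\<ge>0. \<forall>\<phi>. complex_diff_on_ball \<phi> \<longrightarrow> (\<lambda>w. \<phi> w *\<^sub>C x) \<in> A2 \<alpha> \<longrightarrow> integrable (weighted_measure \<alpha>) \<phi> \<longrightarrow>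
    (\<integral>\<^sup>+v. (ennreal (cmod (\<phi> v)))\<^sup>2 \<partial>weighted_measure \<alpha>) < \<infinity> \<longrightarrow>
    (A2_norm \<alpha> (toeplitz \<alpha> b (\<lambda>w. \<phi> w *\<^sub>C x)))\<^sup>2 \<le> ennreal \<epsilon> * (\<integral>\<^sup>+v. (ennreal (cmod (\<phi> v)))\<^sup>2 \<partial>weighted_measure \<alpha>)
      + ennreal C' * (\<integral>\<^sup>+v. indicator {v. norm v < r} v * (ennreal (cmod (\<phi> v)))\<^sup>2 \<partial>weighted_measure \<alpha>)"
proof -
  let ?M = "weighted_measure \<alpha> :: (complex ^ 'n) measure"
  let ?N = "ker_norm \<alpha> b x" and ?K = "abs_kernel2 \<alpha> (\<lambda>_. 1) :: complex ^ 'n \<Rightarrow> _"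
  let ?h = "\<lambda>u :: complex ^ 'n. ennreal (schur_weight \<alpha> u)"
  interpret M: finite_measure ?M by (rule finite_measure_weighted[OF \<alpha>])
  note id = measurable_ident_weighted[of \<alpha>]
  obtain C where C: "C > 0" "\<And>v u. norm v < 1 \<Longrightarrow> norm u < 1 \<Longrightarrow> abs_kernel2 \<alpha> (\<lambda>w. ennreal (norm (b w))) v u \<le> ennreal (C * B) * ?K v u"
    using carleson_abs_kernel2[OF \<alpha>] b by blast
  define D where "D = norm x * (C * B)"
  have CB: "C * B \<ge> 0" using C(1) b by (simp add: carleson_symbol_def)
  then have D: "D \<ge> 0" by (simp add: D_def)
  have ND: "?N v u \<le> ennreal D * ?K v u" if "norm v < 1" "norm u < 1" for v u
    unfolding D_def by (rule ker_norm_le[OF \<alpha> b hom C(2) that CB])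
  obtain K where K: "K > 0" "\<And>v :: complex ^ 'n. norm v < 1 \<Longrightarrow> (\<integral>\<^sup>+u. ?K v u * ?h u \<partial>?M) \<le> ennreal K * ?h v"
    using schur_row[OF \<alpha>] by blast
  obtain L where L: "L > 0" "\<And>\<phi>. \<phi> \<in> borel_measurable ?M \<Longrightarrow> (\<integral>\<^sup>+u. (\<integral>\<^sup>+v. ?K v u * \<phi> v \<partial>?M)\<^sup>2 \<partial>?M) \<le> ennreal (L\<^sup>2) * (\<integral>\<^sup>+v. (\<phi> v)\<^sup>2 \<partial>?M)"
    using schur_L2[OF \<alpha>, where 'n='n] by blast
  have DK: "D * K \<ge> 0" using D K by simp
  \<comment> \<open>The row constant; with column constant D K and the factor 2 from squaring a sum,
    it satisfies 2 \<epsilon>' D K \<le> \<epsilon>.\<close>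
  define \<epsilon>' where "\<epsilon>' = \<epsilon> / 2 / (D * K + 1)"
  have \<epsilon>': "\<epsilon>' > 0" using DK \<epsilon> by (simp add: \<epsilon>'_def)
  have e2: "2 * (\<epsilon>' * (D * K)) \<le> \<epsilon>" using DK \<epsilon> by (simp add: \<epsilon>'_def field_simps)
  obtain r where r: "r < 1" "\<And>v. r \<le> norm v \<Longrightarrow> norm v < 1 \<Longrightarrow> (\<integral>\<^sup>+u. ?N v u * ?h u \<partial>?M) \<le> ennreal \<epsilon>' * ?h v"
    using ker_norm_row[OF \<alpha> b hom lim \<epsilon>'] by blast
  have Kv: "(\<lambda>v. ?K v u) \<in> borel_measurable ?M" for u
    by (intro borel_measurable_abs_kernel2[OF \<alpha>] id) auto
  have hm: "?h \<in> borel_measurable ?M" by (intro measurable_compose[OF borel_measurable_schur_weight[OF id] measurable_ennreal])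
  let ?R = "{v :: complex ^ 'n. norm v < r}"
  have R: "?R \<in> sets borel" by (intro borel_open open_Collect_less continuous_intros)
  have Rm: "(\<lambda>v. indicator ?R v :: ennreal) \<in> borel_measurable ?M" "(\<lambda>v. indicator (- ?R) v :: ennreal) \<in> borel_measurable ?M"
    by (intro measurable_borel_weighted borel_measurable_indicator R borel_comp)+
  \<comment> \<open>Discarding |v| < r makes every row small, while the columns keep the bound D
    K.\<close>
  define k where "k p = indicator (- ?R) (fst p) * ?N (fst p) (snd p)" for p
  have km: "k \<in> borel_measurable (?M \<Otimes>\<^sub>M ?M)"
    unfolding k_def by (intro borel_measurable_times_ennreal ker_norm_measurable[OF \<alpha> b hom] measurable_compose[OF measurable_fst Rm(2)])
  have Nm: "(\<lambda>v. ?N v u) \<in> borel_measurable ?M" if "norm u < 1" for u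
    using measurable_compose[OF measurable_Pair2' ker_norm_measurable[OF \<alpha> b hom, of x], of u] that by simp
  show ?thesis
  proof (rule exI[of _ r], intro exI[of _ "2 * (D\<^sup>2 * L\<^sup>2)"] conjI allI impI r(1))
    show "0 \<le> 2 * (D\<^sup>2 * L\<^sup>2)" by simp
    fix \<phi> :: "complex ^ 'n \<Rightarrow> complex"
    assume \<phi>: "complex_diff_on_ball \<phi>" "(\<lambda>w. \<phi> w *\<^sub>C x) \<in> A2 \<alpha>" "integrable ?M \<phi>" and fin: "(\<integral>\<^sup>+v. (ennreal (cmod (\<phi> v)))\<^sup>2 \<partial>?M) < \<infinity>"
    define p where "p v = ennreal (cmod (\<phi> v))" for v
    have pm: "p \<in> borel_measurable ?M"
      unfolding p_def using \<phi>(3) by (intro measurable_compose[OF _ measurable_ennreal] measurable_compose[OF _ borel_measurable_norm]) auto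
    have qm: "(\<lambda>v. indicator ?R v * p v) \<in> borel_measurable ?M" by (intro borel_measurable_times_ennreal Rm pm)
    let ?P1 = "\<lambda>u. \<integral>\<^sup>+v. k (v, u) * p v \<partial>?M" and ?P2 = "\<lambda>u. \<integral>\<^sup>+v. ?K v u * (indicator ?R v * p v) \<partial>?M"
    have P1m: "?P1 \<in> borel_measurable ?M"
    proof (rule M.borel_measurable_nn_integral)
      show "(\<lambda>(u, v). k (v, u) * p v) \<in> borel_measurable (?M \<Otimes>\<^sub>M ?M)"
        unfolding split_beta' by (intro borel_measurable_times_ennreal measurable_compose[OF measurable_snd pm] measurable_compose[OF _ km] measurable_Pair measurable_fst measurable_snd)
    qed
    have P2m: "?P2 \<in> borel_measurable ?M"
    proof (rule M.borel_measurable_nn_integral)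
      show "(\<lambda>(u, v). ?K v u * (indicator ?R v * p v)) \<in> borel_measurable (?M \<Otimes>\<^sub>M ?M)"
        unfolding split_beta' by (intro borel_measurable_times_ennreal measurable_compose[OF measurable_snd pm] measurable_compose[OF measurable_snd Rm(1)]
            borel_measurable_abs_kernel2[OF \<alpha>] measurable_compose[OF measurable_fst id] measurable_compose[OF measurable_snd id]) auto
    qed
    have ts: "AE u in ?M. ennreal (norm (toeplitz \<alpha> b (\<lambda>w. \<phi> w *\<^sub>C x) u)) \<le> (\<integral>\<^sup>+v. ?N v u * ennreal (cmod (\<phi> v)) \<partial>?M)"
      by (rule toeplitz_scalar_le[OF \<alpha> b hom \<phi> fin])
    have "(A2_norm \<alpha> (toeplitz \<alpha> b (\<lambda>w. \<phi> w *\<^sub>C x)))\<^sup>2 = (\<integral>\<^sup>+u. (ennreal (norm (toeplitz \<alpha> b (\<lambda>w. \<phi> w *\<^sub>C x) u)))\<^sup>2 \<partial>?M)"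
      unfolding A2_norm_sq nn_integral_norm_power2 ..
    also have "\<dots> \<le> (\<integral>\<^sup>+u. 2 * (?P1 u)\<^sup>2 + 2 * (ennreal D * ?P2 u)\<^sup>2 \<partial>?M)"
    proof (rule nn_integral_mono_AE)
      show "AE u in ?M. (ennreal (norm (toeplitz \<alpha> b (\<lambda>w. \<phi> w *\<^sub>C x) u)))\<^sup>2 \<le> 2 * (?P1 u)\<^sup>2 + 2 * (ennreal D * ?P2 u)\<^sup>2"
        using ts AE_space
      proof eventually_elim
        case (elim u)
        then have u: "norm u < 1" by simp
        note elim(1)
        also have "(\<integral>\<^sup>+v. ?N v u * ennreal (cmod (\<phi> v)) \<partial>?M) = (\<integral>\<^sup>+v. k (v, u) * p v + ?N v u * (indicator ?R v * p v) \<partial>?M)"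
          unfolding k_def p_def by (intro nn_integral_cong) (auto simp: indicator_def)
        also have "\<dots> = ?P1 u + (\<integral>\<^sup>+v. ?N v u * (indicator ?R v * p v) \<partial>?M)"
        proof (rule nn_integral_add)
          show "(\<lambda>v. k (v, u) * p v) \<in> borel_measurable ?M"
            unfolding k_def fst_conv snd_conv by (intro borel_measurable_times_ennreal Rm pm Nm u)
        qed (intro borel_measurable_times_ennreal Rm pm Nm u)
        also have "(\<integral>\<^sup>+v. ?N v u * (indicator ?R v * p v) \<partial>?M) \<le> (\<integral>\<^sup>+v. ennreal D * (?K v u * (indicator ?R v * p v)) \<partial>?M)"
          unfolding mult.assoc[of "ennreal D", symmetric] by (intro nn_integral_mono mult_right_mono ND u) auto
        also have "\<dots> = ennreal D * ?P2 u" by (intro nn_integral_cmult borel_measurable_times_ennreal Kv qm)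
        finally have "(ennreal (norm (toeplitz \<alpha> b (\<lambda>w. \<phi> w *\<^sub>C x) u)))\<^sup>2 \<le> (?P1 u + ennreal D * ?P2 u)\<^sup>2"
          by (intro power_mono) auto
        also have "\<dots> \<le> 2 * (?P1 u)\<^sup>2 + 2 * (ennreal D * ?P2 u)\<^sup>2" by (rule ennreal_power2_add_le)
        finally show ?case .
      qed
    qed
    also have "\<dots> = (\<integral>\<^sup>+u. 2 * (?P1 u)\<^sup>2 \<partial>?M) + (\<integral>\<^sup>+u. 2 * (ennreal D * ?P2 u)\<^sup>2 \<partial>?M)"
      by (intro nn_integral_add borel_measurable_times_ennreal borel_measurable_power_ennreal borel_measurable_const P1m P2m)
    also have "(\<integral>\<^sup>+u. 2 * (?P1 u)\<^sup>2 \<partial>?M) = 2 * (\<integral>\<^sup>+u. (?P1 u)\<^sup>2 \<partial>?M)"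
      by (intro nn_integral_cmult borel_measurable_power_ennreal P1m)
    also have "(\<integral>\<^sup>+u. 2 * (ennreal D * ?P2 u)\<^sup>2 \<partial>?M) = 2 * (ennreal (D\<^sup>2) * (\<integral>\<^sup>+u. (?P2 u)\<^sup>2 \<partial>?M))"
      using P2m D by (simp add: power_mult_distrib nn_integral_cmult ennreal_power borel_measurable_times_ennreal borel_measurable_power_ennreal)
    also have "2 * (\<integral>\<^sup>+u. (?P1 u)\<^sup>2 \<partial>?M) + 2 * (ennreal (D\<^sup>2) * (\<integral>\<^sup>+u. (?P2 u)\<^sup>2 \<partial>?M))
       \<le> 2 * (ennreal \<epsilon>' * ennreal (D * K) * (\<integral>\<^sup>+v. (p v)\<^sup>2 \<partial>?M)) + 2 * (ennreal (D\<^sup>2) * (ennreal (L\<^sup>2) * (\<integral>\<^sup>+v. (indicator ?R v * p v)\<^sup>2 \<partial>?M)))"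
    proof (intro add_mono mult_left_mono L(2) qm)
      show "(\<integral>\<^sup>+u. (\<integral>\<^sup>+v. k (v, u) * p v \<partial>?M)\<^sup>2 \<partial>?M) \<le> ennreal \<epsilon>' * ennreal (D * K) * (\<integral>\<^sup>+v. (p v)\<^sup>2 \<partial>?M)"
      proof (rule schur_test[where h = "schur_weight \<alpha>", OF _ km _ pm])
        show "sigma_finite_measure ?M" by unfold_locales
        show "schur_weight \<alpha> \<in> borel_measurable ?M" using borel_measurable_schur_weight[OF id] by simp
        show "0 < schur_weight \<alpha> v" if "v \<in> space ?M" for v using that by (simp add: schur_weight_pos)
        show "(\<integral>\<^sup>+u. k (v, u) * ?h u \<partial>?M) \<le> ennreal \<epsilon>' * ?h v" if "v \<in> space ?M" for v
          using r(2)[of v] that by (cases "norm v < r") (simp_all add: k_def)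
        show "(\<integral>\<^sup>+v. k (v, u) * ?h v \<partial>?M) \<le> ennreal (D * K) * ?h u" if "u \<in> space ?M" for u
        proof -
          have u: "norm u < 1" using that by simp
          have "(\<integral>\<^sup>+v. k (v, u) * ?h v \<partial>?M) \<le> (\<integral>\<^sup>+v. ennreal D * (?K u v * ?h v) \<partial>?M)"
          proof (rule nn_integral_mono)
            fix v assume "v \<in> space ?M"
            then have "?N v u * ?h v \<le> (ennreal D * ?K v u) * ?h v" by (intro mult_right_mono ND u) auto
            then show "k (v, u) * ?h v \<le> ennreal D * (?K u v * ?h v)"
              by (auto simp: k_def indicator_def mult.assoc abs_kernel2_commute[of \<alpha> _ u v])
          qed
          also have "\<dots> = ennreal D * (\<integral>\<^sup>+v. ?K u v * ?h v \<partial>?M)"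
            unfolding abs_kernel2_commute[of \<alpha> _ u] by (intro nn_integral_cmult borel_measurable_times_ennreal Kv hm)
          also have "\<dots> \<le> ennreal D * (ennreal K * ?h u)" by (intro mult_left_mono K(2) u) simp
          finally show ?thesis using D K(1) by (simp add: ennreal_mult mult.assoc)
        qed
      qed
    qed auto
    also have "2 * (ennreal \<epsilon>' * ennreal (D * K) * (\<integral>\<^sup>+v. (p v)\<^sup>2 \<partial>?M)) = ennreal (2 * (\<epsilon>' * (D * K))) * (\<integral>\<^sup>+v. (p v)\<^sup>2 \<partial>?M)"
      using \<epsilon>' DK by (simp add: ennreal_mult mult.assoc)
    also have "\<dots> \<le> ennreal \<epsilon> * (\<integral>\<^sup>+v. (p v)\<^sup>2 \<partial>?M)" by (intro mult_right_mono ennreal_leI e2) simp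
    also have "(\<integral>\<^sup>+v. (indicator ?R v * p v)\<^sup>2 \<partial>?M) = (\<integral>\<^sup>+v. indicator ?R v * (p v)\<^sup>2 \<partial>?M)"
      by (intro nn_integral_cong) (auto simp: indicator_def)
    also have "2 * (ennreal (D\<^sup>2) * (ennreal (L\<^sup>2) * (\<integral>\<^sup>+v. indicator ?R v * (p v)\<^sup>2 \<partial>?M))) = ennreal (2 * (D\<^sup>2 * L\<^sup>2)) * (\<integral>\<^sup>+v. indicator ?R v * (p v)\<^sup>2 \<partial>?M)"
      by (simp add: ennreal_mult mult.assoc)
    finally show "(A2_norm \<alpha> (toeplitz \<alpha> b (\<lambda>w. \<phi> w *\<^sub>C x)))\<^sup>2 \<le> ennreal \<epsilon> * (\<integral>\<^sup>+v. (ennreal (cmod (\<phi> v)))\<^sup>2 \<partial>?M)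
      + ennreal (2 * (D\<^sup>2 * L\<^sup>2)) * (\<integral>\<^sup>+v. indicator ?R v * (ennreal (cmod (\<phi> v)))\<^sup>2 \<partial>?M)"
      unfolding p_def by (simp add: add_mono)
  qed
qed

section \<open>Norm inequalities, completeness and equicontinuity in A^2\<close>

lemma A2_norm_cong:
  "(\<And>w. norm w < 1 \<Longrightarrow> f w = g w) \<Longrightarrow> A2_norm \<alpha> f = A2_norm \<alpha> (g :: complex ^ 'n \<Rightarrow> ell2)"
  by (rule antisym; rule ennreal_square_le_imp_le; unfold A2_norm_sq; rule nn_integral_mono) auto

lemma L1_le_A2_norm:
  fixes f :: "complex ^ 'n \<Rightarrow> ell2"
  assumes \<alpha>: "\<alpha> > -1" and f: "f \<in> borel_measurable (weighted_measure \<alpha>)"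
  shows "(\<integral>\<^sup>+w. ennreal (norm (f w)) \<partial>weighted_measure \<alpha>) \<le> A2_norm \<alpha> f"
proof (rule ennreal_square_le_imp_le)
  have nf: "(\<lambda>w. ennreal (norm (f w))) \<in> borel_measurable (weighted_measure \<alpha>)" using f by measurable
  have "(\<integral>\<^sup>+w. ennreal (norm (f w)) * 1 \<partial>weighted_measure \<alpha>)\<^sup>2 \<le>
    (\<integral>\<^sup>+w. (ennreal (norm (f w)))\<^sup>2 \<partial>weighted_measure \<alpha>) * (\<integral>\<^sup>+w. 1\<^sup>2 \<partial>(weighted_measure \<alpha> :: (complex ^ 'n) measure))"
    by (intro Cauchy_Schwarz_nn_integral nf borel_measurable_const)
  then show "(\<integral>\<^sup>+w. ennreal (norm (f w)) \<partial>weighted_measure \<alpha>)\<^sup>2 \<le> (A2_norm \<alpha> f)\<^sup>2"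
    unfolding A2_norm_sq nn_integral_norm_power2 using emeasure_weighted_space[OF \<alpha>, where 'n='n] by simp
qed

lemma integrable_of_A2_norm:
  fixes f :: "complex ^ 'n \<Rightarrow> ell2"
  assumes "\<alpha> > -1" "f \<in> borel_measurable (weighted_measure \<alpha>)" "A2_norm \<alpha> f < \<infinity>"
  shows "integrable (weighted_measure \<alpha>) f"
  using L1_le_A2_norm[OF assms(1,2)] assms(2,3) by (intro integrableI_bounded) auto

lemma A2_norm_add_sq:
  fixes f g :: "complex ^ 'n \<Rightarrow> ell2"
  assumes "f \<in> borel_measurable (weighted_measure \<alpha>)" "g \<in> borel_measurable (weighted_measure \<alpha>)"
  shows "(A2_norm \<alpha> (\<lambda>w. f w + g w))\<^sup>2 \<le> 2 * (A2_norm \<alpha> f)\<^sup>2 + 2 * (A2_norm \<alpha> g)\<^sup>2"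
proof -
  let ?M = "weighted_measure \<alpha> :: (complex ^ 'n) measure"
  have m: "(\<lambda>w. (ennreal (norm (f w)))\<^sup>2) \<in> borel_measurable ?M" "(\<lambda>w. (ennreal (norm (g w)))\<^sup>2) \<in> borel_measurable ?M"
    using assms by measurable
  have "(\<integral>\<^sup>+w. (ennreal (norm (f w + g w)))\<^sup>2 \<partial>?M) \<le> (\<integral>\<^sup>+w. 2 * (ennreal (norm (f w)))\<^sup>2 + 2 * (ennreal (norm (g w)))\<^sup>2 \<partial>?M)"
  proof (rule nn_integral_mono)
    fix w
    have "(ennreal (norm (f w + g w)))\<^sup>2 \<le> (ennreal (norm (f w)) + ennreal (norm (g w)))\<^sup>2"
      by (intro power_mono) (simp_all add: norm_triangle_ineq ennreal_leI flip: ennreal_plus)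
    also have "\<dots> \<le> 2 * (ennreal (norm (f w)))\<^sup>2 + 2 * (ennreal (norm (g w)))\<^sup>2" by (rule ennreal_power2_add_le)
    finally show "(ennreal (norm (f w + g w)))\<^sup>2 \<le> 2 * (ennreal (norm (f w)))\<^sup>2 + 2 * (ennreal (norm (g w)))\<^sup>2" .
  qed
  also have "\<dots> = 2 * (\<integral>\<^sup>+w. (ennreal (norm (f w)))\<^sup>2 \<partial>?M) + 2 * (\<integral>\<^sup>+w. (ennreal (norm (g w)))\<^sup>2 \<partial>?M)"
    using m by (simp add: nn_integral_add nn_integral_cmult borel_measurable_times_ennreal)
  finally show ?thesis unfolding A2_norm_sq nn_integral_norm_power2 .
qed

text \<open>The crude factor 2^d comes from iterating (x + y)^2 \<le> 2 x^2 + 2 y^2; it is harmless,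
  as d is fixed before the summands are made small.\<close>

lemma A2_norm_sum_sq:
  fixes f :: "nat \<Rightarrow> complex ^ 'n \<Rightarrow> ell2"
  assumes f: "\<And>i. f i \<in> borel_measurable (weighted_measure \<alpha>)"
  shows "(A2_norm \<alpha> (\<lambda>w. \<Sum>i<d. f i w))\<^sup>2 \<le> 2 ^ d * (\<Sum>i<d. (A2_norm \<alpha> (f i))\<^sup>2)"
proof (induction d)
  case 0 show ?case by (simp add: A2_norm_sq)
next
  case (Suc d)
  have "(A2_norm \<alpha> (\<lambda>w. (\<Sum>i<d. f i w) + f d w))\<^sup>2 \<le> 2 * (A2_norm \<alpha> (\<lambda>w. \<Sum>i<d. f i w))\<^sup>2 + 2 * (A2_norm \<alpha> (f d))\<^sup>2"
    by (intro A2_norm_add_sq borel_measurable_sum f)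
  also have "\<dots> \<le> 2 * (2 ^ d * (\<Sum>i<d. (A2_norm \<alpha> (f i))\<^sup>2)) + 2 * (2 ^ d * (A2_norm \<alpha> (f d))\<^sup>2)"
  proof (intro add_mono mult_left_mono Suc.IH)
    have "1 * (A2_norm \<alpha> (f d))\<^sup>2 \<le> 2 ^ d * (A2_norm \<alpha> (f d))\<^sup>2"
      by (intro mult_right_mono) (simp_all add: one_le_power)
    then show "(A2_norm \<alpha> (f d))\<^sup>2 \<le> 2 ^ d * (A2_norm \<alpha> (f d))\<^sup>2" by simp
  qed auto
  also have "\<dots> = 2 ^ Suc d * (\<Sum>i<Suc d. (A2_norm \<alpha> (f i))\<^sup>2)" by (simp add: distrib_left mult.assoc)
  finally show ?case by simp
qed

lemma A2_diff:
  assumes "f \<in> A2 \<alpha>" "g \<in> A2 \<alpha>"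
  shows "(\<lambda>w. f w - g w) \<in> A2 \<alpha>"
  using A2_lincomb[OF assms, of 1 "-1"] by (simp add: scaleC.minus_left)

lemma kernel_integral_le:
  fixes h :: "complex ^ 'n \<Rightarrow> ell2"
  assumes \<alpha>: "\<alpha> > -1" and h: "integrable (weighted_measure \<alpha>) h" and z: "norm z < 1"
  shows "ennreal (norm (LINT w|weighted_measure \<alpha>. cnj (bergman_kernel \<alpha> z w) *\<^sub>C h w))
    \<le> ennreal ((1 - norm z) powr - (real CARD('n) + 1 + \<alpha>)) * A2_norm \<alpha> h"
proof -
  let ?M = "weighted_measure \<alpha> :: (complex ^ 'n) measure" and ?B = "(1 - norm z) powr - (real CARD('n) + 1 + \<alpha>)"
  have hm: "h \<in> borel_measurable ?M" using h by simp
  have "ennreal (norm (LINT w|?M. cnj (bergman_kernel \<alpha> z w) *\<^sub>C h w)) \<le> (\<integral>\<^sup>+w. abs_kernel \<alpha> z w * ennreal (norm (h w)) \<partial>?M)"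
    by (rule norm_integral_kernel_le[OF \<alpha> h z])
  also have "\<dots> \<le> (\<integral>\<^sup>+w. ennreal ?B * ennreal (norm (h w)) \<partial>?M)"
    using bergman_kernel_bound(1)[OF \<alpha> z] by (intro nn_integral_mono mult_right_mono) (auto simp: abs_kernel_bergman intro!: ennreal_leI)
  also have "\<dots> = ennreal ?B * (\<integral>\<^sup>+w. ennreal (norm (h w)) \<partial>?M)" using hm by (intro nn_integral_cmult) measurable
  also have "\<dots> \<le> ennreal ?B * A2_norm \<alpha> h" by (intro mult_left_mono L1_le_A2_norm[OF \<alpha> hm]) simp
  finally show ?thesis .
qed

lemma A2_point_bound:
  fixes f :: "complex ^ 'n \<Rightarrow> ell2"
  assumes "\<alpha> > -1" "f \<in> A2 \<alpha>" "norm z < 1" "A2_norm \<alpha> f \<le> ennreal t" "t \<ge> 0"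
  shows "norm (f z) \<le> (1 - norm z) powr - (real CARD('n) + 1 + \<alpha>) * t"
proof -
  have "ennreal (norm (f z)) \<le> ennreal ((1 - norm z) powr - (real CARD('n) + 1 + \<alpha>)) * A2_norm \<alpha> f"
    using kernel_integral_le[OF assms(1) A2_integrable[OF assms(1,2)] assms(3)] unfolding A2_reproducing[OF assms(1-3)] .
  also have "\<dots> \<le> ennreal ((1 - norm z) powr - (real CARD('n) + 1 + \<alpha>)) * ennreal t" by (intro mult_left_mono assms) simp
  finally show ?thesis using assms(5) by (simp add: ennreal_mult[symmetric] del: ennreal_le_iff) (subst (asm) ennreal_le_iff; simp)
qed

text \<open>Point evaluations are bounded, so a Cauchy sequence converges pointwise, and Fatou
  upgrades this to convergence in norm. The reproducing formula passes to the limit, and it makes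
  the limit holomorphic as a kernel integral.\<close>

theorem A2_complete:
  fixes g :: "nat \<Rightarrow> complex ^ 'n \<Rightarrow> ell2"
  assumes \<alpha>: "\<alpha> > -1" and g: "\<And>k. g k \<in> A2 \<alpha>"
    and C: "\<And>\<epsilon>. \<epsilon> > 0 \<Longrightarrow> \<exists>N. \<forall>k\<ge>N. \<forall>l\<ge>N. A2_norm \<alpha> (\<lambda>z. g k z - g l z) \<le> ennreal \<epsilon>"
  shows "\<exists>h\<in>A2 \<alpha>. (\<lambda>k. A2_norm \<alpha> (\<lambda>z. g k z - h z)) \<longlonglongrightarrow> 0"
proof -
  let ?M = "weighted_measure \<alpha> :: (complex ^ 'n) measure" and ?B = "\<lambda>z :: complex ^ 'n. (1 - norm z) powr - (real CARD('n) + 1 + \<alpha>)"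
  define h where "h z = lim (\<lambda>k. g k z)" for z
  have h: "(\<lambda>k. g k z) \<longlonglongrightarrow> h z" if z: "norm z < 1" for z
  proof -
    define \<beta> where "\<beta> = ?B z"
    have B: "\<beta> > 0" using z by (simp add: \<beta>_def)
    have "Cauchy (\<lambda>k. g k z)"
    proof (rule CauchyI)
      fix e :: real assume e: "e > 0"
      have t: "e / (2 * \<beta>) > 0" using B e by simp
      obtain N where N: "\<And>k l. k \<ge> N \<Longrightarrow> l \<ge> N \<Longrightarrow> A2_norm \<alpha> (\<lambda>z. g k z - g l z) \<le> ennreal (e / (2 * \<beta>))"
        using C[OF t] by blast
      have "norm (g k z - g l z) < e" if "k \<ge> N" "l \<ge> N" for k l
      proof -
        have "norm (g k z - g l z) \<le> \<beta> * (e / (2 * \<beta>))"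
          unfolding \<beta>_def by (rule A2_point_bound[OF \<alpha> A2_diff[OF g g] z N[OF that, unfolded \<beta>_def] less_imp_le[OF t, unfolded \<beta>_def]])
        also have "\<dots> < e" using B e by simp
        finally show ?thesis .
      qed
      then show "\<exists>N. \<forall>k\<ge>N. \<forall>l\<ge>N. norm (g k z - g l z) < e" by blast
    qed
    then show ?thesis unfolding h_def by (simp add: Cauchy_convergent_iff convergent_LIMSEQ_iff)
  qed
  have gm: "g k \<in> borel_measurable ?M" for k by (rule A2_measurable[OF g])
  have hm: "h \<in> borel_measurable ?M" by (rule borel_measurable_LIMSEQ_metric[OF gm h]) simp
  have close: "\<exists>N. \<forall>k\<ge>N. A2_norm \<alpha> (\<lambda>z. g k z - h z) \<le> ennreal \<epsilon>" if \<epsilon>: "\<epsilon> > 0" for \<epsilon>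
  proof -
    obtain N where N: "\<And>k l. k \<ge> N \<Longrightarrow> l \<ge> N \<Longrightarrow> A2_norm \<alpha> (\<lambda>z. g k z - g l z) \<le> ennreal \<epsilon>"
      using C[OF \<epsilon>] by blast
    have "A2_norm \<alpha> (\<lambda>z. g k z - h z) \<le> ennreal \<epsilon>" if k: "k \<ge> N" for k
    proof (rule ennreal_square_le_imp_le)
      have "(A2_norm \<alpha> (\<lambda>z. g k z - h z))\<^sup>2 = (\<integral>\<^sup>+z. liminf (\<lambda>l. ennreal ((norm (g k z - g l z))\<^sup>2)) \<partial>?M)"
        unfolding A2_norm_sq
      proof (rule nn_integral_cong)
        fix z assume "z \<in> space ?M"
        then have "(\<lambda>l. ennreal ((norm (g k z - g l z))\<^sup>2)) \<longlonglongrightarrow> ennreal ((norm (g k z - h z))\<^sup>2)"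
          by (intro tendsto_intros h) simp
        then show "ennreal ((norm (g k z - h z))\<^sup>2) = liminf (\<lambda>l. ennreal ((norm (g k z - g l z))\<^sup>2))"
          by (rule lim_imp_Liminf[OF sequentially_bot, symmetric])
      qed
      also have "\<dots> \<le> liminf (\<lambda>l. \<integral>\<^sup>+z. ennreal ((norm (g k z - g l z))\<^sup>2) \<partial>?M)"
        using gm by (intro nn_integral_liminf) measurable
      also have "\<dots> \<le> (ennreal \<epsilon>)\<^sup>2"
        unfolding A2_norm_sq[symmetric]
        by (intro Liminf_le sequentially_bot eventually_sequentiallyI[of N] power_mono N k) auto
      finally show "(A2_norm \<alpha> (\<lambda>z. g k z - h z))\<^sup>2 \<le> (ennreal \<epsilon>)\<^sup>2" .
    qed
    then show ?thesis by blast
  qed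
  have gh: "(\<lambda>z. g k z - h z) \<in> borel_measurable ?M" for k using gm hm by measurable
  obtain N where N: "A2_norm \<alpha> (\<lambda>z. g N z - h z) \<le> ennreal 1" using close[of 1] by auto
  \<comment> \<open>h is recovered as g N - (g N - h), a difference of two functions of finite
    norm.\<close>
  have hfin: "A2_norm \<alpha> h < \<infinity>"
  proof -
    have nm: "(\<lambda>z. - (g N z - h z)) \<in> borel_measurable ?M" using gh by (intro borel_measurable_uminus)
    have "(A2_norm \<alpha> (\<lambda>z. g N z + - (g N z - h z)))\<^sup>2 \<le> 2 * (A2_norm \<alpha> (g N))\<^sup>2 + 2 * (A2_norm \<alpha> (\<lambda>z. - (g N z - h z)))\<^sup>2"
      by (rule A2_norm_add_sq[OF gm nm])
    also have "(A2_norm \<alpha> (\<lambda>z. - (g N z - h z)))\<^sup>2 = (A2_norm \<alpha> (\<lambda>z. g N z - h z))\<^sup>2"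
      unfolding A2_norm_sq norm_minus_cancel ..
    also have "2 * (A2_norm \<alpha> (g N))\<^sup>2 + 2 * (A2_norm \<alpha> (\<lambda>z. g N z - h z))\<^sup>2 < \<infinity>"
      using g[of N] le_less_trans[OF N, of \<infinity>] by (auto simp: A2_iff_norm ennreal_mult_less_top power_less_top_ennreal)
    finally have "(A2_norm \<alpha> h)\<^sup>2 < \<infinity>" by simp
    then show ?thesis by (simp add: power_less_top_ennreal)
  qed
  have hint: "integrable ?M h" by (rule integrable_of_A2_norm[OF \<alpha> hm hfin])
  have "h z = (LINT w|?M. cnj (bergman_kernel \<alpha> z w) *\<^sub>C h w)" if z: "norm z < 1" for z
  proof (rule LIMSEQ_unique[OF h[OF z]])
    let ?k = "\<lambda>w. cnj (bergman_kernel \<alpha> z w)"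
    show "(\<lambda>k. g k z) \<longlonglongrightarrow> (LINT w|?M. ?k w *\<^sub>C h w)"
    proof (rule LIMSEQ_I)
      fix e :: real assume e: "e > 0"
      define \<beta> where "\<beta> = ?B z"
      have B: "\<beta> > 0" using z by (simp add: \<beta>_def)
      have t: "e / (2 * \<beta>) > 0" using B e by simp
      obtain N where N: "\<And>k. k \<ge> N \<Longrightarrow> A2_norm \<alpha> (\<lambda>z. g k z - h z) \<le> ennreal (e / (2 * \<beta>))"
        using close[OF t] by blast
      have "norm (g k z - (LINT w|?M. ?k w *\<^sub>C h w)) < e" if "k \<ge> N" for k
      proof -
        have gi: "integrable ?M (g k)" by (rule A2_integrable[OF \<alpha> g])
        have "g k z - (LINT w|?M. ?k w *\<^sub>C h w) = (LINT w|?M. ?k w *\<^sub>C g k w) - (LINT w|?M. ?k w *\<^sub>C h w)"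
          unfolding A2_reproducing[OF \<alpha> g z] ..
        also have "\<dots> = (LINT w|?M. ?k w *\<^sub>C (g k w - h w))"
          unfolding scaleC.diff_right by (intro Bochner_Integration.integral_diff[symmetric] integrable_kernel_scaleC[OF \<alpha> _ z] gi hint)
        finally have eq: "g k z - (LINT w|?M. ?k w *\<^sub>C h w) = (LINT w|?M. ?k w *\<^sub>C (g k w - h w))" .
        have "ennreal (norm (g k z - (LINT w|?M. ?k w *\<^sub>C h w))) \<le> ennreal \<beta> * A2_norm \<alpha> (\<lambda>w. g k w - h w)"
          unfolding eq \<beta>_def by (rule kernel_integral_le[OF \<alpha> Bochner_Integration.integrable_diff[OF gi hint] z])
        also have "\<dots> \<le> ennreal \<beta> * ennreal (e / (2 * \<beta>))" by (intro mult_left_mono N that) simp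
        also have "\<dots> = ennreal (e / 2)" using B e by (subst ennreal_mult[symmetric]) auto
        finally show ?thesis using e by (subst (asm) ennreal_le_iff) auto
      qed
      then show "\<exists>N. \<forall>k\<ge>N. norm (g k z - (LINT w|?M. ?k w *\<^sub>C h w)) < e" by blast
    qed
  qed
  then have "holomorphic_on_ball h" by (rule holomorphic_kernel_integral[OF \<alpha> hint])
  then have "h \<in> A2 \<alpha>" using hfin by (simp add: A2_iff_norm)
  moreover have "(\<lambda>k. A2_norm \<alpha> (\<lambda>z. g k z - h z)) \<longlonglongrightarrow> 0"
  proof (rule order_tendstoI)
    fix a :: ennreal assume "0 < a"
    then obtain t where t: "0 < t" "t < a" using dense by blast
    then obtain \<eta> where \<eta>: "t = ennreal \<eta>" "\<eta> > 0" by (cases t) (auto simp: top_unique)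
    obtain N where N: "\<And>k. k \<ge> N \<Longrightarrow> A2_norm \<alpha> (\<lambda>z. g k z - h z) \<le> ennreal \<eta>" using close[OF \<eta>(2)] by blast
    then show "\<forall>\<^sub>F k in sequentially. A2_norm \<alpha> (\<lambda>z. g k z - h z) < a"
      using t(2) unfolding \<eta>(1) by (intro eventually_sequentiallyI[of N] le_less_trans[OF N])
  qed simp
  ultimately show ?thesis by blast
qed

text \<open>For |v| \<le> \<rho> < 1 the kernel extends continuously to |w| = 1, so it is uniformly
  continuous on a compact product; this yields uniformity in w.\<close>

lemma bergman_kernel_equicontinuous:
  fixes v :: "complex ^ 'n"
  assumes v: "norm v < 1" and \<epsilon>: "\<epsilon> > 0"
  shows "\<exists>\<delta>>0. \<forall>v'. norm v' < 1 \<longrightarrow> dist v' v < \<delta> \<longrightarrow> (\<forall>w. norm w < 1 \<longrightarrow> cmod (bergman_kernel \<alpha> v' w - bergman_kernel \<alpha> v w) < \<epsilon>)"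
proof -
  define \<rho> where "\<rho> = (1 + norm v) / 2"
  have \<rho>: "norm v < \<rho>" "\<rho> < 1" using v by (auto simp: \<rho>_def)
  let ?K = "cball 0 \<rho> \<times> cball 0 1 :: ((complex ^ 'n) \<times> (complex ^ 'n)) set"
  let ?f = "\<lambda>p :: (complex ^ 'n) \<times> (complex ^ 'n). bergman_kernel \<alpha> (fst p) (snd p)"
  have "continuous_on ?K ?f"
    unfolding bergman_kernel_def
  proof (intro continuous_on_powr_complex continuous_intros)
    show "continuous_on ?K (\<lambda>p. herm (snd p) (fst p))" unfolding herm_def by (intro continuous_intros)
    have pos: "Re (1 - herm (snd p) (fst p)) > 0" if "p \<in> ?K" for p
    proof -
      have "cmod (herm (snd p) (fst p)) \<le> norm (snd p) * norm (fst p)" by (rule norm_herm_le)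
      also have "\<dots> \<le> 1 * \<rho>" using that by (intro mult_mono) auto
      finally show ?thesis using complex_Re_le_cmod[of "herm (snd p) (fst p)"] \<rho> by simp
    qed
    then show "?K \<subseteq> {p. 0 \<le> Re (1 - herm (snd p) (fst p)) \<or> Im (1 - herm (snd p) (fst p)) \<noteq> 0}" by (fastforce simp: less_imp_le)
    show "1 - herm (snd p) (fst p) = 0 \<Longrightarrow> 0 < Re (- complex_of_real (real CARD('n) + 1 + \<alpha>))" if "p \<in> ?K" for p
      using pos[OF that] by auto
  qed
  then have "uniformly_continuous_on ?K ?f" by (rule compact_uniformly_continuous) (intro compact_Times compact_cball)
  then obtain \<delta> where \<delta>: "\<delta> > 0" "\<And>p q. p \<in> ?K \<Longrightarrow> q \<in> ?K \<Longrightarrow> dist q p < \<delta> \<Longrightarrow> dist (?f q) (?f p) < \<epsilon>"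
    using \<epsilon> unfolding uniformly_continuous_on_def by metis
  show ?thesis
  proof (intro exI[of _ "min \<delta> (\<rho> - norm v)"] conjI allI impI)
    show "min \<delta> (\<rho> - norm v) > 0" using \<delta> \<rho> by simp
    fix v' w :: "complex ^ 'n" assume v': "dist v' v < min \<delta> (\<rho> - norm v)" and w: "norm w < 1"
    have "norm v' \<le> \<rho>" using v' norm_triangle_ineq2[of v' v] by (simp add: dist_norm)
    then show "cmod (bergman_kernel \<alpha> v' w - bergman_kernel \<alpha> v w) < \<epsilon>"
      using \<delta>(2)[of "(v, w)" "(v', w)"] v' w \<rho> by (simp add: dist_Pair_Pair) (simp add: dist_norm)
  qed
qed

lemma A2_equicontinuous:
  fixes v :: "complex ^ 'n"
  assumes \<alpha>: "\<alpha> > -1" and v: "norm v < 1" and \<epsilon>: "\<epsilon> > 0"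
  shows "\<exists>\<delta>>0. \<forall>v'. norm v' < 1 \<longrightarrow> dist v' v < \<delta> \<longrightarrow> (\<forall>f. f \<in> A2 \<alpha> \<longrightarrow> A2_norm \<alpha> f \<le> 1 \<longrightarrow> norm (f v' - f v) \<le> \<epsilon>)"
proof -
  let ?M = "weighted_measure \<alpha> :: (complex ^ 'n) measure"
  obtain \<delta> where \<delta>: "\<delta> > 0" "\<And>v' w. norm v' < 1 \<Longrightarrow> dist v' v < \<delta> \<Longrightarrow> norm w < 1 \<Longrightarrow> cmod (bergman_kernel \<alpha> v' w - bergman_kernel \<alpha> v w) < \<epsilon>"
    using bergman_kernel_equicontinuous[OF v \<epsilon>] by blast
  show ?thesis
  proof (intro exI[of _ \<delta>] conjI allI impI \<delta>(1))
    fix v' :: "complex ^ 'n" and f :: "complex ^ 'n \<Rightarrow> ell2"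
    assume v': "norm v' < 1" "dist v' v < \<delta>" and f: "f \<in> A2 \<alpha>" "A2_norm \<alpha> f \<le> 1"
    let ?d = "\<lambda>w. cnj (bergman_kernel \<alpha> v' w) *\<^sub>C f w - cnj (bergman_kernel \<alpha> v w) *\<^sub>C f w"
    note i = integrable_kernel_scaleC[OF \<alpha> A2_integrable[OF \<alpha> f(1)]]
    have fm: "f \<in> borel_measurable ?M" by (rule A2_measurable[OF f(1)])
    have "f v' - f v = (LINT w|?M. ?d w)"
      unfolding A2_reproducing[OF \<alpha> f(1) v'(1), symmetric] A2_reproducing[OF \<alpha> f(1) v, symmetric]
      by (rule Bochner_Integration.integral_diff[OF i[OF v'(1)] i[OF v], symmetric])
    then have "ennreal (norm (f v' - f v)) \<le> (\<integral>\<^sup>+w. ennreal (norm (?d w)) \<partial>?M)"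
      using integral_norm_bound_ennreal[OF Bochner_Integration.integrable_diff[OF i[OF v'(1)] i[OF v]]] by simp
    also have "\<dots> \<le> (\<integral>\<^sup>+w. ennreal \<epsilon> * ennreal (norm (f w)) \<partial>?M)"
    proof (rule nn_integral_mono)
      fix w assume "w \<in> space ?M"
      then have "cmod (bergman_kernel \<alpha> v' w - bergman_kernel \<alpha> v w) \<le> \<epsilon>" using \<delta>(2)[OF v', of w] by simp
      then have "norm (?d w) \<le> \<epsilon> * norm (f w)"
        unfolding scaleC.diff_left[symmetric] norm_scaleC complex_cnj_diff[symmetric] complex_mod_cnj by (rule mult_right_mono) simp
      then show "ennreal (norm (?d w)) \<le> ennreal \<epsilon> * ennreal (norm (f w))"
        using \<epsilon> by (simp add: ennreal_mult[symmetric] ennreal_leI)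
    qed
    also have "\<dots> = ennreal \<epsilon> * (\<integral>\<^sup>+w. ennreal (norm (f w)) \<partial>?M)" using fm by (intro nn_integral_cmult) measurable
    also have "\<dots> \<le> ennreal \<epsilon> * 1" by (intro mult_left_mono order_trans[OF L1_le_A2_norm[OF \<alpha> fm] f(2)]) simp
    finally show "norm (f v' - f v) \<le> \<epsilon>" using \<epsilon> by simp
  qed
qed

text \<open>A diagonal subsequence handles all basis indices and a countable dense set of points;
  equicontinuity of the unit ball of A^2 extends convergence to every point. Only the components
  along the e_i are asked to converge, since bounded sequences in l^2 have no norm-convergent
  subsequences in general.\<close>

lemma A2_weakly_convergent_subsequence:
  fixes F :: "nat \<Rightarrow> complex ^ 'n \<Rightarrow> ell2" and e :: "nat \<Rightarrow> ell2"
  assumes \<alpha>: "\<alpha> > -1" and F: "\<And>k. F k \<in> A2 \<alpha>" "\<And>k. A2_norm \<alpha> (F k) \<le> 1" and e: "\<And>i. norm (e i) = 1"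
  shows "\<exists>r. strict_mono r \<and> (\<forall>v i. norm v < 1 \<longrightarrow> convergent (\<lambda>k. cinner (F (r k) v) (e i)))"
proof -
  let ?B = "\<lambda>z :: complex ^ 'n. (1 - norm z) powr - (real CARD('n) + 1 + \<alpha>)"
  obtain D :: "(complex ^ 'n) set" where D: "countable D" "\<And>X. open X \<Longrightarrow> X \<noteq> {} \<Longrightarrow> \<exists>d\<in>D. d \<in> X"
    using countable_dense_setE by blast
  let ?S = "UNIV \<times> (D \<inter> ball 0 1) :: (nat \<times> (complex ^ 'n)) set"
  \<comment> \<open>Division by the bound for point evaluation makes all entries at most 1 in
    modulus, one common bound for the diagonal argument.\<close>
  let ?f = "\<lambda>k p. cinner (F k (snd p)) (e (fst p)) / complex_of_real (?B (snd p))"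
  have "countable ?S" using D(1) by auto
  moreover have "norm (?f k p) \<le> 1" if "p \<in> ?S" for k p
  proof -
    have z: "norm (snd p) < 1" using that by auto
    have "cmod (cinner (F k (snd p)) (e (fst p))) \<le> norm (F k (snd p))"
      using norm_cinner_le[of "F k (snd p)" "e (fst p)"] e by simp
    also have "\<dots> \<le> ?B (snd p) * 1" using F(2)[of k] by (intro A2_point_bound[OF \<alpha> F(1) z]) auto
    finally show ?thesis using z by (simp add: norm_divide)
  qed
  ultimately obtain r where r: "strict_mono (r :: nat \<Rightarrow> nat)" "\<And>p. p \<in> ?S \<Longrightarrow> \<exists>l. (\<lambda>k. ?f (r k) p) \<longlonglongrightarrow> l"
    using function_convergent_subsequence[of ?S ?f 1] by blast
  have conv: "convergent (\<lambda>k. cinner (F (r k) d) (e i))" if dd: "d \<in> D" "norm d < 1" for d i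
  proof -
    obtain l where "(\<lambda>k. ?f (r k) (i, d)) \<longlonglongrightarrow> l" using r(2)[of "(i, d)"] dd by auto
    then have "(\<lambda>k. ?f (r k) (i, d) * complex_of_real (?B d)) \<longlonglongrightarrow> l * complex_of_real (?B d)" by (intro tendsto_mult tendsto_const)
    moreover have "?f (r k) (i, d) * complex_of_real (?B d) = cinner (F (r k) d) (e i)" for k using dd(2) by simp
    ultimately show ?thesis unfolding convergent_def by (intro exI) (simp only:)
  qed
  have cauchy: "Cauchy (\<lambda>k. cinner (F (r k) v) (e i))" if v: "norm v < 1" for v i
  proof (rule CauchyI)
    fix \<epsilon> :: real assume \<epsilon>: "\<epsilon> > 0"
    then have \<epsilon>4: "\<epsilon> / 4 > 0" by simp
    obtain \<delta> where \<delta>: "\<delta> > 0" "\<And>v' f. norm v' < 1 \<Longrightarrow> dist v' v < \<delta> \<Longrightarrow> f \<in> A2 \<alpha> \<Longrightarrow> A2_norm \<alpha> f \<le> 1 \<Longrightarrow> norm (f v' - f v) \<le> \<epsilon> / 4"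
      using A2_equicontinuous[OF \<alpha> v \<epsilon>4] by blast
    have "v \<in> ball 0 1 \<inter> ball v \<delta>" using v \<delta>(1) by simp
    then obtain d where d: "d \<in> D" "d \<in> ball 0 1 \<inter> ball v \<delta>"
      using D(2)[OF open_Int[OF open_ball open_ball]] by blast
    then have dn: "norm d < 1" by simp
    have near: "cmod (cinner (F k d) (e i) - cinner (F k v) (e i)) \<le> \<epsilon> / 4" for k
    proof -
      have "cmod (cinner (F k d - F k v) (e i)) \<le> norm (F k d - F k v) * norm (e i)" by (rule norm_cinner_le)
      also have "\<dots> \<le> \<epsilon> / 4" using \<delta>(2)[of d "F k"] d(2) F by (simp add: e dist_commute)
      finally show ?thesis unfolding linear_diff[OF bounded_linear.linear[OF bounded_linear_cinner]] .
    qed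
    obtain N where "\<forall>k\<ge>N. \<forall>l\<ge>N. cmod (cinner (F (r k) d) (e i) - cinner (F (r l) d) (e i)) < \<epsilon> / 4"
      using CauchyD[OF convergent_Cauchy[OF conv[OF d(1) dn, of i]] \<epsilon>4] by (rule exE)
    note N = this[rule_format]
    have "cmod (cinner (F (r k) v) (e i) - cinner (F (r l) v) (e i)) < \<epsilon>" if "k \<ge> N" "l \<ge> N" for k l
    proof -
      have t: "cmod (p + q - s) < \<epsilon>" if "cmod s \<le> \<epsilon> / 4" "cmod q \<le> \<epsilon> / 4" "cmod p < \<epsilon> / 4" for p q s
        using that \<epsilon> norm_triangle_ineq4[of "p + q" s] norm_triangle_ineq[of p q] by linarith
      have eq: "x - y = (x' - y') + (y' - y) - (x' - x)" for x y x' y' :: complex by (simp add: algebra_simps)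
      show ?thesis by (rule ssubst[where P = "\<lambda>x. cmod x < \<epsilon>", OF eq t[OF near[of "r k"] near[of "r l"] N[OF that]]])
    qed
    then show "\<exists>N. \<forall>k\<ge>N. \<forall>l\<ge>N. cmod (cinner (F (r k) v) (e i) - cinner (F (r l) v) (e i)) < \<epsilon>" by blast
  qed
  show ?thesis by (intro exI[of _ r] conjI allI impI r(1) Cauchy_convergent cauchy)
qed

section \<open>Splitting into finitely many components plus a tail\<close>

lemma ennreal_two_mult: "x \<ge> 0 \<Longrightarrow> 2 * ennreal x = ennreal (2 * x)"
  by (subst ennreal_mult) auto

lemma A2_component:
  fixes G :: "complex ^ 'n \<Rightarrow> ell2"
  assumes \<alpha>: "\<alpha> > -1" and G: "G \<in> A2 \<alpha>" and x: "norm x = 1"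
  shows "complex_diff_on_ball (\<lambda>w. cinner (G w) x)" "(\<lambda>w. cinner (G w) x *\<^sub>C x) \<in> A2 \<alpha>"
    "integrable (weighted_measure \<alpha>) (\<lambda>w. cinner (G w) x)"
    "(\<integral>\<^sup>+w. (ennreal (cmod (cinner (G w) x)))\<^sup>2 \<partial>weighted_measure \<alpha>) \<le> (A2_norm \<alpha> G)\<^sup>2"
proof -
  have le: "cmod (cinner y x) \<le> norm y" for y using norm_cinner_le[of y x] x by simp
  show d: "complex_diff_on_ball (\<lambda>w. cinner (G w) x)"
    unfolding complex_diff_on_ball_def
  proof
    fix z :: "complex ^ 'n" assume "z \<in> ball 0 1"
    then obtain D where D: "(G has_derivative D) (at z)" "\<And>c v. D (c *s v) = c *\<^sub>C D v"
      using G unfolding A2_iff holomorphic_on_ball_def by blast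
    from bounded_linear.has_derivative[OF bounded_linear_cinner D(1)]
    show "\<exists>D. ((\<lambda>w. cinner (G w) x) has_derivative D) (at z) \<and> (\<forall>c v. D (c *s v) = c * D v)"
      by (intro exI conjI) (auto simp: D(2) cinner_scaleC)
  qed
  show "integrable (weighted_measure \<alpha>) (\<lambda>w. cinner (G w) x)"
    by (rule integrable_bounded_linear[OF bounded_linear_cinner A2_integrable[OF \<alpha> G]])
  show L2: "(\<integral>\<^sup>+w. (ennreal (cmod (cinner (G w) x)))\<^sup>2 \<partial>weighted_measure \<alpha>) \<le> (A2_norm \<alpha> G)\<^sup>2"
    unfolding A2_norm_sq nn_integral_norm_power2 using le by (intro nn_integral_mono ennreal_leI power_mono) auto
  have "holomorphic_on_ball (\<lambda>w. cinner (G w) x *\<^sub>C x)"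
    unfolding holomorphic_on_ball_def
  proof
    fix z :: "complex ^ 'n" assume "z \<in> ball 0 1"
    then obtain D where D: "((\<lambda>w. cinner (G w) x) has_derivative D) (at z)" "\<And>c v. D (c *s v) = c * D v"
      using d unfolding complex_diff_on_ball_def by blast
    from bounded_linear.has_derivative[OF scaleC.bounded_linear_left D(1)]
    show "\<exists>D. ((\<lambda>w. cinner (G w) x *\<^sub>C x) has_derivative D) (at z) \<and> (\<forall>c v. D (c *s v) = c *\<^sub>C D v)"
      by (intro exI conjI) (auto simp: D(2) scaleC_scaleC)
  qed
  moreover have "(A2_norm \<alpha> (\<lambda>w. cinner (G w) x *\<^sub>C x))\<^sup>2 \<le> (A2_norm \<alpha> G)\<^sup>2"
    unfolding A2_norm_sq using le x by (intro nn_integral_mono ennreal_leI power_mono) (auto simp: norm_scaleC)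
  then have "A2_norm \<alpha> (\<lambda>w. cinner (G w) x *\<^sub>C x) < \<infinity>"
    by (rule le_less_trans[OF ennreal_square_le_imp_le]) (use G in \<open>simp add: A2_iff_norm\<close>)
  ultimately show "(\<lambda>w. cinner (G w) x *\<^sub>C x) \<in> A2 \<alpha>" by (simp add: A2_iff_norm)
qed

text \<open>G is its tail projection plus its first d components, and every piece has an absolutely
  convergent Toeplitz integral, so the integral may be split.\<close>

lemma toeplitz_tail_split:
  fixes b :: "complex ^ 'n \<Rightarrow> ell2 \<Rightarrow>\<^sub>L ell2"
  assumes \<alpha>: "\<alpha> > -1" and b: "carleson_symbol \<alpha> b B" and t: "carleson_symbol \<alpha> (\<lambda>w. b w o\<^sub>L tail_proj e d) B'"
    and e: "\<And>i. norm (e i) = 1" and G: "G \<in> A2 \<alpha>" and z: "norm z < 1"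
  shows "toeplitz \<alpha> b G z = toeplitz \<alpha> (\<lambda>w. b w o\<^sub>L tail_proj e d) G z + (\<Sum>i<d. toeplitz \<alpha> b (\<lambda>w. cinner (G w) (e i) *\<^sub>C e i) z)"
proof -
  let ?M = "weighted_measure \<alpha> :: (complex ^ 'n) measure" and ?k = "\<lambda>w. cnj (bergman_kernel \<alpha> z w)"
  let ?b' = "\<lambda>w. b w o\<^sub>L tail_proj e d" and ?G = "\<lambda>i w. cinner (G w) (e i) *\<^sub>C e i"
  note i = toeplitz_integrable[OF \<alpha> b G] toeplitz_integrable[OF \<alpha> t G] toeplitz_integrable[OF \<alpha> b A2_component(2)[OF \<alpha> G e]]
  note k = i[THEN integrable_kernel_scaleC[OF \<alpha> _ z]]
  have eq: "blinfun_apply (b w) (G w) = blinfun_apply (?b' w) (G w) + (\<Sum>i<d. blinfun_apply (b w) (?G i w))" for w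
    by (simp add: tail_proj.rep_eq blinfun.diff_right blinfun.sum_right)
  have "toeplitz \<alpha> b G z = (LINT w|?M. ?k w *\<^sub>C blinfun_apply (?b' w) (G w) + (\<Sum>i<d. ?k w *\<^sub>C blinfun_apply (b w) (?G i w)))"
    unfolding toeplitz_eq[OF \<alpha> i(1) z] by (subst eq) (simp only: scaleC.add_right scaleC.sum_right)
  also have "\<dots> = (LINT w|?M. ?k w *\<^sub>C blinfun_apply (?b' w) (G w)) + (\<Sum>i<d. LINT w|?M. ?k w *\<^sub>C blinfun_apply (b w) (?G i w))"
    by (subst Bochner_Integration.integral_add[OF k(2)])
       (intro Bochner_Integration.integrable_sum k(3), simp only: Bochner_Integration.integral_sum[OF k(3)])
  finally show ?thesis unfolding toeplitz_eq[OF \<alpha> i(2) z] toeplitz_eq[OF \<alpha> i(3) z] .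
qed

text \<open>Inside the smaller ball the components share one bound, so pointwise convergence becomes
  L^2 convergence by dominated convergence. A uniform bound of this kind is available only because r
  < 1.\<close>

lemma component_Cauchy:
  fixes F :: "nat \<Rightarrow> complex ^ 'n \<Rightarrow> ell2"
  assumes \<alpha>: "\<alpha> > -1" and F: "\<And>k. F k \<in> A2 \<alpha>" "\<And>k. A2_norm \<alpha> (F k) \<le> 1" and x: "norm x = 1"
    and conv: "\<And>v. norm v < 1 \<Longrightarrow> convergent (\<lambda>k. cinner (F k v) x)" and r: "r < 1" and t: "t > 0"
  shows "\<exists>N. \<forall>k\<ge>N. \<forall>l\<ge>N. (\<integral>\<^sup>+v. indicator {v. norm v < r} v * (ennreal (cmod (cinner (F k v - F l v) x)))\<^sup>2 \<partial>weighted_measure \<alpha>) \<le> ennreal t"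
proof -
  let ?M = "weighted_measure \<alpha> :: (complex ^ 'n) measure" and ?R = "{v :: complex ^ 'n. norm v < r}"
  define c where "c k v = cinner (F k v) x" for k v
  define \<psi> where "\<psi> v = lim (\<lambda>k. c k v)" for v
  have \<psi>: "(\<lambda>k. c k v) \<longlonglongrightarrow> \<psi> v" if "norm v < 1" for v
    using conv[OF that] unfolding \<psi>_def c_def by (simp add: convergent_LIMSEQ_iff)
  define \<beta> where "\<beta> = (1 - r) powr - (real CARD('n) + 1 + \<alpha>)"
  have cb: "cmod (c k v) \<le> \<beta>" if v: "norm v < r" for k v
  proof -
    have v1: "norm v < 1" using v r by simp
    have "cmod (c k v) \<le> norm (F k v)" using norm_cinner_le[of "F k v" x] x by (simp add: c_def)
    also have "\<dots> \<le> (1 - norm v) powr - (real CARD('n) + 1 + \<alpha>) * 1" using F(2)[of k] by (intro A2_point_bound[OF \<alpha> F(1) v1]) auto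
    also have "\<dots> \<le> \<beta>" unfolding \<beta>_def mult_1_right using \<alpha> v r by (intro powr_mono2') auto
    finally show ?thesis .
  qed
  have pb: "cmod (\<psi> v) \<le> \<beta>" if "norm v < r" for v
    by (rule LIMSEQ_le_const2[OF tendsto_norm[OF \<psi>]]) (use that r cb in auto)
  have cm: "c k \<in> borel_measurable ?M" for k
    using A2_component(3)[OF \<alpha> F(1) x, of k] unfolding c_def by (rule borel_measurable_integrable)
  have pm: "\<psi> \<in> borel_measurable ?M" by (rule borel_measurable_LIMSEQ_metric[OF cm \<psi>]) simp
  have R: "?R \<in> sets borel" by (intro borel_open open_Collect_less continuous_intros)
  have Rm: "(\<lambda>v. indicator ?R v :: ennreal) \<in> borel_measurable ?M" by (intro measurable_borel_weighted borel_measurable_indicator R)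
  let ?u = "\<lambda>k v. indicator ?R v * (ennreal (cmod (c k v - \<psi> v)))\<^sup>2"
  have um: "?u k \<in> borel_measurable ?M" for k using cm pm Rm by measurable
  have "(\<lambda>k. \<integral>\<^sup>+v. ?u k v \<partial>?M) \<longlonglongrightarrow> (\<integral>\<^sup>+v. 0 \<partial>?M)"
  proof (rule nn_integral_dominated_convergence[where w = "\<lambda>_. ennreal ((2 * \<beta>)\<^sup>2)"])
    have "?u k v \<le> ennreal ((2 * \<beta>)\<^sup>2)" for k v
    proof (cases "norm v < r")
      case True
      then have "cmod (c k v - \<psi> v) \<le> 2 * \<beta>" using norm_triangle_ineq4[of "c k v" "\<psi> v"] cb[OF True, of k] pb[OF True] by linarith
      then have "(cmod (c k v - \<psi> v))\<^sup>2 \<le> (2 * \<beta>)\<^sup>2" by (rule power_mono) simp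
      then show ?thesis using True by (simp add: ennreal_power ennreal_leI)
    qed simp
    then show "AE v in ?M. ?u k v \<le> ennreal ((2 * \<beta>)\<^sup>2)" for k by simp
    have "(\<lambda>k. ?u k v) \<longlonglongrightarrow> 0" if v: "norm v < 1" for v
    proof (cases "norm v < r")
      case True
      have "(\<lambda>k. ennreal ((cmod (c k v - \<psi> v))\<^sup>2)) \<longlonglongrightarrow> ennreal ((cmod (\<psi> v - \<psi> v))\<^sup>2)"
        by (intro tendsto_intros \<psi> v)
      then show ?thesis using True by (simp add: ennreal_power)
    qed simp
    then show "AE v in ?M. (\<lambda>k. ?u k v) \<longlonglongrightarrow> 0" by (intro AE_I2) simp
    show "(\<integral>\<^sup>+v. ennreal ((2 * \<beta>)\<^sup>2) \<partial>?M) < \<infinity>" using emeasure_weighted_space[OF \<alpha>, where 'n='n] by simp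
  qed (use um in auto)
  then have "(\<lambda>k. \<integral>\<^sup>+v. ?u k v \<partial>?M) \<longlonglongrightarrow> 0" by simp
  then have "\<forall>\<^sub>F k in sequentially. (\<integral>\<^sup>+v. ?u k v \<partial>?M) < ennreal (t / 4)" using t by (intro order_tendstoD(2)) auto
  then obtain N where N: "\<And>k. k \<ge> N \<Longrightarrow> (\<integral>\<^sup>+v. ?u k v \<partial>?M) < ennreal (t / 4)"
    unfolding eventually_sequentially by blast
  have "(\<integral>\<^sup>+v. indicator ?R v * (ennreal (cmod (cinner (F k v - F l v) x)))\<^sup>2 \<partial>?M) \<le> ennreal t" if k: "k \<ge> N" and l: "l \<ge> N" for k l
  proof -
    have "(\<integral>\<^sup>+v. indicator ?R v * (ennreal (cmod (cinner (F k v - F l v) x)))\<^sup>2 \<partial>?M) \<le> (\<integral>\<^sup>+v. 2 * ?u k v + 2 * ?u l v \<partial>?M)"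
    proof (rule nn_integral_mono)
      fix v
      have "cinner (F k v - F l v) x = (c k v - \<psi> v) - (c l v - \<psi> v)"
        unfolding c_def linear_diff[OF bounded_linear.linear[OF bounded_linear_cinner]] by simp
      then have "cmod (cinner (F k v - F l v) x) \<le> cmod (c k v - \<psi> v) + cmod (c l v - \<psi> v)"
        using norm_triangle_ineq4[of "c k v - \<psi> v" "c l v - \<psi> v"] by (simp only:)
      then have "(ennreal (cmod (cinner (F k v - F l v) x)))\<^sup>2 \<le> (ennreal (cmod (c k v - \<psi> v)) + ennreal (cmod (c l v - \<psi> v)))\<^sup>2"
        by (intro power_mono) (simp_all add: ennreal_leI flip: ennreal_plus)
      also have "\<dots> \<le> 2 * (ennreal (cmod (c k v - \<psi> v)))\<^sup>2 + 2 * (ennreal (cmod (c l v - \<psi> v)))\<^sup>2" by (rule ennreal_power2_add_le)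
      finally show "indicator ?R v * (ennreal (cmod (cinner (F k v - F l v) x)))\<^sup>2 \<le> 2 * ?u k v + 2 * ?u l v"
        by (simp add: indicator_def)
    qed
    also have "\<dots> = 2 * (\<integral>\<^sup>+v. ?u k v \<partial>?M) + 2 * (\<integral>\<^sup>+v. ?u l v \<partial>?M)"
      by (subst nn_integral_add) (intro borel_measurable_times_ennreal borel_measurable_const um | simp add: nn_integral_cmult[OF um])+
    also have "\<dots> \<le> 2 * ennreal (t / 4) + 2 * ennreal (t / 4)"
      by (intro add_mono mult_left_mono less_imp_le[OF N] k l) auto
    also have "2 * ennreal (t / 4) = ennreal (2 * (t / 4))" using t by (intro ennreal_two_mult) simp
    also have "\<dots> + \<dots> = ennreal t" using t by (simp flip: ennreal_plus)
    finally show ?thesis .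
  qed
  then show ?thesis by blast
qed

text \<open>The images along the subsequence are shown to be Cauchy. The tail operator has small
  norm on the bounded differences G, and each of the finitely many remaining components becomes
  small by \<open>toeplitz_vector_small\<close> together with
  \<open>component_Cauchy\<close>.\<close>

theorem toeplitz_compact_operator:
  fixes b :: "complex ^ 'n \<Rightarrow> ell2 \<Rightarrow>\<^sub>L ell2"
  assumes \<alpha>: "\<alpha> > -1" and b: "carleson_symbol \<alpha> b B"
    and hom: "\<And>w c x. norm w < 1 \<Longrightarrow> blinfun_apply (b w) (c *\<^sub>C x) = c *\<^sub>C blinfun_apply (b w) x"
    and e: "\<And>i. norm (e i) = 1"
    and lim: "\<And>i. ((\<lambda>z. A2_norm \<alpha> (toeplitz \<alpha> b (\<lambda>w. normalized_kernel \<alpha> z w *\<^sub>C e i))) \<longlongrightarrow> 0) to_boundary"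
    and tail: "\<And>\<epsilon>. \<epsilon> > 0 \<Longrightarrow> \<exists>d. carleson_symbol \<alpha> (\<lambda>w. b w o\<^sub>L tail_proj e d) \<epsilon>"
  shows "compact_operator_A2 \<alpha> (toeplitz \<alpha> b)"
  unfolding compact_operator_A2_def
proof (intro conjI allI impI)
  show "bounded_operator_A2 \<alpha> (toeplitz \<alpha> b)" by (rule toeplitz_bounded_operator[OF \<alpha> b hom])
  fix F :: "nat \<Rightarrow> complex ^ 'n \<Rightarrow> ell2"
  assume "\<forall>k. F k \<in> A2 \<alpha> \<and> A2_norm \<alpha> (F k) \<le> 1"
  then have F: "\<And>k. F k \<in> A2 \<alpha>" "\<And>k. A2_norm \<alpha> (F k) \<le> 1" by auto
  obtain r where r: "strict_mono (r :: nat \<Rightarrow> nat)" "\<And>v i. norm v < 1 \<Longrightarrow> convergent (\<lambda>k. cinner (F (r k) v) (e i))"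
    using A2_weakly_convergent_subsequence[where F = F and e = e, OF \<alpha> F e] by blast
  let ?T = "toeplitz \<alpha> b"
  define G where "G k l v = F (r k) v - F (r l) v" for k l v
  have G: "G k l \<in> A2 \<alpha>" for k l unfolding G_def by (rule A2_diff[OF F(1) F(1)])
  have G4: "(A2_norm \<alpha> (G k l))\<^sup>2 \<le> 4" for k l
  proof -
    have "(A2_norm \<alpha> (G k l))\<^sup>2 \<le> 2 * (A2_norm \<alpha> (F (r k)))\<^sup>2 + 2 * (A2_norm \<alpha> (\<lambda>v. - F (r l) v))\<^sup>2"
      using A2_norm_add_sq[OF A2_measurable[OF F(1)] borel_measurable_uminus[OF A2_measurable[OF F(1)]], of "r k" "r l"]
      by (simp add: G_def[abs_def])
    also have "(A2_norm \<alpha> (\<lambda>v. - F (r l) v))\<^sup>2 = (A2_norm \<alpha> (F (r l)))\<^sup>2" unfolding A2_norm_sq norm_minus_cancel ..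
    also have "2 * (A2_norm \<alpha> (F (r k)))\<^sup>2 + 2 * (A2_norm \<alpha> (F (r l)))\<^sup>2 \<le> 2 * 1\<^sup>2 + 2 * 1\<^sup>2"
      by (intro add_mono mult_left_mono power_mono F(2)) auto
    finally show ?thesis by simp
  qed
  have comp: "\<exists>N. \<forall>k\<ge>N. \<forall>l\<ge>N. (A2_norm \<alpha> (?T (\<lambda>w. cinner (G k l w) (e i) *\<^sub>C e i)))\<^sup>2 \<le> ennreal \<eta>" if \<eta>: "\<eta> > 0" for i \<eta>
  proof -
    have \<eta>8: "\<eta> / 8 > 0" using \<eta> by simp
    obtain \<rho> C' where \<rho>: "\<rho> < 1" "C' \<ge> 0" "\<And>\<phi>. complex_diff_on_ball \<phi> \<Longrightarrow> (\<lambda>w. \<phi> w *\<^sub>C e i) \<in> A2 \<alpha> \<Longrightarrow> integrable (weighted_measure \<alpha>) \<phi> \<Longrightarrow>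
      (\<integral>\<^sup>+v. (ennreal (cmod (\<phi> v)))\<^sup>2 \<partial>weighted_measure \<alpha>) < \<infinity> \<Longrightarrow>
      (A2_norm \<alpha> (?T (\<lambda>w. \<phi> w *\<^sub>C e i)))\<^sup>2 \<le> ennreal (\<eta> / 8) * (\<integral>\<^sup>+v. (ennreal (cmod (\<phi> v)))\<^sup>2 \<partial>weighted_measure \<alpha>)
        + ennreal C' * (\<integral>\<^sup>+v. indicator {v. norm v < \<rho>} v * (ennreal (cmod (\<phi> v)))\<^sup>2 \<partial>weighted_measure \<alpha>)"
      using toeplitz_vector_small[OF \<alpha> b hom lim \<eta>8] by blast
    \<comment> \<open>Since the squared norm of G is at most 4, the first term is at most \<eta>/2;
      t makes C' t \<le> \<eta>/2 as well, and the + 1 allows C' = 0.\<close>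
    define t where "t = \<eta> / 2 / (C' + 1)"
    have t: "t > 0" "C' * t \<le> \<eta> / 2" using \<eta> \<rho>(2) by (simp_all add: t_def field_simps)
    obtain N where N: "\<And>k l. k \<ge> N \<Longrightarrow> l \<ge> N \<Longrightarrow>
      (\<integral>\<^sup>+v. indicator {v. norm v < \<rho>} v * (ennreal (cmod (cinner (G k l v) (e i))))\<^sup>2 \<partial>weighted_measure \<alpha>) \<le> ennreal t"
      unfolding G_def using component_Cauchy[where F = "\<lambda>k. F (r k)", OF \<alpha> F(1) F(2) e r(2) \<rho>(1) t(1)] by blast
    have "(A2_norm \<alpha> (?T (\<lambda>w. cinner (G k l w) (e i) *\<^sub>C e i)))\<^sup>2 \<le> ennreal \<eta>" if k: "k \<ge> N" and l: "l \<ge> N" for k l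
    proof -
      note c = A2_component[OF \<alpha> G[of k l] e[of i]]
      have c4: "(\<integral>\<^sup>+v. (ennreal (cmod (cinner (G k l v) (e i))))\<^sup>2 \<partial>weighted_measure \<alpha>) \<le> 4" by (rule order_trans[OF c(4) G4])
      have "(A2_norm \<alpha> (?T (\<lambda>w. cinner (G k l w) (e i) *\<^sub>C e i)))\<^sup>2 \<le> ennreal (\<eta> / 8) * (\<integral>\<^sup>+v. (ennreal (cmod (cinner (G k l v) (e i))))\<^sup>2 \<partial>weighted_measure \<alpha>)
        + ennreal C' * (\<integral>\<^sup>+v. indicator {v. norm v < \<rho>} v * (ennreal (cmod (cinner (G k l v) (e i))))\<^sup>2 \<partial>weighted_measure \<alpha>)"
        by (rule \<rho>(3)[OF c(1-3)]) (use c4 in \<open>simp add: order_le_less_trans[OF c4]\<close>)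
      also have "\<dots> \<le> ennreal (\<eta> / 8) * ennreal 4 + ennreal C' * ennreal t"
        using c4 by (intro add_mono mult_left_mono N k l) simp_all
      also have "\<dots> = ennreal (\<eta> / 8 * 4 + C' * t)"
        using \<eta> \<rho>(2) t(1) by (subst ennreal_plus) (auto simp: ennreal_mult[symmetric] simp del: ennreal_numeral)
      also have "\<dots> \<le> ennreal \<eta>" using t(2) by (intro ennreal_leI) simp
      finally show ?thesis .
    qed
    then show ?thesis by blast
  qed
  obtain C where C: "C > 0" "\<And>(b :: complex ^ 'n \<Rightarrow> ell2 \<Rightarrow>\<^sub>L ell2) B f. carleson_symbol \<alpha> b B \<Longrightarrow> f \<in> A2 \<alpha> \<Longrightarrow>
    (A2_norm \<alpha> (toeplitz \<alpha> b f))\<^sup>2 \<le> (ennreal (C * B) * A2_norm \<alpha> f)\<^sup>2"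
    using toeplitz_L2_bound[OF \<alpha>, where 'n='n] by blast
  have Cauchy: "\<exists>N. \<forall>k\<ge>N. \<forall>l\<ge>N. A2_norm \<alpha> (\<lambda>z. ?T (F (r k)) z - ?T (F (r l)) z) \<le> ennreal \<epsilon>" if \<epsilon>: "\<epsilon> > 0" for \<epsilon>
  proof -
    \<comment> \<open>The Carleson constant for which the tail operator has norm at most
      \<epsilon>/4.\<close>
    have "\<epsilon> / (4 * C) > 0" using \<epsilon> C(1) by simp
    from tail[OF this] obtain d where d: "carleson_symbol \<alpha> (\<lambda>w. b w o\<^sub>L tail_proj e d) (\<epsilon> / (4 * C))" by blast
    \<comment> \<open>The tail contributes 2 (\<epsilon>/4)^2 4 = \<epsilon>^2/2; this \<eta> keeps
      the components, 2 * 2^d d \<eta>, below \<epsilon>^2/2 as well.\<close>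
    define \<eta> where "\<eta> = \<epsilon>\<^sup>2 / (4 * 2 ^ d * (real d + 1))"
    have \<eta>: "\<eta> > 0" using \<epsilon> by (simp add: \<eta>_def)
    have "\<forall>i. \<exists>N. \<forall>k\<ge>N. \<forall>l\<ge>N. (A2_norm \<alpha> (?T (\<lambda>w. cinner (G k l w) (e i) *\<^sub>C e i)))\<^sup>2 \<le> ennreal \<eta>" using comp[OF \<eta>] by blast
    then obtain n where n: "\<And>i k l. k \<ge> n i \<Longrightarrow> l \<ge> n i \<Longrightarrow> (A2_norm \<alpha> (?T (\<lambda>w. cinner (G k l w) (e i) *\<^sub>C e i)))\<^sup>2 \<le> ennreal \<eta>" by metis
    \<comment> \<open>The sum dominates every n i and also makes sense for d = 0.\<close>
    define N where "N = (\<Sum>i<d. n i)"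
    have nN: "n i \<le> N" if "i < d" for i unfolding N_def using that by (intro member_le_sum) auto
    have "A2_norm \<alpha> (\<lambda>z. ?T (F (r k)) z - ?T (F (r l)) z) \<le> ennreal \<epsilon>" if k: "k \<ge> N" and l: "l \<ge> N" for k l
    proof (rule ennreal_square_le_imp_le)
      let ?S = "\<lambda>z. toeplitz \<alpha> (\<lambda>w. b w o\<^sub>L tail_proj e d) (G k l) z" and ?c = "\<lambda>i z. ?T (\<lambda>w. cinner (G k l w) (e i) *\<^sub>C e i) z"
      have cm: "?c i \<in> borel_measurable (weighted_measure \<alpha>)" for i
        by (rule A2_measurable[OF toeplitz_in_A2[OF \<alpha> b A2_component(2)[OF \<alpha> G e]]])
      have Sm: "?S \<in> borel_measurable (weighted_measure \<alpha>)" by (rule A2_measurable[OF toeplitz_in_A2[OF \<alpha> d G]])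
      have "A2_norm \<alpha> (\<lambda>z. ?T (F (r k)) z - ?T (F (r l)) z) = A2_norm \<alpha> (\<lambda>z. ?S z + (\<Sum>i<d. ?c i z))"
      proof (rule A2_norm_cong)
        fix z :: "complex ^ 'n" assume z: "norm z < 1"
        have "?T (\<lambda>w. 1 *\<^sub>C F (r k) w + (-1) *\<^sub>C F (r l) w) z = 1 *\<^sub>C ?T (F (r k)) z + (-1) *\<^sub>C ?T (F (r l)) z"
          by (rule toeplitz_lincomb[OF \<alpha> b F(1) F(1) z hom])
        then have "?T (F (r k)) z - ?T (F (r l)) z = ?T (G k l) z" by (simp add: scaleC.minus_left G_def[abs_def])
        then show "?T (F (r k)) z - ?T (F (r l)) z = ?S z + (\<Sum>i<d. ?c i z)"
          unfolding toeplitz_tail_split[OF \<alpha> b d e G z] .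
      qed
      then have "(A2_norm \<alpha> (\<lambda>z. ?T (F (r k)) z - ?T (F (r l)) z))\<^sup>2 \<le> 2 * (A2_norm \<alpha> ?S)\<^sup>2 + 2 * (A2_norm \<alpha> (\<lambda>z. \<Sum>i<d. ?c i z))\<^sup>2"
        using A2_norm_add_sq[OF Sm borel_measurable_sum[of "{..<d}" ?c, OF cm]] by simp
      also have "\<dots> \<le> 2 * (ennreal ((\<epsilon> / 4)\<^sup>2) * ennreal 4) + 2 * (ennreal (2 ^ d) * (\<Sum>i<d. ennreal \<eta>))"
      proof (intro add_mono mult_left_mono)
        have "(A2_norm \<alpha> ?S)\<^sup>2 \<le> (ennreal (C * (\<epsilon> / (4 * C))))\<^sup>2 * (A2_norm \<alpha> (G k l))\<^sup>2"
          using C(2)[OF d G] by (simp only: power_mult_distrib)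
        also have "C * (\<epsilon> / (4 * C)) = \<epsilon> / 4" using C(1) by simp
        also have "(ennreal (\<epsilon> / 4))\<^sup>2 * (A2_norm \<alpha> (G k l))\<^sup>2 \<le> (ennreal (\<epsilon> / 4))\<^sup>2 * ennreal 4"
          using G4 by (intro mult_left_mono) simp_all
        finally show "(A2_norm \<alpha> ?S)\<^sup>2 \<le> ennreal ((\<epsilon> / 4)\<^sup>2) * ennreal 4" using \<epsilon> by (simp add: ennreal_power)
        have "(A2_norm \<alpha> (\<lambda>z. \<Sum>i<d. ?c i z))\<^sup>2 \<le> 2 ^ d * (\<Sum>i<d. (A2_norm \<alpha> (?c i))\<^sup>2)" by (rule A2_norm_sum_sq[OF cm])
        also have "\<dots> \<le> 2 ^ d * (\<Sum>i<d. ennreal \<eta>)"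
          using nN k l by (intro mult_left_mono sum_mono n) (auto intro: order_trans)
        finally show "(A2_norm \<alpha> (\<lambda>z. \<Sum>i<d. ?c i z))\<^sup>2 \<le> ennreal (2 ^ d) * (\<Sum>i<d. ennreal \<eta>)" by (simp flip: ennreal_power)
      qed auto
      also have "(\<Sum>i<d. ennreal \<eta>) = ennreal (real d * \<eta>)" using \<eta> by (simp add: ennreal_mult ennreal_of_nat_eq_real_of_nat)
      also have "ennreal ((\<epsilon> / 4)\<^sup>2) * ennreal 4 = ennreal ((\<epsilon> / 4)\<^sup>2 * 4)" by (rule ennreal_mult[symmetric]) auto
      also have "ennreal (2 ^ d) * ennreal (real d * \<eta>) = ennreal (2 ^ d * (real d * \<eta>))" using \<eta> by (intro ennreal_mult[symmetric]) auto
      also have "2 * ennreal ((\<epsilon> / 4)\<^sup>2 * 4) = ennreal (2 * ((\<epsilon> / 4)\<^sup>2 * 4))" by (rule ennreal_two_mult) simp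
      also have "2 * ennreal (2 ^ d * (real d * \<eta>)) = ennreal (2 * (2 ^ d * (real d * \<eta>)))" using \<eta> by (intro ennreal_two_mult) simp
      also have "ennreal (2 * ((\<epsilon> / 4)\<^sup>2 * 4)) + ennreal (2 * (2 ^ d * (real d * \<eta>))) = ennreal (2 * ((\<epsilon> / 4)\<^sup>2 * 4) + 2 * (2 ^ d * (real d * \<eta>)))"
        using \<eta> by (intro ennreal_plus[symmetric]) auto
      also have "\<dots> \<le> ennreal (\<epsilon>\<^sup>2)"
      proof (rule ennreal_leI)
        have "2 * (2 ^ d * (real d * \<eta>)) = \<epsilon>\<^sup>2 / 2 * (real d / (real d + 1))"
          by (simp add: \<eta>_def divide_simps)
        also have "\<dots> \<le> \<epsilon>\<^sup>2 / 2 * 1" by (intro mult_left_mono) auto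
        finally show "2 * ((\<epsilon> / 4)\<^sup>2 * 4) + 2 * (2 ^ d * (real d * \<eta>)) \<le> \<epsilon>\<^sup>2" by (simp add: power_divide)
      qed
      also have "ennreal (\<epsilon>\<^sup>2) = (ennreal \<epsilon>)\<^sup>2" using \<epsilon> by (simp add: ennreal_power)
      finally show "(A2_norm \<alpha> (\<lambda>z. ?T (F (r k)) z - ?T (F (r l)) z))\<^sup>2 \<le> (ennreal \<epsilon>)\<^sup>2" .
    qed
    then show ?thesis by blast
  qed
  have "\<exists>g\<in>A2 \<alpha>. (\<lambda>k. A2_norm \<alpha> (\<lambda>z. ?T (F (r k)) z - g z)) \<longlonglongrightarrow> 0"
    by (rule A2_complete[where g = "\<lambda>k. ?T (F (r k))", OF \<alpha> toeplitz_in_A2[OF \<alpha> b F(1)] Cauchy])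
  then show "\<exists>r g. strict_mono (r :: nat \<Rightarrow> nat) \<and> g \<in> A2 \<alpha> \<and> (\<lambda>k. A2_norm \<alpha> (\<lambda>z. ?T (F (r k)) z - g z)) \<longlonglongrightarrow> 0"
    using r(1) by blast
qed

theorem corollary1p20:
  fixes \<alpha> :: real
    and e :: "nat \<Rightarrow> ell2"
    and b :: "complex ^ 'n \<Rightarrow> ell2 \<Rightarrow>\<^sub>L ell2"
  assumes "\<alpha> > -1"
    and "orthonormal_basis e"
    and "b \<in> BMO1 \<alpha> (ops_from_l2 (l1_cap_l2_space e))"
    and "berezin \<alpha> (ops_from_l2 (l1_cap_l2_space e)) b \<in> Linf (ops_from_l2 l2_space) ball_measure"
    and "(\<lambda>w. op_adjoint (b w)) \<in> BMO1 \<alpha> (ops_from_l2 (l1_space e))"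
  shows "toeplitz_bounded \<alpha> b \<and>
    ((\<lambda>d. Linf_norm C_space (ball_measure :: (complex ^ 'n) measure)
            (berezin \<alpha> C_space
              (\<lambda>w. complex_of_real (nrm (ops_from_l2 l2_space) (tail_op e d (b w))))))
       \<longlonglongrightarrow> 0 \<longrightarrow>
     (\<forall>d>0. \<exists>L :: ell2 \<Rightarrow> ennreal.
        (\<forall>u\<in>first_span e d. norm u = 1 \<longrightarrow>
           ((\<lambda>z. A2_norm \<alpha> (toeplitz \<alpha> b (\<lambda>w. normalized_kernel \<alpha> z w *\<^sub>C u))) \<longlongrightarrow> L u)
             to_boundary) \<and>
        (SUP u\<in>{u \<in> first_span e d. norm u = 1}. L u) = 0) \<longrightarrow>
     toeplitz_compact \<alpha> b)"
proof -
  note \<alpha> = assms(1) and F = l2_target_l1_cap_l2[of e] and bmo = assms(3)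
  let ?M = "weighted_measure \<alpha> :: (complex ^ 'n) measure"
  have hom: "blinfun_apply (b w) (c *\<^sub>C x) = c *\<^sub>C blinfun_apply (b w) x" if "norm w < 1" for w c x
    by (rule bmo_homogeneous[OF \<alpha> F bmo that])
  note opm = bmo_op_measurable[OF \<alpha> F bmo]
  obtain B where B: "carleson_symbol \<alpha> b B"
    using bmo_berezin_bounded[OF \<alpha> F bmo assms(4)] opm unfolding carleson_symbol_def by blast
  \<comment> \<open>\<open>toeplitz\<close> is given by its integral on every function, so it is
    itself the operator extending T_b from the bounded holomorphic functions.\<close>
  have ext: "toeplitz_extension \<alpha> b (toeplitz \<alpha> b)" by (simp add: toeplitz_extension_def)
  have bounded: "bounded_operator_A2 \<alpha> (toeplitz \<alpha> b)" by (rule toeplitz_bounded_operator[OF \<alpha> B hom])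
  have e1: "norm (e i) = 1" for i
    using assms(2) Re_cinner[of "e i" "e i"] by (simp add: orthonormal_basis_def norm_eq_1)
  show ?thesis
  proof (intro conjI impI)
    show "toeplitz_bounded \<alpha> b" unfolding toeplitz_bounded_def using bounded ext by blast
  next
    assume tail: "(\<lambda>d. Linf_norm C_space (ball_measure :: (complex ^ 'n) measure)
            (berezin \<alpha> C_space (\<lambda>w. complex_of_real (nrm (ops_from_l2 l2_space) (tail_op e d (b w)))))) \<longlonglongrightarrow> 0"
      and L: "\<forall>d>0. \<exists>L :: ell2 \<Rightarrow> ennreal.
        (\<forall>u\<in>first_span e d. norm u = 1 \<longrightarrow>
           ((\<lambda>z. A2_norm \<alpha> (toeplitz \<alpha> b (\<lambda>w. normalized_kernel \<alpha> z w *\<^sub>C u))) \<longlongrightarrow> L u) to_boundary) \<and>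
        (SUP u\<in>{u \<in> first_span e d. norm u = 1}. L u) = 0"
    \<comment> \<open>Indices start at 0, so e i lies in the span of the first i + 1 basis vectors.
      A supremum 0 of nonnegative limits forces each limit to be 0.\<close>
    have lim: "((\<lambda>z. A2_norm \<alpha> (toeplitz \<alpha> b (\<lambda>w. normalized_kernel \<alpha> z w *\<^sub>C e i))) \<longlongrightarrow> 0) to_boundary" for i
    proof -
      have "(\<Sum>j<Suc i. (if j = i then 1 else 0) *\<^sub>C e j) = (\<Sum>j<Suc i. if j = i then e j else 0)"
        by (rule sum.cong) (auto simp: scaleC.zero_left)
      then have "e i = (\<Sum>j<Suc i. (if j = i then 1 else 0) *\<^sub>C e j)" by simp
      then have ei: "e i \<in> first_span e (Suc i)" unfolding first_span_def
        by (intro CollectI exI[of _ "\<lambda>j. if j = i then 1 else 0"] conjI TrueI)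
      obtain L' :: "ell2 \<Rightarrow> ennreal" where L': "\<And>u. u \<in> first_span e (Suc i) \<Longrightarrow> norm u = 1 \<Longrightarrow>
           ((\<lambda>z. A2_norm \<alpha> (toeplitz \<alpha> b (\<lambda>w. normalized_kernel \<alpha> z w *\<^sub>C u))) \<longlongrightarrow> L' u) to_boundary"
        "(SUP u\<in>{u \<in> first_span e (Suc i). norm u = 1}. L' u) = 0"
        using L[rule_format, of "Suc i"] by auto
      have "L' (e i) \<le> (SUP u\<in>{u \<in> first_span e (Suc i). norm u = 1}. L' u)" using ei e1 by (intro SUP_upper) auto
      then have "L' (e i) = 0" using L'(2) by simp
      then show ?thesis using L'(1)[OF ei e1] by simp
    qed
    have small: "\<exists>d. carleson_symbol \<alpha> (\<lambda>w. b w o\<^sub>L tail_proj e d) \<epsilon>" if "\<epsilon> > 0" for \<epsilon>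
      using tail_berezin_small[OF \<alpha> assms(2) opm bmo_norm_integrable[OF \<alpha> F bmo] hom tail that] that op_measurable_compose[OF opm]
      unfolding carleson_symbol_def by (auto intro: less_imp_le)
    have "compact_operator_A2 \<alpha> (toeplitz \<alpha> b)" by (rule toeplitz_compact_operator[where e = e, OF \<alpha> B hom e1 lim small])
    then show "toeplitz_compact \<alpha> b" unfolding toeplitz_compact_def using ext by blast
  qed
qed

end
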